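(* Let $M$ be a CM field that is a finite Galois extension of $\mathbb{Q}$, let $p$ be a prime number, and let $\Gamma$ be a non-empty subset of the set of prime ideals of $\mathcal{O}_M$ above $p$. Let $\Delta_\Gamma$, $Y$, $\overline{\Delta_\Gamma(Y)}$, $E_p$ and $S_p$ be as defined in the context, and let $r=\operatorname{rank}_{\mathbb{Z}}\mathcal{O}_M^*$. Let $c$ be the unique element of $G=\operatorname{Gal}(M/\mathbb{Q})$ induced by complex conjugation. For any choice of $\sigma\in E_p$, let $J_\sigma=\{g\in G:\sigma\circ g\in E_p\smallsetminus S_p\}$ and let $t$ be the number of right cosets $\{g,cg\}$ of $\{\mathrm{id},c\}$ contained in $J_\sigma$. Assume both Schanuel's Conjecture and the $p$-adic Schanuel Conjecture (stated in the context). Then \[\operatorname{rank}_{\mathbb{Z}_p}\bigl(\overline{\Delta_\Gamma(Y)}\bigr)= r-(t-1)^+.\]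
   Context: Notation. $\mathcal{O}_M$ is the ring of integers of $M$, $\mathcal{O}_M^*$ its unit group. For a prime $\mathfrak{p}$ of $\mathcal{O}_M$ above $p$: $M_\mathfrak{p}$ is the completion of $M$ at $\mathfrak{p}$, $\mathcal{O}_\mathfrak{p}$ its ring of integers, $\pi$ a uniformizer, $\mathcal{O}_{\mathfrak{p}}^*$ the group of local units and $\mathcal{O}_{\mathfrak{p},1}^*=1+\pi\mathcal{O}_\mathfrak{p}$ the group of principal local units (a $\mathbb{Z}_p$-module under exponentiation). $\mathbb{C}_p$ is the completion of an algebraic closure of $\mathbb{Q}_p$. For $x\in\mathbb{R}$, $x^+=x$ if $x\ge 0$ and $x^+=0$ if $x<0$. The element $c\in G$ induced by complex conjugation satisfies $\tau(c(m))=\overline{\tau(m)}$ for all $m\in M$ and all embeddings $\tau:M\to\mathbb{C}$. $\Delta_\Gamma:\mathcal{O}_M^*\to\prod_{\mathfrak{p}\in\Gamma}\mathcal{O}_\mathfrak{p}^*$ is the diagonal embedding $u\mapsto(u,\dots,u)$; $Y:=\Delta_\Gamma^{-1}\bigl(\prod_{\mathfrak{p}\in\Gamma}\mathcal{O}_{\mathfrak{p},1}^*\bigr)$; $\overline{\Delta_\Gamma(Y)}$ is the topological closure of $\Delta_\Gamma(Y)$ in $\prod_{\mathfrak{p}\in\Gamma}\mathcal{O}_{\mathfrak{p},1}^*$ (a $\mathbb{Z}_p$-submodule). $E_p$ is the set of all field embeddings $M\to\mathbb{C}_p$. Fix $\mathfrak{p}_0\in\Gamma$ and let $\sigma_0\in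 E_p$ be the composite $M\to M_{\mathfrak{p}_0}\to\mathbb{C}_p$ for a fixed continuous embedding $M_{\mathfrak{p}_0}\to\mathbb{C}_p$. Every element of $E_p$ is $\sigma_0 g=\sigma_0\circ g$ for a unique $g\in G$, and $S_p:=\{\sigma_0 g : g\in G,\ g^{-1}\mathfrak{p}_0\in\Gamma\}$. $\log_p:\mathbb{C}_p^*\to\mathbb{C}_p$ is the $p$-adic logarithm, given by the usual power series on $|x-1|_p<1$ and extended to $\mathbb{C}_p^*$ by $\log_p(ab)=\log_p(a)+\log_p(b)$ and $\log_p(\zeta p^s)=0$ for all roots of unity $\zeta$ and $s\in\mathbb{Z}$. Schanuel's Conjecture (logarithmic formulation): let non-zero complex numbers $\alpha_1,\dots,\alpha_n$ be algebraic over $\mathbb{Q}$ and suppose that for any choice of the multi-valued logarithm, $\log\alpha_1,\dots,\log\alpha_n$ are linearly independent over $\mathbb{Q}$. Then $\log\alpha_1,\dots,\log\alpha_n$ are algebraically independent over $\mathbb{Q}$. $p$-adic Schanuel Conjecture (logarithmic formulation): let non-zero $\alpha_1,\dots,\alpha_n$ be algebraic over $\mathbb{Q}$ and contained in an extension of $\mathbb{Q}_p$ (inside $\mathbb{C}_p$). If $\log_p\alpha_1,\dots,\log_p\alpha_n$ are linearly independent over $\mathbb{Q}$, then they are algebraically independent over $\mathbb{Q}$. *)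

theory Defs
  imports
    "HOL-Analysis.Analysis"
    "HOL-Library.Poly_Mapping"
    "HOL-Library.Extended_Nat"
    "HOL-Algebra.Algebraic_Closure_Type"
    "HOL-Algebra.Ideal_Product"
    "HOL-Algebra.IntRing"
    "Jordan_Normal_Form.Missing_VectorSpace"
begin

text \<open>
  Fields are types; whenever a notion of HOL-Algebra is used (ring homomorphisms, subfields,
  dimensions, ideals, algebraic closures, modules), the type is turned into a structure by
  \<^const>\<open>ring_of_type_algebra\<close>.
\<close>

abbreviation fld :: "'a::field ring" where
  "fld \<equiv> ring_of_type_algebra"


section \<open>Number fields\<close>

definition number_field :: "'m::field_char_0 itself \<Rightarrow> bool" where
  "number_field _ \<longleftrightarrow> ring.finite_dimension (fld :: 'm ring) \<rat> UNIV"

text \<open>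
  The polynomial \<open>q\<close> below is the minimal polynomial of \<open>x\<close> over the rationals; that it splits in
  \<open>M\<close> is normality, that its linear factors are distinct is separability.
\<close>

definition galois_over_rat :: "'m::field_char_0 itself \<Rightarrow> bool" where
  "galois_over_rat _ \<longleftrightarrow>
     (\<forall>x::'m. \<exists>q::rat poly. Factorial_Ring.irreducible q \<and>
        (\<exists>A. finite A \<and> x \<in> A \<and> map_poly of_rat q = (\<Prod>a\<in>A. [:- a, 1:])))"

definition totally_real :: "'m::field_char_0 set \<Rightarrow> bool" where
  "totally_real F \<longleftrightarrow>
     (\<forall>\<tau> \<in> ring_hom (fld\<lparr>carrier := F\<rparr>) (fld :: complex ring). \<tau> ` F \<subseteq> \<real>)"

definition totally_imaginary :: "'m::field_char_0 itself \<Rightarrow> bool" where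
  "totally_imaginary _ \<longleftrightarrow>
     (\<forall>\<tau> \<in> ring_hom (fld :: 'm ring) (fld :: complex ring). \<not> range \<tau> \<subseteq> \<real>)"

definition CM_field :: "'m::field_char_0 itself \<Rightarrow> bool" where
  "CM_field _ \<longleftrightarrow>
     number_field TYPE('m) \<and> totally_imaginary TYPE('m) \<and>
     (\<exists>F. subfield F (fld :: 'm ring) \<and> totally_real F \<and>
          ring.dimension (fld :: 'm ring) 2 F UNIV)"

text \<open>The Galois group of \<open>M\<close> over the rationals; the product is composition of maps.\<close>

definition gal :: "('m::field_char_0 \<Rightarrow> 'm) monoid" where
  "gal = \<lparr>carrier = {g \<in> ring_iso fld fld. \<forall>x\<in>\<rat>. g x = x}, monoid.mult = (\<circ>), one = id\<rparr>"

definition ring_of_integers :: "'m::field_char_0 ring" where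
  "ring_of_integers = fld\<lparr>carrier := {x. algebraic_int x}\<rparr>"

definition primes_above :: "nat \<Rightarrow> 'm::field_char_0 set set" where
  "primes_above p = {P. primeideal P ring_of_integers \<and> of_nat p \<in> P}"

definition ideal_ord :: "'m::field_char_0 set \<Rightarrow> 'm \<Rightarrow> nat" where
  "ideal_ord P a = (GREATEST n. a \<in> P [^]\<^bsub>ideals_set ring_of_integers\<^esub> n)"


section \<open>Ranks of modules\<close>

text \<open>The maximal number of linearly independent elements (\<open>\<infinity>\<close> if there is no maximum).\<close>

definition module_rank :: "('a, 'x) ring_scheme \<Rightarrow> ('a, 'b, 'y) module_scheme \<Rightarrow> enat" where
  "module_rank R N =
     (SUP S \<in> {S. finite S \<and> S \<subseteq> carrier N \<and> \<not> module.lin_dep R N S}. enat (card S))"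

text \<open>
  Multiplicative groups become modules with the group operation as addition and exponentiation
  as scalar multiplication; the ring multiplication and one of the record play no role.
\<close>

definition unit_module :: "(int, 'm::field_char_0) module" where
  "unit_module =
     \<lparr>carrier = Units ring_of_integers, monoid.mult = undefined, one = undefined,
      ring.zero = 1, add = (*), module.smult = (\<lambda>n u. u powi n)\<rparr>"


section \<open>Fields with a non-archimedean absolute value\<close>

class nonarch_field = field_char_0 + metric_space +
  fixes absval :: "'a \<Rightarrow> real"
  assumes dist_absval: "dist x y = absval (x - y)"
    and absval_mult: "absval (x * y) = absval x * absval y"
    and absval_add: "absval (x + y) \<le> max (absval x) (absval y)"

text \<open>
  A completion of \<open>M\<close> at the prime \<open>P\<close> is given by an embedding \<open>\<iota>\<close> of \<open>M\<close> into a complete field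
  \<open>'k\<close> whose absolute value restricts to a \<open>P\<close>-adic one on \<open>M\<close> (it is enough to say this on
  integers); the completion itself is the closure of the image of \<open>\<iota>\<close>.  Its absolute value need
  not be normalised in any particular way, so that completions at several primes fit into one
  \<open>'k\<close>.
\<close>

definition adic_completion ::
    "'m::field_char_0 set \<Rightarrow> ('m \<Rightarrow> 'k::{nonarch_field, complete_space}) \<Rightarrow> bool" where
  "adic_completion P \<iota> \<longleftrightarrow> \<iota> \<in> ring_hom fld fld \<and>
     (\<exists>c. 0 < c \<and> c < 1 \<and>
        (\<forall>a. algebraic_int a \<longrightarrow> a \<noteq> 0 \<longrightarrow> absval (\<iota> a) = c ^ ideal_ord P a))"

definition local_field :: "('m \<Rightarrow> 'k::{nonarch_field, complete_space}) \<Rightarrow> 'k ring" where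
  "local_field \<iota> = fld\<lparr>carrier := closure (range \<iota>)\<rparr>"

definition local_integers :: "('m \<Rightarrow> 'k::{nonarch_field, complete_space}) \<Rightarrow> 'k ring" where
  "local_integers \<iota> = fld\<lparr>carrier := {x \<in> carrier (local_field \<iota>). absval x \<le> 1}\<rparr>"

definition uniformizer :: "('m \<Rightarrow> 'k::{nonarch_field, complete_space}) \<Rightarrow> 'k \<Rightarrow> bool" where
  "uniformizer \<iota> \<pi> \<longleftrightarrow> \<pi> \<in> carrier (local_integers \<iota>) \<and>
     PIdl\<^bsub>local_integers \<iota>\<^esub> \<pi> = {x \<in> carrier (local_integers \<iota>). absval x < 1}"

text \<open>The set below does not depend on the uniformizer \<open>\<pi>\<close>.\<close>

definition principal_units :: "('m \<Rightarrow> 'k::{nonarch_field, complete_space}) \<Rightarrow> 'k set" where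
  "principal_units \<iota> =
     {1 + \<pi> * y |\<pi> y. uniformizer \<iota> \<pi> \<and> y \<in> carrier (local_integers \<iota>)}"

text \<open>
  The closure of the integers (of the rationals) in a complete field with \<open>absval p < 1\<close> is the
  ring of \<open>p\<close>-adic integers (the field of \<open>p\<close>-adic numbers).
\<close>

definition padic_integers :: "'k::{nonarch_field, complete_space} ring" where
  "padic_integers = fld\<lparr>carrier := closure \<int>\<rparr>"

text \<open>
  Exponentiation with \<open>p\<close>-adic integer exponents: the limit of \<open>u ^ s n\<close> along any sequence \<open>s\<close>
  of natural numbers that converges to the exponent.
\<close>

definition padic_power :: "'k::{nonarch_field, complete_space} \<Rightarrow> 'k \<Rightarrow> 'k" where
  "padic_power u a =
     (THE y. \<forall>s::nat \<Rightarrow> nat. (\<lambda>n. of_nat (s n)) \<longlonglongrightarrow> a \<longrightarrow> (\<lambda>n. u ^ s n) \<longlonglongrightarrow> y)"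


section \<open>The diagonal embedding\<close>

text \<open>
  The family \<open>\<iota>\<close> provides a completion \<open>\<iota> P\<close> for each prime \<open>P\<close> in \<open>\<Gamma>\<close>; elements of a product
  over \<open>\<Gamma>\<close> are functions that are \<^const>\<open>undefined\<close> outside \<open>\<Gamma>\<close>.
\<close>

definition diag :: "'m set set \<Rightarrow> ('m set \<Rightarrow> 'm \<Rightarrow> 'k) \<Rightarrow> 'm \<Rightarrow> ('m set \<Rightarrow> 'k)" where
  "diag \<Gamma> \<iota> u = (\<lambda>P\<in>\<Gamma>. \<iota> P u)"

definition Y_group ::
    "'m::field_char_0 set set \<Rightarrow> ('m set \<Rightarrow> 'm \<Rightarrow> 'k::{nonarch_field, complete_space}) \<Rightarrow> 'm set"
  where
  "Y_group \<Gamma> \<iota> =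
     {u \<in> Units ring_of_integers. diag \<Gamma> \<iota> u \<in> (\<Pi>\<^sub>E P\<in>\<Gamma>. principal_units (\<iota> P))}"

definition closure_diag_Y ::
    "'m::field_char_0 set set \<Rightarrow> ('m set \<Rightarrow> 'm \<Rightarrow> 'k::{nonarch_field, complete_space})
      \<Rightarrow> ('m set \<Rightarrow> 'k) set" where
  "closure_diag_Y \<Gamma> \<iota> =
     product_topology (\<lambda>P. top_of_set (principal_units (\<iota> P))) \<Gamma> closure_of
       (diag \<Gamma> \<iota> ` Y_group \<Gamma> \<iota>)"

definition closure_module ::
    "'m::field_char_0 set set \<Rightarrow> ('m set \<Rightarrow> 'm \<Rightarrow> 'k::{nonarch_field, complete_space})
      \<Rightarrow> ('k, 'm set \<Rightarrow> 'k) module" where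
  "closure_module \<Gamma> \<iota> =
     \<lparr>carrier = closure_diag_Y \<Gamma> \<iota>, monoid.mult = undefined, one = undefined,
      ring.zero = (\<lambda>P\<in>\<Gamma>. 1), add = (\<lambda>x y. \<lambda>P\<in>\<Gamma>. x P * y P),
      module.smult = (\<lambda>a x. \<lambda>P\<in>\<Gamma>. padic_power (x P) a)\<rparr>"


section \<open>The field of \<open>p\<close>-adic complex numbers and embeddings into it\<close>

text \<open>
  Being complete, \<open>'c\<close> contains the field of \<open>p\<close>-adic numbers as the closure of the rationals,
  and \<open>'c\<close> is a completion of an algebraic closure \<open>A\<close> of that field.
\<close>

definition padic_complex :: "nat \<Rightarrow> 'c::{nonarch_field, complete_space} itself \<Rightarrow> bool" where
  "padic_complex p _ \<longleftrightarrow> absval (of_nat p :: 'c) = 1 / real p \<and>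
     (\<exists>A::'c set. algebraic_closure (fld\<lparr>carrier := A\<rparr>) (closure \<rat>) \<and> closure A = UNIV)"

abbreviation E_p :: "('m::field_char_0 \<Rightarrow> 'c::{nonarch_field, complete_space}) set" where
  "E_p \<equiv> ring_hom fld fld"

definition S_p ::
    "'m::field_char_0 set set \<Rightarrow> 'm set \<Rightarrow> ('m \<Rightarrow> 'c::{nonarch_field, complete_space})
      \<Rightarrow> ('m \<Rightarrow> 'c) set" where
  "S_p \<Gamma> P\<^sub>0 \<sigma>\<^sub>0 = {\<sigma>\<^sub>0 \<circ> g |g. g \<in> carrier gal \<and> (inv\<^bsub>gal\<^esub> g) ` P\<^sub>0 \<in> \<Gamma>}"

definition J_set ::
    "('m::field_char_0 \<Rightarrow> 'c::{nonarch_field, complete_space}) set \<Rightarrow> ('m \<Rightarrow> 'c)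
      \<Rightarrow> ('m \<Rightarrow> 'm) set" where
  "J_set S \<sigma> = {g \<in> carrier gal. \<sigma> \<circ> g \<in> E_p - S}"


section \<open>Schanuel's conjecture for logarithms of algebraic numbers\<close>

definition rat_independent :: "nat \<Rightarrow> (nat \<Rightarrow> 'a::field_char_0) \<Rightarrow> bool" where
  "rat_independent n x \<longleftrightarrow>
     (\<forall>q::nat \<Rightarrow> rat. (\<Sum>i<n. of_rat (q i) * x i) = 0 \<longrightarrow> (\<forall>i<n. q i = 0))"

text \<open>
  A multivariate rational polynomial is a finitely supported map from monomials to coefficients,
  where a monomial is a finitely supported map from (indices of) variables to exponents.
\<close>

definition eval_mpoly ::
    "(nat \<Rightarrow> 'a::field_char_0) \<Rightarrow> ((nat \<Rightarrow>\<^sub>0 nat) \<Rightarrow>\<^sub>0 rat) \<Rightarrow> 'a" where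
  "eval_mpoly x f =
     (\<Sum>m\<in>Poly_Mapping.keys f. of_rat (Poly_Mapping.lookup f m) *
        (\<Prod>i\<in>Poly_Mapping.keys m. x i ^ Poly_Mapping.lookup m i))"

definition alg_independent :: "nat \<Rightarrow> (nat \<Rightarrow> 'a::field_char_0) \<Rightarrow> bool" where
  "alg_independent n x \<longleftrightarrow>
     (\<forall>f. (\<forall>m\<in>Poly_Mapping.keys f. Poly_Mapping.keys m \<subseteq> {..<n}) \<longrightarrow>
        eval_mpoly x f = 0 \<longrightarrow> f = 0)"

text \<open>
  The hypothesis requires independence for every choice \<open>l\<close> of the logarithms, and the conclusion
  then also holds for every choice.
\<close>

definition schanuel_log_conjecture :: bool where
  "schanuel_log_conjecture \<longleftrightarrow>
     (\<forall>n. \<forall>\<alpha>::nat \<Rightarrow> complex. (\<forall>i<n. \<alpha> i \<noteq> 0 \<and> algebraic (\<alpha> i)) \<longrightarrow>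
        (\<forall>l. (\<forall>i<n. exp (l i) = \<alpha> i) \<longrightarrow> rat_independent n l) \<longrightarrow>
        (\<forall>l. (\<forall>i<n. exp (l i) = \<alpha> i) \<longrightarrow> alg_independent n l))"

text \<open>
  The defining properties determine the logarithm on nonzero arguments, because some power of
  each nonzero element is an integral power of \<open>p\<close> times a root of unity times an element at
  distance less than 1 from 1. The value at 0 is a convention.
\<close>

definition padic_log :: "nat \<Rightarrow> 'c::{nonarch_field, complete_space} \<Rightarrow> 'c" where
  "padic_log p = (THE L.
     (\<forall>x. absval (x - 1) < 1 \<longrightarrow> (\<lambda>n. (-1) ^ n * (x - 1) ^ Suc n / of_nat (Suc n)) sums L x) \<and>
     (\<forall>a b. a \<noteq> 0 \<longrightarrow> b \<noteq> 0 \<longrightarrow> L (a * b) = L a + L b) \<and>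
     (\<forall>\<zeta> (k::nat) (s::int). k > 0 \<longrightarrow> \<zeta> ^ k = 1 \<longrightarrow> L (\<zeta> * of_nat p powi s) = 0) \<and>
     L 0 = 0)"

definition padic_schanuel_log_conjecture ::
    "nat \<Rightarrow> 'c::{nonarch_field, complete_space} itself \<Rightarrow> bool" where
  "padic_schanuel_log_conjecture p _ \<longleftrightarrow>
     (\<forall>n. \<forall>\<alpha>::nat \<Rightarrow> 'c. (\<forall>i<n. \<alpha> i \<noteq> 0 \<and> algebraic (\<alpha> i)) \<longrightarrow>
        rat_independent n (\<lambda>i. padic_log p (\<alpha> i)) \<longrightarrow>
        alg_independent n (\<lambda>i. padic_log p (\<alpha> i)))"

end

theory Submission
  imports "Jordan_Normal_Form.Char_Poly" Defs
begin

text \<open>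
  Let \<open>m\<close> be the number of cosets of \<open>{id, c}\<close> in \<open>G\<close>, so that \<open>r = m - 1\<close>.  The logarithms
  \<open>\<Lambda>\<^sub>g\<close> of the components of an element of the closure, with \<open>g\<close> ranging over the index set \<open>S\<close> of
  \<open>S_p\<close>, determine it up to torsion.  On a unit \<open>u\<close> they are the \<open>log\<^sub>p (\<sigma>\<^sub>0 (g u))\<close>, which only
  depend on the coset of \<open>g\<close> because \<open>c u / u\<close> is a root of unity, and which sum to zero over all
  cosets.  Hence the coordinates at \<open>d = min (m - t) (m - 1)\<close> cosets determine the others, and any
  \<open>d + 1\<close> elements satisfy a linear relation over the completion of \<open>M\<close> at \<open>P\<^sub>0\<close>.  Taking its trace
  over the decomposition group, which permutes the coordinates, makes the coefficients \<open>p\<close>-adic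
  numbers.

  Conversely, let \<open>u\<close> be a Minkowski unit.  By the \<open>p\<close>-adic Schanuel conjecture the logarithms of
  its nontrivial conjugates (one for each coset) are algebraically independent.  The matrix with the
  entries \<open>log\<^sub>p (\<sigma>\<^sub>0 (g h\<^sup>-\<^sup>1 u))\<close> for \<open>g\<close>, \<open>h\<close> in \<open>d \<le> m - 1\<close> cosets specialises to
  \<open>m I - J\<close> with the all-ones matrix \<open>J\<close>, hence is nonsingular, and the units \<open>h\<^sup>-\<^sup>1 u\<close> are
  independent over the \<open>p\<close>-adic integers.
\<close>

text \<open>The archimedean side controls only rational relations: a rational relation between the
  logarithms of the conjugates of a Minkowski unit would make a product of conjugates a root of
  unity. Independence over the \<open>p\<close>-adic integers asks for a nonvanishing determinant
  instead, a polynomial of degree \<open>d\<close> in these logarithms, and this is the point where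
  algebraic independence enters. The logarithm at the identity coset is eliminated by the zero sum,
  so that the determinant becomes a polynomial in independent quantities; at the value -1 for all of
  them the diagonal entry is \<open>m - 1\<close>, and the \<open>d\<close> by \<open>d\<close>
  matrix \<open>J\<close> has the largest eigenvalue \<open>d < m\<close>. The quotients of
  \<open>g\<close> and \<open>h\<close> make sense on cosets because complex conjugation is central.
  The two cases of the minimum arise as follows: the zero sum runs over all cosets and is a relation
  between the available coordinates only if \<open>S\<close> meets every coset, that is, if
  \<open>t = 0\<close>. A trace can destroy a relation; one coefficient is therefore scaled to 1
  beforehand, and its trace is the order of the decomposition group. Fields with different
  normalisations are compared only through the condition \<open>absval x < 1\<close>.\<close>

hide_const (open) Polynomials.degree Polynomials.lead_coeff up_ring.coeff up_ring.monom Module.smult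
  Finite_Cartesian_Product.mat Finite_Cartesian_Product.vec Finite_Cartesian_Product.row
  Determinants.det Divisibility.prime Divisibility.irreducible Coset.order
no_notation Finite_Cartesian_Product.vec_nth (infixl \<open>$\<close> 90)
no_notation fps_nth (infixl \<open>$\<close> 75)

section \<open>Algebraic integers\<close>

definition int_span :: "'i set \<Rightarrow> ('i \<Rightarrow> 'a::field_char_0) \<Rightarrow> 'a set" where
  "int_span I v = {\<Sum>i\<in>I. of_int (k i) * v i |k. True}"

text \<open>The coefficients of the products form an integer matrix with the vector of generators as
  an eigenvector for \<open>x\<close>; \<open>i0\<close> keeps this vector from being zero. So
  \<open>x\<close> is a root of the characteristic polynomial, which is monic with integer
  coefficients.\<close>

lemma algebraic_int_if_int_span:
  fixes v :: "'i \<Rightarrow> 'a::field_char_0"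
  assumes "finite I" "i0 \<in> I" "v i0 \<noteq> 0" and x: "\<And>i. i \<in> I \<Longrightarrow> x * v i \<in> int_span I v"
  shows "algebraic_int x"
proof -
  obtain f where f: "bij_betw f {0..<card I} I"
    using ex_bij_betw_nat_finite[OF assms(1)] by blast
  define n where "n = card I"
  have "\<exists>k. x * v i = (\<Sum>j\<in>I. of_int (k j) * v j)" if "i \<in> I" for i
    using x[OF that] by (auto simp: int_span_def)
  then obtain k where k: "\<And>i. i \<in> I \<Longrightarrow> x * v i = (\<Sum>j\<in>I. of_int (k i j) * v j)"
    by metis
  define A :: "int mat" where "A = mat n n (\<lambda>(i, j). k (f i) (f j))"
  define w where "w = vec n (\<lambda>i. v (f i))"
  have A: "A \<in> carrier_mat n n" by (simp add: A_def)
  have fI: "f i \<in> I" if "i < n" for i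
    using f that by (auto simp: bij_betw_def n_def)
  obtain j0 where j0: "j0 < n" "f j0 = i0"
    using f \<open>i0 \<in> I\<close> that unfolding bij_betw_def n_def by (metis atLeastLessThan_iff imageE)
  have "w \<noteq> 0\<^sub>v n"
  proof
    assume "w = 0\<^sub>v n"
    then have "w $ j0 = 0" using j0 by simp
    then show False using j0 assms(3) by (simp add: w_def)
  qed
  moreover have "map_mat of_int A *\<^sub>v w = x \<cdot>\<^sub>v w"
  proof (rule eq_vecI)
    fix i assume "i < dim_vec (x \<cdot>\<^sub>v w)"
    then have i: "i < n" by (simp add: w_def)
    have "(map_mat of_int A *\<^sub>v w) $ i = (\<Sum>j = 0..<n. of_int (k (f i) (f j)) * v (f j))"
      using i by (simp add: A_def w_def scalar_prod_def)
    also have "\<dots> = (\<Sum>j\<in>I. of_int (k (f i) j) * v j)"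
      using sum.reindex_bij_betw[OF f] by (simp add: n_def)
    also have "\<dots> = x * v (f i)" using k[OF fI[OF i]] by simp
    finally show "(map_mat of_int A *\<^sub>v w) $ i = (x \<cdot>\<^sub>v w) $ i"
      using i by (simp add: w_def)
  qed (simp add: A_def w_def)
  ultimately have "eigenvector (map_mat of_int A) w x"
    using A by (simp add: eigenvector_def w_def)
  then have "poly (char_poly (map_mat of_int A)) x = 0"
    using eigenvalue_root_char_poly[of "map_mat of_int A" n x] A by (auto simp: eigenvalue_def)
  then have "poly (map_poly of_int (char_poly A)) x = 0"
    by (simp add: of_int_hom.char_poly_hom[OF A])
  moreover have "lead_coeff (char_poly A) = 1"
    using degree_monic_char_poly[OF A] by simp
  ultimately show ?thesis by (auto simp: algebraic_int_altdef_ipoly)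
qed

lemma int_span_add: "a \<in> int_span I v \<Longrightarrow> b \<in> int_span I v \<Longrightarrow> a + b \<in> int_span I v"
proof -
  assume "a \<in> int_span I v" "b \<in> int_span I v"
  then obtain k l where "a = (\<Sum>i\<in>I. of_int (k i) * v i)" "b = (\<Sum>i\<in>I. of_int (l i) * v i)"
    by (auto simp: int_span_def)
  then have "a + b = (\<Sum>i\<in>I. of_int (k i + l i) * v i)"
    by (simp add: sum.distrib distrib_right)
  then show ?thesis unfolding int_span_def by (intro CollectI exI[of _ "\<lambda>i. k i + l i"]) simp
qed

lemma int_span_mult_int: "a \<in> int_span I v \<Longrightarrow> of_int z * a \<in> int_span I v"
proof -
  assume "a \<in> int_span I v"
  then obtain k where "a = (\<Sum>i\<in>I. of_int (k i) * v i)"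
    by (auto simp: int_span_def)
  then have "of_int z * a = (\<Sum>i\<in>I. of_int (z * k i) * v i)"
    by (simp add: sum_distrib_left mult.assoc)
  then show ?thesis unfolding int_span_def by (intro CollectI exI[of _ "\<lambda>i. z * k i"]) simp
qed

lemma int_span_0: "0 \<in> int_span I v"
  unfolding int_span_def by (intro CollectI exI[of _ "\<lambda>i. 0"]) simp

lemma int_span_sum:
  "(\<And>j. j \<in> J \<Longrightarrow> a j \<in> int_span I v) \<Longrightarrow> (\<Sum>j\<in>J. a j) \<in> int_span I v"
  by (induction J rule: infinite_finite_induct) (auto simp: int_span_0 intro: int_span_add)

lemma int_span_base: "finite I \<Longrightarrow> i \<in> I \<Longrightarrow> v i \<in> int_span I v"
  unfolding int_span_def
  by (intro CollectI exI[of _ "\<lambda>j. if j = i then 1 else 0"]) (simp add: if_distrib[of of_int] sum.delta' if_distrib[of "\<lambda>x. x * _"] cong: if_cong)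

lemma int_span_mult_closed:
  assumes "\<And>i. i \<in> I \<Longrightarrow> x * v i \<in> int_span I v" "a \<in> int_span I v"
  shows "x * a \<in> int_span I v"
proof -
  obtain k where "a = (\<Sum>i\<in>I. of_int (k i) * v i)"
    using assms(2) by (auto simp: int_span_def)
  then have "x * a = (\<Sum>i\<in>I. of_int (k i) * (x * v i))"
    by (simp add: sum_distrib_left mult_ac)
  also have "\<dots> \<in> int_span I v"
    by (intro int_span_sum int_span_mult_int assms(1))
  finally show ?thesis .
qed

text \<open>This solved form of a monic relation serves the later reductions: of monomials in a
  span, of absolute values and of residues modulo a prime. The degree is positive because a monic
  constant has no root.\<close>

lemma algebraic_int_power_eq:
  fixes x :: "'a::field_char_0"
  assumes "algebraic_int x"
  obtains n k where "n > 0" "x ^ n = (\<Sum>i<n. of_int (k i) * x ^ i)"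
proof -
  obtain p where p: "poly (map_poly of_int p) x = 0" "lead_coeff p = 1"
    using assms by (auto simp: algebraic_int_altdef_ipoly)
  let ?n = "degree p"
  have "?n > 0"
  proof (rule ccontr)
    assume "\<not> 0 < ?n"
    then obtain a where "p = [:a:]" by (auto elim: degree_eq_zeroE)
    then show False using p by auto
  qed
  have "0 = (\<Sum>i\<le>?n. of_int (coeff p i) * x ^ i)"
    using p(1) by (simp add: poly_altdef degree_map_poly coeff_map_poly)
  also have "\<dots> = x ^ ?n + (\<Sum>i<?n. of_int (coeff p i) * x ^ i)"
    using p(2) by (simp add: lessThan_Suc_atMost[symmetric])
  finally have "x ^ ?n = (\<Sum>i<?n. of_int (- coeff p i) * x ^ i)"
    by (simp add: sum_negf add_eq_0_iff2)
  with \<open>?n > 0\<close> show ?thesis by (rule that[of ?n "\<lambda>i. - coeff p i"])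
qed

text \<open>The monomials \<open>x ^ i * y ^ j\<close> with \<open>i < m\<close> and
  \<open>j < n\<close> span a module that multiplication by \<open>x\<close> and by \<open>y\<close>
  maps to itself; exponents that reach \<open>m\<close> or \<open>n\<close> are lowered by the monic
  relations.\<close>

lemma algebraic_int_add_mult:
  fixes x y :: "'a::field_char_0"
  assumes "algebraic_int x" "algebraic_int y"
  shows "algebraic_int (x + y) \<and> algebraic_int (x * y)"
proof -
  obtain m k where m: "m > 0" "x ^ m = (\<Sum>i<m. of_int (k i) * x ^ i)"
    using algebraic_int_power_eq[OF assms(1)] by blast
  obtain n l where n: "n > 0" "y ^ n = (\<Sum>i<n. of_int (l i) * y ^ i)"
    using algebraic_int_power_eq[OF assms(2)] by blast
  define I where "I = {..<m} \<times> {..<n}"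
  define v where "v = (\<lambda>(i, j). x ^ i * y ^ j)"
  have I: "finite I" by (simp add: I_def)
  have vI: "x ^ i * y ^ j \<in> int_span I v" if "i < m" "j < n" for i j
    using int_span_base[of I "(i, j)" v] that by (simp add: I_def v_def)
  have vx: "x * v i \<in> int_span I v" if "i \<in> I" for i
  proof -
    obtain a b where i: "i = (a, b)" by (cases i)
    with that have ab: "a < m" "b < n" by (auto simp: I_def)
    show ?thesis
    proof (cases "Suc a < m")
      case True
      then show ?thesis using vI[OF True ab(2)] by (simp add: i v_def mult.assoc)
    next
      case False
      with ab have "Suc a = m" by simp
      then have "x * v i = x ^ m * y ^ b" using i by (auto simp: v_def)
      also have "\<dots> = (\<Sum>i<m. of_int (k i) * (x ^ i * y ^ b))"
        by (simp add: m(2) sum_distrib_right mult.assoc)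
      also have "\<dots> \<in> int_span I v"
        using ab by (intro int_span_sum int_span_mult_int vI) auto
      finally show ?thesis .
    qed
  qed
  have vy: "y * v i \<in> int_span I v" if "i \<in> I" for i
  proof -
    obtain a b where i: "i = (a, b)" by (cases i)
    with that have ab: "a < m" "b < n" by (auto simp: I_def)
    show ?thesis
    proof (cases "Suc b < n")
      case True
      then show ?thesis using vI[OF ab(1) True] by (simp add: i v_def mult_ac)
    next
      case False
      with ab have "Suc b = n" by simp
      then have "y * v i = x ^ a * y ^ n" using i by (auto simp: v_def mult_ac)
      also have "\<dots> = (\<Sum>j<n. of_int (l j) * (x ^ a * y ^ j))"
        by (simp add: n(2) sum_distrib_left mult_ac)
      also have "\<dots> \<in> int_span I v"
        using ab by (intro int_span_sum int_span_mult_int vI) auto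
      finally show ?thesis .
    qed
  qed
  have i0: "(0, 0) \<in> I" "v (0, 0) \<noteq> 0" using m n by (auto simp: I_def v_def)
  have "algebraic_int (x + y)"
    by (rule algebraic_int_if_int_span[where v = v, OF I i0])
       (auto simp: distrib_right intro!: int_span_add vx vy)
  moreover have "algebraic_int (x * y)"
    by (rule algebraic_int_if_int_span[where v = v, OF I i0])
       (auto simp: mult.assoc intro!: int_span_mult_closed[OF vx] vy)
  ultimately show ?thesis by blast
qed

lemma algebraic_int_add: "algebraic_int x \<Longrightarrow> algebraic_int y \<Longrightarrow> algebraic_int (x + y :: 'a::field_char_0)"
  and algebraic_int_mult: "algebraic_int x \<Longrightarrow> algebraic_int y \<Longrightarrow> algebraic_int (x * y :: 'a::field_char_0)"
  using algebraic_int_add_mult by blast+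

lemma algebraic_int_diff: "algebraic_int x \<Longrightarrow> algebraic_int y \<Longrightarrow> algebraic_int (x - y :: 'a::field_char_0)"
  using algebraic_int_add[of x "- y"] by simp

lemma algebraic_int_power: "algebraic_int x \<Longrightarrow> algebraic_int (x ^ n :: 'a::field_char_0)"
  by (induction n) (auto intro: algebraic_int_mult)

lemma algebraic_int_sum:
  "(\<And>i. i \<in> I \<Longrightarrow> algebraic_int (f i)) \<Longrightarrow> algebraic_int (\<Sum>i\<in>I. f i :: 'a::field_char_0)"
  by (induction I rule: infinite_finite_induct) (auto intro: algebraic_int_add)

lemma algebraic_int_prod:
  "(\<And>i. i \<in> I \<Longrightarrow> algebraic_int (f i)) \<Longrightarrow> algebraic_int (\<Prod>i\<in>I. f i :: 'a::field_char_0)"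
  by (induction I rule: infinite_finite_induct) (auto intro: algebraic_int_mult)

lemma algebraic_int_of_int: "algebraic_int (of_int n :: 'a::field_char_0)"
  by (rule int_imp_algebraic_int) auto

lemma algebraic_int_prod_ints:
  fixes f :: "'i \<Rightarrow> 'a::field_char_0"
  assumes "\<And>i. i \<in> I \<Longrightarrow> algebraic_int (f i)" "(\<Prod>i\<in>I. f i) \<in> \<rat>"
  shows "(\<Prod>i\<in>I. f i) \<in> \<int>"
  using rational_algebraic_int_is_int algebraic_int_prod assms by blast

section \<open>Field homomorphisms\<close>

text \<open>Homomorphisms of structures become instances of the locale \<open>field_hom\<close>.
  Preservation of zero, which \<open>ring_hom\<close> does not ask for, follows by cancellation in
  the image of \<open>0 + 0\<close>.\<close>

lemma ring_hom_fld_iff: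
  fixes f :: "'a::field_char_0 \<Rightarrow> 'b::field_char_0"
  shows "f \<in> ring_hom fld fld \<longleftrightarrow> field_hom f"
proof
  assume f: "f \<in> ring_hom fld fld"
  have 1: "f (x + y) = f x + f y" "f (x * y) = f x * f y" "f 1 = 1" for x y
    using ring_hom_add[OF f, of x y] ring_hom_mult[OF f, of x y] ring_hom_one[OF f]
    by (simp_all add: ring_of_type_algebra_def)
  have "f 0 + f 0 = f 0 + 0" using 1(1)[of 0 0] by simp
  then have "f 0 = 0" by simp
  with 1 show "field_hom f" by unfold_locales auto
next
  assume "field_hom f"
  then interpret field_hom f .
  show "f \<in> ring_hom fld fld"
    by (rule ring_hom_memI) (auto simp: ring_of_type_algebra_def hom_distribs)
qed

lemma field_hom_inject: "field_hom f \<Longrightarrow> f x = f y \<longleftrightarrow> x = y"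
proof -
  assume "field_hom f"
  then interpret field_hom f .
  show ?thesis by simp
qed

lemma field_hom_comp: "field_hom f \<Longrightarrow> field_hom g \<Longrightarrow> field_hom (f \<circ> g)"
proof -
  assume "field_hom f" "field_hom g"
  then interpret f: field_hom f + g: field_hom g .
  show ?thesis by unfold_locales (auto simp: hom_distribs)
qed

lemma field_hom_of_rat:
  fixes f :: "'a::field_char_0 \<Rightarrow> 'b::field_char_0"
  assumes "field_hom f" shows "f (of_rat q) = of_rat q"
proof -
  interpret field_hom f by fact
  obtain a b where q: "q = Rat.Fract a b" "b > 0" by (cases q) auto
  then have "f (of_rat q) = f (of_int a / of_int b)" by (simp add: of_rat_rat)
  also have "\<dots> = of_rat q" using q by (simp add: hom_distribs of_rat_rat)
  finally show ?thesis .
qed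

lemma field_hom_poly_rat:
  fixes f :: "'a::field_char_0 \<Rightarrow> 'b::field_char_0"
  assumes "field_hom f" shows "f (poly (map_poly of_rat q) x) = poly (map_poly of_rat q) (f x)"
proof -
  interpret field_hom f by fact
  show ?thesis
    by (simp add: poly_altdef degree_map_poly coeff_map_poly hom_distribs field_hom_of_rat[OF assms])
qed

lemma field_hom_algebraic_int:
  fixes f :: "'a::field_char_0 \<Rightarrow> 'b::field_char_0"
  assumes f: "field_hom f" shows "algebraic_int (f x) \<longleftrightarrow> algebraic_int x"
proof -
  interpret field_hom f by fact
  have *: "poly (map_poly of_int p) (f x) = f (poly (map_poly of_int p) x)" for p
    by (simp add: poly_altdef degree_map_poly coeff_map_poly hom_distribs)
  show ?thesis unfolding algebraic_int_altdef_ipoly * by simp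
qed

lemma field_hom_algebraic:
  fixes f :: "'a::field_char_0 \<Rightarrow> 'b::field_char_0"
  assumes f: "field_hom f" and x: "algebraic x" shows "algebraic (f x)"
proof -
  interpret field_hom f by fact
  obtain p where p: "poly (map_poly of_int p) x = 0" "p \<noteq> 0"
    using x by (auto elim: algebraicE')
  have "poly (map_poly of_int p) (f x) = f (poly (map_poly of_int p) x)"
    by (simp add: poly_altdef degree_map_poly coeff_map_poly hom_distribs)
  with p show ?thesis by (intro algebraicI'[of "map_poly of_int p"]) (auto simp: coeff_map_poly)
qed

section \<open>The Galois group\<close>

abbreviation rpoly :: "rat poly \<Rightarrow> 'a::field_char_0 \<Rightarrow> 'a" where
  "rpoly f x \<equiv> poly (map_poly of_rat f) x"

lemma rpoly_simps:
  "rpoly (f + g) x = rpoly f x + rpoly g x"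
  "rpoly (f * g) x = rpoly f x * rpoly g x"
  "rpoly (f - g) x = rpoly f x - rpoly g x"
  "rpoly (f ^ k) x = rpoly f x ^ k"
  "rpoly (pcompose f g) x = rpoly f (rpoly g x)"
  "rpoly (pCons a f) x = of_rat a + x * rpoly f x"
  "rpoly 0 x = 0"
  "rpoly 1 x = 1"
proof -
  interpret r: map_poly_comm_ring_hom "of_rat :: rat \<Rightarrow> 'a" ..
  show "rpoly (f + g) x = rpoly f x + rpoly g x" "rpoly (f * g) x = rpoly f x * rpoly g x"
    "rpoly (f - g) x = rpoly f x - rpoly g x" "rpoly (f ^ k) x = rpoly f x ^ k"
    by (simp_all add: r.hom_add r.hom_mult r.hom_minus r.hom_power)
  show "rpoly (pcompose f g) x = rpoly f (rpoly g x)"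
    by (simp add: of_rat_hom.map_poly_pcompose poly_pcompose)
  show "rpoly (pCons a f) x = of_rat a + x * rpoly f x"
    by (simp add: of_rat_hom.map_poly_pCons_hom)
qed simp_all

text \<open>This is only the ring generated by \<open>x\<close> over the rationals; for a root
  \<open>x\<close> of an irreducible polynomial it is the field generated by \<open>x\<close>, by
  \<open>simple_ext_inverse\<close>.\<close>

definition simple_ext :: "'a::field_char_0 \<Rightarrow> 'a set" where
  "simple_ext x = range (\<lambda>f. rpoly f x)"

lemma simple_extI: "y = rpoly f x \<Longrightarrow> y \<in> simple_ext x"
  by (auto simp: simple_ext_def)

lemma simple_ext_closed:
  "a \<in> simple_ext x \<Longrightarrow> b \<in> simple_ext x \<Longrightarrow> a + b \<in> simple_ext x"
  "a \<in> simple_ext x \<Longrightarrow> b \<in> simple_ext x \<Longrightarrow> a - b \<in> simple_ext x"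
  "a \<in> simple_ext x \<Longrightarrow> b \<in> simple_ext x \<Longrightarrow> a * b \<in> simple_ext x"
  "of_rat r \<in> simple_ext x"
  "x \<in> simple_ext x"
proof -
  show "a + b \<in> simple_ext x" "a - b \<in> simple_ext x" "a * b \<in> simple_ext x"
    if "a \<in> simple_ext x" "b \<in> simple_ext x"
    using that unfolding simple_ext_def by (auto simp: rpoly_simps[symmetric])
  show "of_rat r \<in> simple_ext x" by (rule simple_extI[of _ "[:r:]"]) (simp add: rpoly_simps)
  show "x \<in> simple_ext x" by (rule simple_extI[of _ "[:0, 1:]"]) (simp add: rpoly_simps)
qed

lemma simple_ext_0_1: "0 \<in> simple_ext x" "1 \<in> simple_ext x"
  using simple_ext_closed(4)[of 0 x] simple_ext_closed(4)[of 1 x] by simp_all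

lemma simple_ext_sum: "(\<And>i. i \<in> I \<Longrightarrow> f i \<in> simple_ext x) \<Longrightarrow> (\<Sum>i\<in>I. f i) \<in> simple_ext x"
  by (induction I rule: infinite_finite_induct) (auto intro: simple_ext_closed simple_ext_0_1)

lemma simple_ext_mono: "x \<in> simple_ext y \<Longrightarrow> simple_ext x \<subseteq> simple_ext y"
  by (auto simp: simple_ext_def rpoly_simps(5)[symmetric])

text \<open>Were \<open>q\<close> and \<open>f\<close> coprime, a Bezout identity evaluated at the
  common root would read 0 = 1.\<close>

lemma irreducible_rpoly_dvd:
  fixes x :: "'a::field_char_0"
  assumes "Factorial_Ring.irreducible q" "rpoly q x = 0" "rpoly f x = 0"
  shows "q dvd f"
proof (rule ccontr)
  assume "\<not> q dvd f"
  then have "Rings.coprime q f"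
    using assms(1) by (simp add: prime_elem_imp_coprime irreducible_imp_prime_elem_gcd)
  then obtain a b where "a * q + b * f = 1"
    using bezout_coefficients_fst_snd[of q f] by (metis coprime_iff_gcd_eq_1)
  then have "rpoly (a * q + b * f) x = 1" by (simp add: rpoly_simps)
  then show False using assms by (simp only: rpoly_simps) simp
qed

lemma simple_ext_inverse:
  fixes x :: "'a::field_char_0"
  assumes "Factorial_Ring.irreducible q" "rpoly q x = 0" "y \<in> simple_ext x"
  shows "inverse y \<in> simple_ext x"
proof (cases "y = 0")
  case False
  obtain f where f: "y = rpoly f x" using assms(3) by (auto simp: simple_ext_def)
  have "\<not> q dvd f" using False f assms(2) by (auto elim!: dvdE simp: rpoly_simps)
  then have "Rings.coprime q f"
    using assms(1) by (simp add: prime_elem_imp_coprime irreducible_imp_prime_elem_gcd)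
  then obtain a b where "a * q + b * f = 1"
    using bezout_coefficients_fst_snd[of q f] by (metis coprime_iff_gcd_eq_1)
  then have "rpoly (a * q + b * f) x = 1" by (simp add: rpoly_simps)
  then have "rpoly b x * y = 1" using assms f by (simp only: rpoly_simps) simp
  then have "inverse y = rpoly b x" using False by (simp add: field_simps)
  then show ?thesis by (rule simple_extI)
qed (simp add: simple_ext_0_1)

text \<open>In a factorisation through \<open>h\<close>, each \<open>b\<close> is a root of the
  product but not of \<open>h\<close>, hence of the cofactor, and its linear factor can be
  cancelled.\<close>

lemma dvd_mult_linear_factors:
  fixes h :: "'a::field poly"
  assumes "finite S" "h dvd P * (\<Prod>b\<in>S. [:- b, 1:])" "\<And>b. b \<in> S \<Longrightarrow> poly h b \<noteq> 0"
  shows "h dvd P"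
  using assms
proof (induction S rule: finite_induct)
  case (insert b S)
  obtain k where k: "P * (\<Prod>b\<in>insert b S. [:- b, 1:]) = h * k" using insert.prems(1) unfolding dvd_def by blast
  then have "poly (h * k) b = 0" using insert.hyps by (simp add: k[symmetric])
  then have "poly k b = 0" using insert.prems(2) by simp
  then obtain k' where k': "k = [:- b, 1:] * k'" unfolding poly_eq_0_iff_dvd dvd_def by blast
  have "[:- b, 1:] * (P * (\<Prod>b\<in>S. [:- b, 1:])) = [:- b, 1:] * (h * k')"
    using k[unfolded prod.insert[OF insert.hyps(1,2)] k']
    by (simp only: mult.assoc mult.commute mult.left_commute)
  then have "P * (\<Prod>b\<in>S. [:- b, 1:]) = h * k'"
    by (subst (asm) mult_cancel_left) auto
  then have "h dvd P * (\<Prod>b\<in>S. [:- b, 1:])" by simp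
  with insert show ?case by blast
qed simp

text \<open>Division by a monic polynomial uses only differences and products of coefficients and so
  stays within \<open>K\<close>, which is a set and not a type. Leading terms are removed one at a
  time until minimality applies.\<close>

lemma minimal_degree_dvd:
  fixes h p :: "'a::field poly"
  assumes closed: "\<And>a b. a \<in> K \<Longrightarrow> b \<in> K \<Longrightarrow> a - b \<in> K" "\<And>a b. a \<in> K \<Longrightarrow> b \<in> K \<Longrightarrow> a * b \<in> K"
    and "0 \<in> K"
    and h: "lead_coeff h = 1" "\<And>i. coeff h i \<in> K" "poly h \<beta> = 0"
    and min: "\<And>p. p \<noteq> 0 \<Longrightarrow> (\<And>i. coeff p i \<in> K) \<Longrightarrow> poly p \<beta> = 0 \<Longrightarrow> degree h \<le> degree p"
    and p: "\<And>i. coeff p i \<in> K" "poly p \<beta> = 0"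
  shows "h dvd p"
  using p
proof (induction "degree p" arbitrary: p rule: less_induct)
  case (less p)
  show ?case
  proof (cases "p = 0")
    case False
    then have le: "degree h \<le> degree p" using min less.prems by blast
    define m where "m = monom (lead_coeff p) (degree p - degree h)"
    define p' where "p' = p - m * h"
    have c: "coeff (m * h) i = (if i < degree p - degree h then 0
        else lead_coeff p * coeff h (i - (degree p - degree h)))" for i
      unfolding m_def by (subst coeff_monom_mult) auto
    have K: "coeff p' i \<in> K" for i
      unfolding p'_def coeff_diff c using less.prems(1) h(2) closed \<open>0 \<in> K\<close> by auto
    have "h \<noteq> 0" using h(1) by auto
    have dm: "degree (m * h) = degree p"
      using False \<open>h \<noteq> 0\<close> le by (simp add: m_def degree_mult_eq degree_monom_eq monom_eq_0_iff)
    have r: "poly p' \<beta> = 0" using less.prems(2) h(3) by (simp add: p'_def)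
    have "coeff p' (degree p) = 0" using le h(1) by (simp add: p'_def c)
    moreover have "degree p' \<le> degree p" using dm by (simp add: p'_def degree_diff_le)
    ultimately have "p' = 0 \<or> degree p' < degree p"
      using eq_zero_or_degree_less by blast
    then have "h dvd p'" using less.hyps[OF _ K r] by auto
    then have "h dvd p' + m * h" by simp
    then show ?thesis by (simp add: p'_def)
  qed simp
qed

text \<open>For \<open>\<theta> = \<alpha> + c \<beta>\<close>, a polynomial \<open>h\<close> of
  least degree over the field of \<open>\<theta>\<close> with root \<open>\<beta>\<close> divides
  both \<open>g\<close> and \<open>F = f(\<theta> - c X)\<close>. For all but finitely many
  \<open>c\<close> the only common root of these two is \<open>\<beta>\<close>, and the distinct
  linear factors of \<open>g\<close> leave degree one for \<open>h\<close>.\<close>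

lemma primitive_element_two:
  fixes \<alpha> \<beta> :: "'m::field_char_0"
  assumes gal: "galois_over_rat TYPE('m::field_char_0)"
  obtains \<theta> :: 'm where "\<alpha> \<in> simple_ext \<theta>" "\<beta> \<in> simple_ext \<theta>"
proof -
  obtain f A where f: "Factorial_Ring.irreducible f" "finite A" "\<alpha> \<in> A"
    "map_poly of_rat f = (\<Prod>a\<in>A. [:- a, 1:])"
    using gal unfolding galois_over_rat_def by blast
  obtain g B where g: "Factorial_Ring.irreducible g" "finite B" "\<beta> \<in> B"
    "map_poly of_rat g = (\<Prod>a\<in>B. [:- a, 1:])"
    using gal unfolding galois_over_rat_def by blast
  \<comment> \<open>These quotients are the \<open>c\<close> for which \<open>\<theta> - c b\<close>
    is a root \<open>a\<close> of \<open>f\<close>. For \<open>b = \<beta>\<close> the division by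
    zero merely adds the value 0.\<close>
  define bad where "bad = (\<lambda>(a, b). (\<alpha> - a) / (b - \<beta>)) ` (A \<times> B)"
  have "finite bad" using f g by (simp add: bad_def)
  moreover have "infinite (range (of_nat :: nat \<Rightarrow> 'm))"
    by (rule range_inj_infinite) (simp add: inj_def)
  ultimately obtain c where c: "(of_nat c :: 'm) \<notin> bad"
    by (meson finite_subset image_subsetI)
  define \<theta> where "\<theta> = \<alpha> + of_nat c * \<beta>"
  define K where "K = simple_ext \<theta>"
  obtain q where q: "Factorial_Ring.irreducible q" "rpoly q \<theta> = 0"
  proof -
    obtain q C where *: "Factorial_Ring.irreducible q" "finite C" "\<theta> \<in> C"
      "map_poly of_rat q = (\<Prod>a\<in>C. [:- a, 1:])"
      using gal unfolding galois_over_rat_def by blast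
    then have "rpoly q \<theta> = 0" by (auto simp: poly_prod prod_zero_iff)
    with * show ?thesis using that by blast
  qed
  have ratK: "of_rat r \<in> K" for r by (simp add: K_def simple_ext_closed)
  note K_closed = simple_ext_closed[where x = \<theta>, folded K_def] simple_ext_0_1[of \<theta>, folded K_def]
  have g\<beta>: "rpoly g \<beta> = 0" using g by (auto simp: poly_prod prod_zero_iff)
  have "g \<noteq> 0" using g(1) by auto
  have ex: "\<exists>p::'m poly. p \<noteq> 0 \<and> (\<forall>i. coeff p i \<in> K) \<and> poly p \<beta> = 0"
    by (rule exI[of _ "map_poly of_rat g"]) (use g\<beta> ratK \<open>g \<noteq> 0\<close> in \<open>auto simp: coeff_map_poly\<close>)
  define Q where "Q = (\<lambda>p::'m poly. p \<noteq> 0 \<and> (\<forall>i. coeff p i \<in> K) \<and> poly p \<beta> = 0)"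
  obtain h0 where h0: "Q h0" and min0: "\<And>p. Q p \<Longrightarrow> degree h0 \<le> degree p"
    using ex ex_has_least_nat[of Q _ degree] unfolding Q_def by blast
  define h where "h = Polynomial.smult (inverse (lead_coeff h0)) h0"
  have lc: "lead_coeff h0 \<noteq> 0" "inverse (lead_coeff h0) \<in> K"
    using h0 simple_ext_inverse[OF q] by (auto simp: Q_def K_def)
  have h: "lead_coeff h = 1" "\<And>i. coeff h i \<in> K" "poly h \<beta> = 0" "degree h = degree h0"
    using lc h0 K_closed(3) by (auto simp: h_def Q_def)
  have h_dvd: "h dvd p" if "\<And>i. coeff p i \<in> K" "poly p \<beta> = 0" for p
    using minimal_degree_dvd[of K h \<beta> p] h min0 that K_closed by (auto simp: Q_def)
  have hg: "h dvd (\<Prod>a\<in>B. [:- a, 1:])"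
    unfolding g(4)[symmetric] by (rule h_dvd) (use g\<beta> ratK in \<open>auto simp: coeff_map_poly\<close>)
  define F where "F = pcompose (map_poly of_rat f) [:\<theta>, - of_nat c:]"
  have "coeff F i \<in> K" for i
  proof -
    have lin: "coeff [:\<theta>, - of_nat c:] i \<in> K" for i
      using K_closed(2)[OF K_closed(6) K_closed(4)[of "of_nat c"]] K_closed(5)
      by (auto simp: coeff_pCons K_closed split: nat.splits)
    have mult: "coeff (a * b) i \<in> K" if "\<And>i. coeff a i \<in> K" "\<And>i. coeff b i \<in> K" for a b i
      unfolding coeff_mult K_def using that by (intro simple_ext_sum simple_ext_closed(3)) (auto simp: K_def)
    have "\<forall>i. coeff (pcompose (map_poly of_rat f) [:\<theta>, - of_nat c:]) i \<in> K"
    proof (induction f)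
      case (pCons a f)
      have "coeff [:of_rat a:] i \<in> K" for i
        using ratK K_closed by (auto simp: coeff_pCons split: nat.splits)
      moreover have "coeff ([:\<theta>, - of_nat c:] * pcompose (map_poly of_rat f) [:\<theta>, - of_nat c:]) i \<in> K" for i
        using pCons.IH by (intro mult lin) blast
      ultimately show ?case
        unfolding of_rat_hom.map_poly_pCons_hom pcompose_pCons coeff_add by (intro allI K_closed(1))
    qed (simp add: K_closed)
    then show ?thesis by (simp add: F_def)
  qed
  moreover have "poly F \<beta> = 0"
  proof -
    have "rpoly f \<alpha> = 0" using f by (auto simp: poly_prod prod_zero_iff)
    moreover have "poly [:\<theta>, - of_nat c:] \<beta> = \<alpha>" by (simp add: \<theta>_def mult.commute)
    ultimately show ?thesis unfolding F_def poly_pcompose by metis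
  qed
  ultimately have hF: "h dvd F" by (rule h_dvd)
  have "poly h b \<noteq> 0" if "b \<in> B - {\<beta>}" for b
  proof
    assume "poly h b = 0"
    then have "poly F b = 0" using hF by (meson dvd_trans poly_eq_0_iff_dvd)
    then have "rpoly f (\<theta> - b * of_nat c) = 0" by (simp add: F_def poly_pcompose)
    then obtain a where a: "a \<in> A" "\<theta> - b * of_nat c = a"
      using f by (auto simp: poly_prod prod_zero_iff)
    have "b - \<beta> \<noteq> 0" using that by auto
    moreover have "of_nat c * (b - \<beta>) = \<alpha> - a"
      using a(2) unfolding a(2)[symmetric] \<theta>_def by (simp add: algebra_simps)
    ultimately have "of_nat c = (\<alpha> - a) / (b - \<beta>)" by (simp add: eq_divide_eq)
    then show False using c a that by (force simp: bad_def)
  qed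
  moreover have "h dvd [:- \<beta>, 1:] * (\<Prod>a\<in>B - {\<beta>}. [:- a, 1:])"
    using hg unfolding prod.remove[OF g(2,3)] .
  ultimately have "h dvd [:- \<beta>, 1:]"
    using dvd_mult_linear_factors[of "B - {\<beta>}" h "[:- \<beta>, 1:]"] g(2) by blast
  then have "degree h \<le> 1" using dvd_imp_degree_le[of h "[:- \<beta>, 1:]"] by simp
  moreover have "degree h \<noteq> 0"
  proof
    assume "degree h = 0"
    then have "poly h \<beta> = lead_coeff h" by (simp add: poly_altdef)
    then show False using h(1,3) by simp
  qed
  ultimately have "degree h = 1" by linarith
  then have "poly h \<beta> = coeff h 0 + \<beta>" using h(1) by (simp add: poly_altdef)
  then have "\<beta> = - coeff h 0" using h(3) by (metis add_eq_0_iff)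
  then have \<beta>: "\<beta> \<in> K" using K_closed(2)[OF K_closed(6) h(2)[of 0]] by (metis diff_0)
  have "of_nat c * \<beta> \<in> K" using K_closed(3)[OF ratK[of "of_nat c"] \<beta>] by simp
  then have "\<theta> - of_nat c * \<beta> \<in> K" by (rule K_closed(2)[OF K_closed(5)])
  moreover have "\<theta> - of_nat c * \<beta> = \<alpha>" unfolding \<theta>_def by simp
  ultimately have "\<alpha> \<in> K" by metis
  with \<beta> show ?thesis unfolding K_def by (rule that[rotated])
qed

lemma line_ext_fld:
  "ring.line_extension (fld :: 'a::field_char_0 ring) K v E = {k * v + e |k e. k \<in> K \<and> e \<in> E}"
  unfolding ring.line_extension_def[OF ring_from_type_algebra] set_add_def set_mult_def r_coset_def
  by (auto simp: ring_of_type_algebra_def)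

lemma primitive_element:
  assumes nf: "number_field TYPE('m::{field_char_0})" and gal: "galois_over_rat TYPE('m::field_char_0)"
  obtains \<theta> :: "'m::field_char_0" where "simple_ext \<theta> = UNIV"
proof -
  note R = ring_from_type_algebra[where 'a = 'm]
  \<comment> \<open>The field is a variable of the induction over dimensions, so it is fixed by a
    premise. Each step adjoins one vector and merges two generators into one.\<close>
  have "K = \<rat> \<longrightarrow> (\<exists>\<theta>. E \<subseteq> simple_ext \<theta>)" if "ring.dimension (fld :: 'm ring) n K E" for n K E
    using that
  proof (induction rule: ring.dimension.induct[OF R, consumes 1, case_names zero_dim Suc_dim])
    case (zero_dim K)
    have "\<zero>\<^bsub>fld\<^esub> = (0::'m)" by (simp add: ring_of_type_algebra_def)
    then show ?case using simple_ext_0_1(1)[of 0] by auto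
  next
    case (Suc_dim v E n K)
    show ?case
    proof
      assume "K = \<rat>"
      then obtain \<theta>0 where t0: "E \<subseteq> simple_ext \<theta>0" using Suc_dim by blast
      obtain \<theta> where t: "\<theta>0 \<in> simple_ext \<theta>" "v \<in> simple_ext \<theta>"
        using primitive_element_two[OF gal] by blast
      have "ring.line_extension fld K v E \<subseteq> simple_ext \<theta>"
      proof
        fix y assume "y \<in> ring.line_extension fld K v E"
        then have "y \<in> {k * v + e |k e. k \<in> \<rat> \<and> e \<in> E}"
          unfolding line_ext_fld \<open>K = \<rat>\<close> .
        then obtain k e where y: "y = k * v + e" "k \<in> \<rat>" "e \<in> E"
          unfolding mem_Collect_eq by (elim exE conjE)
        have "e \<in> simple_ext \<theta>" using y t0 simple_ext_mono[OF t(1)] by auto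
        moreover have "k \<in> simple_ext \<theta>" using simple_ext_closed(4) Rats_cases[OF y(2)] by metis
        ultimately show "y \<in> simple_ext \<theta>"
            unfolding y(1) by (intro simple_ext_closed(1) simple_ext_closed(3) t(2))
      qed
      then show "\<exists>\<theta>. ring.line_extension fld K v E \<subseteq> simple_ext \<theta>" by blast
    qed
  qed
  moreover obtain n where "ring.dimension (fld :: 'm ring) n \<rat> (UNIV :: 'm set)"
    using nf by (auto simp: number_field_def ring.finite_dimension_def[OF R])
  ultimately obtain \<theta> :: 'm where "UNIV \<subseteq> simple_ext \<theta>" by blast
  then show ?thesis using that by blast
qed

lemma algebraic_int_if_power_eq:
  fixes x :: "'a::field_char_0"
  assumes "n > 0" "x ^ n = (\<Sum>i<n. of_int (k i) * x ^ i)"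
  shows "algebraic_int x"
proof (rule algebraic_int_if_int_span[where I = "{..<n}" and v = "\<lambda>i. x ^ i" and ?i0.0 = 0])
  fix i assume "i \<in> {..<n}"
  show "x * x ^ i \<in> int_span {..<n} (\<lambda>i. x ^ i)"
  proof (cases "Suc i < n")
    case True
    then show ?thesis using int_span_base[of "{..<n}" "Suc i" "\<lambda>i. x ^ i"] by simp
  next
    case False
    with \<open>i \<in> {..<n}\<close> have "Suc i = n" by simp
    then have "x * x ^ i = x ^ n" by auto
    then show ?thesis unfolding int_span_def using assms(2) by auto
  qed
qed (use assms in auto)

text \<open>Multiplied by \<open>l ^ (n - 1)\<close>, with \<open>l\<close> the leading coefficient,
  the relation for \<open>x\<close> becomes a monic relation for \<open>l * x\<close>.\<close>

lemma algebraic_int_multiple: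
  fixes x :: "'a::field_char_0"
  assumes "algebraic x"
  obtains d :: int where "d \<noteq> 0" "algebraic_int (of_int d * x)"
proof -
  obtain p where p: "poly (map_poly of_int p) x = 0" "p \<noteq> 0"
    using assms by (auto elim: algebraicE')
  define n where "n = degree p"
  define l where "l = lead_coeff p"
  have l: "l \<noteq> 0" using p by (simp add: l_def)
  have "n > 0"
  proof (rule ccontr)
    assume "\<not> 0 < n"
    then have "poly (map_poly of_int p) x = of_int l" by (simp add: poly_altdef n_def l_def degree_map_poly coeff_map_poly)
    then show False using p l by simp
  qed
  define y where "y = of_int l * x"
  have "0 = of_int l ^ (n - 1) * (\<Sum>i\<le>n. of_int (coeff p i) * x ^ i)"
    using p(1) by (simp add: poly_altdef degree_map_poly coeff_map_poly n_def)
  also have "\<dots> = of_int l ^ (n - 1) * (of_int l * x ^ n) + of_int l ^ (n - 1) * (\<Sum>i<n. of_int (coeff p i) * x ^ i)"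
    by (simp add: lessThan_Suc_atMost[symmetric] l_def n_def distrib_left)
  also have "of_int l ^ (n - 1) * (of_int l * x ^ n) = y ^ n"
    using \<open>n > 0\<close> by (cases n) (simp_all add: y_def power_mult_distrib)
  also have "of_int l ^ (n - 1) * (\<Sum>i<n. of_int (coeff p i) * x ^ i) =
      (\<Sum>i<n. of_int (coeff p i * l ^ (n - 1 - i)) * y ^ i)"
    unfolding sum_distrib_left
  proof (rule sum.cong)
    fix i assume "i \<in> {..<n}"
    then have "of_int l ^ (n - 1) = (of_int l ^ (n - 1 - i) * of_int l ^ i :: 'a)"
      by (simp add: power_add[symmetric])
    then show "of_int l ^ (n - 1) * (of_int (coeff p i) * x ^ i) = of_int (coeff p i * l ^ (n - 1 - i)) * y ^ i"
      by (simp add: y_def power_mult_distrib mult_ac)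
  qed simp
  finally have "y ^ n = (\<Sum>i<n. of_int (- (coeff p i * l ^ (n - 1 - i))) * y ^ i)"
    by (simp add: sum_negf add_eq_0_iff2)
  then have "algebraic_int y" by (rule algebraic_int_if_power_eq[OF \<open>n > 0\<close>])
  then show ?thesis using that l by (simp add: y_def)
qed

lemma algebraic_if_galois:
  fixes x :: "'m::field_char_0"
  assumes "galois_over_rat TYPE('m)"
  shows "algebraic x"
proof -
  obtain q A where *: "Factorial_Ring.irreducible q" "finite A" "x \<in> A"
    "map_poly of_rat q = (\<Prod>a\<in>A. [:- a, 1:])"
    using assms unfolding galois_over_rat_def by blast
  then have "rpoly q x = 0" by (auto simp: poly_prod prod_zero_iff)
  moreover have "map_poly of_rat q \<noteq> (0 :: 'm poly)" using *(1) by auto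
  ultimately show ?thesis unfolding algebraic_altdef
    by (intro exI[of _ "map_poly of_rat q"]) (auto simp: coeff_map_poly)
qed

section \<open>Embeddings and automorphisms in terms of the roots of one polynomial\<close>

locale primitive_generator =
  fixes \<theta> :: "'m::field_char_0" and q :: "rat poly" and A :: "'m set"
  assumes \<theta>_int: "algebraic_int \<theta>" and simple_ext_\<theta>: "simple_ext \<theta> = UNIV"
    and q_irreducible: "Factorial_Ring.irreducible q"
    and finite_A: "finite A" and \<theta>_in_A: "\<theta> \<in> A"
    and galois: "galois_over_rat TYPE('m)"
    and q_split: "map_poly of_rat q = (\<Prod>a\<in>A. [:- a, 1:])"

text \<open>The generator is replaced by an integral multiple so that integer combinations of its
  powers are algebraic integers; they form the lattice of the later pigeonhole argument.\<close>

lemma primitive_generator_exists: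
  assumes nf: "number_field TYPE('m::field_char_0)" and gal: "galois_over_rat TYPE('m::field_char_0)"
  obtains \<theta> :: "'m::field_char_0" and q A where "primitive_generator \<theta> q A"
proof -
  obtain x :: 'm where x: "simple_ext x = UNIV" using primitive_element[OF nf gal] .
  obtain d where d: "d \<noteq> 0" "algebraic_int (of_int d * x)"
    using algebraic_int_multiple[OF algebraic_if_galois[OF gal]] .
  define \<theta> where "\<theta> = of_int d * x"
  have "x = of_rat (1 / of_int d) * \<theta>" using d by (simp add: \<theta>_def of_rat_divide)
  then have "x \<in> simple_ext \<theta>" using simple_ext_closed by metis
  then have "simple_ext \<theta> = UNIV" using simple_ext_mono x by blast
  moreover obtain q A where *: "Factorial_Ring.irreducible q" "finite A" "\<theta> \<in> A"
    "map_poly of_rat q = (\<Prod>a\<in>A. [:- a, 1:])"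
    using gal unfolding galois_over_rat_def by blast
  ultimately have "primitive_generator \<theta> q A"
    using d gal by unfold_locales (auto simp: \<theta>_def)
  then show ?thesis by (rule that)
qed

lemma gal_iff: "g \<in> carrier gal \<longleftrightarrow> field_hom g \<and> bij g"
proof -
  have "g \<in> ring_iso fld fld \<longleftrightarrow> field_hom g \<and> bij g"
    by (auto simp: ring_iso_def ring_hom_fld_iff) (auto simp: ring_of_type_algebra_def)
  moreover have "field_hom g \<Longrightarrow> x \<in> \<rat> \<Longrightarrow> g x = x" for x
    by (auto elim!: Rats_cases simp: field_hom_of_rat)
  ultimately show ?thesis by (auto simp: gal_def)
qed

lemma gal_simps: "g \<otimes>\<^bsub>gal\<^esub> h = g \<circ> h" "\<one>\<^bsub>gal\<^esub> = id"
  by (simp_all add: gal_def)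

lemma id_gal: "id \<in> carrier gal"
  unfolding gal_iff by (intro conjI bij_id) (unfold_locales, simp_all)

lemma comp_gal: "g \<in> carrier gal \<Longrightarrow> h \<in> carrier gal \<Longrightarrow> g \<circ> h \<in> carrier gal"
  by (simp add: gal_iff field_hom_comp bij_comp)

lemma inv_gal: "g \<in> carrier gal \<Longrightarrow> inv_into UNIV g \<in> carrier gal"
proof -
  assume g: "g \<in> carrier gal"
  then interpret g: field_hom g by (simp add: gal_iff)
  have b: "bij g" using g by (simp add: gal_iff)
  have i: "inv_into UNIV g (g x) = x" "g (inv_into UNIV g x) = x" for x
    using b by (auto simp: bij_is_inj bij_is_surj surj_f_inv_f)
  have "field_hom (inv_into UNIV g)"
  proof
    show "inv_into UNIV g (x + y) = inv_into UNIV g x + inv_into UNIV g y" for x y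
      by (metis i g.hom_add)
    show "inv_into UNIV g (x * y) = inv_into UNIV g x * inv_into UNIV g y" for x y
      by (metis i g.hom_mult)
    show "inv_into UNIV g 0 = 0" by (metis i(1) g.hom_zero)
    show "inv_into UNIV g 1 = 1" by (metis i(1) g.hom_one)
  qed
  with b show ?thesis by (simp add: gal_iff bij_imp_bij_inv)
qed

lemma gal_inv_comp:
  assumes "g \<in> carrier gal" shows "inv_into UNIV g \<circ> g = id" "g \<circ> inv_into UNIV g = id"
  using assms by (auto simp: gal_iff fun_eq_iff bij_is_inj bij_is_surj surj_f_inv_f)

lemma group_gal: "group gal"
proof (rule groupI)
  fix g :: "'a \<Rightarrow> 'a" assume "g \<in> carrier gal"
  then show "\<exists>y\<in>carrier gal. y \<otimes>\<^bsub>gal\<^esub> g = \<one>\<^bsub>gal\<^esub>"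
    using inv_gal gal_inv_comp by (auto simp: gal_simps)
qed (simp_all only: gal_simps id_gal comp_gal comp_assoc id_comp)

lemma m_inv_gal: "g \<in> carrier gal \<Longrightarrow> inv\<^bsub>gal\<^esub> g = inv_into UNIV g"
  by (rule group.inv_equality[OF group_gal]) (auto simp: gal_simps gal_inv_comp inv_gal)

lemma gal_algebraic_int: "g \<in> carrier gal \<Longrightarrow> algebraic_int (g x) \<longleftrightarrow> algebraic_int x"
  by (simp add: gal_iff field_hom_algebraic_int)

lemma bij_betw_gal_comp:
  assumes "h \<in> carrier gal"
  shows "bij_betw (\<lambda>g. h \<circ> g) (carrier gal) (carrier gal)" "bij_betw (\<lambda>g. g \<circ> h) (carrier gal) (carrier gal)"
proof -
  have "inv_into UNIV h \<circ> (h \<circ> g) = g" "h \<circ> (inv_into UNIV h \<circ> g) = g"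
    "(g \<circ> h) \<circ> inv_into UNIV h = g" "(g \<circ> inv_into UNIV h) \<circ> h = g" for g :: "'a \<Rightarrow> 'a"
    using gal_inv_comp[OF assms] by (metis comp_assoc comp_id id_comp)+
  note w = this
  show "bij_betw (\<lambda>g. h \<circ> g) (carrier gal) (carrier gal)"
    by (rule bij_betw_byWitness[where f' = "\<lambda>g. inv_into UNIV h \<circ> g"])
       (use w comp_gal[OF assms] comp_gal[OF inv_gal[OF assms]] in blast)+
  show "bij_betw (\<lambda>g. g \<circ> h) (carrier gal) (carrier gal)"
    by (rule bij_betw_byWitness[where f' = "\<lambda>g. g \<circ> inv_into UNIV h"])
       (use w comp_gal[OF _ assms] comp_gal[OF _ inv_gal[OF assms]] in blast)+
qed

context primitive_generator
begin

abbreviation G :: "('m \<Rightarrow> 'm) set" where "G \<equiv> carrier gal"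

lemma q_roots: "rpoly q (x::'m) = 0 \<longleftrightarrow> x \<in> A"
  using finite_A by (auto simp: q_split poly_prod prod_zero_iff)

lemma degree_q: "degree q = card A"
proof -
  have "degree q = degree (map_poly of_rat q :: 'm poly)" by (simp add: degree_map_poly)
  also have "\<dots> = (\<Sum>a\<in>A. degree [:- a, 1:])"
    unfolding q_split by (rule degree_prod_sum_eq) auto
  finally show ?thesis by simp
qed

lemma card_A_pos: "card A > 0"
  using finite_A \<theta>_in_A by (auto simp: card_gt_0_iff)

lemma repr: "\<exists>f. degree f < card A \<and> x = rpoly f \<theta>"
proof -
  obtain f where f: "x = rpoly f \<theta>" using simple_ext_\<theta> by (auto simp: simple_ext_def)
  have "q \<noteq> 0" using q_irreducible by auto
  have "f = q * (f div q) + f mod q" by simp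
  then have "x = rpoly (f mod q) \<theta>"
    using f \<theta>_in_A q_roots[of \<theta>] by (metis rpoly_simps(1,2) mult_zero_left add_0)
  moreover have "degree (f mod q) < card A"
    using degree_mod_less[OF \<open>q \<noteq> 0\<close>, of f] card_A_pos degree_q by auto
  ultimately show ?thesis by blast
qed

lemma repr_unique:
  assumes "degree f < card A" "rpoly f \<theta> = 0"
  shows "f = 0"
proof -
  have "q dvd f"
    using irreducible_rpoly_dvd[OF q_irreducible _ assms(2)] q_roots \<theta>_in_A by simp
  then show ?thesis using assms(1) degree_q dvd_imp_degree_le[of q f] by fastforce
qed

lemma hom_eqI:
  fixes \<sigma> \<tau> :: "'m \<Rightarrow> 'b::field_char_0"
  assumes "field_hom \<sigma>" "field_hom \<tau>" "\<sigma> \<theta> = \<tau> \<theta>"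
  shows "\<sigma> = \<tau>"
proof
  fix x
  obtain f where "x = rpoly f \<theta>" using repr by blast
  then show "\<sigma> x = \<tau> x" using assms by (simp add: field_hom_poly_rat)
qed

text \<open>Sending \<open>rpoly f \<theta>\<close> to \<open>rpoly f y\<close> is well defined:
  \<open>q\<close> divides the difference of two polynomials with the same value at
  \<open>\<theta>\<close>, and \<open>y\<close> is a root of \<open>q\<close>.\<close>

lemma hom_exists:
  fixes y :: "'b::field_char_0"
  assumes "rpoly q y = 0"
  obtains \<sigma> :: "'m \<Rightarrow> 'b" where "field_hom \<sigma>" "\<sigma> \<theta> = y"
proof -
  have wd: "rpoly f y = rpoly g y" if "rpoly f \<theta> = rpoly g \<theta>" for f g
  proof -
    have "rpoly (f - g) \<theta> = 0" using that by (simp only: rpoly_simps) simp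
    then have "q dvd f - g"
      using irreducible_rpoly_dvd[OF q_irreducible] q_roots \<theta>_in_A by blast
    then have "rpoly (f - g) y = 0" using assms unfolding dvd_def by (auto simp: rpoly_simps(2))
    then show ?thesis by (simp only: rpoly_simps) simp
  qed
  define \<sigma> where "\<sigma> x = rpoly (SOME f. x = rpoly f \<theta>) y" for x
  have \<sigma>: "\<sigma> (rpoly f \<theta>) = rpoly f y" for f
  proof -
    have "rpoly f \<theta> = rpoly (SOME g. rpoly f \<theta> = rpoly g \<theta>) \<theta>" by (rule someI) (rule refl)
    from wd[OF this[symmetric]] show ?thesis by (simp add: \<sigma>_def)
  qed
  have "field_hom \<sigma>"
  proof
    fix a b
    obtain f g where fg: "a = rpoly f \<theta>" "b = rpoly g \<theta>" using repr by blast
    show "\<sigma> (a + b) = \<sigma> a + \<sigma> b" using \<sigma>[of "f + g"] \<sigma> fg by (simp only: rpoly_simps)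
    show "\<sigma> (a * b) = \<sigma> a * \<sigma> b" using \<sigma>[of "f * g"] \<sigma> fg by (simp only: rpoly_simps)
  next
    show "\<sigma> 0 = 0" using \<sigma>[of 0] by simp
    show "\<sigma> 1 = 1" using \<sigma>[of 1] by simp
  qed
  moreover have "\<sigma> \<theta> = y" using \<sigma>[of "[:0, 1:]"] by (simp add: rpoly_simps)
  ultimately show ?thesis by (rule that)
qed

text \<open>Applying \<open>\<sigma>\<^sub>0\<close> to the splitting of \<open>q\<close> shows that
  the roots of \<open>q\<close> in the target are the images of \<open>A\<close>, and
  \<open>\<sigma> \<theta>\<close> is such a root.\<close>

lemma hom_root:
  fixes \<sigma> \<sigma>\<^sub>0 :: "'m \<Rightarrow> 'b::field_char_0"
  assumes "field_hom \<sigma>" "field_hom \<sigma>\<^sub>0"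
  shows "\<sigma> \<theta> \<in> \<sigma>\<^sub>0 ` A"
proof -
  interpret s0: field_hom \<sigma>\<^sub>0 by fact
  interpret s: field_hom \<sigma> by fact
  have "rpoly q (\<sigma> \<theta>) = \<sigma> (rpoly q \<theta>)" using field_hom_poly_rat[OF assms(1)] by simp
  also have "\<dots> = 0" using q_roots \<theta>_in_A by simp
  finally have r: "rpoly q (\<sigma> \<theta>) = 0" .
  have "map_poly of_rat q = map_poly \<sigma>\<^sub>0 (map_poly of_rat q)"
    by (rule poly_eqI) (simp add: coeff_map_poly field_hom_of_rat[OF assms(2)])
  also have "\<dots> = (\<Prod>a\<in>A. [:- \<sigma>\<^sub>0 a, 1:])"
  proof -
    interpret mp: map_poly_comm_ring_hom \<sigma>\<^sub>0 ..
    show ?thesis unfolding q_split mp.hom_prod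
      by (rule prod.cong) (simp_all add: s0.map_poly_pCons_hom hom_distribs)
  qed
  finally have "rpoly q (\<sigma> \<theta>) = (\<Prod>a\<in>A. \<sigma> \<theta> - \<sigma>\<^sub>0 a)" by (simp add: poly_prod)
  then show ?thesis using r finite_A by (auto simp: prod_zero_iff)
qed

text \<open>An endomorphism is injective and so permutes the finite set \<open>A\<close>; hence
  \<open>\<theta>\<close>, and with it every polynomial in \<open>\<theta>\<close>, is in its
  range.\<close>

lemma endo_in_gal:
  fixes g :: "'m \<Rightarrow> 'm"
  assumes "field_hom g"
  shows "g \<in> carrier gal"
proof -
  have inj: "inj g" using field_hom_inject[OF assms] by (auto simp: inj_def)
  have "g ` A \<subseteq> A"
  proof
    interpret g: field_hom g by fact
    fix y assume "y \<in> g ` A"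
    then obtain a where a: "a \<in> A" "y = g a" by blast
    then have "rpoly q y = g (rpoly q a)" using field_hom_poly_rat[OF assms, of q a] by simp
    then show "y \<in> A" using a q_roots[of a] q_roots[of y] g.hom_zero by simp
  qed
  then have "g ` A = A" using endo_inj_surj[OF finite_A] inj by (meson inj_on_subset subset_UNIV)
  then obtain a where a: "\<theta> = g a" using \<theta>_in_A by blast
  have "x \<in> range g" for x
  proof -
    obtain f where "x = rpoly f \<theta>" using repr by blast
    then have "x = g (rpoly f a)" using a field_hom_poly_rat[OF assms] by simp
    then show ?thesis by blast
  qed
  then have "surj g" by blast
  with inj assms show ?thesis by (simp add: gal_iff bij_def)
qed

lemma gal_eq: "carrier gal = {g::'m \<Rightarrow> 'm. field_hom g}"
  using endo_in_gal by (auto simp: gal_iff)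

lemma gal_root_bij: "bij_betw (\<lambda>g::'m \<Rightarrow> 'm. g \<theta>) (carrier gal) A"
  unfolding bij_betw_def
proof
  show "inj_on (\<lambda>g::'m \<Rightarrow> 'm. g \<theta>) (carrier gal)"
  proof (rule inj_onI)
    fix g h :: "'m \<Rightarrow> 'm" assume "g \<in> carrier gal" "h \<in> carrier gal" "g \<theta> = h \<theta>"
    then show "g = h" by (intro hom_eqI) (simp_all add: gal_eq)
  qed
  have id: "field_hom (id :: 'm \<Rightarrow> 'm)" using id_gal gal_eq by blast
  show "(\<lambda>g::'m \<Rightarrow> 'm. g \<theta>) ` carrier gal = A"
  proof (intro subset_antisym subsetI)
    fix a assume "a \<in> A"
    then have "rpoly q a = 0" using q_roots by simp
    then obtain g :: "'m \<Rightarrow> 'm" where "field_hom g" "g \<theta> = a" using hom_exists[of a] by metis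
    then show "a \<in> (\<lambda>g::'m \<Rightarrow> 'm. g \<theta>) ` carrier gal"
      unfolding gal_eq by (intro image_eqI[of _ _ g]) simp_all
  next
    fix a assume "a \<in> (\<lambda>g::'m \<Rightarrow> 'm. g \<theta>) ` carrier gal"
    then obtain g :: "'m \<Rightarrow> 'm" where "field_hom g" "a = g \<theta>" unfolding gal_eq by blast
    then show "a \<in> A" using hom_root[OF _ id, of g] by simp
  qed
qed

lemma root_conj: "a \<in> A \<Longrightarrow> \<exists>g\<in>carrier gal. g \<theta> = a"
  unfolding bij_betw_imp_surj_on[OF gal_root_bij, symmetric] by blast

lemma finite_gal: "finite (carrier gal :: ('m \<Rightarrow> 'm) set)"
  using bij_betw_finite[OF gal_root_bij] finite_A by simp

lemma card_gal: "card (carrier gal :: ('m \<Rightarrow> 'm) set) = card A"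
  using bij_betw_same_card[OF gal_root_bij] .

text \<open>Both embeddings are determined by the image of \<open>\<theta>\<close>, and an
  automorphism moves \<open>\<theta>\<close> to any prescribed root. The arbitrary
  \<open>\<sigma>\<close> of the theorem is reduced to \<open>\<sigma>\<^sub>0\<close> in this
  way.\<close>

lemma hom_factor:
  fixes \<sigma> \<sigma>\<^sub>0 :: "'m \<Rightarrow> 'b::field_char_0"
  assumes "field_hom \<sigma>" "field_hom \<sigma>\<^sub>0"
  obtains g where "g \<in> carrier gal" "\<sigma> = \<sigma>\<^sub>0 \<circ> g"
proof -
  obtain a where a: "a \<in> A" "\<sigma> \<theta> = \<sigma>\<^sub>0 a" using hom_root[OF assms] by blast
  obtain g where g: "g \<in> carrier gal" "g \<theta> = a"
    using root_conj[OF a(1)] by blast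
  moreover have "\<sigma> = \<sigma>\<^sub>0 \<circ> g"
  proof (rule hom_eqI[OF assms(1) field_hom_comp[OF assms(2)]])
    show "field_hom g" using g(1) unfolding gal_eq by blast
    show "\<sigma> \<theta> = (\<sigma>\<^sub>0 \<circ> g) \<theta>" using a(2) unfolding g(2)[symmetric] by simp
  qed
  ultimately show ?thesis using that by blast
qed

text \<open>Write \<open>x\<close> as a polynomial of degree below \<open>card A\<close> in
  \<open>\<theta>\<close>. At each of the \<open>card A\<close> conjugates of
  \<open>\<theta>\<close> the polynomial again has the value \<open>x\<close>, so it is
  constant.\<close>

lemma fixed_rational:
  assumes "\<And>g. g \<in> carrier gal \<Longrightarrow> g x = (x::'m)"
  shows "x \<in> \<rat>"
proof -
  obtain f where f: "degree f < card A" "x = rpoly f \<theta>" using repr by blast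
  have r: "poly (map_poly of_rat f - [:x:]) a = 0" if "a \<in> A" for a
  proof -
    obtain g where g: "g \<in> carrier gal" "g \<theta> = a"
      using root_conj[OF \<open>a \<in> A\<close>] by blast
    then have "rpoly f a = g x" using f field_hom_poly_rat[of g f \<theta>] by (simp add: gal_eq)
    then show ?thesis using assms[OF g(1)] by simp
  qed
  have d: "degree (map_poly of_rat f - [:x:]) < card A"
    using f(1) degree_diff_le_max[of "map_poly of_rat f" "[:x:]"] by (simp add: degree_map_poly)
  have "map_poly of_rat f - [:x:] = 0" (is "?p = 0")
  proof (rule ccontr)
    assume nz: "?p \<noteq> 0"
    have "card A \<le> card {a. poly ?p a = 0}"
      using r poly_roots_finite[OF nz] by (intro card_mono) auto
    also have "\<dots> \<le> degree ?p" by (rule poly_roots_degree[OF nz])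
    finally show False using d by simp
  qed
  then have "map_poly of_rat f = [:x:]" by simp
  then have "x = coeff (map_poly of_rat f) 0" by simp
  also have "\<dots> = of_rat (coeff f 0)" by (simp add: coeff_map_poly)
  finally show ?thesis by simp
qed

lemma gal_prod_Rats: "(\<Prod>g\<in>carrier gal. g x) \<in> (\<rat> :: 'm set)"
  and gal_sum_Rats: "(\<Sum>g\<in>carrier gal. g x) \<in> (\<rat> :: 'm set)"
proof -
  have h: "h (\<Prod>g\<in>carrier gal. g x) = (\<Prod>g\<in>carrier gal. g x) \<and> h (\<Sum>g\<in>carrier gal. g x) = (\<Sum>g\<in>carrier gal. g x)"
    if "h \<in> carrier gal" for h :: "'m \<Rightarrow> 'm"
  proof -
    interpret h: field_hom h using that by (simp add: gal_eq)
    show ?thesis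
      using prod.reindex_bij_betw[OF bij_betw_gal_comp(1)[OF that], of "\<lambda>g. g x"]
        sum.reindex_bij_betw[OF bij_betw_gal_comp(1)[OF that], of "\<lambda>g. g x"]
      by (simp add: h.hom_prod h.hom_sum)
  qed
  show "(\<Prod>g\<in>carrier gal. g x) \<in> (\<rat> :: 'm set)" "(\<Sum>g\<in>carrier gal. g x) \<in> (\<rat> :: 'm set)"
    using h by (auto intro: fixed_rational)
qed

lemma gal_norm_int: "algebraic_int x \<Longrightarrow> (\<Prod>g\<in>carrier gal. g x) \<in> (\<int> :: 'm set)"
  by (rule algebraic_int_prod_ints) (auto simp: gal_algebraic_int gal_prod_Rats)

lemma integer_denominator:
  obtains d :: int where "d \<noteq> 0" "algebraic_int (of_int d * (x::'m))"
  using algebraic_int_multiple[OF algebraic_if_galois[OF galois]] that by blast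

end

section \<open>Units of a Galois CM field\<close>

lemma unit_iff: "x \<in> Units ring_of_integers \<longleftrightarrow> algebraic_int (x::'m::field_char_0) \<and> x \<noteq> 0 \<and> algebraic_int (inverse x)"
proof -
  have "x \<in> Units ring_of_integers \<longleftrightarrow> algebraic_int x \<and> (\<exists>y. algebraic_int y \<and> y * x = 1 \<and> x * y = 1)"
    by (auto simp: Units_def ring_of_integers_def ring_of_type_algebra_def)
  also have "\<dots> \<longleftrightarrow> algebraic_int x \<and> x \<noteq> 0 \<and> algebraic_int (inverse x)"
    by (metis inverse_unique left_inverse mult.commute mult_zero_left zero_neq_one)
  finally show ?thesis .
qed

lemma unit_mult: "x \<in> Units ring_of_integers \<Longrightarrow> y \<in> Units ring_of_integers \<Longrightarrow> (x * y :: 'm::field_char_0) \<in> Units ring_of_integers"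
  by (simp add: unit_iff algebraic_int_mult inverse_mult_distrib)

lemma unit_inverse: "x \<in> Units ring_of_integers \<Longrightarrow> (inverse x :: 'm::field_char_0) \<in> Units ring_of_integers"
  by (simp add: unit_iff)

lemma unit_one: "(1 :: 'm::field_char_0) \<in> Units ring_of_integers"
  by (simp add: unit_iff)

lemma unit_power: "x \<in> Units ring_of_integers \<Longrightarrow> (x ^ n :: 'm::field_char_0) \<in> Units ring_of_integers"
  by (induction n) (auto intro: unit_one unit_mult)

lemma unit_power_int: "x \<in> Units ring_of_integers \<Longrightarrow> (x powi n :: 'm::field_char_0) \<in> Units ring_of_integers"
  by (simp add: power_int_def unit_power unit_inverse)

lemma unit_prod: "(\<And>i. i \<in> I \<Longrightarrow> f i \<in> Units ring_of_integers) \<Longrightarrow> (\<Prod>i\<in>I. f i :: 'm::field_char_0) \<in> Units ring_of_integers"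
  by (induction I rule: infinite_finite_induct) (auto intro: unit_one unit_mult)

lemma unit_nonzero: "x \<in> Units ring_of_integers \<Longrightarrow> (x :: 'm::field_char_0) \<noteq> 0"
  by (simp add: unit_iff)

lemma unit_gal: "g \<in> carrier gal \<Longrightarrow> x \<in> Units ring_of_integers \<Longrightarrow> (g x :: 'm::field_char_0) \<in> Units ring_of_integers"
proof -
  assume g: "g \<in> carrier gal" and x: "x \<in> Units ring_of_integers"
  interpret g: field_hom g using g by (simp add: gal_iff)
  show ?thesis using x g by (simp add: unit_iff gal_algebraic_int g.hom_inverse[symmetric])
qed

section \<open>Cosets of complex conjugation and archimedean absolute values\<close>

locale cm_galois = primitive_generator \<theta> q A
  for \<theta> :: "'m::field_char_0" and q A +
  fixes \<tau> :: "'m \<Rightarrow> complex" and c :: "'m \<Rightarrow> 'm"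
  assumes \<tau>: "field_hom \<tau>" and c_gal: "c \<in> G" and c_not_id: "c \<noteq> id"
    and c_conj: "\<And>\<tau>' x. field_hom \<tau>' \<Longrightarrow> \<tau>' (c x) = cnj (\<tau>' x)"
begin

lemma \<tau>_gal: "g \<in> G \<Longrightarrow> field_hom (\<lambda>x. \<tau> (g x))"
  using field_hom_comp[OF \<tau>, of g] by (simp add: gal_eq comp_def)

lemma c_c: "c (c x) = x"
proof -
  have "\<tau> (c (c x)) = \<tau> x" using c_conj[OF \<tau>] by simp
  then show ?thesis using field_hom_inject[OF \<tau>] by simp
qed

text \<open>\<open>c\<close> is central because it becomes complex conjugation under every complex
  embedding, in particular under both \<open>\<tau>\<close> and
  \<open>\<tau> \<circ> g\<close>.\<close>

lemma c_commute: "g \<in> G \<Longrightarrow> g (c x) = c (g x)"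
proof -
  assume g: "g \<in> G"
  have "\<tau> (g (c x)) = \<tau> (c (g x))" using c_conj[OF \<tau>_gal[OF g]] c_conj[OF \<tau>] by simp
  then show ?thesis using field_hom_inject[OF \<tau>] by simp
qed

lemma c_comp: "c \<circ> c = id" "g \<in> G \<Longrightarrow> g \<circ> c = c \<circ> g" "c \<circ> (c \<circ> g) = g"
  by (auto simp: fun_eq_iff c_c c_commute)

lemma c_comp_neq: "g \<in> G \<Longrightarrow> c \<circ> g \<noteq> g"
proof
  assume g: "g \<in> G" and "c \<circ> g = g"
  then have "c \<circ> g \<circ> inv_into UNIV g = g \<circ> inv_into UNIV g" by simp
  then show False using gal_inv_comp(2)[OF g] c_not_id by (simp add: comp_assoc)
qed

text \<open>A choice from the set \<open>{g, c \<circ> g}\<close> gives both members of a coset the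
  same value. The coset of the identity is forced to \<open>id\<close>, the place at which a
  Minkowski unit is large and whose coordinate is eliminated.\<close>

definition rep :: "('m \<Rightarrow> 'm) \<Rightarrow> ('m \<Rightarrow> 'm)" where
  "rep g = (if g \<in> {id, c} then id else SOME h. h \<in> {g, c \<circ> g})"

definition reps :: "('m \<Rightarrow> 'm) set" where
  "reps = rep ` G"

lemma rep_cases: "rep g = g \<or> rep g = c \<circ> g"
proof (cases "g \<in> {id, c}")
  case False
  have "(SOME h. h \<in> {g, c \<circ> g}) \<in> {g, c \<circ> g}" by (rule someI[of _ g]) simp
  with False show ?thesis by (auto simp: rep_def)
qed (auto simp: rep_def c_comp)

lemma rep_c: "rep (c \<circ> g) = rep g"
proof -
  have "c \<circ> g \<in> {id, c} \<longleftrightarrow> g \<in> {id, c}"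
    using c_comp(1,3) by (metis comp_id insert_iff singleton_iff)
  moreover have "{c \<circ> g, c \<circ> (c \<circ> g)} = {g, c \<circ> g}" using c_comp(3) by auto
  ultimately show ?thesis by (simp add: rep_def)
qed

lemma rep_id: "rep id = id" by (simp add: rep_def)

lemma rep_gal: "g \<in> G \<Longrightarrow> rep g \<in> G"
  using rep_cases[of g] comp_gal[OF c_gal, of g] by metis

lemma rep_rep: "rep (rep g) = rep g"
  using rep_cases[of g] rep_c[of g] by metis

lemma reps_gal: "reps \<subseteq> G"
  using rep_gal by (auto simp: reps_def)

lemma rep_in_reps: "g \<in> G \<Longrightarrow> rep g \<in> reps"
  by (simp add: reps_def)

lemma rep_reps: "g \<in> reps \<Longrightarrow> rep g = g"
  by (auto simp: reps_def rep_rep)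

lemma id_reps: "id \<in> reps"
  using rep_in_reps[OF id_gal] rep_id by simp

lemma finite_reps: "finite reps"
  using finite_subset[OF reps_gal finite_gal] .

lemma rep_eq_iff: "rep g = rep h \<longleftrightarrow> g = h \<or> g = c \<circ> h"
proof
  assume "rep g = rep h"
  then show "g = h \<or> g = c \<circ> h" using rep_cases[of g] rep_cases[of h] c_comp(3) by metis
qed (auto simp: rep_c)

lemma gal_split: "G = reps \<union> (\<lambda>g. c \<circ> g) ` reps" "reps \<inter> (\<lambda>g. c \<circ> g) ` reps = {}"
proof -
  show "G = reps \<union> (\<lambda>g. c \<circ> g) ` reps"
  proof (intro subset_antisym subsetI)
    fix g assume g: "g \<in> G"
    show "g \<in> reps \<union> (\<lambda>g. c \<circ> g) ` reps"
    proof (cases "rep g = g")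
      case True then show ?thesis using rep_in_reps[OF g] by simp
    next
      case False
      then have "g = c \<circ> rep g" using rep_cases[of g] c_comp(3) by auto
      then show ?thesis using rep_in_reps[OF g] by blast
    qed
  next
    fix g assume "g \<in> reps \<union> (\<lambda>g. c \<circ> g) ` reps"
    then show "g \<in> G" using reps_gal comp_gal[OF c_gal] by blast
  qed
  show "reps \<inter> (\<lambda>g. c \<circ> g) ` reps = {}"
  proof (rule ccontr)
    assume "reps \<inter> (\<lambda>g. c \<circ> g) ` reps \<noteq> {}"
    then obtain h where h: "h \<in> reps" "c \<circ> h \<in> reps" by blast
    then have "c \<circ> h = h" using rep_reps rep_c by metis
    then show False using c_comp_neq reps_gal h(1) by blast
  qed
qed

lemma inj_c_comp: "inj_on (\<lambda>g. c \<circ> g) (S :: ('m \<Rightarrow> 'm) set)"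
  by (rule inj_on_inverseI[where g = "\<lambda>g. c \<circ> g"]) (simp add: c_comp(3))

lemma card_gal_reps: "card G = 2 * card reps"
  unfolding gal_split(1) using card_Un_disjoint[OF finite_reps _ gal_split(2)] finite_reps
    card_image[OF inj_c_comp] by simp

lemma sum_gal_reps: "(\<Sum>g\<in>G. f g) = (\<Sum>g\<in>reps. f g + f (c \<circ> g))"
proof -
  have "(\<Sum>g\<in>G. f g) = (\<Sum>g\<in>reps. f g) + (\<Sum>g\<in>(\<lambda>g. c \<circ> g) ` reps. f g)"
    unfolding gal_split(1) using finite_reps gal_split(2) by (intro sum.union_disjoint) auto
  also have "(\<Sum>g\<in>(\<lambda>g. c \<circ> g) ` reps. f g) = (\<Sum>g\<in>reps. f (c \<circ> g))"
    by (simp add: sum.reindex[OF inj_c_comp])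
  finally show ?thesis by (simp add: sum.distrib)
qed

lemma prod_gal_reps: "(\<Prod>g\<in>G. f g) = (\<Prod>g\<in>reps. f g * f (c \<circ> g))"
proof -
  have "(\<Prod>g\<in>G. f g) = (\<Prod>g\<in>reps. f g) * (\<Prod>g\<in>(\<lambda>g. c \<circ> g) ` reps. f g)"
    unfolding gal_split(1) using finite_reps gal_split(2) by (intro prod.union_disjoint) auto
  also have "(\<Prod>g\<in>(\<lambda>g. c \<circ> g) ` reps. f g) = (\<Prod>g\<in>reps. f (c \<circ> g))"
    by (simp add: prod.reindex[OF inj_c_comp])
  finally show ?thesis by (simp add: prod.distrib)
qed

text \<open>The representatives need not be stable under composition with \<open>h\<close>; the sum
  over the whole group is, and it counts each coset twice.\<close>

lemma sum_reps_translate: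
  fixes f :: "('m \<Rightarrow> 'm) \<Rightarrow> 'a::field_char_0"
  assumes "h \<in> G" "\<And>g. g \<in> G \<Longrightarrow> f (c \<circ> g) = f g"
  shows "(\<Sum>g\<in>reps. f (h \<circ> g)) = (\<Sum>g\<in>reps. f g)"
proof -
  have "f (h \<circ> (c \<circ> g)) = f (h \<circ> g)" if "g \<in> G" for g
    using assms(2)[OF comp_gal[OF assms(1) that]] c_comp(2)[OF assms(1)] by (metis comp_assoc)
  then have "(\<Sum>g\<in>G. f (h \<circ> g)) = 2 * (\<Sum>g\<in>reps. f (h \<circ> g))"
    unfolding sum_gal_reps sum_distrib_left using reps_gal by (intro sum.cong) auto
  moreover have "(\<Sum>g\<in>G. f g) = 2 * (\<Sum>g\<in>reps. f g)"
    unfolding sum_gal_reps sum_distrib_left using reps_gal assms(2) by (intro sum.cong) auto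
  moreover have "(\<Sum>g\<in>G. f (h \<circ> g)) = (\<Sum>g\<in>G. f g)"
    using sum.reindex_bij_betw[OF bij_betw_gal_comp(1)[OF assms(1)]] .
  ultimately show ?thesis by simp
qed

definition av :: "('m \<Rightarrow> 'm) \<Rightarrow> 'm \<Rightarrow> real" where
  "av g x = cmod (\<tau> (g x))"

lemma av_simps:
  assumes "g \<in> G"
  shows "av g (x * y) = av g x * av g y" "av g (x ^ n) = av g x ^ n" "av g 0 = 0" "av g 1 = 1"
    "av g (inverse x) = inverse (av g x)" "av g (x / y) = av g x / av g y"
    "av g (x + y) \<le> av g x + av g y" "av g (of_int k) = \<bar>of_int k\<bar>"
    "av g x = 0 \<longleftrightarrow> x = 0" "av g x \<ge> 0" "av g (x powi k) = av g x powi k"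
    "av g (\<Prod>i\<in>I. F i) = (\<Prod>i\<in>I. av g (F i))" "av g (\<Sum>i\<in>I. F i) \<le> (\<Sum>i\<in>I. av g (F i))"
    "av g (x - y) \<le> av g x + av g y"
proof -
  interpret t: field_hom "\<lambda>x. \<tau> (g x)" by (rule \<tau>_gal[OF assms])
  show m: "av g (x * y) = av g x * av g y" for x y by (simp add: av_def t.hom_mult norm_mult)
  show p: "av g (x ^ n) = av g x ^ n" for x n by (simp add: av_def t.hom_power norm_power)
  show "av g 0 = 0" "av g 1 = 1" "av g x \<ge> 0" using t.hom_zero t.hom_one by (simp_all add: av_def)
  show i: "av g (inverse x) = inverse (av g x)" for x by (simp add: av_def t.hom_inverse norm_inverse)
  show "av g (x / y) = av g x / av g y" by (simp add: divide_inverse m i)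
  show "av g (x + y) \<le> av g x + av g y" by (simp add: av_def t.hom_add norm_triangle_ineq)
  show "av g (x - y) \<le> av g x + av g y" by (simp add: av_def t.hom_minus norm_triangle_ineq4)
  show "av g (of_int k) = \<bar>of_int k\<bar>" by (simp add: av_def t.hom_of_int)
  show "av g x = 0 \<longleftrightarrow> x = 0" by (simp add: av_def)
  show "av g (x powi k) = av g x powi k" by (simp add: power_int_def p i)
  show "av g (\<Prod>i\<in>I. F i) = (\<Prod>i\<in>I. av g (F i))" by (simp add: av_def t.hom_prod prod_norm)
  show "av g (\<Sum>i\<in>I. F i) \<le> (\<Sum>i\<in>I. av g (F i))" by (simp add: av_def t.hom_sum norm_sum)
qed

lemma av_c: "g \<in> G \<Longrightarrow> av (c \<circ> g) x = av g x" "g \<in> G \<Longrightarrow> av g (c x) = av g x"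
  using c_conj[OF \<tau>] c_conj[OF \<tau>_gal] by (auto simp: av_def)

lemma av_comp: "av g (h x) = av (g \<circ> h) x" by (simp add: av_def)

lemma av_rep: "g \<in> G \<Longrightarrow> av (rep g) x = av g x"
  using rep_cases[of g] av_c(1) by auto

lemma norm_eq_av: "av id (\<Prod>g\<in>G. g x) = (\<Prod>g\<in>reps. av g x) ^ 2"
proof -
  have "av id (\<Prod>g\<in>G. g x) = (\<Prod>g\<in>G. av g x)"
    using av_simps(12)[OF id_gal, of "\<lambda>g. g x" G] by (simp add: av_def)
  also have "\<dots> = (\<Prod>g\<in>reps. av g x * av g x)"
    unfolding prod_gal_reps by (rule prod.cong) (use reps_gal av_c(1) in auto)
  finally show ?thesis by (simp add: prod.distrib power2_eq_square)
qed

lemma norm_int: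
  assumes "algebraic_int x"
  obtains k :: int where "(\<Prod>g\<in>G. g x) = of_int k" "of_int \<bar>k\<bar> = (\<Prod>g\<in>reps. av g x) ^ 2"
proof -
  obtain k where k: "(\<Prod>g\<in>G. g x) = of_int k"
    using gal_norm_int[OF assms] by (auto elim: Ints_cases)
  then have "av id (of_int k) = (\<Prod>g\<in>reps. av g x) ^ 2" using norm_eq_av[of x] by simp
  then show ?thesis using that[OF k] av_simps(8)[OF id_gal] by simp
qed

lemma prod_gal_eq_0_iff: "(\<Prod>g\<in>G. g x) = 0 \<longleftrightarrow> x = (0::'m)"
proof -
  have "g x = 0 \<longleftrightarrow> x = 0" if "g \<in> G" for g :: "'m \<Rightarrow> 'm"
  proof -
    interpret g: field_hom g using that by (simp add: gal_iff)
    show ?thesis by simp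
  qed
  then show ?thesis using id_gal by (auto simp: prod_zero_iff[OF finite_gal])
qed

text \<open>The square of the product is the absolute value of the norm, a nonzero integer. So the
  product is at least 1 for the unit and for its inverse.\<close>

lemma unit_av_prod:
  assumes "x \<in> Units ring_of_integers"
  shows "(\<Prod>g\<in>reps. av g x) = 1"
proof -
  have 1: "(\<Prod>g\<in>reps. av g y) \<ge> 1" if y: "y \<in> Units ring_of_integers" for y
  proof -
    obtain k where k: "(\<Prod>g\<in>G. g y) = of_int k" "of_int \<bar>k\<bar> = (\<Prod>g\<in>reps. av g y) ^ 2"
      using norm_int y unit_iff by blast
    have "k \<noteq> 0" using k(1) prod_gal_eq_0_iff[of y] unit_nonzero[OF y] by auto
    then have "1 \<le> (\<Prod>g\<in>reps. av g y) ^ 2" using k(2)[symmetric] by linarith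
    moreover have "0 \<le> (\<Prod>g\<in>reps. av g y)" using av_simps(10) reps_gal by (intro prod_nonneg) blast
    ultimately show ?thesis by (simp add: one_le_power power2_nonneg_ge_1_iff)
  qed
  have "(\<Prod>g\<in>reps. av g (inverse x)) = inverse (\<Prod>g\<in>reps. av g x)"
    unfolding prod_inversef[symmetric] comp_def using av_simps(5) reps_gal by (intro prod.cong) auto
  then show ?thesis using 1[OF assms] 1[OF unit_inverse[OF assms]] by (metis one_le_inverse_iff order_antisym)
qed

lemma ln_unit_av_sum:
  assumes "x \<in> Units ring_of_integers"
  shows "(\<Sum>g\<in>reps. ln (av g x)) = 0"
proof -
  have "av g x > 0" if "g \<in> reps" for g
    using av_simps(9,10)[of g x] that reps_gal unit_nonzero[OF assms] by (metis order_le_less subsetD)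
  then have "(\<Sum>g\<in>reps. ln (av g x)) = ln (\<Prod>g\<in>reps. av g x)"
    by (subst ln_prod[OF finite_reps]) force+
  then show ?thesis using unit_av_prod[OF assms] by simp
qed

end

subsection \<open>Existence of a Minkowski unit\<close>

lemma floor_div_eq_imp_close:
  fixes a b \<delta> :: real
  assumes "\<delta> > 0" "\<lfloor>a / \<delta>\<rfloor> = \<lfloor>b / \<delta>\<rfloor>"
  shows "\<bar>a - b\<bar> \<le> \<delta>"
proof -
  have "\<bar>a / \<delta> - b / \<delta>\<bar> \<le> 1" using assms(2) by linarith
  then have "\<bar>(a - b) / \<delta>\<bar> \<le> 1" by (simp add: diff_divide_distrib)
  then show ?thesis using assms(1) by (simp add: abs_divide pos_divide_le_eq)
qed

context cm_galois
begin

definition lat :: "(nat \<Rightarrow> int) \<Rightarrow> 'm" where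
  "lat x = (\<Sum>i<card A. of_int (x i) * \<theta> ^ i)"

lemma lat_diff: "lat x - lat y = lat (\<lambda>i. x i - y i)"
  by (simp add: lat_def sum_subtractf left_diff_distrib)

lemma lat_int: "algebraic_int (lat x)"
  unfolding lat_def using \<theta>_int
  by (intro algebraic_int_sum algebraic_int_mult algebraic_int_power algebraic_int_of_int)

lemma lat_eq_0:
  assumes "lat x = 0" "i < card A"
  shows "x i = 0"
proof -
  define f where "f = (\<Sum>i<card A. monom (rat_of_int (x i)) i)"
  have cf: "coeff f j = (if j < card A then rat_of_int (x j) else 0)" for j
    by (simp add: f_def coeff_sum)
  have "degree f < card A"
    using card_A_pos by (intro degree_lessI) (auto simp: cf)
  moreover have "rpoly f \<theta> = 0"
  proof -
    have "rpoly f \<theta> = (\<Sum>j\<le>degree f. of_rat (coeff f j) * \<theta> ^ j)"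
      by (simp add: poly_altdef degree_map_poly coeff_map_poly)
    also have "\<dots> = (\<Sum>j<card A. of_rat (coeff f j) * \<theta> ^ j)"
      using \<open>degree f < card A\<close> by (intro sum.mono_neutral_left) (auto simp: coeff_eq_0)
    also have "\<dots> = lat x" by (simp add: lat_def cf)
    finally show ?thesis using assms(1) by simp
  qed
  ultimately have "f = 0" by (rule repr_unique)
  then show ?thesis using cf[of i] assms(2) by simp
qed

lemma av_lat_bound: "\<exists>C::real. C \<ge> 1 \<and> (\<forall>g\<in>G. \<forall>x K. (\<forall>i<card A. \<bar>x i\<bar> \<le> int K) \<longrightarrow> av g (lat x) \<le> C * real K)"
proof -
  define C where "C = 1 + (\<Sum>g\<in>G. \<Sum>i<card A. av g (\<theta> ^ i))"
  have nn: "0 \<le> (\<Sum>i<card A. av g (\<theta> ^ i))" if "g \<in> G" for g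
    using av_simps(10)[OF that] by (intro sum_nonneg) auto
  have "av g (lat x) \<le> C * real K" if g: "g \<in> G" and x: "\<forall>i<card A. \<bar>x i\<bar> \<le> int K" for g x K
  proof -
    have "av g (lat x) \<le> (\<Sum>i<card A. av g (of_int (x i) * \<theta> ^ i))"
      unfolding lat_def by (rule av_simps(13)[OF g])
    also have "\<dots> \<le> (\<Sum>i<card A. real K * av g (\<theta> ^ i))"
    proof (rule sum_mono)
      fix i assume "i \<in> {..<card A}"
      then have "\<bar>x i\<bar> \<le> int K" using x by simp
      then have "real_of_int \<bar>x i\<bar> \<le> real_of_int (int K)" by (simp only: of_int_le_iff)
      then show "av g (of_int (x i) * \<theta> ^ i) \<le> real K * av g (\<theta> ^ i)"
        unfolding av_simps(1)[OF g] av_simps(8)[OF g] using av_simps(10)[OF g] by (intro mult_right_mono) auto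
    qed
    also have "\<dots> = real K * (\<Sum>i<card A. av g (\<theta> ^ i))" by (simp add: sum_distrib_left)
    also have "\<dots> \<le> real K * C"
    proof (rule mult_left_mono)
      have "(\<Sum>i<card A. av g (\<theta> ^ i)) \<le> (\<Sum>g\<in>G. \<Sum>i<card A. av g (\<theta> ^ i))"
        using nn g finite_gal by (intro member_le_sum) auto
      then show "(\<Sum>i<card A. av g (\<theta> ^ i)) \<le> C" by (simp add: C_def)
    qed simp
    finally show ?thesis by (simp add: mult.commute)
  qed
  moreover have "C \<ge> 1" unfolding C_def using nn by (simp add: sum_nonneg)
  ultimately show ?thesis by blast
qed

lemma card_A_reps: "card A = 2 * card reps"
  using card_gal card_gal_reps by simp

text \<open>With \<open>m\<close> representatives the \<open>(s ^ (m - 1) + 1) ^ (2 * m)\<close> lattice points with coordinates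
  in \<open>{0..s ^ (m - 1)}\<close> are distributed among \<open>(s ^ m) ^ (2 * (m - 1))\<close> boxes.\<close>

lemma small_lattice_point:
  obtains B :: real where "\<And>\<epsilon>. \<epsilon> > 0 \<Longrightarrow> \<exists>x. lat x \<noteq> 0 \<and> (\<forall>g\<in>reps - {id}. av g (lat x) < \<epsilon>) \<and>
      (\<Prod>g\<in>reps. av g (lat x)) ^ 2 \<le> B"
proof -
  obtain C where C: "C \<ge> 1" "\<And>g x K. g \<in> G \<Longrightarrow> (\<And>i. i < card A \<Longrightarrow> \<bar>x i\<bar> \<le> int K) \<Longrightarrow> av g (lat x) \<le> C * real K"
    using av_lat_bound by blast
  define m where "m = card reps"
  have m: "m \<ge> 1" using id_reps finite_reps by (auto simp: m_def card_gt_0_iff Suc_le_eq)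
  \<comment> \<open>The cells will have sides of at most \<open>4 * C / s\<close>, which bounds the
    small values by \<open>8 * C / s\<close>; the constant 16 doubles this to reach a strict
    inequality.\<close>
  define D where "D = 16 * C"
  \<comment> \<open>The bound \<open>C * s ^ (m - 1)\<close> at the identity times the
    \<open>m - 1\<close> bounds \<open>D / s\<close> at the other places: the powers of
    \<open>s\<close> cancel, so the bound does not depend on \<open>\<epsilon>\<close>.\<close>
  define B where "B = (C * D ^ (m - 1)) ^ 2"
  show ?thesis
  proof (rule that[of B])
    fix \<epsilon> :: real assume \<epsilon>: "\<epsilon> > 0"
    obtain s0 :: nat where s0: "D / \<epsilon> < real s0" using reals_Archimedean2 by blast
    define s where "s = max 2 s0"
    have s: "s \<ge> 2" "D / \<epsilon> < real s" using s0 by (auto simp: s_def)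
    define K where "K = s ^ (m - 1)"
    define T where "T = s ^ m"
    have KT: "real T = real s * real K" using m by (cases m) (simp_all add: K_def T_def)
    have K1: "K \<ge> 1" and T2: "T \<ge> 2"
      using s m self_le_power[of s m] by (auto simp: K_def T_def)
    \<comment> \<open>An interval of length \<open>2 * C * K\<close> is cut into
      \<open>T - 1\<close> pieces; its right end opens one further cell, so the cell numbers stay
      below \<open>T\<close>.\<close>
    define \<delta> where "\<delta> = 2 * C * real K / (real T - 1)"
    have \<delta>: "\<delta> > 0" using C(1) K1 T2 by (simp add: \<delta>_def)
    define cell where "cell = (\<lambda>r::real. nat \<lfloor>(r + C * real K) / \<delta>\<rfloor>)"
    have cell_range: "cell r < T" if "\<bar>r\<bar> \<le> C * real K" for r
    proof -
      have "(r + C * real K) / \<delta> \<le> (2 * C * real K) / \<delta>"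
        using that \<delta> by (intro divide_right_mono) auto
      also have "\<dots> = real T - 1" using C(1) K1 T2 by (simp add: \<delta>_def)
      finally have "\<lfloor>(r + C * real K) / \<delta>\<rfloor> \<le> int T - 1" by linarith
      then show ?thesis using T2 unfolding cell_def by linarith
    qed
    have cell_eq: "\<bar>r - r'\<bar> \<le> \<delta>" if "\<bar>r\<bar> \<le> C * real K" "\<bar>r'\<bar> \<le> C * real K" "cell r = cell r'" for r r'
    proof -
      have "(r + C * real K) / \<delta> \<ge> 0" "(r' + C * real K) / \<delta> \<ge> 0"
        using that(1,2) \<delta> by (auto intro!: divide_nonneg_pos)
      then have "\<lfloor>(r + C * real K) / \<delta>\<rfloor> = \<lfloor>(r' + C * real K) / \<delta>\<rfloor>"
        using that(3) unfolding cell_def by (simp add: nat_eq_iff)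
      from floor_div_eq_imp_close[OF \<delta> this] show ?thesis by simp
    qed
    define S where "S = PiE {..<card A} (\<lambda>_. {0..int K})"
    define F where "F = (\<lambda>x. \<lambda>g\<in>reps - {id}. (cell (Re (\<tau> (g (lat x)))), cell (Im (\<tau> (g (lat x))))))"
    have bnd: "av g (lat x) \<le> C * real K" if "x \<in> S" "g \<in> reps" for x g
    proof (rule C(2))
      show "g \<in> G" using that reps_gal by blast
      fix i assume "i < card A"
      then have "x i \<in> {0..int K}" using PiE_mem[OF that(1)[unfolded S_def], of i] by simp
      then show "\<bar>x i\<bar> \<le> int K" by simp
    qed
    have re_im: "\<bar>Re (\<tau> (g (lat x)))\<bar> \<le> C * real K" "\<bar>Im (\<tau> (g (lat x)))\<bar> \<le> C * real K" if "x \<in> S" "g \<in> reps" for x g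
      by (rule order_trans[OF abs_Re_le_cmod bnd[OF that, unfolded av_def]]
          order_trans[OF abs_Im_le_cmod bnd[OF that, unfolded av_def]])+
    have "F ` S \<subseteq> PiE (reps - {id}) (\<lambda>_. {..<T} \<times> {..<T})"
    proof
      fix y assume "y \<in> F ` S"
      then obtain x where x: "x \<in> S" "y = F x" by blast
      show "y \<in> PiE (reps - {id}) (\<lambda>_. {..<T} \<times> {..<T})"
        unfolding x(2) F_def
      proof (rule restrict_PiE[THEN iffD2], rule Pi_I)
        fix g assume "g \<in> reps - {id}"
        then show "(cell (Re (\<tau> (g (lat x)))), cell (Im (\<tau> (g (lat x))))) \<in> {..<T} \<times> {..<T}"
          using re_im[OF x(1), of g] cell_range by blast
      qed
    qed
    then have "card (F ` S) \<le> card (PiE (reps - {id}) (\<lambda>_. {..<T} \<times> {..<T}))"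
      using finite_reps by (intro card_mono finite_PiE) auto
    also have "\<dots> = (T * T) ^ (m - 1)"
      using finite_reps id_reps by (simp add: card_PiE m_def card_Diff_singleton)
    also have "\<dots> = K ^ (2 * m)"
    proof -
      have "(T * T) ^ (m - 1) = s ^ ((m + m) * (m - 1))"
        unfolding T_def power_add[symmetric] power_mult[symmetric] ..
      also have "\<dots> = s ^ ((m - 1) * (2 * m))" by (metis mult.commute mult_2)
      finally show ?thesis unfolding K_def power_mult[symmetric] .
    qed
    also have "\<dots> < (K + 1) ^ (2 * m)" using m K1 by (intro power_strict_mono) auto
    also have "\<dots> = card S"
    proof -
      have "card {0..int K} = K + 1" by simp
      then show ?thesis by (simp only: S_def card_PiE[OF finite_lessThan] prod_constant card_lessThan card_A_reps m_def)
    qed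
    finally have "\<not> inj_on F S" by (rule pigeonhole)
    then obtain x y where xy: "x \<in> S" "y \<in> S" "x \<noteq> y" "F x = F y" by (auto simp: inj_on_def)
    define z where "z = (\<lambda>i. x i - y i)"
    have z_lat: "lat z = lat x - lat y" by (simp add: z_def lat_diff)
    have "lat z \<noteq> 0"
    proof
      assume "lat z = 0"
      then have "x i = y i" if "i < card A" for i using lat_eq_0[OF _ that, of z] by (simp add: z_def)
      then show False using xy(1-3) unfolding S_def by (metis PiE_ext lessThan_iff)
    qed
    have zK: "av g (lat z) \<le> C * real K" if "g \<in> reps" for g
    proof (rule C(2))
      show "g \<in> G" using that reps_gal by blast
      fix i assume "i < card A"
      then have "x i \<in> {0..int K}" "y i \<in> {0..int K}" using xy(1,2) unfolding S_def by (auto intro: PiE_mem)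
      then show "\<bar>z i\<bar> \<le> int K" by (auto simp: z_def)
    qed
    have small: "av g (lat z) \<le> D / 2 / real s" if g: "g \<in> reps - {id}" for g
    proof -
      have gG: "g \<in> G" using g reps_gal by blast
      interpret t: field_hom "\<lambda>x. \<tau> (g x)" by (rule \<tau>_gal[OF gG])
      have "F x g = F y g" using xy(4) by simp
      then have "cell (Re (\<tau> (g (lat x)))) = cell (Re (\<tau> (g (lat y))))"
        "cell (Im (\<tau> (g (lat x)))) = cell (Im (\<tau> (g (lat y))))"
        using g by (simp_all add: F_def)
      then have "\<bar>Re (\<tau> (g (lat x))) - Re (\<tau> (g (lat y)))\<bar> \<le> \<delta>" "\<bar>Im (\<tau> (g (lat x))) - Im (\<tau> (g (lat y)))\<bar> \<le> \<delta>"
        using re_im xy g by (auto intro!: cell_eq)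
      then have "av g (lat z) \<le> 2 * \<delta>"
        using cmod_le[of "\<tau> (g (lat x)) - \<tau> (g (lat y))"] by (simp add: av_def z_lat t.hom_minus)
      also have "\<delta> \<le> 4 * C * real K / real T"
      proof -
        have "real T - 1 \<ge> real T / 2" using T2 by simp
        then have "\<delta> \<le> 2 * C * real K / (real T / 2)"
          unfolding \<delta>_def using C(1) T2 by (intro divide_left_mono) auto
        then show ?thesis by simp
      qed
      also have "4 * C * real K / real T = 4 * C / real s" using KT K1 s by simp
      finally show ?thesis by (simp add: D_def)
    qed
    have "av g (lat z) < \<epsilon>" if g: "g \<in> reps - {id}" for g
    proof -
      have "av g (lat z) \<le> D / 2 / real s" by (rule small[OF g])
      also have "\<dots> < D / real s" using C(1) s by (simp add: D_def divide_strict_right_mono)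
      also have "\<dots> < \<epsilon>" using s(2) \<epsilon> s(1) by (simp add: field_simps)
      finally show ?thesis .
    qed
    moreover have "(\<Prod>g\<in>reps. av g (lat z)) ^ 2 \<le> B"
    proof -
      have nn: "0 \<le> av g (lat z)" if "g \<in> reps" for g using that reps_gal av_simps(10) by blast
      have "(\<Prod>g\<in>reps. av g (lat z)) = av id (lat z) * (\<Prod>g\<in>reps - {id}. av g (lat z))"
        by (rule prod.remove[OF finite_reps id_reps])
      also have "\<dots> \<le> (C * real K) * (\<Prod>g\<in>reps - {id}. D / real s)"
      proof (intro mult_mono prod_mono)
        show "av id (lat z) \<le> C * real K" by (rule zK[OF id_reps])
        show "0 \<le> av g (lat z) \<and> av g (lat z) \<le> D / real s" if "g \<in> reps - {id}" for g
        proof -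
          have "D / 2 / real s \<le> D / real s" using C(1) s by (simp add: D_def divide_right_mono)
          then show ?thesis using small[OF that] nn[of g] that by auto
        qed
        show "0 \<le> C * real K" using C(1) by simp
        show "0 \<le> (\<Prod>g\<in>reps - {id}. av g (lat z))" using nn by (intro prod_nonneg) auto
      qed
      also have "(\<Prod>g\<in>reps - {id}. D / real s) = (D / real s) ^ (m - 1)"
        using id_reps finite_reps by (simp add: m_def card_Diff_singleton)
      also have "(C * real K) * (D / real s) ^ (m - 1) = C * D ^ (m - 1)"
        using s by (simp add: K_def power_divide)
      finally have "(\<Prod>g\<in>reps. av g (lat z)) \<le> C * D ^ (m - 1)" .
      then show ?thesis unfolding B_def using nn by (intro power_mono prod_nonneg) auto
    qed
    ultimately show "\<exists>x. lat x \<noteq> 0 \<and> (\<forall>g\<in>reps - {id}. av g (lat x) < \<epsilon>) \<and>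
      (\<Prod>g\<in>reps. av g (lat x)) ^ 2 \<le> B" using \<open>lat z \<noteq> 0\<close> by blast
  qed
qed

text \<open>By the congruences \<open>a - b\<close> is \<open>N\<close> times an algebraic integer,
  and \<open>N\<close> is the product of \<open>b\<close> with its other conjugates. So
  \<open>b\<close> divides \<open>a\<close>, and by symmetry \<open>a\<close> divides
  \<open>b\<close>.\<close>

lemma quotient_unit:
  assumes a: "a = lat x" "a \<noteq> 0" and b: "b = lat y" "b \<noteq> 0"
    and N: "(\<Prod>g\<in>G. g a) = of_int N" "(\<Prod>g\<in>G. g b) = of_int N"
    and mod: "\<And>i. i < card A \<Longrightarrow> x i mod N = y i mod N"
  shows "a / b \<in> Units ring_of_integers"
proof -
  have *: "algebraic_int (a / b)"
    if a: "a = lat x" "a \<noteq> 0" and b: "b = lat y" "b \<noteq> 0" and N: "(\<Prod>g\<in>G. g b) = of_int N"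
      and mod: "\<And>i. i < card A \<Longrightarrow> x i mod N = y i mod N" for a b x y
  proof -
    have "\<exists>k. x i - y i = N * k" if "i < card A" for i
      using mod[OF that] by (metis mod_eq_dvd_iff dvd_def)
    then obtain k where k: "\<And>i. i < card A \<Longrightarrow> x i - y i = N * k i" by metis
    have "a - b = of_int N * lat k"
    proof -
      have "a - b = (\<Sum>i<card A. of_int (x i - y i) * \<theta> ^ i)" unfolding a(1) b(1) lat_diff by (rule lat_def)
      also have "\<dots> = (\<Sum>i<card A. of_int (N * k i) * \<theta> ^ i)" using k by simp
      finally show ?thesis by (simp add: lat_def sum_distrib_left mult.assoc)
    qed
    moreover have "of_int N = b * (\<Prod>g\<in>G - {id}. g b)"
      unfolding N[symmetric] using prod.remove[OF finite_gal id_gal, of "\<lambda>g. g b"] by simp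
    ultimately have "a = b * (1 + (\<Prod>g\<in>G - {id}. g b) * lat k)" by (simp add: algebra_simps)
    then have "a / b = 1 + (\<Prod>g\<in>G - {id}. g b) * lat k" using b(2) by simp
    moreover have "algebraic_int (\<Prod>g\<in>G - {id}. g b)"
      using lat_int gal_algebraic_int unfolding b(1) by (intro algebraic_int_prod) blast
    ultimately show ?thesis by (simp add: algebraic_int_add algebraic_int_mult lat_int)
  qed
  have "algebraic_int (a / b)" by (rule *[OF a b N(2) mod])
  moreover have "algebraic_int (b / a)" by (rule *[OF b a N(1) mod[symmetric]])
  ultimately show ?thesis using a b by (simp add: unit_iff)
qed

text \<open>A Minkowski unit in the form used here: small at every place but one, and by the product
  formula correspondingly large at that one.\<close>

definition mink :: "'m \<Rightarrow> bool" where
  "mink u \<longleftrightarrow> u \<in> Units ring_of_integers \<and> (\<forall>g\<in>reps - {id}. av g u < 1)"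

text \<open>A sequence of lattice elements of bounded norm is built that decreases at every place
  other than \<open>id\<close>. Only finitely many pairs of a norm and residues of the coordinates
  modulo it occur, so two elements share them, and the later divided by the earlier is the desired
  unit.\<close>

lemma mink_exists: "\<exists>u. mink u"
proof -
  obtain B where B: "\<And>\<epsilon>. \<epsilon> > 0 \<Longrightarrow> \<exists>x. lat x \<noteq> 0 \<and> (\<forall>g\<in>reps - {id}. av g (lat x) < \<epsilon>) \<and>
      (\<Prod>g\<in>reps. av g (lat x)) ^ 2 \<le> B"
    using small_lattice_point by blast
  define P where "P = (\<lambda>(k::nat) x. lat x \<noteq> 0 \<and> (\<Prod>g\<in>reps. av g (lat x)) ^ 2 \<le> B)"
  define Q where "Q = (\<lambda>(k::nat) x y. \<forall>g\<in>reps - {id}. av g (lat y) < av g (lat x))"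
  have "\<exists>x. P 0 x" using B[of 1] by (auto simp: P_def)
  moreover have "\<exists>y. P (Suc k) y \<and> Q k x y" if x: "P k x" for k x
  proof -
    \<comment> \<open>The additional 1 keeps the minimum defined when \<open>id\<close> is the only
      representative.\<close>
    define \<epsilon> where "\<epsilon> = Min (insert 1 ((\<lambda>g. av g (lat x)) ` (reps - {id})))"
    have fin: "finite (insert 1 ((\<lambda>g. av g (lat x)) ` (reps - {id})))" using finite_reps by simp
    have "av g (lat x) > 0" if "g \<in> reps - {id}" for g
    proof -
      have gG: "g \<in> G" using that reps_gal by blast
      show ?thesis using x av_simps(9)[OF gG, of "lat x"] av_simps(10)[OF gG, of "lat x"]
        unfolding P_def by linarith
    qed
    then have "\<epsilon> > 0" unfolding \<epsilon>_def using fin by (subst Min_gr_iff) auto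
    moreover have "\<epsilon> \<le> av g (lat x)" if "g \<in> reps - {id}" for g
      unfolding \<epsilon>_def using fin that by (intro Min_le) auto
    ultimately show ?thesis using B[of \<epsilon>] unfolding P_def Q_def by (meson order_less_le_trans)
  qed
  ultimately obtain f where f: "\<And>k. P k (f k)" "\<And>k. Q k (f k) (f (Suc k))"
    using dependent_nat_choice[of P Q] by blast
  have mono: "av g (lat (f j)) < av g (lat (f i))" if "i < j" "g \<in> reps - {id}" for i j g
    using that(1)
  proof (induction rule: less_Suc_induct)
    case (1 i)
    then show ?case using f(2)[of i] that(2) unfolding Q_def by blast
  qed simp
  have "\<exists>N. (\<Prod>g\<in>G. g (lat (f k))) = of_int N \<and> \<bar>N\<bar> \<le> \<lfloor>B\<rfloor>" for k
  proof -
    obtain N where N: "(\<Prod>g\<in>G. g (lat (f k))) = of_int N" "of_int \<bar>N\<bar> = (\<Prod>g\<in>reps. av g (lat (f k))) ^ 2"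
      using norm_int[OF lat_int] by blast
    then have "of_int \<bar>N\<bar> \<le> B" using f(1)[of k] by (simp add: P_def)
    then show ?thesis using N(1) by (auto simp: le_floor_iff)
  qed
  then obtain N where N: "\<And>k. (\<Prod>g\<in>G. g (lat (f k))) = of_int (N k)" "\<And>k. \<bar>N k\<bar> \<le> \<lfloor>B\<rfloor>" by metis
  define H where "H = (\<lambda>k. (N k, \<lambda>i\<in>{..<card A}. f k i mod N k))"
  have "N k \<noteq> 0" for k
    using f(1)[of k] prod_gal_eq_0_iff[of "lat (f k)"] N(1)[of k] by (auto simp: P_def)
  then have "\<bar>f k i mod N k\<bar> \<le> \<bar>N k\<bar>" for k i
    by (meson abs_mod_less less_imp_le)
  then have "f k i mod N k \<in> {- \<lfloor>B\<rfloor>..\<lfloor>B\<rfloor>}" for k i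
    using order_trans[OF _ N(2)] by (metis abs_le_D1 abs_le_D2 atLeastAtMost_iff minus_le_iff)
  moreover have "N k \<in> {- \<lfloor>B\<rfloor>..\<lfloor>B\<rfloor>}" for k
    using N(2)[of k] by (simp add: abs_le_iff minus_le_iff)
  ultimately have "range H \<subseteq> {- \<lfloor>B\<rfloor>..\<lfloor>B\<rfloor>} \<times> PiE {..<card A} (\<lambda>_. {- \<lfloor>B\<rfloor>..\<lfloor>B\<rfloor>})"
    unfolding H_def by (intro image_subsetI SigmaI restrict_PiE[THEN iffD2] Pi_I)
  then have "finite (range H)" by (rule finite_subset) (intro finite_cartesian_product finite_PiE, auto)
  then have "\<not> inj H" using finite_imageD infinite_UNIV_nat by blast
  then obtain i j where ij: "H i = H j" "i \<noteq> j" by (auto simp: inj_def)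
  have "\<exists>i j. i < j \<and> H i = H j"
  proof (cases "i < j")
    case False
    then have "j < i" using ij(2) by simp
    then show ?thesis using ij(1) by metis
  qed (use ij in blast)
  then obtain i j where ij: "i < j" "H i = H j" by blast
  define u where "u = lat (f j) / lat (f i)"
  have "N i = N j" and md: "(\<lambda>k\<in>{..<card A}. f i k mod N i) = (\<lambda>k\<in>{..<card A}. f j k mod N j)"
    using ij(2) unfolding H_def prod.inject by blast+
  have "f j k mod N i = f i k mod N i" if "k < card A" for k
    using fun_cong[OF md, of k] that \<open>N i = N j\<close> by simp
  then have "u \<in> Units ring_of_integers"
    unfolding u_def using f(1) N(1) \<open>N i = N j\<close>
    by (intro quotient_unit[where N = "N i" and x = "f j" and y = "f i"]) (simp_all add: P_def)
  moreover have "av g u < 1" if "g \<in> reps - {id}" for g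
  proof -
    have gG: "g \<in> G" using that reps_gal by blast
    have "0 < av g (lat (f i))"
      using f(1)[of i] av_simps(9)[OF gG, of "lat (f i)"] av_simps(10)[OF gG, of "lat (f i)"]
        unfolding P_def by linarith
    then show ?thesis using mono[OF ij(1) that] by (simp add: u_def av_simps(6)[OF gG])
  qed
  ultimately show ?thesis unfolding mink_def by blast
qed

end

subsection \<open>The rank of the unit group\<close>

lemma ln_power_int: "x > 0 \<Longrightarrow> ln (x powi k) = of_int k * ln (x::real)"
  by (cases "k \<ge> 0") (simp_all add: power_int_def ln_realpow ln_inverse)

lemma coeff_prod_linear_bound:
  fixes f :: "'i \<Rightarrow> complex"
  assumes "finite I" "\<rho> \<ge> 0" "\<And>i. i \<in> I \<Longrightarrow> cmod (f i) \<le> \<rho>"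
  shows "cmod (coeff (\<Prod>i\<in>I. [:- f i, 1:]) k) \<le> (1 + \<rho>) ^ card I"
  using assms(1,3)
proof (induction I arbitrary: k rule: finite_induct)
  case empty
  then show ?case by (simp add: coeff_1)
next
  case (insert i I)
  let ?p = "\<Prod>i\<in>I. [:- f i, 1:]"
  have b: "cmod (coeff ?p k) \<le> (1 + \<rho>) ^ card I" for k using insert by blast
  have "coeff ([:- f i, 1:] * ?p) k = - f i * coeff ?p k + (if k = 0 then 0 else coeff ?p (k - 1))"
    by (cases k) (simp_all add: coeff_pCons)
  then have "cmod (coeff ([:- f i, 1:] * ?p) k) \<le> cmod (- f i * coeff ?p k) + cmod (if k = 0 then 0 else coeff ?p (k - 1))"
    by (simp only: norm_triangle_ineq)
  also have "\<dots> = cmod (f i) * cmod (coeff ?p k) + cmod (if k = 0 then 0 else coeff ?p (k - 1))"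
    by (simp add: norm_mult)
  also have "\<dots> \<le> \<rho> * (1 + \<rho>) ^ card I + (1 + \<rho>) ^ card I"
    using b insert.prems assms(2) by (intro add_mono mult_mono) auto
  also have "\<dots> = (1 + \<rho>) ^ card (insert i I)" using insert.hyps by (simp add: algebra_simps)
  finally show ?case using insert.hyps by simp
qed

lemma finite_bounded_polys:
  assumes "finite F"
  shows "finite {p :: 'a::zero poly. degree p \<le> n \<and> (\<forall>i. coeff p i \<in> F)}"
proof (rule finite_subset)
  show "{p :: 'a poly. degree p \<le> n \<and> (\<forall>i. coeff p i \<in> F)} \<subseteq> Poly ` {l. set l \<subseteq> F \<and> length l = Suc n}"
  proof
    fix p :: "'a poly" assume p: "p \<in> {p. degree p \<le> n \<and> (\<forall>i. coeff p i \<in> F)}"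
    have "p = Poly (map (coeff p) [0..<Suc n])"
      using p by (intro poly_eqI) (auto simp: nth_default_def coeff_eq_0 not_less simp del: upt_Suc)
    moreover have "map (coeff p) [0..<Suc n] \<in> {l. set l \<subseteq> F \<and> length l = Suc n}"
      using p by (auto simp del: upt_Suc)
    ultimately show "p \<in> Poly ` {l. set l \<subseteq> F \<and> length l = Suc n}" by blast
  qed
  show "finite (Poly ` {l. set l \<subseteq> F \<and> length l = Suc n})"
    using finite_lists_length_eq[OF assms] by simp
qed

context primitive_generator
begin

lemma char_poly_rat: "coeff (\<Prod>g\<in>G. [:- g x, 1:]) i \<in> \<rat>"
proof (rule fixed_rational)
    fix h assume h: "h \<in> G"
    interpret h: field_hom h using h by (simp add: gal_iff)
    interpret mp: map_poly_comm_ring_hom h ..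
    have "map_poly h (\<Prod>g\<in>G. [:- g x, 1:]) = (\<Prod>g\<in>G. [:- h (g x), 1:])"
      unfolding mp.hom_prod by (rule prod.cong) (simp_all add: h.map_poly_pCons_hom h.hom_uminus)
    also have "\<dots> = (\<Prod>g\<in>G. [:- g x, 1:])"
      using prod.reindex_bij_betw[OF bij_betw_gal_comp(1)[OF h], of "\<lambda>g. [:- g x, 1:]"] by simp
    finally show "h (coeff (\<Prod>g\<in>G. [:- g x, 1:]) i) = coeff (\<Prod>g\<in>G. [:- g x, 1:]) i"
      using coeff_map_poly[of h "\<Prod>g\<in>G. [:- g x, 1:]" i] h.hom_zero by simp
qed

lemma char_poly_int: "algebraic_int x \<Longrightarrow> coeff (\<Prod>g\<in>G. [:- g x, 1:]) i \<in> \<int>"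
proof -
  assume x: "algebraic_int x"
  have "coeff (\<Prod>g\<in>G. [:- g x, 1:]) i \<in> \<rat>" by (rule char_poly_rat)
  moreover have "algebraic_int (coeff (\<Prod>g\<in>I. [:- g x, 1:]) i)" if "finite I" "I \<subseteq> G" for I
    using that
  proof (induction I arbitrary: i rule: finite_induct)
    case (insert g I)
    let ?p = "\<Prod>i\<in>I. [:- i x, 1:]"
    have "coeff ([:- g x, 1:] * ?p) i = - g x * coeff ?p i + (if i = 0 then 0 else coeff ?p (i - 1))"
      by (cases i) (simp_all add: coeff_pCons)
    moreover have "algebraic_int (g x)" using insert.prems gal_algebraic_int x by blast
    moreover have "algebraic_int (coeff ?p i)" for i using insert by blast
    ultimately show ?case using insert.hyps by (simp add: algebraic_int_diff algebraic_int_mult)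
  qed (simp add: coeff_1)
  ultimately show ?thesis using rational_algebraic_int_is_int finite_gal by blast
qed

end

context cm_galois
begin

text \<open>Such an element is a root of the polynomial whose roots are its conjugates. The integer
  coefficients of this polynomial are bounded in terms of \<open>\<rho>\<close>, which leaves
  finitely many polynomials.\<close>

lemma finite_bounded_av:
  assumes "\<rho> \<ge> 0"
  shows "finite {y. algebraic_int y \<and> (\<forall>g\<in>G. av g y \<le> \<rho>)}"
proof -
  define n where "n = card G"
  define B where "B = \<lfloor>(1 + \<rho>) ^ n\<rfloor>"
  define F where "F = (of_int ` {-B..B} :: 'm set)"
  define PS where "PS = {p :: 'm poly. degree p \<le> n \<and> (\<forall>i. coeff p i \<in> F)} - {0}"
  have "finite PS" unfolding PS_def F_def by (intro finite_Diff finite_bounded_polys) simp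
  have "{y. algebraic_int y \<and> (\<forall>g\<in>G. av g y \<le> \<rho>)} \<subseteq> (\<Union>p\<in>PS. {y. poly p y = 0})"
  proof
    fix y assume "y \<in> {y. algebraic_int y \<and> (\<forall>g\<in>G. av g y \<le> \<rho>)}"
    then have y: "algebraic_int y" "\<And>g. g \<in> G \<Longrightarrow> av g y \<le> \<rho>" by auto
    define p where "p = (\<Prod>g\<in>G. [:- g y, 1:])"
    have "p \<noteq> 0" unfolding p_def by (simp add: prod_zero_iff[OF finite_gal])
    have "poly p y = 0" unfolding p_def poly_prod prod_zero_iff[OF finite_gal]
      by (rule bexI[OF _ id_gal]) simp
    have "degree p = (\<Sum>g\<in>G. degree [:- g y, 1:])" unfolding p_def by (rule degree_prod_sum_eq) simp
    then have "degree p = n" by (simp add: n_def)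
    have "coeff p i \<in> F" for i
    proof -
      obtain k where k: "coeff p i = of_int k" using char_poly_int[OF y(1)] unfolding p_def by (auto elim: Ints_cases)
      interpret t: field_hom \<tau> by (rule \<tau>)
      interpret mp: map_poly_comm_ring_hom \<tau> ..
      have "of_int k = coeff (map_poly \<tau> p) i" using k t.hom_zero by (simp add: coeff_map_poly t.hom_of_int)
      also have "map_poly \<tau> p = (\<Prod>g\<in>G. [:- \<tau> (g y), 1:])"
        unfolding p_def mp.hom_prod by (rule prod.cong) (simp_all add: t.map_poly_pCons_hom t.hom_uminus)
      finally have "cmod (of_int k) \<le> (1 + \<rho>) ^ n"
        using coeff_prod_linear_bound[OF finite_gal assms, of "\<lambda>g. \<tau> (g y)" i] y(2) by (simp add: n_def av_def)
      then have "of_int \<bar>k\<bar> \<le> (1 + \<rho>) ^ n" by simp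
      then have "\<bar>k\<bar> \<le> B" unfolding B_def by (simp only: le_floor_iff)
      then show ?thesis unfolding F_def k by (intro imageI) (simp add: abs_le_iff minus_le_iff)
    qed
    then have "p \<in> PS" using \<open>p \<noteq> 0\<close> \<open>degree p = n\<close> by (simp add: PS_def)
    then show "y \<in> (\<Union>p\<in>PS. {y. poly p y = 0})" using \<open>poly p y = 0\<close> by blast
  qed
  moreover have "finite (\<Union>p\<in>PS. {y. poly p y = 0})"
    using \<open>finite PS\<close> by (intro finite_UN_I) (auto simp: PS_def intro: poly_roots_finite)
  ultimately show ?thesis by (rule finite_subset)
qed

text \<open>Kronecker's argument: all powers lie in a finite set of bounded integers, so two of them
  coincide.\<close>

lemma root_of_unity:
  assumes "algebraic_int y" "y \<noteq> 0" "\<And>g. g \<in> G \<Longrightarrow> av g y = 1"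
  obtains N where "N > 0" "y ^ N = 1"
proof -
  have "range (\<lambda>k. y ^ k) \<subseteq> {y. algebraic_int y \<and> (\<forall>g\<in>G. av g y \<le> 1)}"
    using assms av_simps(2) by (auto intro: algebraic_int_power)
  then have "finite (range (\<lambda>k. y ^ k))" using finite_bounded_av[of 1] finite_subset by auto
  then have "\<not> inj (\<lambda>k. y ^ k)" using finite_imageD infinite_UNIV_nat by blast
  then obtain i j where ij: "y ^ i = y ^ j" "i \<noteq> j" by (auto simp: inj_def)
  have *: "\<exists>N>0. y ^ N = 1" if "y ^ i = y ^ j" "i < j" for i j
  proof -
    have "y ^ j = y ^ i * y ^ (j - i)" using that(2) by (simp add: power_add[symmetric])
    then show ?thesis using that assms(2) by (intro exI[of _ "j - i"]) auto
  qed
  have "\<exists>N>0. y ^ N = 1" using *[of i j] *[of j i] ij by (metis linorder_neqE_nat)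
  then show ?thesis using that by blast
qed

text \<open>Conjugation does not change complex absolute values, so \<open>c x / x\<close> has
  absolute value 1 at every place and is a root of unity. This is why logarithms only see
  cosets.\<close>

lemma unit_c_quotient:
  assumes "x \<in> Units ring_of_integers"
  obtains N where "N > 0" "c x ^ N = x ^ N"
proof -
  have x0: "x \<noteq> 0" by (rule unit_nonzero[OF assms])
  have u: "c x * inverse x \<in> Units ring_of_integers"
    by (intro unit_mult unit_inverse unit_gal[OF c_gal] assms)
  have "av g (c x * inverse x) = 1" if "g \<in> G" for g
    using av_c(2)[OF that] av_simps(1,5,9)[OF that] x0 by simp
  then obtain N where "N > 0" "(c x * inverse x) ^ N = 1"
    using root_of_unity u unit_iff unit_nonzero[OF u] by metis
  then show ?thesis using that x0 by (simp add: power_mult_distrib power_inverse field_simps)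
qed

text \<open>The logarithms of the absolute values of the conjugates of \<open>u\<close> form a matrix with zero row
  sums whose only positive entries are on the diagonal; compare a row at a maximal exponent.\<close>

lemma mink_exponents_const:
  assumes u: "mink u" and w: "\<And>h. h \<in> G \<Longrightarrow> av h (\<Prod>g\<in>reps. g u powi k g) = 1"
    and g: "g \<in> reps" "g' \<in> reps"
  shows "k g = k g'"
proof -
  define l where "l g = ln (av g u)" for g
  have uU: "u \<in> Units ring_of_integers" using u by (simp add: mink_def)
  have pos: "av g u > 0" if "g \<in> G" for g
    using av_simps(9,10)[OF that, of u] unit_nonzero[OF uU] by linarith
  have l_c: "l (c \<circ> g) = l g" if "g \<in> G" for g using av_c(1)[OF that] by (simp add: l_def)
  have l_rep: "l (rep g) = l g" if "g \<in> G" for g using av_rep[OF that] by (simp add: l_def)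
  have l_neg: "l g < 0" if "g \<in> reps - {id}" for g
    using that u pos reps_gal by (auto simp: l_def mink_def)
  have max: "\<exists>h\<in>reps. \<forall>g\<in>reps. k g \<le> k h"
  proof -
    have "Max (k ` reps) \<in> k ` reps" using finite_reps id_reps by (intro Max_in) auto
    then obtain h where "h \<in> reps" "k h = Max (k ` reps)" by auto
    then show ?thesis using finite_reps by (intro bexI[of _ h]) auto
  qed
  then obtain h where h: "h \<in> reps" "\<And>g. g \<in> reps \<Longrightarrow> k g \<le> k h" by blast
  define h' where "h' = inv_into UNIV h"
  have hG: "h \<in> G" using h reps_gal by blast
  then have h'G: "h' \<in> G" unfolding h'_def by (rule inv_gal)
  have l_neg': "l (h' \<circ> g) < 0" if "g \<in> reps" "g \<noteq> h" for g
  proof -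
    have gG: "g \<in> G" using that reps_gal by blast
    have hg: "h' \<circ> g \<in> G" using h'G gG by (rule comp_gal)
    have "rep (h' \<circ> g) \<noteq> id"
    proof
      assume "rep (h' \<circ> g) = id"
      then have "rep (h' \<circ> g) = rep id" by (simp add: rep_id)
      then have "h' \<circ> g = id \<or> h' \<circ> g = c" unfolding rep_eq_iff by simp
      then have "h \<circ> (h' \<circ> g) = h \<or> h \<circ> (h' \<circ> g) = c \<circ> h" using c_comp(2)[OF hG] by auto
      then have "g = h \<or> g = c \<circ> h"
        using gal_inv_comp(2)[OF hG] by (simp add: h'_def comp_assoc[symmetric])
      then have "rep g = rep h" using rep_c by auto
      then show False using that h rep_reps by metis
    qed
    then have "l (rep (h' \<circ> g)) < 0" using l_neg rep_in_reps[OF hg] by blast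
    then show ?thesis using l_rep[OF hg] by simp
  qed
  have "0 = ln (av h' (\<Prod>g\<in>reps. g u powi k g))" using w[OF h'G] by simp
  also have "\<dots> = ln (\<Prod>g\<in>reps. av (h' \<circ> g) u powi k g)"
    unfolding av_simps(12)[OF h'G] av_simps(11)[OF h'G] by (simp only: av_comp)
  also have "\<dots> = (\<Sum>g\<in>reps. of_int (k g) * l (h' \<circ> g))"
  proof -
    have *: "av (h' \<circ> g) u > 0" if "g \<in> reps" for g
      using pos comp_gal[OF h'G] reps_gal that by blast
    have "ln (\<Prod>g\<in>reps. av (h' \<circ> g) u powi k g) = (\<Sum>g\<in>reps. ln (av (h' \<circ> g) u powi k g))"
      using * by (intro ln_prod[OF finite_reps]) force
    also have "\<dots> = (\<Sum>g\<in>reps. of_int (k g) * l (h' \<circ> g))"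
      using * by (intro sum.cong) (simp_all add: l_def ln_power_int)
    finally show ?thesis .
  qed
  finally have s1: "(\<Sum>g\<in>reps. of_int (k g) * l (h' \<circ> g)) = 0" by simp
  have "(\<Sum>g\<in>reps. l (h' \<circ> g)) = (\<Sum>g\<in>reps. l g)"
    by (rule sum_reps_translate[of h' l, OF h'G l_c])
  also have "\<dots> = 0" unfolding l_def by (rule ln_unit_av_sum[OF uU])
  finally have s2: "(\<Sum>g\<in>reps. l (h' \<circ> g)) = 0" .
  \<comment> \<open>Subtracting \<open>k h\<close> times the sum in \<open>s2\<close> from the one
    in \<open>s1\<close> makes every summand nonnegative. Hence all summands vanish, and the factors
    \<open>l (h' \<circ> g)\<close> with \<open>g \<noteq> h\<close> are nonzero.\<close>
  have "(\<Sum>g\<in>reps. of_int (k g - k h) * l (h' \<circ> g)) = 0"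
  proof -
    have "(\<Sum>g\<in>reps. of_int (k g - k h) * l (h' \<circ> g)) =
        (\<Sum>g\<in>reps. of_int (k g) * l (h' \<circ> g)) - of_int (k h) * (\<Sum>g\<in>reps. l (h' \<circ> g))"
      by (simp add: sum_distrib_left sum_subtractf[symmetric] left_diff_distrib)
    then show ?thesis by (simp only: s1 s2)
  qed
  moreover have "of_int (k g - k h) * l (h' \<circ> g) \<ge> 0" if "g \<in> reps" for g
  proof (cases "g = h")
    case False
    then show ?thesis using l_neg'[OF that False] h(2)[OF that] by (intro mult_nonpos_nonpos) auto
  qed simp
  ultimately have z: "of_int (k g - k h) * l (h' \<circ> g) = 0" if "g \<in> reps" for g
    using that sum_nonneg_eq_0_iff[OF finite_reps, of "\<lambda>g. of_int (k g - k h) * l (h' \<circ> g)"] by blast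
  have "k g = k h" if "g \<in> reps" for g
  proof (cases "g = h")
    case False
    then show ?thesis using l_neg'[OF that False] z[OF that] by simp
  qed simp
  then show ?thesis using g by metis
qed

lemma mink_independent:
  assumes "mink u" "(\<Prod>g\<in>reps. g u powi k g) ^ N = 1" "N > 0" "k id = 0" "g \<in> reps"
  shows "k g = 0"
proof -
  have "av h (\<Prod>g\<in>reps. g u powi k g) = 1" if "h \<in> G" for h
  proof -
    have "av h (\<Prod>g\<in>reps. g u powi k g) ^ N = 1"
      using av_simps(2)[OF that, symmetric] av_simps(4)[OF that] assms(2) by metis
    then show ?thesis using av_simps(10)[OF that] assms(3) power_eq_imp_eq_base[of "av h (\<Prod>g\<in>reps. g u powi k g)" N 1] by simp
  qed
  then show ?thesis using mink_exponents_const[OF assms(1) _ assms(5) id_reps] assms(4) by metis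
qed

text \<open>Points of a large box are mapped to few cells of bounded logarithmic size, and each cell contains
  boundedly many units.\<close>

lemma units_dependent:
  fixes x :: "'i \<Rightarrow> 'm"
  assumes x: "\<And>i. i \<in> I \<Longrightarrow> x i \<in> Units ring_of_integers" and I: "finite I" "card I \<ge> card reps"
  obtains k :: "'i \<Rightarrow> int" where "\<exists>i\<in>I. k i \<noteq> 0" "(\<Prod>i\<in>I. x i powi k i) = 1"
proof -
  define m where "m = card reps"
  have m: "m \<ge> 1" using id_reps finite_reps by (auto simp: m_def card_gt_0_iff Suc_le_eq)
  define C where "C = (\<Sum>g\<in>reps. \<Sum>i\<in>I. \<bar>ln (av g (x i))\<bar>)"
  have C0: "C \<ge> 0" by (simp add: C_def sum_nonneg)
  define C' where "C' = nat \<lceil>C\<rceil>"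
  have C': "C \<le> real C'" using C0 by (simp add: C'_def)
  define pr where "pr k = (\<Prod>i\<in>I. x i powi int (k i))" for k :: "'i \<Rightarrow> nat"
  define lv where "lv g k = ln (av g (pr k))" for g k
  have pr_unit: "pr k \<in> Units ring_of_integers" for k
    unfolding pr_def using x by (intro unit_prod unit_power_int)
  have pos: "av g y > 0" if "g \<in> G" "y \<in> Units ring_of_integers" for g y
    using av_simps(9,10)[OF that(1), of y] unit_nonzero[OF that(2)] by linarith
  have lv_eq: "lv g k = (\<Sum>i\<in>I. real (k i) * ln (av g (x i)))" if g: "g \<in> G" for g k
  proof -
    have "lv g k = ln (\<Prod>i\<in>I. av g (x i) powi int (k i))"
      unfolding lv_def pr_def av_simps(12)[OF g] av_simps(11)[OF g] ..
    also have "\<dots> = (\<Sum>i\<in>I. ln (av g (x i) powi int (k i)))"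
      using pos[OF g x] by (intro ln_prod[OF I(1)]) force
    also have "\<dots> = (\<Sum>i\<in>I. real (k i) * ln (av g (x i)))"
      using pos[OF g x] by (intro sum.cong) (simp_all only: ln_power_int of_int_of_nat_eq)
    finally show ?thesis .
  qed
  \<comment> \<open>Two elements of one cell differ by a unit whose logarithms lie between -1 and 1
    at the \<open>m - 1\<close> places other than \<open>id\<close>; by the product formula its
    logarithms are then at most \<open>m\<close> at all places.\<close>
  define F where "F = {y. algebraic_int y \<and> (\<forall>g\<in>G. av g y \<le> exp (real m))}"
  have finF: "finite F" unfolding F_def by (rule finite_bounded_av) simp
  define W where "W = card F * (2 * C' + 1) ^ (m - 1)"
  \<comment> \<open>With \<open>K > W\<close>, the at most \<open>W * K ^ (m - 1)\<close> pairs of a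
    cell and a quotient are fewer than \<open>K ^ m\<close>, and so fewer than the exponent
    vectors.\<close>
  define K where "K = W + 1"
  define S where "S = PiE I (\<lambda>_. {..K})"
  define cell where "cell k = (\<lambda>g\<in>reps - {id}. \<lfloor>lv g k\<rfloor>)" for k
  define CS where "CS = PiE (reps - {id}) (\<lambda>_. {- int (C' * K)..int (C' * K)})"
  have cell_CS: "cell k \<in> CS" if k: "k \<in> S" for k
    unfolding cell_def CS_def
  proof (rule restrict_PiE[THEN iffD2], rule Pi_I)
    fix g assume g: "g \<in> reps - {id}"
    then have gG: "g \<in> G" using reps_gal by blast
    have "\<bar>lv g k\<bar> \<le> (\<Sum>i\<in>I. \<bar>real (k i) * ln (av g (x i))\<bar>)"
      unfolding lv_eq[OF gG] by (rule sum_abs)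
    also have "\<dots> \<le> (\<Sum>i\<in>I. real K * \<bar>ln (av g (x i))\<bar>)"
    proof (rule sum_mono)
      fix i assume "i \<in> I"
      then have "k i \<le> K" using PiE_mem[OF k[unfolded S_def]] by simp
      then show "\<bar>real (k i) * ln (av g (x i))\<bar> \<le> real K * \<bar>ln (av g (x i))\<bar>"
        by (simp add: abs_mult mult_right_mono)
    qed
    also have "\<dots> = real K * (\<Sum>i\<in>I. \<bar>ln (av g (x i))\<bar>)" by (simp add: sum_distrib_left)
    also have "\<dots> \<le> real K * C"
      unfolding C_def using finite_reps g by (intro mult_left_mono member_le_sum) (auto intro: sum_nonneg)
    also have "\<dots> \<le> real (C' * K)" using mult_right_mono[OF C', of "real K"] by (simp add: mult.commute)
    finally have "\<bar>lv g k\<bar> \<le> real (C' * K)" .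
    then have "lv g k \<le> of_int (int (C' * K))" "of_int (- int (C' * K)) \<le> lv g k"
      unfolding of_int_minus of_int_of_nat_eq by linarith+
    then have "\<lfloor>lv g k\<rfloor> \<le> int (C' * K)" "- int (C' * K) \<le> \<lfloor>lv g k\<rfloor>"
      by linarith+
    then show "\<lfloor>lv g k\<rfloor> \<in> {- int (C' * K)..int (C' * K)}" by simp
  qed
  \<comment> \<open>A base point for each occupied cell: every element is recorded by its cell and
    its quotient by the base point.\<close>
  define b where "b q = (SOME k. k \<in> S \<and> cell k = q)" for q
  have b: "b (cell k) \<in> S \<and> cell (b (cell k)) = cell k" if "k \<in> S" for k
    unfolding b_def by (rule someI[of _ k]) (use that in simp)
  have quot: "pr k / pr (b (cell k)) \<in> F" if k: "k \<in> S" for k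
  proof -
    define y where "y = pr k / pr (b (cell k))"
    have yU: "y \<in> Units ring_of_integers"
      unfolding y_def divide_inverse by (intro unit_mult unit_inverse pr_unit)
    have ln_y: "ln (av g y) = lv g k - lv g (b (cell k))" if "g \<in> G" for g
      unfolding y_def lv_def using pos[OF that pr_unit] by (simp add: av_simps(6)[OF that] ln_div less_imp_neq[symmetric])
    have small: "\<bar>ln (av g y)\<bar> \<le> 1" if g: "g \<in> reps - {id}" for g
    proof -
      have "cell k g = cell (b (cell k)) g" using b[OF k] by simp
      then have "\<lfloor>lv g k\<rfloor> = \<lfloor>lv g (b (cell k))\<rfloor>" using g by (simp add: cell_def)
      then show ?thesis using ln_y[of g] g reps_gal by (subst ln_y) (blast, linarith)
    qed
    have rep_bound: "ln (av g y) \<le> real m" if g: "g \<in> reps" for g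
    proof (cases "g = id")
      case True
      have "ln (av id y) = - (\<Sum>g\<in>reps - {id}. ln (av g y))"
        using ln_unit_av_sum[OF yU] sum.remove[OF finite_reps id_reps, of "\<lambda>g. ln (av g y)"] by simp
      also have "\<dots> \<le> (\<Sum>g\<in>reps - {id}. \<bar>ln (av g y)\<bar>)"
        unfolding sum_negf[symmetric] by (rule sum_mono) simp
      also have "\<dots> \<le> (\<Sum>g\<in>reps - {id}. 1)" by (rule sum_mono[OF small])
      also have "\<dots> \<le> real m" using finite_reps by (simp add: m_def card_Diff1_le)
      finally show ?thesis using True by simp
    next
      case False
      then show ?thesis using small[of g] g m by (simp add: abs_le_iff)
    qed
    have "av g y \<le> exp (real m)" if g: "g \<in> G" for g
    proof -
      have "ln (av g y) \<le> real m" using rep_bound[OF rep_in_reps[OF g]] av_rep[OF g] by simp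
      then show ?thesis using pos[OF g yU] by (metis exp_le_cancel_iff exp_ln)
    qed
    then show ?thesis using yU unfolding F_def y_def[symmetric] by (simp add: unit_iff)
  qed
  define H where "H k = (cell k, pr k / pr (b (cell k)))" for k
  have "card (H ` S) \<le> card (CS \<times> F)"
    using finF finite_reps cell_CS quot unfolding CS_def H_def
    by (intro card_mono finite_cartesian_product finite_PiE image_subsetI SigmaI) auto
  also have "\<dots> = card F * (2 * (C' * K) + 1) ^ (m - 1)"
  proof -
    have "card {- int (C' * K)..int (C' * K)} = 2 * (C' * K) + 1"
      unfolding card_atLeastAtMost_int by linarith
    then have "card CS = (2 * (C' * K) + 1) ^ (m - 1)"
      using finite_reps id_reps unfolding CS_def by (subst card_PiE) (simp_all add: m_def card_Diff_singleton)
    then show ?thesis by (simp add: card_cartesian_product)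
  qed
  also have "\<dots> \<le> card F * ((2 * C' + 1) * K) ^ (m - 1)"
    by (intro mult_left_mono power_mono) (simp_all add: K_def)
  also have "\<dots> = W * K ^ (m - 1)" unfolding W_def power_mult_distrib by (rule mult.assoc[symmetric])
  also have "\<dots> < K * K ^ (m - 1)" by (rule mult_strict_right_mono) (simp_all add: K_def)
  also have "\<dots> = K ^ m" using m by (cases m) simp_all
  also have "\<dots> \<le> (K + 1) ^ m" by (intro power_mono) simp_all
  also have "\<dots> \<le> (K + 1) ^ card I" using I(2) by (intro power_increasing) (simp_all add: m_def)
  also have "\<dots> = card S" unfolding S_def using I(1) by (subst card_PiE) simp_all
  finally have "\<not> inj_on H S" by (rule pigeonhole)
  then obtain k l where kl: "k \<in> S" "l \<in> S" "k \<noteq> l" "H k = H l" unfolding inj_on_def by blast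
  have "cell k = cell l" "pr k / pr (b (cell k)) = pr l / pr (b (cell l))"
    using kl(4) unfolding H_def prod.inject by blast+
  then have "pr k = pr l" using unit_nonzero[OF pr_unit] by simp
  show ?thesis
  proof (rule that[of "\<lambda>i. int (k i) - int (l i)"])
    show "\<exists>i\<in>I. int (k i) - int (l i) \<noteq> 0"
    proof (rule ccontr)
      assume "\<not> (\<exists>i\<in>I. int (k i) - int (l i) \<noteq> 0)"
      then have "k i = l i" if "i \<in> I" for i using that by simp
      then show False using kl(1-3) PiE_ext unfolding S_def by blast
    qed
    have "(\<Prod>i\<in>I. x i powi (int (k i) - int (l i))) = (\<Prod>i\<in>I. x i powi int (k i) / x i powi int (l i))"
      using unit_nonzero[OF x] by (intro prod.cong) (simp_all add: power_int_diff)
    also have "\<dots> = pr k / pr l" by (simp add: pr_def prod_dividef)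
    finally show "(\<Prod>i\<in>I. x i powi (int (k i) - int (l i))) = 1"
      using \<open>pr k = pr l\<close> unit_nonzero[OF pr_unit] by simp
  qed
qed

end

section \<open>The unit group as a module over the integers\<close>

lemma module_unit_module: "module \<Z> (unit_module :: (int, 'm::field_char_0) module)"
proof (rule moduleI)
  show "abelian_group (unit_module :: (int, 'm) module)"
  proof (rule abelian_groupI)
    fix x :: 'm assume "x \<in> carrier unit_module"
    then have "inverse x \<in> Units ring_of_integers" "inverse x * x = 1"
      using unit_nonzero[of x] by (simp_all add: unit_module_def unit_inverse)
    then show "\<exists>y\<in>carrier unit_module. y \<oplus>\<^bsub>unit_module\<^esub> x = \<zero>\<^bsub>unit_module\<^esub>"
      by (auto simp: unit_module_def)
  qed (auto simp: unit_module_def unit_mult unit_one mult_ac)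
qed (auto simp: unit_module_def unit_power_int int_is_cring power_int_add unit_nonzero power_int_mult_distrib,
  metis power_int_mult mult.commute)

lemma lincomb_unit_module:
  assumes "finite A" "A \<subseteq> Units (ring_of_integers :: 'm::field_char_0 ring)"
  shows "module.lincomb unit_module k A = (\<Prod>x\<in>A. x powi k x)"
proof -
  interpret N: module \<Z> "unit_module :: (int, 'm) module" by (rule module_unit_module)
  show ?thesis
    using assms
  proof (induction A rule: finite_induct)
    case empty
    then show ?case by (simp add: N.lincomb_def) (simp add: unit_module_def)
  next
    case (insert x A)
    have c: "carrier unit_module = Units (ring_of_integers :: 'm ring)" by (simp add: unit_module_def)
    have "N.lincomb k (insert x A) = (k x \<odot>\<^bsub>unit_module\<^esub> x) \<oplus>\<^bsub>unit_module\<^esub> N.lincomb k A"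
      unfolding N.lincomb_def using insert.hyps insert.prems
      by (intro N.finsum_insert) (auto simp: unit_module_def unit_power_int)
    then show ?case using insert by (simp add: unit_module_def)
  qed
qed

text \<open>Dependence is defined through finite subsets; extending the coefficients by zero moves
  the relation to \<open>S\<close> itself.\<close>

lemma lin_dep_unit_module:
  assumes "finite S" "S \<subseteq> Units (ring_of_integers :: 'm::field_char_0 ring)"
  shows "module.lin_dep \<Z> unit_module S \<longleftrightarrow> (\<exists>k. (\<exists>x\<in>S. k x \<noteq> 0) \<and> (\<Prod>x\<in>S. x powi k x) = 1)"
proof -
  interpret N: module \<Z> "unit_module :: (int, 'm) module" by (rule module_unit_module)
  have 0: "\<zero>\<^bsub>unit_module\<^esub> = (1 :: 'm)" by (simp add: unit_module_def)
  show ?thesis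
  proof
    assume "N.lin_dep S"
    then obtain A k v where A: "finite A" "A \<subseteq> S" "N.lincomb k A = 1" "v \<in> A" "k v \<noteq> 0"
      unfolding N.lin_dep_def 0 by auto
    define k' where "k' x = (if x \<in> A then k x else 0)" for x
    have "(\<Prod>x\<in>S. x powi k' x) = (\<Prod>x\<in>A. x powi k x)"
      using A(2) assms(1) by (intro prod.mono_neutral_cong_right) (auto simp: k'_def)
    also have "\<dots> = 1" using A lincomb_unit_module[of A k] assms by auto
    finally show "\<exists>k. (\<exists>x\<in>S. k x \<noteq> 0) \<and> (\<Prod>x\<in>S. x powi k x) = 1"
      using A by (intro exI[of _ k']) (auto simp: k'_def)
  next
    assume "\<exists>k. (\<exists>x\<in>S. k x \<noteq> 0) \<and> (\<Prod>x\<in>S. x powi k x) = 1"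
    then obtain k x where k: "x \<in> S" "k x \<noteq> 0" "(\<Prod>x\<in>S. x powi k x) = 1" by blast
    show "N.lin_dep S" unfolding N.lin_dep_def 0
      using k assms lincomb_unit_module[OF assms, of k] by (intro exI[of _ S] exI[of _ k] exI[of _ x]) auto
  qed
qed

lemma module_rank_eqI:
  assumes "\<And>S. finite S \<Longrightarrow> S \<subseteq> carrier N \<Longrightarrow> \<not> module.lin_dep R N S \<Longrightarrow> card S \<le> d"
    and "finite S0" "S0 \<subseteq> carrier N" "\<not> module.lin_dep R N S0" "card S0 = d"
  shows "module_rank R N = enat d"
  unfolding module_rank_def
proof (rule antisym)
  show "(SUP S\<in>{S. finite S \<and> S \<subseteq> carrier N \<and> \<not> module.lin_dep R N S}. enat (card S)) \<le> enat d"
  proof (rule SUP_least)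
    fix S assume "S \<in> {S. finite S \<and> S \<subseteq> carrier N \<and> \<not> module.lin_dep R N S}"
    then show "enat (card S) \<le> enat d"
      unfolding mem_Collect_eq enat_ord_simps by (elim conjE) (rule assms(1))
  qed
  have "S0 \<in> {S. finite S \<and> S \<subseteq> carrier N \<and> \<not> module.lin_dep R N S}" using assms(2-4) by blast
  then show "enat d \<le> (SUP S\<in>{S. finite S \<and> S \<subseteq> carrier N \<and> \<not> module.lin_dep R N S}. enat (card S))"
    by (rule SUP_upper2) (simp add: assms(5))
qed

text \<open>Dirichlet's unit theorem for this field: the nontrivial conjugates of one Minkowski unit
  are independent, and the pigeonhole argument bounds every independent set.\<close>

lemma (in cm_galois) unit_rank: "module_rank \<Z> (unit_module :: (int, 'm) module) = enat (card reps - 1)"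
proof -
  obtain u where u: "mink u" using mink_exists by (rule exE)
  then have uU: "u \<in> Units ring_of_integers" by (simp add: mink_def)
  have c: "carrier unit_module = Units (ring_of_integers :: 'm ring)" by (simp add: unit_module_def)
  define R where "R = reps - {id}"
  have finR: "finite R" using finite_reps by (simp add: R_def)
  have indep: "k g = 0" if "(\<Prod>g\<in>R. g u powi k g) = 1" "g \<in> R" for k g
  proof -
    define k' where "k' g = (if g = id then 0 else k g)" for g
    have "(\<Prod>g\<in>reps. g u powi k' g) = (\<Prod>g\<in>R. g u powi k g)"
      using finite_reps by (intro prod.mono_neutral_cong_right) (auto simp: R_def k'_def)
    then have "(\<Prod>g\<in>reps. g u powi k' g) ^ 1 = 1" using that by simp
    then have "k' g = 0" using mink_independent[OF u, of k' 1 g] that(2) by (simp add: k'_def R_def)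
    then show ?thesis using that(2) by (auto simp: k'_def R_def)
  qed
  have inj: "inj_on (\<lambda>g. g u) R"
  proof (rule inj_onI, rule ccontr)
    fix g h assume gh: "g \<in> R" "h \<in> R" "g u = h u" "g \<noteq> h"
    define k :: "('m \<Rightarrow> 'm) \<Rightarrow> int" where "k x = (if x = g then 1 else if x = h then -1 else 0)" for x
    have "(\<Prod>x\<in>R. x u powi k x) = (\<Prod>x\<in>{g, h}. x u powi k x)"
      using gh finR by (intro prod.mono_neutral_right) (auto simp: k_def)
    also have "\<dots> = 1"
      using gh unit_nonzero[OF unit_gal[of g u]] uU reps_gal by (auto simp: k_def R_def power_int_minus)
    finally show False using indep[of k g] gh by (simp add: k_def)
  qed
  show ?thesis
  proof (rule module_rank_eqI[where ?S0.0 = "(\<lambda>g. g u) ` R"])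
    fix S assume S: "finite S" "S \<subseteq> carrier unit_module" "\<not> module.lin_dep \<Z> unit_module (S :: 'm set)"
    show "card S \<le> card reps - 1"
    proof (rule ccontr)
      assume "\<not> card S \<le> card reps - 1"
      then have "card reps \<le> card S" by simp
      moreover have "x \<in> Units ring_of_integers" if "x \<in> S" for x using S(2) that unfolding c by blast
      ultimately obtain k where "\<exists>x\<in>S. k x \<noteq> 0" "(\<Prod>x\<in>S. x powi k x) = 1"
        using units_dependent[of S "\<lambda>x. x"] S(1) by metis
      then show False using S lin_dep_unit_module[of S] c by blast
    qed
  next
    have sub: "(\<lambda>g. g u) ` R \<subseteq> Units ring_of_integers"
      using unit_gal[OF _ uU] reps_gal by (auto simp: R_def)
    then show "(\<lambda>g. g u) ` R \<subseteq> carrier unit_module" by (simp add: c)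
    show "finite ((\<lambda>g. g u) ` R)" using finR by simp
    show "card ((\<lambda>g. g u) ` R) = card reps - 1"
      using card_image[OF inj] finite_reps id_reps by (simp add: R_def)
    show "\<not> module.lin_dep \<Z> unit_module ((\<lambda>g. g u) ` R)"
    proof
      assume "module.lin_dep \<Z> unit_module ((\<lambda>g. g u) ` R)"
      then obtain k g where k: "g \<in> R" "k (g u) \<noteq> 0" "(\<Prod>x\<in>(\<lambda>g. g u) ` R. x powi k x) = 1"
        using lin_dep_unit_module[OF _ sub] finR by auto
      then have "(\<Prod>g\<in>R. g u powi k (g u)) = 1" by (simp add: prod.reindex[OF inj])
      then show False using indep[of "\<lambda>g. k (g u)" g] k by simp
    qed
  qed
qed

section \<open>Non-archimedean absolute values\<close>

lemma absval_eq_dist: "absval (x::'a::nonarch_field) = dist x 0"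
  by (simp add: dist_absval)

lemma absval_nonneg [simp]: "absval (x::'a::nonarch_field) \<ge> 0"
  by (simp add: absval_eq_dist)

lemma absval_eq_0_iff [simp]: "absval (x::'a::nonarch_field) = 0 \<longleftrightarrow> x = 0"
  by (simp add: absval_eq_dist)

lemma absval_0 [simp]: "absval (0::'a::nonarch_field) = 0"
  by simp

lemma absval_pos_iff [simp]: "absval (x::'a::nonarch_field) > 0 \<longleftrightarrow> x \<noteq> 0"
  by (simp add: absval_eq_dist)

lemma absval_1 [simp]: "absval (1::'a::nonarch_field) = 1"
proof -
  have "absval (1::'a) * absval (1::'a) = absval (1::'a)"
    using absval_mult[of "1::'a" 1] by simp
  moreover have "absval (1::'a) \<noteq> 0" by simp
  ultimately show ?thesis by (metis mult_cancel_right1)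
qed

lemma absval_minus [simp]: "absval (- x::'a::nonarch_field) = absval x"
  using dist_absval[of x 0] dist_absval[of 0 x] by (simp add: dist_commute)

lemma absval_minus_commute: "absval (x - y::'a::nonarch_field) = absval (y - x)"
  using absval_minus[of "x - y"] by simp

lemma absval_power: "absval (x ^ n::'a::nonarch_field) = absval x ^ n"
  by (induction n) (simp_all add: absval_mult)

lemma absval_inverse: "absval (inverse x::'a::nonarch_field) = inverse (absval x)"
proof (cases "x = 0")
  case False
  then have "absval x * absval (inverse x) = 1"
    by (simp add: absval_mult[symmetric])
  then show ?thesis using inverse_unique by metis
qed simp

lemma absval_divide: "absval (x / y::'a::nonarch_field) = absval x / absval y"
  by (simp add: divide_inverse absval_mult absval_inverse)

lemma absval_power_int: "absval (x powi k::'a::nonarch_field) = absval x powi k"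
  by (simp add: power_int_def absval_power absval_inverse)

lemma absval_diff: "absval (x - y::'a::nonarch_field) \<le> max (absval x) (absval y)"
  using absval_add[of x "- y"] by simp

lemma absval_add_le: "absval x \<le> r \<Longrightarrow> absval y \<le> r \<Longrightarrow> absval (x + y::'a::nonarch_field) \<le> r"
  using absval_add[of x y] by linarith

lemma absval_diff_le: "absval x \<le> r \<Longrightarrow> absval y \<le> r \<Longrightarrow> absval (x - y::'a::nonarch_field) \<le> r"
  using absval_diff[of x y] by linarith

lemma absval_add_less: "absval x < r \<Longrightarrow> absval y < r \<Longrightarrow> absval (x + y::'a::nonarch_field) < r"
  using absval_add[of x y] by linarith

lemma absval_diff_less: "absval x < r \<Longrightarrow> absval y < r \<Longrightarrow> absval (x - y::'a::nonarch_field) < r"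
  using absval_diff[of x y] by linarith

lemma absval_sum_le:
  "r \<ge> 0 \<Longrightarrow> (\<And>i. i \<in> I \<Longrightarrow> absval (f i) \<le> r) \<Longrightarrow> absval (\<Sum>i\<in>I. f i::'a::nonarch_field) \<le> r"
  by (induction I rule: infinite_finite_induct) (auto intro: absval_add_le)

lemma absval_sum_less:
  "r > 0 \<Longrightarrow> (\<And>i. i \<in> I \<Longrightarrow> absval (f i) < r) \<Longrightarrow> absval (\<Sum>i\<in>I. f i::'a::nonarch_field) < r"
  by (induction I rule: infinite_finite_induct) (auto intro: absval_add_less)

lemma absval_prod: "absval (\<Prod>i\<in>I. f i::'a::nonarch_field) = (\<Prod>i\<in>I. absval (f i))"
  by (induction I rule: infinite_finite_induct) (auto simp: absval_mult)

text \<open>The usual transfer from a dense subset: an approximation whose error is smaller than the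
  element itself has the same absolute value.\<close>

lemma absval_eq_if_close: "absval (x - y::'a::nonarch_field) < absval y \<Longrightarrow> absval x = absval y"
  using absval_add[of "x - y" y] absval_diff[of x "x - y"] by simp

lemma absval_of_nat_le_1: "absval (of_nat n::'a::nonarch_field) \<le> 1"
  by (induction n) (auto intro: absval_add_le)

lemma absval_of_int_le_1: "absval (of_int n::'a::nonarch_field) \<le> 1"
proof (cases "n \<ge> 0")
  case True
  then show ?thesis using absval_of_nat_le_1[of "nat n", where 'a = 'a] by simp
next
  case False
  then have "of_int n = (- of_nat (nat (- n)) :: 'a)" by simp
  then show ?thesis using absval_of_nat_le_1[of "nat (- n)", where 'a = 'a] by (metis absval_minus)
qed

lemma absval_lt_1_mult: "absval x \<le> 1 \<Longrightarrow> absval y < 1 \<Longrightarrow> absval (x * y::'a::nonarch_field) < 1"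
  unfolding absval_mult using mult_mono[of "absval x" 1 "absval y" "absval y"] by simp

text \<open>If \<open>absval x > 1\<close>, then \<open>x ^ n\<close> would exceed every term on the
  other side of its monic relation, as integers have absolute value at most 1.\<close>

lemma absval_algebraic_int:
  assumes "algebraic_int (x::'a::nonarch_field)"
  shows "absval x \<le> 1"
proof (rule ccontr)
  assume "\<not> absval x \<le> 1"
  then have x: "absval x > 1" by simp
  obtain n k where nk: "n > 0" "x ^ n = (\<Sum>i<n. of_int (k i) * x ^ i)"
    using algebraic_int_power_eq[OF assms] .
  have "absval (\<Sum>i<n. of_int (k i) * x ^ i) \<le> absval x ^ (n - 1)"
  proof (rule absval_sum_le)
    fix i assume "i \<in> {..<n}"
    then have "absval x ^ i \<le> absval x ^ (n - 1)" using x by (intro power_increasing) auto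
    moreover have "absval (of_int (k i) * x ^ i) \<le> 1 * absval x ^ i"
      unfolding absval_mult absval_power by (intro mult_right_mono absval_of_int_le_1) simp
    ultimately show "absval (of_int (k i) * x ^ i) \<le> absval x ^ (n - 1)" by simp
  qed simp
  also have "\<dots> < absval x ^ n" using x nk(1) by (intro power_strict_increasing) auto
  finally show False unfolding nk(2)[symmetric] by (simp add: absval_power)
qed

lemma tendsto_absval_iff:
  fixes f :: "'b \<Rightarrow> 'a::nonarch_field"
  shows "(f \<longlongrightarrow> l) F \<longleftrightarrow> ((\<lambda>x. absval (f x - l)) \<longlongrightarrow> 0) F"
  by (subst tendsto_dist_iff) (simp add: dist_absval)

instance nonarch_field < topological_ab_group_add
proof
  fix a b :: 'a
  have fs: "((\<lambda>x. absval (fst x - a)) \<longlongrightarrow> 0) (nhds a \<times>\<^sub>F nhds b)"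
    "((\<lambda>x. absval (snd x - b)) \<longlongrightarrow> 0) (nhds a \<times>\<^sub>F nhds b)"
    unfolding tendsto_absval_iff[symmetric] by (rule filterlim_fst, rule filterlim_snd)
  show "LIM x (nhds a \<times>\<^sub>F nhds b). fst x + snd x :> nhds (a + b)"
    unfolding tendsto_absval_iff
  proof (rule Lim_null_comparison)
    have "absval (fst x + snd x - (a + b)) \<le> max (absval (fst x - a)) (absval (snd x - b))" for x
      using absval_add[of "fst x - a" "snd x - b"] by (simp add: algebra_simps)
    then show "\<forall>\<^sub>F x in nhds a \<times>\<^sub>F nhds b. norm (absval (fst x + snd x - (a + b))) \<le> max (absval (fst x - a)) (absval (snd x - b))"
      by simp
    show "((\<lambda>x. max (absval (fst x - a)) (absval (snd x - b))) \<longlongrightarrow> 0) (nhds a \<times>\<^sub>F nhds b)"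
      using tendsto_max[OF fs] by simp
  qed
  show "(uminus \<longlongrightarrow> - a) (nhds a)"
    unfolding tendsto_absval_iff
  proof -
    have "((\<lambda>x. absval (x - a)) \<longlongrightarrow> 0) (nhds a)"
      unfolding tendsto_absval_iff[symmetric] by (rule filterlim_ident)
    moreover have "absval (- x - - a) = absval (x - a)" for x
      by (rule trans[OF _ absval_minus_commute]) simp
    ultimately show "((\<lambda>x. absval (- x - - a)) \<longlongrightarrow> 0) (nhds a)" by simp
  qed
qed

lemma eventually_absval_eq:
  fixes f :: "'b \<Rightarrow> 'a::nonarch_field"
  assumes "(f \<longlongrightarrow> l) F" "l \<noteq> 0"
  shows "\<forall>\<^sub>F x in F. absval (f x) = absval l"
proof -
  have "\<forall>\<^sub>F x in F. dist (f x) l < absval l"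
    using assms by (intro tendstoD) auto
  then show ?thesis
    by (rule eventually_mono) (rule absval_eq_if_close, simp add: dist_absval)
qed

lemma tendsto_absval:
  fixes f :: "'b \<Rightarrow> 'a::nonarch_field"
  assumes "(f \<longlongrightarrow> l) F"
  shows "((\<lambda>x. absval (f x)) \<longlongrightarrow> absval l) F"
  using tendsto_dist[OF assms tendsto_const[of 0]] by (simp add: absval_eq_dist)

instance nonarch_field < topological_semigroup_mult
proof
  fix a b :: 'a
  have fs: "(fst \<longlongrightarrow> a) (nhds a \<times>\<^sub>F nhds b)" "(snd \<longlongrightarrow> b) (nhds a \<times>\<^sub>F nhds b)"
    by (rule filterlim_fst, rule filterlim_snd)
  have fs': "((\<lambda>x. absval (fst x - a)) \<longlongrightarrow> 0) (nhds a \<times>\<^sub>F nhds b)"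
    "((\<lambda>x. absval (snd x - b)) \<longlongrightarrow> 0) (nhds a \<times>\<^sub>F nhds b)"
    using fs unfolding tendsto_absval_iff[symmetric] by simp_all
  show "LIM x (nhds a \<times>\<^sub>F nhds b). fst x * snd x :> nhds (a * b)"
    unfolding tendsto_absval_iff
  proof (rule Lim_null_comparison)
    let ?m = "\<lambda>x. max (absval (fst x - a) * absval (snd x)) (absval a * absval (snd x - b))"
    have "absval (fst x * snd x - a * b) \<le> ?m x" for x
      using absval_add[of "(fst x - a) * snd x" "a * (snd x - b)"] by (simp add: algebra_simps absval_mult[symmetric])
    then show "\<forall>\<^sub>F x in nhds a \<times>\<^sub>F nhds b. norm (absval (fst x * snd x - a * b)) \<le> ?m x" by simp
    show "(?m \<longlongrightarrow> 0) (nhds a \<times>\<^sub>F nhds b)"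
      using tendsto_max[OF tendsto_mult[OF fs'(1) tendsto_absval[OF fs(2)]] tendsto_mult[OF tendsto_const[of "absval a"] fs'(2)]]
      by simp
  qed
qed

instance nonarch_field < topological_comm_monoid_mult ..

text \<open>Near a nonzero limit the absolute value is constant, so the error of the inverse is the
  error of the function up to a fixed factor.\<close>

lemma tendsto_inverse_nonarch:
  fixes f :: "'b \<Rightarrow> 'a::nonarch_field"
  assumes "(f \<longlongrightarrow> l) F" "l \<noteq> 0"
  shows "((\<lambda>x. inverse (f x)) \<longlongrightarrow> inverse l) F"
  unfolding tendsto_absval_iff
proof (rule Lim_transform_eventually)
  show "((\<lambda>x. absval (f x - l) / (absval l * absval l)) \<longlongrightarrow> 0) F"
    using tendsto_divide_zero assms(1) unfolding tendsto_absval_iff by blast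
  show "\<forall>\<^sub>F x in F. absval (f x - l) / (absval l * absval l) = absval (inverse (f x) - inverse l)"
    using eventually_absval_eq[OF assms]
  proof eventually_elim
    case (elim x)
    then have "f x \<noteq> 0" using assms(2) by auto
    then have "inverse (f x) - inverse l = (l - f x) / (f x * l)"
      using assms(2) by (simp add: field_simps)
    then show ?case using elim by (simp add: absval_divide absval_mult absval_minus_commute)
  qed
qed

text \<open>By the ultrametric inequality the distance of two terms is at most the largest step
  between them.\<close>

lemma Cauchy_nonarch:
  fixes s :: "nat \<Rightarrow> 'a::nonarch_field"
  assumes "(\<lambda>n. absval (s (Suc n) - s n)) \<longlonglongrightarrow> 0"
  shows "Cauchy s"
proof (rule metric_CauchyI)
  fix e :: real assume "e > 0"
  then obtain N where N: "\<And>n. n \<ge> N \<Longrightarrow> absval (s (Suc n) - s n) < e"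
    using LIMSEQ_D[OF assms, of e] by auto
  have "absval (s (n + k) - s n) < e" if "n \<ge> N" for n k
  proof (induction k)
    case (Suc k)
    have "absval ((s (Suc (n + k)) - s (n + k)) + (s (n + k) - s n)) < e"
      using N[of "n + k"] that Suc by (intro absval_add_less) auto
    then show ?case by simp
  qed (simp add: \<open>e > 0\<close>)
  note * = this
  have "dist (s m) (s n) < e" if "m \<ge> N" "n \<ge> N" for m n
    using *[of n "m - n"] *[of m "n - m"] that unfolding dist_absval
    by (cases "m \<le> n") (simp_all add: absval_minus_commute)
  then show "\<exists>M. \<forall>m\<ge>M. \<forall>n\<ge>M. dist (s m) (s n) < e" by blast
qed

lemma closure_closed_op:
  fixes S :: "'a::nonarch_field set"
  shows closure_add: "(\<And>x y. x \<in> S \<Longrightarrow> y \<in> S \<Longrightarrow> x + y \<in> S) \<Longrightarrow> a \<in> closure S \<Longrightarrow> b \<in> closure S \<Longrightarrow> a + b \<in> closure S"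
    and closure_mult: "(\<And>x y. x \<in> S \<Longrightarrow> y \<in> S \<Longrightarrow> x * y \<in> S) \<Longrightarrow> a \<in> closure S \<Longrightarrow> b \<in> closure S \<Longrightarrow> a * b \<in> closure S"
    and closure_uminus: "(\<And>x. x \<in> S \<Longrightarrow> - x \<in> S) \<Longrightarrow> a \<in> closure S \<Longrightarrow> - a \<in> closure S"
    and closure_inverse: "(\<And>x. x \<in> S \<Longrightarrow> inverse x \<in> S) \<Longrightarrow> a \<in> closure S \<Longrightarrow> inverse a \<in> closure S"
proof -
  show "a + b \<in> closure S" if cl: "\<And>x y. x \<in> S \<Longrightarrow> y \<in> S \<Longrightarrow> x + y \<in> S" and ab: "a \<in> closure S" "b \<in> closure S"
  proof -
    obtain x y where "\<And>n. x n \<in> S" "x \<longlonglongrightarrow> a" "\<And>n. y n \<in> S" "y \<longlonglongrightarrow> b"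
      using ab unfolding closure_sequential by blast
    then show ?thesis unfolding closure_sequential
      using cl tendsto_add[of x a sequentially y b] by (intro exI[of _ "\<lambda>n. x n + y n"]) auto
  qed
  show "a * b \<in> closure S" if cl: "\<And>x y. x \<in> S \<Longrightarrow> y \<in> S \<Longrightarrow> x * y \<in> S" and ab: "a \<in> closure S" "b \<in> closure S"
  proof -
    obtain x y where "\<And>n. x n \<in> S" "x \<longlonglongrightarrow> a" "\<And>n. y n \<in> S" "y \<longlonglongrightarrow> b"
      using ab unfolding closure_sequential by blast
    then show ?thesis unfolding closure_sequential
      using cl tendsto_mult[of x a sequentially y b] by (intro exI[of _ "\<lambda>n. x n * y n"]) auto
  qed
  show "- a \<in> closure S" if cl: "\<And>x. x \<in> S \<Longrightarrow> - x \<in> S" and ab: "a \<in> closure S"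
  proof -
    obtain x where "\<And>n. x n \<in> S" "x \<longlonglongrightarrow> a"
      using ab unfolding closure_sequential by blast
    then show ?thesis unfolding closure_sequential
      using cl tendsto_minus[of x a sequentially] by (intro exI[of _ "\<lambda>n. - x n"]) auto
  qed
  show "inverse a \<in> closure S" if cl: "\<And>x. x \<in> S \<Longrightarrow> inverse x \<in> S" and ab: "a \<in> closure S"
  proof (cases "a = 0")
    case False
    obtain x where "\<And>n. x n \<in> S" "x \<longlonglongrightarrow> a"
      using ab unfolding closure_sequential by blast
    then show ?thesis unfolding closure_sequential
      using cl tendsto_inverse_nonarch[of x a sequentially] False by (intro exI[of _ "\<lambda>n. inverse (x n)"]) auto
  qed (use ab in simp)
qed

lemma closure_approx:
  fixes S :: "'a::nonarch_field set"
  assumes "x \<in> closure S" "e > 0"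
  obtains y where "y \<in> S" "absval (y - x) < e"
  using assms closure_approachable[of x S] by (auto simp: dist_absval)

subsection \<open>Residue characteristic \<open>p\<close>\<close>

text \<open>\<open>absval p\<close> may be any number between 0 and 1, so that completions and the
  field of \<open>p\<close>-adic complex numbers are treated alike whatever their
  normalisation.\<close>

locale padic_field =
  fixes p :: nat and T :: "'a::{nonarch_field, complete_space} itself"
  assumes prime_p: "Factorial_Ring.prime p" and absval_p: "absval (of_nat p :: 'a) < 1"
begin

lemma p_gt_1: "p > 1"
  using prime_p prime_gt_1_nat by blast

lemma pv_pos: "absval (of_nat p :: 'a) > 0"
  using p_gt_1 by simp

text \<open>In a Bezout identity for \<open>n\<close> and \<open>p\<close> the multiple of
  \<open>p\<close> is smaller than 1, so the multiple of \<open>n\<close> is not.\<close>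

lemma absval_coprime:
  assumes "\<not> p dvd n"
  shows "absval (of_nat n :: 'a) = 1"
proof -
  have "Rings.coprime (int n) (int p)"
    using prime_imp_coprime[OF prime_p assms] by (simp add: coprime_commute)
  then obtain a b where ab: "a * int n + b * int p = 1"
    using bezout_int[of "int n" "int p"] by auto
  have "(of_int a * of_nat n + of_int b * of_nat p :: 'a) = of_int (a * int n + b * int p)" by simp
  then have 1: "(of_int a * of_nat n + of_int b * of_nat p :: 'a) = 1" unfolding ab by simp
  have "absval (of_int b * of_nat p :: 'a) < 1"
    by (rule absval_lt_1_mult[OF absval_of_int_le_1 absval_p])
  then have "\<not> absval (of_int a * of_nat n :: 'a) < 1"
    using absval_add_less[of "of_int a * of_nat n :: 'a" 1 "of_int b * of_nat p"] 1 by auto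
  then have "\<not> absval (of_nat n :: 'a) < 1"
    using absval_lt_1_mult[OF absval_of_int_le_1[of a], of "of_nat n :: 'a"] by blast
  then show ?thesis using absval_of_nat_le_1[of n, where 'a = 'a] by simp
qed

lemma absval_of_nat:
  assumes "n > 0"
  shows "absval (of_nat n :: 'a) = absval (of_nat p :: 'a) ^ multiplicity p n"
proof -
  obtain m where m: "n = p ^ multiplicity p n * m" "\<not> p dvd m"
    by (rule multiplicity_decompose'[of n p]) (use assms p_gt_1 in auto)
  then have "absval (of_nat n :: 'a) = absval (of_nat (p ^ multiplicity p n * m) :: 'a)" by simp
  also have "\<dots> = absval (of_nat p :: 'a) ^ multiplicity p n"
    using absval_coprime[OF m(2)] by (simp only: of_nat_mult of_nat_power absval_mult absval_power mult_1_right)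
  finally show ?thesis .
qed

lemma dvd_if_absval_le:
  assumes "absval (of_nat n :: 'a) \<le> absval (of_nat p :: 'a) ^ N"
  shows "p ^ N dvd n"
proof (cases "n = 0")
  case False
  then have "absval (of_nat p :: 'a) ^ multiplicity p n \<le> absval (of_nat p :: 'a) ^ N" using assms absval_of_nat by simp
  then have "N \<le> multiplicity p n"
    using power_strict_decreasing[of "multiplicity p n" N "absval (of_nat p :: 'a)"] pv_pos absval_p by (meson linorder_not_le)
  then show ?thesis by (rule multiplicity_dvd')
qed simp

lemma absval_of_int_pos: "absval (of_int n :: 'a) = absval (of_nat (nat \<bar>n\<bar>) :: 'a)"
proof (cases "n \<ge> 0")
  case False
  then have "(of_int n :: 'a) = - of_nat (nat \<bar>n\<bar>)" by simp
  then show ?thesis by (metis absval_minus)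
qed simp

lemma absval_of_int_nonzero:
  "z \<noteq> 0 \<Longrightarrow> absval (of_int z :: 'a) = absval (of_nat p :: 'a) ^ multiplicity p (nat \<bar>z\<bar>)"
  unfolding absval_of_int_pos by (rule absval_of_nat) simp

lemma absval_of_rat:
  assumes "q \<noteq> 0"
  shows "\<exists>s. absval (of_rat q :: 'a) = absval (of_nat p :: 'a) powi s"
proof -
  obtain a b where q: "q = Rat.Fract a b" "b > 0" by (cases q) auto
  then have "a \<noteq> 0" using assms by (auto simp: rat_number_collapse)
  have "absval (of_rat q :: 'a) = absval (of_int a :: 'a) / absval (of_int b :: 'a)"
    using q by (simp add: of_rat_rat absval_divide)
  also have "\<dots> = absval (of_nat p :: 'a) ^ multiplicity p (nat \<bar>a\<bar>) / absval (of_nat p :: 'a) ^ multiplicity p (nat \<bar>b\<bar>)"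
    using absval_of_int_nonzero[of a] absval_of_int_nonzero[of b] \<open>a \<noteq> 0\<close> q(2) by simp
  also have "\<dots> = absval (of_nat p :: 'a) powi (int (multiplicity p (nat \<bar>a\<bar>)) - int (multiplicity p (nat \<bar>b\<bar>)))"
    using pv_pos by (simp add: power_int_diff)
  finally show ?thesis by blast
qed

lemma absval_closure_Rats:
  assumes "x \<in> closure (\<rat> :: 'a set)" "x \<noteq> 0"
  shows "\<exists>s. absval x = absval (of_nat p :: 'a) powi s"
proof -
  obtain y where y: "y \<in> \<rat>" "absval (y - x) < absval x"
    using closure_approx[OF assms(1), of "absval x"] assms(2) by auto
  then have "absval y = absval x" by (intro absval_eq_if_close)
  moreover from y(1) obtain q where "y = of_rat q" by (rule Rats_cases)
  moreover have "q \<noteq> 0" using calculation assms(2) by auto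
  ultimately show ?thesis using absval_of_rat by metis
qed

lemma p_power_tendsto: "(\<lambda>n. (of_nat p :: 'a) ^ n) \<longlonglongrightarrow> 0"
proof -
  have "(\<lambda>n. absval (of_nat p :: 'a) ^ n) \<longlonglongrightarrow> 0" using pv_pos absval_p by (intro LIMSEQ_power_zero) simp
  then show ?thesis unfolding tendsto_absval_iff by (simp add: absval_power)
qed

lemma pv_power_small:
  assumes "e > 0"
  obtains N where "absval (of_nat p :: 'a) ^ N < e"
  using real_arch_pow_inv[OF assms absval_p] by blast

lemma closure_Ints_nat_approx:
  assumes "x \<in> closure (\<int> :: 'a set)" "e > 0"
  obtains n :: nat where "absval (of_nat n - x) < e"
proof -
  obtain y where y: "y \<in> \<int>" "absval (y - x) < e" using closure_approx[OF assms] .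
  obtain z where z: "y = of_int z" using y(1) by (auto elim: Ints_cases)
  obtain N where N: "absval (of_nat p :: 'a) ^ N < e" using pv_power_small[OF assms(2)] .
  \<comment> \<open>A multiple of \<open>p ^ N\<close> is close to zero; adding this one makes the
    integer nonnegative without leaving the ball.\<close>
  define n where "n = nat (z + \<bar>z\<bar> * int p ^ N)"
  have "int p ^ N \<ge> 1" using p_gt_1 by simp
  then have "\<bar>z\<bar> * int p ^ N \<ge> \<bar>z\<bar>" by (simp add: mult_le_cancel_left1)
  then have "z + \<bar>z\<bar> * int p ^ N \<ge> 0" by linarith
  then have "int n = z + \<bar>z\<bar> * int p ^ N" by (simp add: n_def)
  then have "(of_int (int n) :: 'a) = of_int (z + \<bar>z\<bar> * int p ^ N)" by simp
  then have n: "(of_nat n :: 'a) = y + of_int \<bar>z\<bar> * of_nat p ^ N" by (simp add: z)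
  have "absval (of_int \<bar>z\<bar> * of_nat p ^ N :: 'a) \<le> 1 * absval (of_nat p :: 'a) ^ N"
    unfolding absval_mult absval_power by (intro mult_right_mono absval_of_int_le_1) simp
  then have "absval ((y - x) + of_int \<bar>z\<bar> * of_nat p ^ N) < e"
    using N y(2) by (intro absval_add_less) auto
  then show ?thesis using that[of n] n by (simp add: algebra_simps)
qed

lemma closure_Ints_nat_seq:
  assumes "x \<in> closure (\<int> :: 'a set)"
  obtains s :: "nat \<Rightarrow> nat" where "(\<lambda>n. of_nat (s n)) \<longlonglongrightarrow> x"
proof -
  have "\<exists>m::nat. absval (of_nat m - x) < inverse (real (Suc n))" for n
    using closure_Ints_nat_approx[OF assms, of "inverse (real (Suc n))"] by auto
  then obtain s :: "nat \<Rightarrow> nat" where s: "\<And>n. absval (of_nat (s n) - x) < inverse (real (Suc n))" by metis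
  have "(\<lambda>n. absval (of_nat (s n) - x)) \<longlonglongrightarrow> 0"
    by (rule Lim_null_comparison[OF _ LIMSEQ_inverse_real_of_nat]) (use s in \<open>auto intro!: always_eventually less_imp_le\<close>)
  then show ?thesis using that tendsto_absval_iff by blast
qed

lemma of_nat_limit_in_closure_Ints:
  assumes "(\<lambda>n. of_nat (s n)) \<longlonglongrightarrow> (x::'a)"
  shows "x \<in> closure \<int>"
  unfolding closure_sequential using assms by (intro exI[of _ "\<lambda>n. of_nat (s n)"]) auto

text \<open>An approximating fraction in lowest terms has a denominator prime to \<open>p\<close>. A
  Bezout identity inverts the denominator modulo a high power of \<open>p\<close> and thereby gives
  an integer approximation.\<close>

lemma closure_Ints_if_absval_le:
  assumes "x \<in> closure (\<rat> :: 'a set)" "absval x \<le> 1"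
  shows "x \<in> closure \<int>"
  unfolding closure_approachable
proof (intro allI impI)
  fix e :: real assume "e > 0"
  obtain y where y: "y \<in> \<rat>" "absval (y - x) < min e 1"
    using closure_approx[OF assms(1), of "min e 1"] \<open>e > 0\<close> by auto
  obtain q where q: "y = of_rat q" using y(1) by (rule Rats_cases)
  obtain a b where ab: "q = Rat.Fract a b" "b > 0" "Rings.coprime a b" by (cases q) auto
  have y_ab: "y = of_int a / of_int b" using q ab by (simp add: of_rat_rat)
  have "absval (x + (y - x)) \<le> 1" using y(2) assms(2) by (intro absval_add_le) auto
  then have "absval y \<le> 1" by simp
  have b1: "\<not> int p dvd b"
  proof
    assume b: "int p dvd b"
    then have "\<not> int p dvd a" using ab(3) p_gt_1 by (metis coprime_common_divisor_int int_ops(2) nat_int_comparison(2) not_coprimeI of_nat_eq_1_iff zdvd1_eq abs_of_nat less_irrefl)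
    then have "\<not> p dvd nat \<bar>a\<bar>" by (simp add: int_dvd_int_iff[of p, symmetric])
    then have "absval (of_int a :: 'a) = 1" unfolding absval_of_int_pos by (rule absval_coprime)
    moreover have "absval (of_int b :: 'a) < 1"
    proof -
      obtain b' where "b = int p * b'" using b by (auto elim: dvdE)
      then have "(of_int b :: 'a) = of_int b' * of_nat p" by simp
      then show ?thesis using absval_lt_1_mult[OF absval_of_int_le_1 absval_p, of b'] by simp
    qed
    moreover have "absval (of_int b :: 'a) > 0" using ab(2) by simp
    ultimately have "absval y > 1" by (simp add: y_ab absval_divide)
    then show False using \<open>absval y \<le> 1\<close> by simp
  qed
  obtain N where N: "absval (of_nat p :: 'a) ^ N < e" using pv_power_small[OF \<open>e > 0\<close>] .
  have "Rings.coprime b (int p ^ N)"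
    using prime_imp_coprime[of "int p" b] b1 prime_p by (simp add: coprime_commute)
  then obtain u v where uv: "u * b + v * int p ^ N = 1" using bezout_int[of b "int p ^ N"] by auto
  have "\<not> p dvd nat \<bar>b\<bar>" using b1 by (simp add: int_dvd_int_iff[of p, symmetric])
  then have bv: "absval (of_int b :: 'a) = 1" unfolding absval_of_int_pos by (rule absval_coprime)
  have "(of_int (u * b + v * int p ^ N) :: 'a) = 1" unfolding uv by simp
  then have "of_int u * of_int b = (1 - of_int v * of_nat p ^ N :: 'a)" by (simp add: algebra_simps)
  then have "of_int a * (of_int u * of_int b) = of_int a * (1 - of_int v * of_nat p ^ N :: 'a)"
    by (simp only:)
  then have "(of_int (a * u) - y) * of_int b = - (of_int a * of_int v * of_nat p ^ N)"
    using ab(2) by (simp add: y_ab left_diff_distrib right_diff_distrib mult.assoc)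
  then have "of_int (a * u) - y = - (of_int a * of_int v * of_nat p ^ N) / of_int b"
    using ab(2) by (metis nonzero_mult_div_cancel_right of_int_eq_0_iff less_irrefl)
  then have "absval (of_int (a * u) - y) = absval (of_int (a * v) :: 'a) * absval (of_nat p :: 'a) ^ N"
    by (simp add: absval_divide absval_mult absval_power bv)
  also have "\<dots> \<le> 1 * absval (of_nat p :: 'a) ^ N" by (intro mult_right_mono absval_of_int_le_1) simp
  finally have "absval ((of_int (a * u) - y) + (y - x)) < e" using N y(2) by (intro absval_add_less) auto
  then show "\<exists>y\<in>\<int>. dist y x < e" by (intro bexI[of _ "of_int (a * u)"]) (simp_all add: dist_absval)
qed

subsection \<open>Powers of principal units\<close>

lemma principal_absval: "absval (x - 1) < 1 \<Longrightarrow> absval (x::'a) = 1"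
  using absval_eq_if_close[of x 1] by simp

lemma principal_mult: "absval (x - 1) < 1 \<Longrightarrow> absval (y - 1) < 1 \<Longrightarrow> absval (x * y - 1 :: 'a) < 1"
proof -
  assume xy: "absval (x - 1) < 1" "absval (y - 1) < 1"
  have "absval (x * (y - 1) + (x - 1)) < 1"
    using absval_lt_1_mult[of x "y - 1"] principal_absval[OF xy(1)] xy by (intro absval_add_less) auto
  then show ?thesis by (simp add: algebra_simps)
qed

lemma principal_inverse: "absval (x - 1) < 1 \<Longrightarrow> absval (inverse x - 1 :: 'a) < 1"
proof -
  assume x: "absval (x - 1) < 1"
  then have "x \<noteq> 0" by auto
  then have "inverse x - 1 = (1 - x) / x" by (simp add: field_simps)
  then show ?thesis using x principal_absval[OF x] by (simp add: absval_divide absval_minus_commute)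
qed

lemma principal_power: "absval (x - 1) < 1 \<Longrightarrow> absval (x ^ n - 1 :: 'a) < 1"
  by (induction n) (auto intro: principal_mult)

lemma absval_power_diff_one:
  assumes "absval x \<le> (1::real)"
  shows "absval (x ^ n - 1 :: 'a) \<le> absval (x - 1)"
proof (induction n)
  case (Suc n)
  have "absval (x * (x ^ n - 1)) \<le> 1 * absval (x - 1)"
    unfolding absval_mult using assms Suc by (intro mult_mono) auto
  then have "absval (x * (x ^ n - 1) + (x - 1)) \<le> absval (x - 1)" by (intro absval_add_le) auto
  then show ?case by (simp add: algebra_simps)
qed simp

text \<open>A bound for the factor by which the \<open>p\<close>-th power shrinks the distance of a
  principal unit to 1. It is below 1 and does not increase when the unit is replaced by a power of
  itself.\<close>

abbreviation contr :: "'a \<Rightarrow> real" where "contr x \<equiv> max (absval (x - 1)) (absval (of_nat p :: 'a))"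

lemma contr_bounds: "absval (x - 1) < 1 \<Longrightarrow> 0 < contr x \<and> contr x < 1"
  using pv_pos absval_p by (simp add: less_max_iff_disj)

text \<open>In the binomial expansion around 1 the inner coefficients are divisible by
  \<open>p\<close>, and the last power is at most the square of the distance to 1.\<close>

lemma absval_p_power_diff_one:
  assumes x: "absval (x - 1 :: 'a) < 1"
  shows "absval (x ^ p - 1) \<le> contr x * absval (x - 1)"
proof -
  define y where "y = x - 1"
  have y: "absval y < 1" using x by (simp add: y_def)
  have "x ^ p = (y + 1) ^ p" by (simp add: y_def)
  also have "\<dots> = (\<Sum>k\<le>p. of_nat (p choose k) * y ^ k)" by (simp add: binomial_ring)
  also have "\<dots> = 1 + (\<Sum>k\<in>{1..p}. of_nat (p choose k) * y ^ k)"
    by (subst sum.atMost_shift) (simp add: sum.atLeast1_atMost_eq lessThan_Suc_atMost)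
  finally have "x ^ p - 1 = (\<Sum>k\<in>{1..p}. of_nat (p choose k) * y ^ k)" by simp
  also have "absval \<dots> \<le> contr x * absval (x - 1)"
  proof (rule absval_sum_le)
    show "0 \<le> contr x * absval (x - 1)" by (rule mult_nonneg_nonneg[OF max.coboundedI1 absval_nonneg]) (rule absval_nonneg)
    fix k assume k: "k \<in> {1..p}"
    show "absval (of_nat (p choose k) * y ^ k) \<le> contr x * absval (x - 1)"
    proof (cases "k = p")
      case True
      have "absval y ^ p \<le> absval y ^ 2" using p_gt_1 y by (intro power_decreasing) auto
      also have "\<dots> \<le> contr x * absval (x - 1)"
        unfolding power2_eq_square by (intro mult_mono) (simp_all add: y_def le_max_iff_disj)
      finally show ?thesis using True by (simp add: absval_power)
    next
      case False
      then have "p dvd p choose k" using k prime_p by (intro dvd_choose_prime) auto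
      then obtain m where "p choose k = p * m" by (auto elim: dvdE)
      then have "absval (of_nat (p choose k) :: 'a) \<le> absval (of_nat p :: 'a) * 1"
        by (simp only: of_nat_mult absval_mult) (intro mult_left_mono absval_of_nat_le_1, simp)
      moreover have "absval y ^ k \<le> absval y ^ 1" using k y by (intro power_decreasing) auto
      ultimately have "absval (of_nat (p choose k) :: 'a) * absval y ^ k \<le> contr x * absval y"
        by (intro mult_mono) (simp_all add: le_max_iff_disj)
      then show ?thesis by (simp add: absval_mult absval_power y_def)
    qed
  qed
  finally show ?thesis .
qed

lemma absval_p_power_iter:
  assumes x: "absval (x - 1 :: 'a) < 1"
  shows "absval (x ^ (p ^ N) - 1) \<le> contr x ^ N * absval (x - 1)"
proof (induction N)
  case (Suc N)
  let ?z = "x ^ (p ^ N)"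
  have z: "absval (?z - 1) \<le> absval (x - 1)"
    using absval_power_diff_one[of x] principal_absval[OF x] by simp
  have "absval (?z ^ p - 1) \<le> contr ?z * absval (?z - 1)"
    using z x by (intro absval_p_power_diff_one) auto
  also have "\<dots> \<le> contr x * (contr x ^ N * absval (x - 1))"
    using Suc z contr_bounds[OF x] by (intro mult_mono) auto
  finally show ?case by (simp add: power_mult[symmetric] mult.commute mult.left_commute)
qed simp

lemma absval_power_dvd:
  assumes x: "absval (x - 1 :: 'a) < 1" and "p ^ N dvd m"
  shows "absval (x ^ m - 1) \<le> contr x ^ N"
proof -
  obtain k where k: "m = p ^ N * k" using assms(2) by (auto elim: dvdE)
  have "absval (x ^ m - 1) \<le> absval (x ^ (p ^ N) - 1)"
    unfolding k power_mult
    by (rule absval_power_diff_one) (use principal_absval[OF principal_power[OF x]] in simp)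
  also have "\<dots> \<le> contr x ^ N * absval (x - 1)" by (rule absval_p_power_iter[OF x])
  also have "\<dots> \<le> contr x ^ N * 1" using x contr_bounds[OF x] by (intro mult_left_mono) auto
  finally show ?thesis by simp
qed

lemma absval_power_cong:
  assumes x: "absval (x - 1 :: 'a) < 1" and "absval (of_nat s - of_nat t :: 'a) \<le> absval (of_nat p :: 'a) ^ N"
  shows "absval (x ^ s - x ^ t) \<le> contr x ^ N"
proof -
  have *: "absval (x ^ s - x ^ t) \<le> contr x ^ N" if "absval (of_nat s - of_nat t :: 'a) \<le> absval (of_nat p :: 'a) ^ N" "t \<le> s" for s t
  proof -
    have "absval (of_nat (s - t) :: 'a) \<le> absval (of_nat p :: 'a) ^ N" using that by (simp add: of_nat_diff)
    then have "p ^ N dvd s - t" by (rule dvd_if_absval_le)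
    then have "absval (x ^ (s - t) - 1) \<le> contr x ^ N" by (rule absval_power_dvd[OF x])
    moreover have "x ^ s - x ^ t = x ^ t * (x ^ (s - t) - 1)"
      using that(2) by (simp add: algebra_simps power_add[symmetric])
    ultimately show ?thesis
      using principal_absval[OF principal_power[OF x, of t]] by (simp add: absval_mult)
  qed
  show ?thesis
  proof (cases "t \<le> s")
    case False
    then have "absval (x ^ t - x ^ s) \<le> contr x ^ N"
      using assms(2) by (intro *) (simp_all add: absval_minus_commute)
    then show ?thesis by (simp add: absval_minus_commute)
  qed (use * assms(2) in blast)
qed

text \<open>With the exponents compared \<open>p\<close>-adically, exponentiation is uniformly
  continuous on the natural numbers and therefore extends to their closure.\<close>

lemma power_uniform:
  assumes x: "absval (x - 1 :: 'a) < 1" and "e > 0"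
  obtains d where "d > 0" "\<And>s t. absval (of_nat s - of_nat t :: 'a) < d \<Longrightarrow> absval (x ^ s - x ^ t) < e"
proof -
  obtain N where N: "contr x ^ N < e"
    using real_arch_pow_inv[OF assms(2)] contr_bounds[OF x] by blast
  show ?thesis
  proof (rule that[of "absval (of_nat p :: 'a) ^ N"])
    show "absval (of_nat p :: 'a) ^ N > 0" using pv_pos by simp
    show "absval (x ^ s - x ^ t) < e" if "absval (of_nat s - of_nat t :: 'a) < absval (of_nat p :: 'a) ^ N" for s t
      using absval_power_cong[OF x less_imp_le[OF that]] N by (rule order_le_less_trans)
  qed
qed

lemma Cauchy_absval: "Cauchy (s :: nat \<Rightarrow> 'a) \<longleftrightarrow> (\<forall>e>0. \<exists>M. \<forall>m\<ge>M. \<forall>n\<ge>M. absval (s m - s n) < e)"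
  by (simp add: Cauchy_def dist_absval)

text \<open>Uniform continuity makes the powers a Cauchy sequence with a limit independent of the
  sequence of exponents, so the definite description in \<open>padic_power\<close> denotes this
  limit.\<close>

lemma padic_power_limit:
  assumes x: "absval (x - 1 :: 'a) < 1" and s: "(\<lambda>n. of_nat (s n)) \<longlonglongrightarrow> a"
  shows "(\<lambda>n. x ^ s n) \<longlonglongrightarrow> padic_power x a"
proof -
  have "Cauchy (\<lambda>n. x ^ s n)"
    unfolding Cauchy_absval
  proof (intro allI impI)
    fix e :: real assume "e > 0"
    obtain d where d: "d > 0" "\<And>s t. absval (of_nat s - of_nat t :: 'a) < d \<Longrightarrow> absval (x ^ s - x ^ t) < e"
      using power_uniform[OF x \<open>e > 0\<close>] by blast
    have "Cauchy (\<lambda>n. of_nat (s n) :: 'a)" using s by (rule LIMSEQ_imp_Cauchy)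
    then obtain M where "\<And>m n. m \<ge> M \<Longrightarrow> n \<ge> M \<Longrightarrow> absval (of_nat (s m) - of_nat (s n) :: 'a) < d"
      using d(1) unfolding Cauchy_absval by blast
    then show "\<exists>M. \<forall>m\<ge>M. \<forall>n\<ge>M. absval (x ^ s m - x ^ s n) < e" using d(2) by blast
  qed
  then obtain y where y: "(\<lambda>n. x ^ s n) \<longlonglongrightarrow> y"
    using Cauchy_convergent convergent_def by blast
  have *: "(\<lambda>n. x ^ t n) \<longlonglongrightarrow> y" if t: "(\<lambda>n. of_nat (t n)) \<longlonglongrightarrow> a" for t :: "nat \<Rightarrow> nat"
  proof -
    have "(\<lambda>n. x ^ t n - x ^ s n) \<longlonglongrightarrow> 0"
    proof (rule metric_LIMSEQ_I)
      fix e :: real assume "e > 0"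
      obtain d where d: "d > 0" "\<And>s t. absval (of_nat s - of_nat t :: 'a) < d \<Longrightarrow> absval (x ^ s - x ^ t) < e"
        using power_uniform[OF x \<open>e > 0\<close>] by blast
      have "(\<lambda>n. of_nat (t n) - of_nat (s n) :: 'a) \<longlonglongrightarrow> 0" using tendsto_diff[OF t s] by simp
      then obtain M where "\<And>n. n \<ge> M \<Longrightarrow> absval (of_nat (t n) - of_nat (s n) :: 'a) < d"
        using metric_LIMSEQ_D[OF _ d(1)] by (force simp: dist_absval)
      then show "\<exists>M. \<forall>n\<ge>M. dist (x ^ t n - x ^ s n) 0 < e" using d(2) by (auto simp: dist_absval)
    qed
    from tendsto_add[OF this y] show ?thesis by simp
  qed
  have "padic_power x a = y"
    unfolding padic_power_def
  proof (rule the_equality)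
    fix y' assume "\<forall>s::nat \<Rightarrow> nat. (\<lambda>n. of_nat (s n)) \<longlonglongrightarrow> a \<longrightarrow> (\<lambda>n. x ^ s n) \<longlonglongrightarrow> y'"
    then have "(\<lambda>n. x ^ s n) \<longlonglongrightarrow> y'" using s by blast
    then show "y' = y" using y LIMSEQ_unique by blast
  qed (use * in blast)
  then show ?thesis using y by simp
qed

lemma padic_power_of_nat: "absval (x - 1 :: 'a) < 1 \<Longrightarrow> padic_power x (of_nat n) = x ^ n"
  using padic_power_limit[of x "\<lambda>_. n" "of_nat n"] LIMSEQ_unique tendsto_const by blast

lemma principal_limit:
  assumes "\<And>n. absval (s n - 1 :: 'a) < 1" "s \<longlonglongrightarrow> y"
  shows "absval (y - 1) < 1"
proof -
  obtain n where "absval (s n - y) < 1"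
    using metric_LIMSEQ_D[OF assms(2), of 1] by (auto simp: dist_absval)
  then have "absval ((s n - 1) - (s n - y)) < 1" by (rule absval_diff_less[OF assms(1)])
  then show ?thesis by simp
qed

lemma padic_power_principal:
  assumes "absval (x - 1 :: 'a) < 1" "a \<in> closure \<int>"
  shows "absval (padic_power x a - 1) < 1"
proof -
  obtain s :: "nat \<Rightarrow> nat" where s: "(\<lambda>n. of_nat (s n)) \<longlonglongrightarrow> a" using closure_Ints_nat_seq[OF assms(2)] .
  show ?thesis
    by (rule principal_limit[OF principal_power[OF assms(1)] padic_power_limit[OF assms(1) s]])
qed

lemma padic_power_add:
  assumes "absval (x - 1 :: 'a) < 1" "a \<in> closure \<int>" "b \<in> closure \<int>"
  shows "padic_power x (a + b) = padic_power x a * padic_power x b"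
proof -
  obtain s :: "nat \<Rightarrow> nat" where s: "(\<lambda>n. of_nat (s n)) \<longlonglongrightarrow> a" using closure_Ints_nat_seq[OF assms(2)] .
  obtain t :: "nat \<Rightarrow> nat" where t: "(\<lambda>n. of_nat (t n)) \<longlonglongrightarrow> b" using closure_Ints_nat_seq[OF assms(3)] .
  have "(\<lambda>n. of_nat (s n + t n)) \<longlonglongrightarrow> a + b" using tendsto_add[OF s t] by simp
  then have "(\<lambda>n. x ^ (s n + t n)) \<longlonglongrightarrow> padic_power x (a + b)" by (rule padic_power_limit[OF assms(1)])
  moreover have "(\<lambda>n. x ^ s n * x ^ t n) \<longlonglongrightarrow> padic_power x a * padic_power x b"
    by (intro tendsto_mult padic_power_limit assms s t)
  ultimately show ?thesis unfolding power_add by (rule LIMSEQ_unique)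
qed

lemma padic_power_mult_base:
  assumes "absval (x - 1 :: 'a) < 1" "absval (y - 1 :: 'a) < 1" "a \<in> closure \<int>"
  shows "padic_power (x * y) a = padic_power x a * padic_power y a"
proof -
  obtain s :: "nat \<Rightarrow> nat" where s: "(\<lambda>n. of_nat (s n)) \<longlonglongrightarrow> a" using closure_Ints_nat_seq[OF assms(3)] .
  have "(\<lambda>n. (x * y) ^ s n) \<longlonglongrightarrow> padic_power (x * y) a"
    by (intro padic_power_limit principal_mult assms s)
  moreover have "(\<lambda>n. x ^ s n * y ^ s n) \<longlonglongrightarrow> padic_power x a * padic_power y a"
    by (intro tendsto_mult padic_power_limit assms s)
  ultimately show ?thesis unfolding power_mult_distrib by (rule LIMSEQ_unique)
qed

lemma padic_power_of_nat_power:
  assumes "absval (x - 1 :: 'a) < 1" "a \<in> closure \<int>"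
  shows "padic_power x a ^ n = padic_power x (a * of_nat n)"
proof -
  obtain s :: "nat \<Rightarrow> nat" where s: "(\<lambda>n. of_nat (s n)) \<longlonglongrightarrow> a" using closure_Ints_nat_seq[OF assms(2)] .
  have "(\<lambda>k. of_nat (s k * n)) \<longlonglongrightarrow> a * of_nat n" using tendsto_mult[OF s tendsto_const[of "of_nat n"]] by simp
  then have "(\<lambda>k. x ^ (s k * n)) \<longlonglongrightarrow> padic_power x (a * of_nat n)" by (rule padic_power_limit[OF assms(1)])
  moreover have "(\<lambda>k. (x ^ s k) ^ n) \<longlonglongrightarrow> padic_power x a ^ n"
    by (intro tendsto_power_strong tendsto_const padic_power_limit assms s)
  ultimately show ?thesis unfolding power_mult using LIMSEQ_unique by blast
qed

text \<open>Base and exponent vary together. The difference of two \<open>t\<close>-th powers of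
  units is bounded by the difference of the bases, uniformly in \<open>t\<close>, and this separates
  the two limits.\<close>

lemma padic_power_power:
  assumes "absval (x - 1 :: 'a) < 1" "a \<in> closure \<int>" "b \<in> closure \<int>"
  shows "padic_power x (a * b) = padic_power (padic_power x a) b"
proof -
  obtain s :: "nat \<Rightarrow> nat" where s: "(\<lambda>n. of_nat (s n)) \<longlonglongrightarrow> a" using closure_Ints_nat_seq[OF assms(2)] .
  obtain t :: "nat \<Rightarrow> nat" where t: "(\<lambda>n. of_nat (t n)) \<longlonglongrightarrow> b" using closure_Ints_nat_seq[OF assms(3)] .
  have "(\<lambda>n. of_nat (s n * t n)) \<longlonglongrightarrow> a * b" using tendsto_mult[OF s t] by simp
  then have 1: "(\<lambda>n. x ^ (s n * t n)) \<longlonglongrightarrow> padic_power x (a * b)" by (rule padic_power_limit[OF assms(1)])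
  define y where "y = padic_power x a"
  have y: "absval (y - 1) < 1" unfolding y_def by (rule padic_power_principal[OF assms(1,2)])
  have 2: "(\<lambda>n. y ^ t n) \<longlonglongrightarrow> padic_power y b" by (rule padic_power_limit[OF y t])
  have sy: "(\<lambda>n. x ^ s n) \<longlonglongrightarrow> y" unfolding y_def by (rule padic_power_limit[OF assms(1) s])
  have "(\<lambda>n. (x ^ s n) ^ t n - y ^ t n) \<longlonglongrightarrow> 0"
    unfolding tendsto_absval_iff
  proof (rule Lim_null_comparison)
    have "absval ((x ^ s n) ^ t n - y ^ t n) \<le> absval (x ^ s n - y)" for n
    proof -
      have "y \<noteq> 0" using y by auto
      have v: "absval (x ^ s n) = 1" "absval y = 1"
        using principal_absval principal_power assms(1) y by blast+
      have "absval ((x ^ s n / y) ^ t n - 1) \<le> absval (x ^ s n / y - 1)"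
        by (rule absval_power_diff_one) (simp add: absval_divide v)
      then have "absval (y ^ t n * ((x ^ s n / y) ^ t n - 1)) \<le> absval (y * (x ^ s n / y - 1))"
        by (simp add: absval_mult absval_power v)
      then show ?thesis using \<open>y \<noteq> 0\<close> by (simp add: right_diff_distrib power_divide)
    qed
    then show "\<forall>\<^sub>F n in sequentially. norm (absval ((x ^ s n) ^ t n - y ^ t n - 0)) \<le> absval (x ^ s n - y)"
      by simp
    show "(\<lambda>n. absval (x ^ s n - y)) \<longlonglongrightarrow> 0" using sy unfolding tendsto_absval_iff[of _ y] .
  qed
  from tendsto_add[OF this 2] have "(\<lambda>n. (x ^ s n) ^ t n) \<longlonglongrightarrow> padic_power y b" by simp
  then have "(\<lambda>n. x ^ (s n * t n)) \<longlonglongrightarrow> padic_power y b" unfolding power_mult .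
  from LIMSEQ_unique[OF 1 this] show ?thesis unfolding y_def .
qed

end

subsection \<open>The logarithm series\<close>

lemma poly_times_geometric_tendsto_0:
  fixes t :: real
  assumes "0 \<le> t" "t < 1"
  shows "(\<lambda>k. real k ^ C * t ^ k) \<longlonglongrightarrow> 0"
proof -
  \<comment> \<open>The root distributes the geometric decay: \<open>(k * s ^ k) ^ Suc C\<close>
    equals \<open>k ^ Suc C * t ^ k\<close>, and its base tends to zero.\<close>
  define s where "s = root (Suc C) t"
  have s: "0 \<le> s" "s < 1" using assms by (simp_all add: s_def)
  have s_pow: "s ^ Suc C = t" unfolding s_def by (rule real_root_pow_pos2) (use assms in auto)
  have "(\<lambda>k. real k * s ^ k) \<longlonglongrightarrow> 0" using powser_times_n_limit_0[of s] s by simp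
  then have "(\<lambda>k. (real k * s ^ k) ^ Suc C) \<longlonglongrightarrow> 0 ^ Suc C" by (rule tendsto_power)
  moreover have "(real k * s ^ k) ^ Suc C = real k ^ Suc C * t ^ k" for k
    unfolding s_pow[symmetric] power_mult_distrib power_mult[symmetric] by (simp only: mult.commute)
  moreover have "0 ^ Suc C = (0 :: real)" by simp
  ultimately have lim: "(\<lambda>k. real k ^ Suc C * t ^ k) \<longlonglongrightarrow> 0" by (simp only:)
  show ?thesis
  proof (rule Lim_null_comparison[OF _ lim])
    have "real k ^ C \<le> real k ^ Suc C" if "k \<ge> 1" for k using that by (intro power_increasing) auto
    then show "\<forall>\<^sub>F k in sequentially. norm (real k ^ C * t ^ k) \<le> real k ^ Suc C * t ^ k"
      using assms(1) by (intro eventually_sequentiallyI[of 1]) (simp add: mult_right_mono)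
  qed
qed

context padic_field
begin

text \<open>The power of \<open>p\<close> that divides \<open>k\<close> is at most \<open>k\<close>,
  so the denominators of the logarithm series grow only polynomially and geometric decay outweighs
  them.\<close>

lemma inverse_absval_of_nat_le:
  "\<exists>C. \<forall>k>0. inverse (absval (of_nat k :: 'a)) \<le> real k ^ C"
proof -
  obtain C where C: "inverse (absval (of_nat p :: 'a)) < 2 ^ C"
    using real_arch_pow[of 2] by auto
  show ?thesis
  proof (intro exI[of _ C] allI impI)
    fix k :: nat assume k: "k > 0"
    define v where "v = multiplicity p k"
    have "2 ^ v \<le> p ^ v" using p_gt_1 by (intro power_mono) auto
    also have "\<dots> \<le> k" unfolding v_def using k by (intro dvd_imp_le multiplicity_dvd)
    finally have vk: "2 ^ v \<le> k" .
    have "inverse (absval (of_nat k :: 'a)) = inverse (absval (of_nat p :: 'a)) ^ v"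
      using absval_of_nat[OF k] by (simp add: v_def power_inverse)
    also have "\<dots> \<le> (2 ^ C) ^ v" using C by (intro power_mono) auto
    also have "\<dots> = (2 ^ v) ^ C" by (simp add: power_mult[symmetric] mult.commute)
    also have "\<dots> \<le> real k ^ C"
    proof (rule power_mono)
      show "2 ^ v \<le> real k" using vk by (metis of_nat_le_iff of_nat_numeral of_nat_power)
    qed simp
    finally show "inverse (absval (of_nat k :: 'a)) \<le> real k ^ C" .
  qed
qed

lemma log_terms_tendsto_0:
  assumes "absval (y :: 'a) < 1"
  shows "(\<lambda>n. absval (y ^ Suc n / of_nat (Suc n))) \<longlonglongrightarrow> 0"
proof -
  obtain C where C: "\<And>k. k > 0 \<Longrightarrow> inverse (absval (of_nat k :: 'a)) \<le> real k ^ C"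
    using inverse_absval_of_nat_le by blast
  have lim: "(\<lambda>n. real (Suc n) ^ C * absval y ^ Suc n) \<longlonglongrightarrow> 0"
    using LIMSEQ_Suc[OF poly_times_geometric_tendsto_0[of "absval y" C]] assms by simp
  show ?thesis
  proof (rule Lim_null_comparison[OF _ lim])
    have "absval (y ^ Suc n / of_nat (Suc n)) \<le> real (Suc n) ^ C * absval y ^ Suc n" for n
    proof -
      have "absval (y ^ Suc n / of_nat (Suc n)) = inverse (absval (of_nat (Suc n) :: 'a)) * absval y ^ Suc n"
        unfolding absval_divide absval_power by (simp add: divide_inverse mult.commute)
      also have "\<dots> \<le> real (Suc n) ^ C * absval y ^ Suc n"
        by (intro mult_right_mono C) auto
      finally show ?thesis .
    qed
    then show "\<forall>\<^sub>F n in sequentially. norm (absval (y ^ Suc n / of_nat (Suc n))) \<le> real (Suc n) ^ C * absval y ^ Suc n"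
      by simp
  qed
qed

definition lg :: "'a \<Rightarrow> 'a" where
  "lg x = suminf (\<lambda>n. (-1) ^ n * (x - 1) ^ Suc n / of_nat (Suc n))"

lemma summable_nonarch:
  fixes f :: "nat \<Rightarrow> 'a"
  assumes "(\<lambda>n. absval (f n)) \<longlonglongrightarrow> 0"
  shows "summable f"
proof -
  have "Cauchy (\<lambda>n. \<Sum>i<n. f i)" by (rule Cauchy_nonarch) (use assms in simp)
  then obtain l where "(\<lambda>n. \<Sum>i<n. f i) \<longlonglongrightarrow> l" using Cauchy_convergent convergent_def by blast
  then show ?thesis unfolding summable_def sums_def by blast
qed

lemma absval_sign: "absval ((-1) ^ n * z :: 'a) = absval z"
  by (simp add: absval_mult absval_power)

lemma lg_sums:
  assumes "absval (x - 1) < 1"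
  shows "(\<lambda>n. (-1) ^ n * (x - 1) ^ Suc n / of_nat (Suc n)) sums lg x"
  unfolding lg_def
proof (rule summable_sums, rule summable_nonarch)
  have "absval ((-1) ^ n * (x - 1) ^ Suc n / of_nat (Suc n)) = absval ((x - 1) ^ Suc n / of_nat (Suc n))" for n
    using absval_sign[of n "(x - 1) ^ Suc n / of_nat (Suc n)"] by simp
  then show "(\<lambda>n. absval ((-1) ^ n * (x - 1) ^ Suc n / of_nat (Suc n))) \<longlonglongrightarrow> 0"
    using log_terms_tendsto_0[OF assms] by simp
qed

text \<open>\<open>lg x\<close> is also the limit of \<open>(x ^ (p ^ n) - 1) / p ^ n\<close>, which makes its additivity evident: by
  the binomial theorem the \<open>k\<close>-th term of that quotient is \<open>(p ^ n - 1 choose k) (x - 1) ^ (k + 1) / (k + 1)\<close>,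
  and \<open>p ^ n - 1 choose k\<close> tends to \<open>-1 gchoose k = (-1) ^ k\<close>.\<close>

lemma binomial_quotient:
  assumes "q > 0"
  shows "((1 + y :: 'a) ^ q - 1) / of_nat q = (\<Sum>k<q. of_nat ((q - 1) choose k) * y ^ Suc k / of_nat (Suc k))"
proof -
  have "(1 + y) ^ q = (\<Sum>k\<le>q. of_nat (q choose k) * y ^ k)"
    using binomial_ring[of y 1 q] by (simp add: add.commute)
  also have "\<dots> = 1 + (\<Sum>k<q. of_nat (q choose Suc k) * y ^ Suc k)"
    by (subst sum.atMost_shift) simp
  finally have "((1 + y) ^ q - 1) / of_nat q = (\<Sum>k<q. of_nat (q choose Suc k) * y ^ Suc k / of_nat q)"
    by (simp add: sum_divide_distrib)
  also have "\<dots> = (\<Sum>k<q. of_nat ((q - 1) choose k) * y ^ Suc k / of_nat (Suc k))"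
  proof (rule sum.cong)
    fix k
    have "Suc k * (q choose Suc k) = q * ((q - 1) choose k)"
      by (rule binomial_absorption)
    then have "of_nat (Suc k) * of_nat (q choose Suc k) = (of_nat q * of_nat ((q - 1) choose k) :: 'a)"
      by (metis of_nat_mult)
    moreover have "of_nat (Suc k) \<noteq> (0 :: 'a)" "of_nat q \<noteq> (0 :: 'a)" using assms by (simp_all del: of_nat_Suc)
    ultimately show "of_nat (q choose Suc k) * y ^ Suc k / of_nat q = of_nat ((q - 1) choose k) * y ^ Suc k / of_nat (Suc k)"
      by (simp add: frac_eq_eq del: of_nat_Suc power_Suc) (simp add: mult_ac)
  qed simp
  finally show ?thesis .
qed

text \<open>A binomial coefficient is a polynomial in its upper argument and hence continuous in
  it.\<close>

lemma binomial_tendsto: "(\<lambda>n. of_nat ((p ^ n - 1) choose k) :: 'a) \<longlonglongrightarrow> (-1) ^ k"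
proof -
  have h: "(\<lambda>n. (of_nat p :: 'a) ^ n - 1) \<longlonglongrightarrow> 0 - 1" by (intro tendsto_diff p_power_tendsto tendsto_const)
  have "(\<lambda>n. (\<Prod>i = 0..<k. ((of_nat p :: 'a) ^ n - 1) - of_nat i) * inverse (fact k)) \<longlonglongrightarrow>
      (\<Prod>i = 0..<k. (0 - 1) - of_nat i) * inverse (fact k)"
    by (intro tendsto_mult tendsto_prod' tendsto_diff[OF h] tendsto_const)
  moreover have "(\<Prod>i = 0..<k. (of_nat p ^ n - 1) - of_nat i) * inverse (fact k) = (of_nat ((p ^ n - 1) choose k) :: 'a)" for n
  proof -
    have "(of_nat ((p ^ n - 1) choose k) :: 'a) = of_nat (p ^ n - 1) gchoose k" by (rule binomial_gbinomial)
    also have "(of_nat (p ^ n - 1) :: 'a) = of_nat p ^ n - 1" using p_gt_1 by (simp add: of_nat_diff Suc_le_eq)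
    finally show ?thesis by (simp add: gbinomial_prod_rev divide_inverse)
  qed
  moreover have "(\<Prod>i = 0..<k. (0 - 1) - of_nat i) * inverse (fact k) = (-1 :: 'a) gchoose k"
    by (simp add: gbinomial_prod_rev divide_inverse)
  moreover have "(-1 :: 'a) gchoose k = (-1) ^ k"
    using gbinomial_minus[of "1 :: 'a" k] binomial_gbinomial[of k k, where 'a = 'a] by simp
  ultimately show ?thesis by simp
qed

lemma lg_limit:
  assumes x: "absval (x - 1) < 1"
  shows "(\<lambda>n. (x ^ (p ^ n) - 1) / of_nat (p ^ n)) \<longlonglongrightarrow> lg x"
proof -
  define y where "y = x - 1"
  have y: "absval y < 1" using x by (simp add: y_def)
  define t where "t k = y ^ Suc k / of_nat (Suc k)" for k
  have t0: "(\<lambda>k. absval (t k)) \<longlonglongrightarrow> 0" unfolding t_def by (rule log_terms_tendsto_0[OF y])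
  have q0: "p ^ n > 0" for n using p_gt_1 by simp
  have E: "(x ^ (p ^ n) - 1) / of_nat (p ^ n) = (\<Sum>k<p ^ n. of_nat ((p ^ n - 1) choose k) * t k)" for n
    using binomial_quotient[OF q0, of y n] by (simp add: y_def t_def)
  have lim: "(\<lambda>n. \<Sum>k<n. (-1) ^ k * t k) \<longlonglongrightarrow> lg x"
    using lg_sums[OF x] by (simp add: sums_def t_def y_def)
  have "strict_mono (\<lambda>n. p ^ n)" using p_gt_1 by (intro strict_monoI_Suc) simp
  from LIMSEQ_subseq_LIMSEQ[OF lim this]
  have lim': "(\<lambda>n. \<Sum>k<p ^ n. (-1) ^ k * t k) \<longlonglongrightarrow> lg x" by (simp add: comp_def)
  have "(\<lambda>n. (\<Sum>k<p ^ n. (of_nat ((p ^ n - 1) choose k) - (-1) ^ k) * t k)) \<longlonglongrightarrow> 0"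
  proof (rule metric_LIMSEQ_I)
    fix e :: real assume e: "e > 0"
    \<comment> \<open>From \<open>K\<close> on the terms are small whatever their coefficients,
      which have absolute value at most 1; the finitely many terms before \<open>K\<close> are
      handled by the convergence of each coefficient.\<close>
    obtain K where K: "\<And>k. k \<ge> K \<Longrightarrow> absval (t k) < e"
      using LIMSEQ_D[OF t0 e] by auto
    have "\<forall>\<^sub>F n in sequentially. \<forall>k<K. absval ((of_nat ((p ^ n - 1) choose k) - (-1) ^ k) * t k) < e"
    proof -
      have "\<forall>\<^sub>F n in sequentially. absval ((of_nat ((p ^ n - 1) choose k) - (-1) ^ k) * t k) < e" for k
      proof -
        have "(\<lambda>n. (of_nat ((p ^ n - 1) choose k) - (-1) ^ k) * t k) \<longlonglongrightarrow> ((-1) ^ k - (-1) ^ k) * t k"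
          by (intro tendsto_mult tendsto_diff binomial_tendsto tendsto_const)
        from tendstoD[OF this e] show ?thesis by (simp add: dist_absval)
      qed
      then show ?thesis by (simp add: eventually_all_finite flip: Ball_def lessThan_iff) (simp add: eventually_ball_finite)
    qed
    then obtain M where M: "\<And>n k. n \<ge> M \<Longrightarrow> k < K \<Longrightarrow> absval ((of_nat ((p ^ n - 1) choose k) - (-1) ^ k) * t k) < e"
      unfolding eventually_sequentially by blast
    have "absval (\<Sum>k<p ^ n. (of_nat ((p ^ n - 1) choose k) - (-1) ^ k) * t k) < e" if "n \<ge> M" for n
    proof (rule absval_sum_less[OF e])
      fix k
      show "absval ((of_nat ((p ^ n - 1) choose k) - (-1) ^ k) * t k) < e"
      proof (cases "k < K")
        case False
        have "absval (of_nat ((p ^ n - 1) choose k) - (-1) ^ k :: 'a) \<le> 1"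
          by (intro absval_diff_le absval_of_nat_le_1) (simp add: absval_power)
        then have "absval ((of_nat ((p ^ n - 1) choose k) - (-1) ^ k) * t k) \<le> 1 * absval (t k)"
          unfolding absval_mult by (intro mult_right_mono) auto
        then show ?thesis using K[of k] False by simp
      qed (use M that in blast)
    qed
    then show "\<exists>M. \<forall>n\<ge>M. dist (\<Sum>k<p ^ n. (of_nat ((p ^ n - 1) choose k) - (-1) ^ k) * t k) 0 < e"
      by (auto simp: dist_absval)
  qed
  from tendsto_add[OF this lim'] show ?thesis
    unfolding E by (simp add: sum.distrib[symmetric] left_diff_distrib)
qed

text \<open>If \<open>x ^ q = 1 + q a\<close> and \<open>y ^ q = 1 + q b\<close> for
  \<open>q = p ^ n\<close>, the quotient for the product is \<open>a + b + q a b\<close>, and the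
  last term vanishes in the limit.\<close>

lemma lg_mult:
  assumes x: "absval (x - 1) < 1" and y: "absval (y - 1) < 1"
  shows "lg (x * y) = lg x + lg y"
proof -
  define a where "a n = (x ^ (p ^ n) - 1) / of_nat (p ^ n)" for n
  define b where "b n = (y ^ (p ^ n) - 1) / of_nat (p ^ n)" for n
  have a: "a \<longlonglongrightarrow> lg x" and b: "b \<longlonglongrightarrow> lg y" unfolding a_def b_def by (rule lg_limit x y)+
  have "(\<lambda>n. a n * b n * of_nat p ^ n + a n + b n) \<longlonglongrightarrow> lg x * lg y * 0 + lg x + lg y"
    by (intro tendsto_add tendsto_mult a b p_power_tendsto)
  moreover have "a n * b n * of_nat p ^ n + a n + b n = ((x * y) ^ (p ^ n) - 1) / of_nat (p ^ n)" for n
  proof -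
    define q :: 'a where "q = of_nat (p ^ n)"
    have "q \<noteq> 0" unfolding q_def of_nat_eq_0_iff using p_gt_1 by simp
    then have xy: "x ^ (p ^ n) = 1 + q * a n" "y ^ (p ^ n) = 1 + q * b n"
      unfolding a_def b_def q_def[symmetric] by simp_all
    have "of_nat p ^ n = q" by (simp add: q_def)
    then show ?thesis using \<open>q \<noteq> 0\<close> unfolding q_def[symmetric] power_mult_distrib xy by (simp add: field_simps)
  qed
  ultimately have "(\<lambda>n. ((x * y) ^ (p ^ n) - 1) / of_nat (p ^ n)) \<longlonglongrightarrow> lg x + lg y" by simp
  from LIMSEQ_unique[OF lg_limit[OF principal_mult[OF x y]] this] show ?thesis .
qed

lemma lg_1: "lg 1 = 0"
  using lg_mult[of 1 1] by simp

lemma lg_power: "absval (x - 1) < 1 \<Longrightarrow> lg (x ^ n) = of_nat n * lg x"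
  by (induction n) (simp_all add: lg_1 lg_mult principal_power algebra_simps)

text \<open>Within the radius \<open>absval p\<close> around 1 the linear term of the series
  dominates all others.\<close>

lemma lg_small:
  assumes "absval (x - 1) < absval (of_nat p :: 'a)" "x \<noteq> 1"
  shows "absval (lg x) = absval (x - 1)"
proof -
  define y where "y = x - 1"
  define \<rho> where "\<rho> = absval y / absval (of_nat p :: 'a)"
  have y: "absval y > 0" "absval y < 1" using assms absval_p by (auto simp: y_def)
  have \<rho>: "0 \<le> \<rho>" "\<rho> < 1" using assms(1) pv_pos by (simp_all add: \<rho>_def y_def)
  define t where "t n = (-1) ^ n * y ^ Suc n / of_nat (Suc n)" for n
  have sums: "t sums lg x" unfolding t_def y_def
    by (rule lg_sums) (use assms(1) absval_p in linarith)
  have t: "absval (t (Suc n)) \<le> \<rho> * absval y" for n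
  proof -
    define v where "v = multiplicity p (Suc (Suc n))"
    have "2 ^ v \<le> p ^ v" using p_gt_1 by (intro power_mono) auto
    also have "\<dots> \<le> Suc (Suc n)" unfolding v_def by (intro dvd_imp_le multiplicity_dvd) simp
    finally have "2 ^ v \<le> Suc (Suc n)" .
    moreover have "v < 2 ^ v" by (rule less_exp)
    \<comment> \<open>From \<open>v < 2 ^ v \<le> n + 2\<close>. With the denominator at most the
      power \<open>n + 1\<close>, one factor \<open>absval y\<close> of the numerator is left over
      beside a power of \<open>\<rho>\<close>.\<close>
    ultimately have v: "v \<le> Suc n" by linarith
    have "absval (t (Suc n)) = absval y ^ Suc (Suc n) / absval (of_nat p :: 'a) ^ v"
      using absval_of_nat[of "Suc (Suc n)"]
      by (simp add: t_def absval_divide absval_mult absval_power v_def del: of_nat_Suc power_Suc)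
    also have "\<dots> \<le> absval y ^ Suc (Suc n) / absval (of_nat p :: 'a) ^ Suc n"
      using v pv_pos absval_p by (intro divide_left_mono power_decreasing mult_pos_pos) auto
    also have "\<dots> = \<rho> ^ Suc n * absval y" by (simp add: \<rho>_def power_divide)
    also have "\<dots> \<le> \<rho> ^ 1 * absval y" using \<rho> by (intro mult_right_mono power_decreasing) auto
    finally show ?thesis by simp
  qed
  have "(\<lambda>n. (\<Sum>i<Suc n. t i) - t 0) \<longlonglongrightarrow> lg x - t 0"
    using LIMSEQ_Suc[OF sums[unfolded sums_def]] by (intro tendsto_diff tendsto_const)
  then have lim: "(\<lambda>n. absval (\<Sum>i<n. t (Suc i))) \<longlonglongrightarrow> absval (lg x - t 0)"
    unfolding sum.lessThan_Suc_shift by (intro tendsto_absval) simp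
  have "absval (lg x - t 0) \<le> \<rho> * absval y"
    by (rule tendsto_upperbound[OF lim]) (use t \<rho> y in \<open>auto intro!: always_eventually absval_sum_le\<close>)
  also have "\<dots> < absval y" using \<rho> y by simp
  finally have "absval (lg x - y) < absval y" by (simp add: t_def)
  then show ?thesis unfolding y_def by (rule absval_eq_if_close)
qed

text \<open>A high \<open>p\<close>-power of \<open>x\<close> lies in the region where 1 is the only
  zero of the logarithm.\<close>

lemma lg_eq_0:
  assumes x: "absval (x - 1) < 1" and "lg x = 0"
  obtains N where "x ^ (p ^ N) = 1"
proof -
  obtain N where N: "contr x ^ N < absval (of_nat p :: 'a)"
    using real_arch_pow_inv[OF pv_pos] contr_bounds[OF x] by blast
  have "absval (x ^ (p ^ N) - 1) \<le> contr x ^ N" by (rule absval_power_dvd[OF x]) simp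
  then have s: "absval (x ^ (p ^ N) - 1) < absval (of_nat p :: 'a)" using N by linarith
  have "lg (x ^ (p ^ N)) = 0" using lg_power[OF x] assms(2) by simp
  then have "x ^ (p ^ N) = 1" using lg_small[OF s] by (metis absval_0 absval_eq_0_iff eq_iff_diff_eq_0)
  then show ?thesis by (rule that)
qed

text \<open>The difference of two logarithms is the logarithm of a quotient, which eventually lies
  in the region where the logarithm preserves the distance to 1.\<close>

lemma lg_continuous:
  assumes x: "\<And>n. absval (s n - 1) < 1" and lim: "s \<longlonglongrightarrow> x"
  shows "(\<lambda>n. lg (s n)) \<longlonglongrightarrow> lg x"
  unfolding tendsto_absval_iff
proof (rule Lim_null_comparison)
  have px: "absval (x - 1) < 1" by (rule principal_limit[OF x lim])
  have "x \<noteq> 0" using px by auto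
  have ix: "absval (inverse x - 1) < 1" by (rule principal_inverse[OF px])
  have d: "absval (s n * inverse x - 1) = absval (s n - x)" for n
  proof -
    have "s n * inverse x - 1 = (s n - x) * inverse x" using \<open>x \<noteq> 0\<close> by (simp add: left_diff_distrib)
    then show ?thesis using principal_absval[OF px] by (simp add: absval_mult absval_inverse)
  qed
  have "\<forall>\<^sub>F n in sequentially. absval (s n - x) < absval (of_nat p :: 'a)"
    using tendstoD[OF lim pv_pos] by (simp add: dist_absval)
  then show "\<forall>\<^sub>F n in sequentially. norm (absval (lg (s n) - lg x)) \<le> absval (s n - x)"
  proof (rule eventually_mono)
    fix n assume n: "absval (s n - x) < absval (of_nat p :: 'a)"
    have "lg (s n * inverse x) + lg x = lg (s n * inverse x * x)"
      by (rule lg_mult[symmetric]) (intro principal_mult x ix, rule px)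
    then have eq: "lg (s n) - lg x = lg (s n * inverse x)" using \<open>x \<noteq> 0\<close> by (simp add: mult.assoc) (metis add_diff_cancel_right')
    show "norm (absval (lg (s n) - lg x)) \<le> absval (s n - x)"
    proof (cases "s n * inverse x = 1")
      case True
      then show ?thesis using eq lg_1 by simp
    next
      case False
      then show ?thesis using lg_small[of "s n * inverse x"] n d[of n] eq by simp
    qed
  qed
  show "(\<lambda>n. absval (s n - x)) \<longlonglongrightarrow> 0" using lim unfolding tendsto_absval_iff[of _ x] .
qed

end

subsection \<open>Algebraic elements over the \<open>p\<close>-adic numbers\<close>

text \<open>In a vanishing sum the largest absolute value occurs twice, since a unique largest term
  would dominate the rest.\<close>

lemma sum_zero_absval_eq:
  fixes f :: "'i \<Rightarrow> 'a::nonarch_field"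
  assumes I: "finite I" "i0 \<in> I" "f i0 \<noteq> 0" "(\<Sum>i\<in>I. f i) = 0"
  obtains i j where "i \<in> I" "j \<in> I" "i \<noteq> j" "absval (f i) = absval (f j)" "f i \<noteq> 0"
proof -
  have "Max ((\<lambda>i. absval (f i)) ` I) \<in> (\<lambda>i. absval (f i)) ` I" using I by (intro Max_in) auto
  then obtain i where i: "i \<in> I" "absval (f i) = Max ((\<lambda>i. absval (f i)) ` I)" by auto
  have le: "absval (f j) \<le> absval (f i)" if "j \<in> I" for j
    unfolding i(2) using I(1) that by (intro Max_ge) auto
  have pos: "absval (f i) > 0" using le[OF I(2)] I(3) by (metis absval_pos_iff less_le_trans)
  have "\<exists>j\<in>I. j \<noteq> i \<and> absval (f j) = absval (f i)"
  proof (rule ccontr)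
    assume "\<not> (\<exists>j\<in>I. j \<noteq> i \<and> absval (f j) = absval (f i))"
    then have "absval (f j) < absval (f i)" if "j \<in> I - {i}" for j
      using le[of j] that by force
    then have "absval (\<Sum>j\<in>I - {i}. f j) < absval (f i)" by (intro absval_sum_less pos)
    moreover have "f i = - (\<Sum>j\<in>I - {i}. f j)"
      using sum.remove[OF I(1) i(1), of f] I(4) by (simp add: eq_neg_iff_add_eq_0)
    ultimately show False by simp
  qed
  then obtain j where "j \<in> I" "j \<noteq> i" "absval (f j) = absval (f i)" by blast
  then show ?thesis using that[of i j] i(1) pos by auto
qed

text \<open>\<open>I\<close> stands for the elements smaller than 1 at a place or for a prime ideal.
  The monic relation of \<open>y\<close> is only assumed modulo \<open>I\<close>, and all powers are
  reduced by it.\<close>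

lemma residue_powers_mod:
  fixes y :: "'r::comm_ring_1"
  assumes add: "\<And>a b. a \<in> I \<Longrightarrow> b \<in> I \<Longrightarrow> a + b \<in> I" and "0 \<in> I"
    and int: "\<And>k a. a \<in> I \<Longrightarrow> of_int k * a \<in> I" and y: "\<And>a. a \<in> I \<Longrightarrow> y * a \<in> I"
    and rel: "y ^ d - (\<Sum>i<d. of_int (b i) * y ^ i) \<in> I"
  shows "\<exists>e. y ^ n - (\<Sum>i<d. of_int (e i) * y ^ i) \<in> I"
proof (cases d)
  case 0
  then have "1 \<in> I" using rel by simp
  then have "y ^ n \<in> I" by (induction n) (auto intro: y)
  then show ?thesis using 0 by simp
next
  case (Suc d')
  show ?thesis
  proof (induction n)
    case 0
    have "(\<Sum>i<d. of_int (if i = 0 then 1 else 0) * y ^ i) = 1"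
    proof -
      have "(\<Sum>i<d. of_int (if i = 0 then 1 else 0) * y ^ i) = (\<Sum>i\<in>{0::nat}. of_int (if i = 0 then 1 else 0) * y ^ i)"
        using Suc by (intro sum.mono_neutral_right) auto
      then show ?thesis by simp
    qed
    then show ?case using \<open>0 \<in> I\<close> by (intro exI[of _ "\<lambda>i. if i = 0 then 1 else 0"]) simp
  next
    case (Suc n)
    then obtain e where e: "y ^ n - (\<Sum>i<d. of_int (e i) * y ^ i) \<in> I" by blast
    define e' where "e' i = (if i = 0 then 0 else e (i - 1)) + e d' * b i" for i
    have "(\<Sum>i<d. of_int (e' i) * y ^ i) = (\<Sum>i<d. of_int (if i = 0 then 0 else e (i - 1)) * y ^ i) + of_int (e d') * (\<Sum>i<d. of_int (b i) * y ^ i)"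
      unfolding e'_def by (simp add: distrib_right sum.distrib sum_distrib_left mult.assoc)
    also have "(\<Sum>i<d. of_int (if i = 0 then 0 else e (i - 1)) * y ^ i) = (\<Sum>i<d'. of_int (e i) * y ^ Suc i)"
      unfolding \<open>d = Suc d'\<close> by (subst sum.lessThan_Suc_shift) simp
    also have "\<dots> = y * (\<Sum>i<d. of_int (e i) * y ^ i) - of_int (e d') * y ^ d"
      unfolding \<open>d = Suc d'\<close> by (simp add: sum_distrib_left mult_ac distrib_left)
    finally have "y ^ Suc n - (\<Sum>i<d. of_int (e' i) * y ^ i) =
        y * (y ^ n - (\<Sum>i<d. of_int (e i) * y ^ i)) + of_int (e d') * (y ^ d - (\<Sum>i<d. of_int (b i) * y ^ i))"
      by (simp add: algebra_simps)
    also have "\<dots> \<in> I" by (intro add y int e rel)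
    finally show ?case by blast
  qed
qed

text \<open>As \<open>I\<close> absorbs multiples of \<open>p\<close>, the powers of
  \<open>y\<close> fall into at most \<open>p ^ d\<close> classes modulo \<open>I\<close>.\<close>

lemma residue_pigeonhole:
  fixes y :: "'r::comm_ring_1"
  assumes add: "\<And>a b. a \<in> I \<Longrightarrow> b \<in> I \<Longrightarrow> a + b \<in> I" and "0 \<in> I"
    and int: "\<And>k a. a \<in> I \<Longrightarrow> of_int k * a \<in> I" and y: "\<And>a. a \<in> I \<Longrightarrow> y * a \<in> I"
    and p: "\<And>i. of_nat p * y ^ i \<in> I" "p > 0"
    and rel: "y ^ d - (\<Sum>i<d. of_int (b i) * y ^ i) \<in> I"
  obtains i j where "i < j" "y ^ j - y ^ i \<in> I"
proof -
  have sum: "(\<Sum>i\<in>J. f i) \<in> I" if "\<And>i. i \<in> J \<Longrightarrow> f i \<in> I" for J :: "nat set" and f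
    using that by (induction J rule: infinite_finite_induct) (auto intro: add \<open>0 \<in> I\<close>)
  have "\<exists>e. \<forall>n. y ^ n - (\<Sum>i<d. of_int (e n i) * y ^ i) \<in> I"
    using residue_powers_mod[OF add \<open>0 \<in> I\<close> int y rel] by metis
  then obtain e where e: "\<And>n. y ^ n - (\<Sum>i<d. of_int (e n i) * y ^ i) \<in> I" by blast
  define H where "H n = (\<lambda>i\<in>{..<d}. e n i mod int p)" for n
  have "range H \<subseteq> PiE {..<d} (\<lambda>_. {0..<int p})" using p(2) by (auto simp: H_def)
  then have "finite (range H)" by (rule finite_subset) (intro finite_PiE, auto)
  then have "\<not> inj H" using finite_imageD infinite_UNIV_nat by blast
  then obtain n m where nm: "H n = H m" "n \<noteq> m" by (auto simp: inj_def)
  have *: "y ^ m - y ^ n \<in> I" if "H n = H m" for n m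
  proof -
    have "\<exists>k. e m i - e n i = int p * k" if "i < d" for i
      using fun_cong[OF \<open>H n = H m\<close>, of i] that by (simp add: H_def) (metis mod_eq_dvd_iff dvd_def)
    then obtain k where k: "\<And>i. i < d \<Longrightarrow> e m i - e n i = int p * k i" by metis
    have "(\<Sum>i<d. of_int (e m i) * y ^ i) - (\<Sum>i<d. of_int (e n i) * y ^ i) = (\<Sum>i<d. of_int (e m i - e n i) * y ^ i)"
      by (simp add: sum_subtractf left_diff_distrib)
    also have "\<dots> = (\<Sum>i<d. of_int (k i) * (of_nat p * y ^ i))"
      by (rule sum.cong) (simp_all add: k mult_ac)
    also have "\<dots> \<in> I" by (intro sum int p(1))
    finally have 1: "(\<Sum>i<d. of_int (e m i) * y ^ i) - (\<Sum>i<d. of_int (e n i) * y ^ i) \<in> I" .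
    have "of_int (-1) * (y ^ n - (\<Sum>i<d. of_int (e n i) * y ^ i)) \<in> I" by (intro int e)
    from add[OF add[OF e[of m] this] 1] show ?thesis by (simp add: algebra_simps)
  qed
  show ?thesis
  proof (cases "n < m")
    case True
    then show ?thesis using that * nm by blast
  next
    case False
    then have "m < n" using nm(2) by simp
    then show ?thesis using that * nm(1) by metis
  qed
qed

context padic_field
begin

lemma closure_Rats_closed:
  "x \<in> closure (\<rat> :: 'a set) \<Longrightarrow> y \<in> closure \<rat> \<Longrightarrow> x + y \<in> closure \<rat>"
  "x \<in> closure (\<rat> :: 'a set) \<Longrightarrow> y \<in> closure \<rat> \<Longrightarrow> x * y \<in> closure \<rat>"
  "x \<in> closure (\<rat> :: 'a set) \<Longrightarrow> - x \<in> closure \<rat>"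
  "x \<in> closure (\<rat> :: 'a set) \<Longrightarrow> inverse x \<in> closure \<rat>"
  "r \<in> \<rat> \<Longrightarrow> (r :: 'a) \<in> closure \<rat>"
  by (rule closure_add[OF Rats_add] closure_mult[OF Rats_mult] closure_uminus[OF Rats_minus_iff[THEN iffD2]]
      closure_inverse[OF Rats_inverse] subsetD[OF closure_subset]; assumption)+

lemma p_powi_inj: "absval (of_nat p :: 'a) powi s = absval (of_nat p :: 'a) powi t \<Longrightarrow> s = t"
proof (rule ccontr)
  assume eq: "absval (of_nat p :: 'a) powi s = absval (of_nat p :: 'a) powi t" and "s \<noteq> t"
  have *: "absval (of_nat p :: 'a) powi t < absval (of_nat p :: 'a) powi s" if "s < t" for s t
    using that pv_pos absval_p by (intro power_int_strict_decreasing) auto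
  show False using *[of s t] *[of t s] eq \<open>s \<noteq> t\<close> by linarith
qed

text \<open>Two terms of the relation have the same absolute value, as along an edge of a Newton
  polygon; their comparison expresses a power of \<open>absval a\<close> by the values of two
  coefficients.\<close>

lemma algebraic_absval:
  fixes a :: 'a
  assumes cf: "\<And>i. i \<le> d \<Longrightarrow> cf i \<in> closure \<rat>" and "i0 \<le> d" "cf i0 \<noteq> 0" "(\<Sum>i\<le>d. cf i * a ^ i) = 0" "a \<noteq> 0"
  obtains k s where "k > 0" "k \<le> d" "absval a ^ k = absval (of_nat p :: 'a) powi s"
proof -
  obtain i j where ij: "i \<le> d" "j \<le> d" "i \<noteq> j" "absval (cf i * a ^ i) = absval (cf j * a ^ j)" "cf i * a ^ i \<noteq> 0"
    using sum_zero_absval_eq[of "{..d}" i0 "\<lambda>i. cf i * a ^ i"] assms by auto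
  have *: "\<exists>s. absval a ^ (j - i) = absval (of_nat p :: 'a) powi s"
    if ij: "i < j" "i \<le> d" "j \<le> d" "absval (cf i * a ^ i) = absval (cf j * a ^ j)" "cf i \<noteq> 0" for i j
  proof -
    have "cf j \<noteq> 0" using ij(4,5) \<open>a \<noteq> 0\<close> by (auto simp: absval_mult absval_power)
    have "absval a ^ j = absval a ^ i * absval a ^ (j - i)" using ij(1) by (simp add: power_add[symmetric])
    then have "absval (cf i) = absval (cf j) * absval a ^ (j - i)"
      using ij(4) \<open>a \<noteq> 0\<close> by (simp add: absval_mult absval_power)
    then have "absval a ^ (j - i) = absval (cf i * inverse (cf j))"
      using \<open>cf j \<noteq> 0\<close> unfolding absval_mult absval_inverse by simp
    moreover have "cf i * inverse (cf j) \<in> closure \<rat>" using ij by (intro closure_Rats_closed(2,4) cf)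
    ultimately show ?thesis using absval_closure_Rats \<open>cf i \<noteq> 0\<close> \<open>cf j \<noteq> 0\<close> by (metis mult_eq_0_iff inverse_zero_imp_zero)
  qed
  have "cf j * a ^ j \<noteq> 0" using ij(4,5) by (metis absval_eq_0_iff)
  with ij(5) have nz: "cf i \<noteq> 0" "cf j \<noteq> 0" by auto
  show ?thesis
  proof (cases "i < j")
    case True
    then show ?thesis using *[OF True ij(1,2,4) nz(1)] that[of "j - i"] ij(2) by auto
  next
    case False
    then have "j < i" using ij(3) by simp
    then show ?thesis using *[OF _ ij(2,1) ij(4)[symmetric] nz(2)] that[of "i - j"] ij(1) by auto
  qed
qed

text \<open>The residue of \<open>y\<close> is algebraic over the field with \<open>p\<close>
  elements and hence a root of unity. The relation is scaled so that a largest coefficient becomes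
  1, the coefficients are replaced by nearby natural numbers, and the result is made monic modulo
  elements smaller than 1.\<close>

lemma algebraic_unit_power:
  fixes y :: 'a
  assumes cf: "\<And>i. i \<le> d \<Longrightarrow> cf i \<in> closure \<rat>" and "i0 \<le> d" "cf i0 \<noteq> 0" "(\<Sum>i\<le>d. cf i * y ^ i) = 0"
    and y: "absval y = 1"
  obtains k where "k > 0" "absval (y ^ k - 1) < 1"
proof -
  have "Max ((\<lambda>i. absval (cf i)) ` {..d}) \<in> (\<lambda>i. absval (cf i)) ` {..d}" by (intro Max_in) auto
  then obtain i1 where "i1 \<in> {..d}" and "Max ((\<lambda>i. absval (cf i)) ` {..d}) = absval (cf i1)"
    by (rule imageE)
  then have i1: "i1 \<le> d" "absval (cf i1) = Max ((\<lambda>i. absval (cf i)) ` {..d})" by simp_all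
  have le: "absval (cf j) \<le> absval (cf i1)" if "j \<le> d" for j
    unfolding i1(2) using that by (intro Max_ge) auto
  have "absval (cf i1) > 0" using le[OF assms(2)] assms(3) by (metis absval_pos_iff less_le_trans)
  then have nz: "cf i1 \<noteq> 0" by simp
  define h where "h i = cf i * inverse (cf i1)" for i
  have h_le: "absval (h i) \<le> 1" if "i \<le> d" for i
    using le[OF that] \<open>absval (cf i1) > 0\<close> unfolding h_def absval_mult absval_inverse by (simp add: field_simps)
  have "h i \<in> closure \<int>" if "i \<le> d" for i
    by (rule closure_Ints_if_absval_le[OF _ h_le[OF that]])
       (unfold h_def, intro closure_Rats_closed cf that i1)
  then have "\<exists>z::nat. absval (of_nat z - h i) < 1" if "i \<le> d" for i
    using closure_Ints_nat_approx[of "h i" 1] that by auto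
  then obtain z :: "nat \<Rightarrow> nat" where z: "\<And>i. i \<le> d \<Longrightarrow> absval (of_nat (z i) - h i) < 1" by metis
  have "h i1 = 1" using nz by (simp add: h_def)
  then have "absval (of_nat (z i1) - 1 :: 'a) < 1" using z[OF i1(1)] by simp
  then have "absval (of_nat (z i1) :: 'a) = 1" by (rule principal_absval)
  have pz: "absval (of_nat n :: 'a) < 1" if n: "p dvd n" for n
  proof -
    obtain m where "n = p * m" using n unfolding dvd_def by blast
    then have "n = m * p" by simp
    then show ?thesis using absval_lt_1_mult[OF absval_of_nat_le_1 absval_p, of m] by simp
  qed
  have "\<not> p dvd z i1" using pz[of "z i1"] \<open>absval (of_nat (z i1) :: 'a) = 1\<close> by auto
  define D where "D = Max {i. i \<le> d \<and> \<not> p dvd z i}"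
  have fin: "finite {i. i \<le> d \<and> \<not> p dvd z i}" by simp
  have "i1 \<in> {i. i \<le> d \<and> \<not> p dvd z i}" using i1(1) \<open>\<not> p dvd z i1\<close> by simp
  then have "{i. i \<le> d \<and> \<not> p dvd z i} \<noteq> {}" by (metis empty_iff)
  then have "D \<in> {i. i \<le> d \<and> \<not> p dvd z i}" unfolding D_def by (rule Max_in[OF fin])
  then have D: "D \<le> d" "\<not> p dvd z D" by simp_all
  have Dmax: "p dvd z i" if "i \<le> d" "D < i" for i
  proof (rule ccontr)
    assume "\<not> p dvd z i"
    then have "i \<le> D" unfolding D_def using that(1) by (intro Max_ge[OF fin]) simp
    then show False using that(2) by simp
  qed
  define I where "I = {x :: 'a. absval x < 1}"
  have zy: "(\<Sum>i\<le>D. of_nat (z i) * y ^ i) \<in> I"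
  proof -
    have "(\<Sum>i\<le>d. h i * y ^ i) = inverse (cf i1) * (\<Sum>i\<le>d. cf i * y ^ i)"
      by (simp add: h_def sum_distrib_left mult_ac)
    then have "(\<Sum>i\<le>d. of_nat (z i) * y ^ i) = (\<Sum>i\<le>d. (of_nat (z i) - h i) * y ^ i)"
      using assms(4) by (simp add: left_diff_distrib sum_subtractf)
    also have "absval \<dots> < 1"
      using z y by (intro absval_sum_less) (auto simp: absval_mult absval_power)
    finally have 1: "absval (\<Sum>i\<le>d. of_nat (z i) * y ^ i) < 1" .
    have "(\<Sum>i\<le>d. of_nat (z i) * y ^ i) = (\<Sum>i\<le>D. of_nat (z i) * y ^ i) + (\<Sum>i\<in>{D<..d}. of_nat (z i) * y ^ i)"
    proof -
      have "{..d} = {..D} \<union> {D<..d}" using D(1) by auto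
      then show ?thesis by (simp only:) (rule sum.union_disjoint, auto)
    qed
    then have eq: "(\<Sum>i\<le>d. of_nat (z i) * y ^ i) - (\<Sum>i\<in>{D<..d}. of_nat (z i) * y ^ i) = (\<Sum>i\<le>D. of_nat (z i) * y ^ i)"
      by simp
    have 2: "absval (\<Sum>i\<in>{D<..d}. of_nat (z i) * y ^ i) < 1"
      using Dmax pz y by (intro absval_sum_less) (auto simp: absval_mult absval_power)
    from absval_diff_less[OF 1 2] show ?thesis unfolding eq by (simp add: I_def)
  qed
  have "Rings.coprime (int (z D)) (int p)"
    using prime_imp_coprime[OF prime_p D(2)] by (simp add: coprime_commute)
  then obtain u v where uv: "u * int (z D) + v * int p = 1" using bezout_int[of "int (z D)" "int p"] by auto
  have I_closed: "\<And>a b. a \<in> I \<Longrightarrow> b \<in> I \<Longrightarrow> a + b \<in> I" "0 \<in> I" "\<And>k a. a \<in> I \<Longrightarrow> of_int k * a \<in> I"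
    "\<And>a. a \<in> I \<Longrightarrow> y * a \<in> I" "\<And>i. of_nat p * y ^ i \<in> I"
    using absval_add_less[of _ 1] absval_lt_1_mult[OF absval_of_int_le_1] y absval_p
    by (auto simp: I_def absval_mult absval_power)
  have "(of_int (u * int (z D) + v * int p) :: 'a) = 1" unfolding uv by simp
  then have uz: "of_int u * of_nat (z D) = (1 - of_int v * of_nat p :: 'a)" by (simp add: algebra_simps)
  have "of_int u * (\<Sum>i\<le>D. of_nat (z i) * y ^ i) + of_int v * (of_nat p * y ^ D) \<in> I"
    by (intro I_closed zy)
  also have "of_int u * (\<Sum>i\<le>D. of_nat (z i) * y ^ i) + of_int v * (of_nat p * y ^ D)
      = y ^ D - (\<Sum>i<D. of_int (- u * int (z i)) * y ^ i)"
  proof -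
    have "(\<Sum>i\<le>D. of_nat (z i) * y ^ i) = (\<Sum>i<D. of_nat (z i) * y ^ i) + of_nat (z D) * y ^ D"
      by (simp add: lessThan_Suc_atMost[symmetric])
    then have "of_int u * (\<Sum>i\<le>D. of_nat (z i) * y ^ i) = of_int u * (\<Sum>i<D. of_nat (z i) * y ^ i) + (1 - of_int v * of_nat p) * y ^ D"
      by (simp add: distrib_left mult.assoc[symmetric] uz)
    then show ?thesis by (simp add: sum_distrib_left sum_negf mult.assoc left_diff_distrib)
  qed
  finally have rel: "y ^ D - (\<Sum>i<D. of_int (- u * int (z i)) * y ^ i) \<in> I" .
  have "0 < p" using p_gt_1 by simp
  from residue_pigeonhole[OF I_closed this rel] obtain i j where ij: "i < j" "y ^ j - y ^ i \<in> I" by metis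
  have "y ^ j - y ^ i = y ^ i * (y ^ (j - i) - 1)" using ij(1) by (simp add: right_diff_distrib power_add[symmetric])
  then have "absval (y ^ (j - i) - 1) < 1" using ij(2) y by (simp add: I_def absval_mult absval_power)
  then show ?thesis using that[of "j - i"] ij(1) by simp
qed

end

subsection \<open>The \<open>p\<close>-adic logarithm\<close>

text \<open>Polynomials over a structure are coefficient lists with the leading coefficient first,
  hence the reversal; the nonzero coefficient is the leading one.\<close>

lemma algebraic_over_relation:
  fixes K A :: "'a::field_char_0 set"
  assumes "algebraic_closure (fld\<lparr>carrier := A\<rparr>) K" "a \<in> A"
  obtains cf d i0 where "\<And>i. i \<le> d \<Longrightarrow> cf i \<in> K" "i0 \<le> d" "cf i0 \<noteq> 0" "(\<Sum>i\<le>d. cf i * a ^ i) = 0"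
proof -
  interpret L: algebraic_closure "fld\<lparr>carrier := A\<rparr>" K by fact
  have pow: "a [^]\<^bsub>fld\<lparr>carrier := A\<rparr>\<^esub> n = a ^ n" for n
    by (induction n) (simp_all add: ring_of_type_algebra_def mult.commute)
  have "(L.algebraic over K) a" using L.algebraic_extension[of a] assms(2) by simp
  then obtain q where q: "q \<in> carrier (K [X]\<^bsub>fld\<lparr>carrier := A\<rparr>\<^esub>)" "q \<noteq> []" "L.eval q a = \<zero>\<^bsub>fld\<lparr>carrier := A\<rparr>\<^esub>"
    using L.algebraicE[OF L.subfield_axioms[THEN subfieldE(1)], of a] assms(2) by auto
  have ev: "L.eval r a = (\<Sum>i<length r. rev r ! i * a ^ i)" for r
  proof (induction r)
    case (Cons b r)
    have "(\<Sum>i<length r. rev (b # r) ! i * a ^ i) = (\<Sum>i<length r. rev r ! i * a ^ i)"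
      by (rule sum.cong) (auto simp: nth_append)
    then show ?case using Cons by (simp add: pow nth_append) (simp add: ring_of_type_algebra_def)
  qed (simp, simp add: ring_of_type_algebra_def)
  have poly: "set q \<subseteq> K" "hd q \<noteq> 0"
    using q(1,2) unfolding univ_poly_carrier[symmetric] polynomial_def by (auto simp: ring_of_type_algebra_def)
  define d where "d = length q - 1"
  have d: "length q = Suc d" using q(2) by (simp add: d_def)
  show ?thesis
  proof (rule that[of d "\<lambda>i. rev q ! i" d])
    show "rev q ! i \<in> K" if "i \<le> d" for i
      using poly(1) that d by (metis length_rev less_Suc_eq_le nth_mem set_rev subsetD)
    show "d \<le> d" by simp
    show "rev q ! d \<noteq> 0" using poly(2) d q(2) by (simp add: rev_nth hd_conv_nth)
    show "(\<Sum>i\<le>d. rev q ! i * a ^ i) = 0"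
      using q(3) ev[of q] d by (simp add: ring_of_type_algebra_def lessThan_Suc_atMost)
  qed
qed

locale padic_complex_field =
  fixes p :: nat and T :: "'a::{nonarch_field, complete_space} itself"
  assumes prime_p': "Factorial_Ring.prime p" and padic_complex: "padic_complex p TYPE('a)"

sublocale padic_complex_field \<subseteq> padic_field p T
proof
  show "Factorial_Ring.prime p" by (rule prime_p')
  then have "p > 1" by (rule prime_gt_1_nat)
  then show "absval (of_nat p :: 'a) < 1" using padic_complex by (simp add: padic_complex_def)
qed

context padic_complex_field
begin

text \<open>By density \<open>x\<close> is a principal unit times an algebraic element
  \<open>a\<close>. Some power of \<open>a\<close> has the absolute value of a power of
  \<open>p\<close>, and a further power of the algebraic unit obtained from it is principal.\<close>

lemma some_power_principal:
  fixes x :: 'a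
  assumes "x \<noteq> 0"
  shows "\<exists>k s. k > 0 \<and> absval (x ^ k * of_nat p powi s - 1) < 1"
proof -
  obtain A :: "'a set" where A: "algebraic_closure (fld\<lparr>carrier := A\<rparr>) (closure \<rat>)" "closure A = UNIV"
    using padic_complex unfolding padic_complex_def by blast
  interpret L: algebraic_closure "fld\<lparr>carrier := A\<rparr>" "closure \<rat>" by (rule A(1))
  have A_mult: "u * v \<in> A" if "u \<in> A" "v \<in> A" for u v
    using monoid.m_closed[OF ring.is_monoid[OF L.ring_axioms], of u v] that by (simp add: ring_of_type_algebra_def)
  have A_one: "1 \<in> A" using monoid.one_closed[OF ring.is_monoid[OF L.ring_axioms]] by (simp add: ring_of_type_algebra_def)
  have A_pow: "u ^ n \<in> A" if "u \<in> A" for u n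
    using that by (induction n) (simp_all add: A_one A_mult)
  have A_Qp: "closure \<rat> \<subseteq> A" using subfieldE(3)[OF L.subfield_axioms] by simp
  obtain a where a: "a \<in> A" "absval (a - x) < absval x"
    using closure_approx[of x A "absval x"] A(2) assms by auto
  have "absval a = absval x" by (rule absval_eq_if_close[OF a(2)])
  then have "a \<noteq> 0" using assms by auto
  obtain cf d i0 where cf: "\<And>i. i \<le> d \<Longrightarrow> cf i \<in> closure \<rat>" "i0 \<le> d" "cf i0 \<noteq> 0" "(\<Sum>i\<le>d. cf i * a ^ i) = 0"
    using algebraic_over_relation[OF A(1) a(1)] by metis
  obtain k s where k: "k > 0" "absval a ^ k = absval (of_nat p :: 'a) powi s"
    using algebraic_absval[OF cf \<open>a \<noteq> 0\<close>] by metis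
  define y where "y = a ^ k * of_nat p powi (- s)"
  have "of_nat p powi (- s) \<in> (\<rat> :: 'a set)" by (simp add: power_int_def)
  then have "y \<in> A" unfolding y_def using A_Qp closure_subset by (intro A_mult A_pow a) blast
  have y1: "absval y = 1"
    using pv_pos by (simp add: y_def absval_mult absval_power k(2) power_int_minus absval_inverse absval_power_int)
  obtain cf' d' j0 where cf': "\<And>i. i \<le> d' \<Longrightarrow> cf' i \<in> closure \<rat>" "j0 \<le> d'" "cf' j0 \<noteq> 0" "(\<Sum>i\<le>d'. cf' i * y ^ i) = 0"
    using algebraic_over_relation[OF A(1) \<open>y \<in> A\<close>] by metis
  obtain l where l: "l > 0" "absval (y ^ l - 1) < 1"
    using algebraic_unit_power[OF cf' y1] by metis
  have "absval (x / a - 1) < 1"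
  proof -
    have "x / a - 1 = - ((a - x) / a)" using \<open>a \<noteq> 0\<close> by (simp add: diff_divide_distrib)
    then show ?thesis using a(2) \<open>absval a = absval x\<close> assms by (simp add: absval_divide)
  qed
  then have "absval ((x / a) ^ (k * l) * y ^ l - 1) < 1"
    by (rule principal_mult[OF principal_power l(2)])
  moreover have "(x / a) ^ (k * l) * y ^ l = x ^ (k * l) * of_nat p powi (- s * int l)"
  proof -
    have "(of_nat p powi (- s)) ^ l = (of_nat p powi (- s * int l) :: 'a)"
      by (simp only: power_int_mult power_int_of_nat)
    then show ?thesis
      using \<open>a \<noteq> 0\<close> by (simp add: y_def power_mult_distrib power_divide power_mult[symmetric])
  qed
  ultimately show ?thesis using k(1) l(1) by (intro exI[of _ "k * l"] exI[of _ "- s * int l"]) simp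
qed

text \<open>Dictated by additivity and the vanishing at \<open>p\<close>: a power of
  \<open>x\<close> is shifted by a power of \<open>p\<close> into the domain of the series, and the
  exponent is divided out.\<close>

definition Lg :: "'a \<Rightarrow> 'a" where
  "Lg x = (if x = 0 then 0 else
     let ks = SOME ks. fst ks > 0 \<and> absval (x ^ fst ks * of_nat p powi snd ks - 1) < 1
     in lg (x ^ fst ks * of_nat p powi snd ks) / of_nat (fst ks))"

text \<open>Both elements are raised to powers in which \<open>x\<close> has the exponent
  \<open>k * l\<close>; equality of absolute values then forces the same power of
  \<open>p\<close>.\<close>

lemma principal_pair_unique:
  fixes x :: 'a
  assumes "k > 0" "l > 0" "absval (x ^ k * of_nat p powi s - 1) < 1" "absval (x ^ l * of_nat p powi t - 1) < 1"
  shows "lg (x ^ k * of_nat p powi s) / of_nat k = lg (x ^ l * of_nat p powi t) / of_nat l"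
proof -
  have p0: "of_nat p \<noteq> (0 :: 'a)" using p_gt_1 by simp
  have e1: "(x ^ k * of_nat p powi s) ^ l = x ^ (k * l) * of_nat p powi (s * int l)"
    and e2: "(x ^ l * of_nat p powi t) ^ k = x ^ (k * l) * of_nat p powi (t * int k)"
    by (simp_all add: power_mult_distrib power_mult[symmetric] power_int_mult mult.commute)
  have "absval (x ^ (k * l) * of_nat p powi (s * int l)) = 1" "absval (x ^ (k * l) * of_nat p powi (t * int k)) = 1"
    unfolding e1[symmetric] e2[symmetric] using principal_absval[OF principal_power] assms(3,4) by blast+
  then have "absval (x ^ (k * l)) * absval (of_nat p :: 'a) powi (s * int l) = 1"
    "absval (x ^ (k * l)) * absval (of_nat p :: 'a) powi (t * int k) = 1"
    by (simp_all only: absval_mult absval_power_int)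
  then have "absval (of_nat p :: 'a) powi (s * int l) = absval (of_nat p :: 'a) powi (t * int k)"
    by (metis mult_left_cancel mult_zero_left zero_neq_one)
  then have "s * int l = t * int k" by (rule p_powi_inj)
  then have "(x ^ k * of_nat p powi s) ^ l = (x ^ l * of_nat p powi t) ^ k" using e1 e2 by simp
  then have "of_nat l * lg (x ^ k * of_nat p powi s) = of_nat k * lg (x ^ l * of_nat p powi t)"
    using lg_power[OF assms(3), of l] lg_power[OF assms(4), of k] by simp
  then show ?thesis using assms(1,2) by (simp add: frac_eq_eq mult.commute)
qed

lemma Lg_eq:
  fixes x :: 'a
  assumes "x \<noteq> 0" "k > 0" "absval (x ^ k * of_nat p powi s - 1) < 1"
  shows "Lg x = lg (x ^ k * of_nat p powi s) / of_nat k"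
proof -
  define ks where "ks = (SOME ks. fst ks > 0 \<and> absval (x ^ fst ks * of_nat p powi snd ks - 1) < 1)"
  have "fst ks > 0 \<and> absval (x ^ fst ks * of_nat p powi snd ks - 1) < 1"
    unfolding ks_def by (rule someI[of _ "(k, s)"]) (simp add: assms)
  then show ?thesis
    using principal_pair_unique[of "fst ks" k x "snd ks" s] assms by (simp add: Lg_def ks_def[symmetric])
qed

lemma Lg_principal: "absval (x - 1) < 1 \<Longrightarrow> Lg x = lg x"
  using Lg_eq[of x 1 0] by force

lemma Lg_mult:
  fixes x y :: 'a
  assumes "x \<noteq> 0" "y \<noteq> 0"
  shows "Lg (x * y) = Lg x + Lg y"
proof -
  obtain k s where k: "k > 0" "absval (x ^ k * of_nat p powi s - 1) < 1" using some_power_principal[OF assms(1)] by blast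
  obtain l t where l: "l > 0" "absval (y ^ l * of_nat p powi t - 1) < 1" using some_power_principal[OF assms(2)] by blast
  have p0: "of_nat p \<noteq> (0 :: 'a)" using p_gt_1 by simp
  define u where "u = x ^ k * of_nat p powi s"
  define v where "v = y ^ l * of_nat p powi t"
  have uv: "absval (u - 1) < 1" "absval (v - 1) < 1" using k l by (simp_all add: u_def v_def)
  have eq: "(x * y) ^ (k * l) * of_nat p powi (s * int l + t * int k) = u ^ l * v ^ k"
    using p0 by (simp add: u_def v_def power_mult_distrib power_mult[symmetric] power_int_mult power_int_add mult_ac)
  have pr: "absval (u ^ l * v ^ k - 1) < 1" by (intro principal_mult principal_power uv)
  have "Lg (x * y) = lg (u ^ l * v ^ k) / of_nat (k * l)"
    using Lg_eq[of "x * y" "k * l" "s * int l + t * int k"] assms k(1) l(1) pr unfolding eq by simp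
  also have "lg (u ^ l * v ^ k) = of_nat l * lg u + of_nat k * lg v"
    using lg_mult[OF principal_power[OF uv(1)] principal_power[OF uv(2)]] lg_power uv by simp
  also have "(of_nat l * lg u + of_nat k * lg v) / of_nat (k * l) = lg u / of_nat k + lg v / of_nat l"
    using k(1) l(1) by (simp add: field_simps)
  also have "\<dots> = Lg x + Lg y" using Lg_eq[OF assms(1) k] Lg_eq[OF assms(2) l] by (simp add: u_def v_def)
  finally show ?thesis .
qed

lemma Lg_power: "x \<noteq> 0 \<Longrightarrow> Lg (x ^ n) = of_nat n * Lg x"
proof (induction n)
  case 0
  show ?case using Lg_principal[of 1] lg_1 by simp
next
  case (Suc n)
  then show ?case using Lg_mult[of x "x ^ n"] by (simp add: algebra_simps)
qed

lemma Lg_torsion: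
  fixes z :: 'a
  assumes "k > 0" "z ^ k = 1"
  shows "Lg (z * of_nat p powi s) = 0"
proof -
  have p0: "of_nat p \<noteq> (0 :: 'a)" using p_gt_1 by simp
  have "z \<noteq> 0" using assms by (auto simp: power_0_left)
  have "(z * of_nat p powi s) ^ k * of_nat p powi (- s * int k) = 1"
  proof -
    have "(of_nat p powi s) ^ k = (of_nat p powi (s * int k) :: 'a)" by (simp add: power_int_mult)
    then show ?thesis using p0 assms(2) by (simp add: power_mult_distrib power_int_minus)
  qed
  then show ?thesis
    using Lg_eq[of "z * of_nat p powi s" k "- s * int k"] p0 \<open>z \<noteq> 0\<close> assms(1) lg_1 by simp
qed

lemma padic_log_eq: "padic_log p = Lg"
  unfolding padic_log_def
proof (rule the_equality)
  show "(\<forall>x. absval (x - 1) < 1 \<longrightarrow> (\<lambda>n. (- 1) ^ n * (x - 1) ^ Suc n / of_nat (Suc n)) sums Lg x) \<and>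
    (\<forall>a b. a \<noteq> 0 \<longrightarrow> b \<noteq> 0 \<longrightarrow> Lg (a * b) = Lg a + Lg b) \<and>
    (\<forall>\<zeta> k s. 0 < k \<longrightarrow> \<zeta> ^ k = 1 \<longrightarrow> Lg (\<zeta> * of_nat p powi s) = 0) \<and> Lg 0 = 0"
  proof (intro conjI allI impI)
    show "(\<lambda>n. (- 1) ^ n * (x - 1) ^ Suc n / of_nat (Suc n)) sums Lg x" if "absval (x - 1) < 1" for x
      unfolding Lg_principal[OF that] by (rule lg_sums[OF that])
    show "Lg 0 = 0" by (simp add: Lg_def)
  qed (rule Lg_mult Lg_torsion; assumption)+
next
  fix L
  assume *: "(\<forall>x. absval (x - 1) < 1 \<longrightarrow> (\<lambda>n. (- 1) ^ n * (x - 1) ^ Suc n / of_nat (Suc n)) sums L x) \<and>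
    (\<forall>a b. a \<noteq> 0 \<longrightarrow> b \<noteq> 0 \<longrightarrow> L (a * b) = L a + L b) \<and>
    (\<forall>(\<zeta>::'a) k s. 0 < k \<longrightarrow> \<zeta> ^ k = 1 \<longrightarrow> L (\<zeta> * of_nat p powi s) = 0) \<and> L 0 = 0"
  then have L: "\<And>x. absval (x - 1) < 1 \<Longrightarrow> (\<lambda>n. (- 1) ^ n * (x - 1) ^ Suc n / of_nat (Suc n)) sums L x"
    "\<And>a b. a \<noteq> 0 \<Longrightarrow> b \<noteq> 0 \<Longrightarrow> L (a * b) = L a + L b"
    "\<And>(\<zeta>::'a) k s. 0 < k \<Longrightarrow> \<zeta> ^ k = 1 \<Longrightarrow> L (\<zeta> * of_nat p powi s) = 0" "L 0 = 0"
    using *[THEN conjunct1] *[THEN conjunct2, THEN conjunct1] *[THEN conjunct2, THEN conjunct2, THEN conjunct1]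
      *[THEN conjunct2, THEN conjunct2, THEN conjunct2] by metis+
  have p0: "of_nat p \<noteq> (0 :: 'a)" using p_gt_1 by simp
  show "L = Lg"
  proof
    fix x
    show "L x = Lg x"
    proof (cases "x = 0")
      case False
      obtain k s where k: "k > 0" "absval (x ^ k * of_nat p powi s - 1) < 1" using some_power_principal[OF False] by blast
      have Lpow: "L (x ^ n) = of_nat n * L x" for n
      proof (induction n)
        case 0
        show ?case using L(3)[of 1 1 0] by simp
      next
        case (Suc n)
        then show ?case using L(2)[of x "x ^ n"] False by (simp add: algebra_simps)
      qed
      have "L (x ^ k * of_nat p powi s) = lg (x ^ k * of_nat p powi s)"
        by (rule sums_unique2[OF L(1)[OF k(2)] lg_sums[OF k(2)]])
      moreover have "L (x ^ k * of_nat p powi s) = of_nat k * L x"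
        using L(2)[of "x ^ k" "of_nat p powi s"] L(3)[of 1 1 s] Lpow False p0 by simp
      ultimately have "of_nat k * L x = of_nat k * Lg x" using Lg_eq[OF False k] k(1) by simp
      then show ?thesis using k(1) by simp
    qed (simp add: L(4) Lg_def)
  qed
qed

text \<open>For absolute value 1 the shift by a power of \<open>p\<close> is trivial, and the series
  vanishes only at roots of unity.\<close>

lemma Lg_eq_0:
  assumes "absval x = 1" "Lg x = 0"
  obtains N where "N > 0" "x ^ N = 1"
proof -
  have "x \<noteq> 0" using assms(1) by auto
  obtain k s where k: "k > 0" "absval (x ^ k * of_nat p powi s - 1) < 1" using some_power_principal[OF \<open>x \<noteq> 0\<close>] by blast
  have "absval (of_nat p :: 'a) powi s = absval (of_nat p :: 'a) powi 0"
    using principal_absval[OF k(2)] assms(1) by (simp add: absval_mult absval_power absval_power_int)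
  then have "s = 0" by (rule p_powi_inj)
  then have 1: "absval (x ^ k - 1) < 1" using k(2) by simp
  have "lg (x ^ k) = 0" using Lg_principal[OF 1] Lg_power[OF \<open>x \<noteq> 0\<close>] assms(2) by simp
  then obtain N where "(x ^ k) ^ (p ^ N) = 1" using lg_eq_0[OF 1] by blast
  then show ?thesis using that[of "k * p ^ N"] k(1) p_gt_1 by (simp add: power_mult)
qed

lemma Lg_inverse: "x \<noteq> 0 \<Longrightarrow> Lg (inverse x) = - Lg x"
  using Lg_mult[of x "inverse x"] Lg_power[of 1 0] by (simp add: eq_neg_iff_add_eq_0 add.commute)

lemma Lg_power_int: "x \<noteq> 0 \<Longrightarrow> Lg (x powi k) = of_int k * Lg x"
  by (cases "k \<ge> 0") (simp_all add: power_int_def Lg_power Lg_inverse)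

lemma Lg_prod: "(\<And>i. i \<in> I \<Longrightarrow> f i \<noteq> 0) \<Longrightarrow> Lg (\<Prod>i\<in>I. f i) = (\<Sum>i\<in>I. Lg (f i))"
proof (induction I rule: infinite_finite_induct)
  case (insert i I)
  then show ?case using Lg_mult[of "f i" "prod f I"] by (simp add: prod_zero_iff)
qed (use Lg_power[of 1 0] in simp_all)

end

section \<open>Primes above \<open>p\<close>\<close>

text \<open>The ideal conditions are spelled out on elements of the type, so that residues and
  centres can be treated without ring structures.\<close>

definition prime_above :: "nat \<Rightarrow> 'm::field_char_0 set \<Rightarrow> bool" where
  "prime_above p P \<longleftrightarrow> P \<subseteq> {x. algebraic_int x} \<and> 0 \<in> P \<and> 1 \<notin> P \<and> of_nat p \<in> P \<and>
     (\<forall>x\<in>P. \<forall>y\<in>P. x + y \<in> P) \<and> (\<forall>a x. algebraic_int a \<longrightarrow> x \<in> P \<longrightarrow> a * x \<in> P) \<and>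
     (\<forall>x y. algebraic_int x \<longrightarrow> algebraic_int y \<longrightarrow> x * y \<in> P \<longrightarrow> x \<in> P \<or> y \<in> P)"

lemma prime_aboveI_primes_above:
  assumes "P \<in> primes_above p"
  shows "prime_above p P"
proof -
  have P: "primeideal P ring_of_integers" and p: "of_nat p \<in> P"
    using assms by (auto simp: primes_above_def)
  interpret P: primeideal P ring_of_integers by (rule P)
  have sub: "P \<subseteq> {x. algebraic_int x}" using P.a_subset by (simp add: ring_of_integers_def)
  have "1 \<notin> P"
  proof
    assume "1 \<in> P"
    then have "\<one>\<^bsub>ring_of_integers\<^esub> \<in> P" by (simp add: ring_of_integers_def ring_of_type_algebra_def)
    then show False using P.one_imp_carrier P.I_notcarr by metis
  qed
  moreover have "0 \<in> P" using additive_subgroup.zero_closed[OF P.additive_subgroup_axioms] by (simp add: ring_of_integers_def ring_of_type_algebra_def)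
  moreover have "x + y \<in> P" if "x \<in> P" "y \<in> P" for x y
    using additive_subgroup.a_closed[OF P.additive_subgroup_axioms that] by (simp add: ring_of_integers_def ring_of_type_algebra_def)
  moreover have "a * x \<in> P" if "algebraic_int a" "x \<in> P" for a x
    using P.I_l_closed[of x a] that by (simp add: ring_of_integers_def ring_of_type_algebra_def)
  moreover have "x \<in> P \<or> y \<in> P" if "algebraic_int x" "algebraic_int y" "x * y \<in> P" for x y
    using P.I_prime[of x y] that by (simp add: ring_of_integers_def ring_of_type_algebra_def)
  ultimately show ?thesis using sub p unfolding prime_above_def by blast
qed

lemma prime_aboveD:
  assumes "prime_above p P"
  shows "x \<in> P \<Longrightarrow> algebraic_int x" "0 \<in> P" "1 \<notin> P" "of_nat p \<in> P"
    "x \<in> P \<Longrightarrow> y \<in> P \<Longrightarrow> x + y \<in> P" "algebraic_int a \<Longrightarrow> x \<in> P \<Longrightarrow> a * x \<in> P"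
    "algebraic_int x \<Longrightarrow> algebraic_int y \<Longrightarrow> x * y \<in> P \<Longrightarrow> x \<in> P \<or> y \<in> P"
proof -
  note * = assms[unfolded prime_above_def]
  show "x \<in> P \<Longrightarrow> algebraic_int x" "0 \<in> P" "1 \<notin> P" "of_nat p \<in> P" using * by (simp_all add: subset_eq)
  show "x \<in> P \<Longrightarrow> y \<in> P \<Longrightarrow> x + y \<in> P" "algebraic_int a \<Longrightarrow> x \<in> P \<Longrightarrow> a * x \<in> P"
    using * by simp_all
  show "algebraic_int x \<Longrightarrow> algebraic_int y \<Longrightarrow> x * y \<in> P \<Longrightarrow> x \<in> P \<or> y \<in> P" using * by simp
qed

lemma prime_above_diff: "prime_above p P \<Longrightarrow> x \<in> P \<Longrightarrow> y \<in> P \<Longrightarrow> x - y \<in> P"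
  using prime_aboveD(5)[of p P x "- 1 * y", OF _ _ prime_aboveD(6)[of p P "- 1" y]] algebraic_int_of_int[of "- 1"]
  by simp

lemma prime_above_int_dvd:
  assumes P: "prime_above p P" and p: "Factorial_Ring.prime p" and z: "(of_int z :: 'm::field_char_0) \<in> P"
  shows "int p dvd z"
proof (rule ccontr)
  assume "\<not> int p dvd z"
  then have "Rings.coprime z (int p)"
    using prime_imp_coprime[of "int p" z] p by (simp add: coprime_commute)
  then obtain u v where uv: "u * z + v * int p = 1" using bezout_int[of z "int p"] by auto
  have "of_int u * of_int z + of_int v * of_nat p \<in> P"
    by (intro prime_aboveD(5,6)[OF P] z algebraic_int_of_int prime_aboveD(4)[OF P])
  moreover have "(of_int u * of_int z + of_int v * of_nat p :: 'm) = of_int (u * z + v * int p)" by simp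
  ultimately show False using prime_aboveD(3)[OF P] unfolding uv by simp
qed

text \<open>Two powers of \<open>x\<close> agree modulo \<open>P\<close> because there are finitely
  many residues of powers. Primality cancels the lower power and leaves an inverse of
  \<open>x\<close>.\<close>

lemma prime_above_maximal:
  assumes P: "prime_above p P" "p > 0" and x: "algebraic_int (x::'m::field_char_0)" "x \<notin> P"
  obtains y where "algebraic_int y" "1 - x * y \<in> P"
proof -
  obtain n k where nk: "n > 0" "x ^ n = (\<Sum>i<n. of_int (k i) * x ^ i)"
    using algebraic_int_power_eq[OF x(1)] .
  have 1: "\<And>a b. a \<in> P \<Longrightarrow> b \<in> P \<Longrightarrow> a + b \<in> P" by (rule prime_aboveD(5)[OF P(1)])
  have 2: "\<And>k a. a \<in> P \<Longrightarrow> of_int k * a \<in> P" by (intro prime_aboveD(6)[OF P(1)] algebraic_int_of_int)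
  have 3: "\<And>a. a \<in> P \<Longrightarrow> x * a \<in> P" by (intro prime_aboveD(6)[OF P(1)] x(1))
  have 4: "of_nat p * x ^ i \<in> P" for i
    using prime_aboveD(6)[OF P(1) algebraic_int_power[OF x(1)] prime_aboveD(4)[OF P(1)]] by (simp add: mult.commute)
  have 5: "x ^ n - (\<Sum>i<n. of_int (k i) * x ^ i) \<in> P" using nk(2) prime_aboveD(2)[OF P(1)] by simp
  obtain i j where ij: "i < j" "x ^ j - x ^ i \<in> P"
    using residue_pigeonhole[OF 1 prime_aboveD(2)[OF P(1)] 2 3 4 P(2) 5] by metis
  have "x ^ i * (x ^ (j - i) - 1) \<in> P"
    using ij by (simp add: right_diff_distrib power_add[symmetric])
  moreover have "x ^ i \<notin> P" for i
  proof (induction i)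
    case (Suc i)
    then show ?case using prime_aboveD(7)[OF P(1) x(1) algebraic_int_power[OF x(1)], of i] x(2) by auto
  qed (use prime_aboveD(3)[OF P(1)] in simp)
  moreover have ai: "algebraic_int (x ^ (j - i) - 1)"
    by (intro algebraic_int_diff algebraic_int_power x) simp
  ultimately have m: "x ^ (j - i) - 1 \<in> P"
    using prime_aboveD(7)[OF P(1) algebraic_int_power[OF x(1)] ai] by blast
  have "0 - (x ^ (j - i) - 1) \<in> P" by (rule prime_above_diff[OF P(1) prime_aboveD(2)[OF P(1)] m])
  moreover have "x ^ (j - i) = x * x ^ (j - i - 1)" using ij(1) by (metis Suc_diff_1 power_Suc zero_less_diff)
  ultimately have "1 - x * x ^ (j - i - 1) \<in> P" by simp
  then show ?thesis using that algebraic_int_power[OF x(1)] by blast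
qed

lemma prime_above_subset_eq:
  assumes P: "prime_above p P" and Q: "prime_above p Q" and "p > 0" "P \<subseteq> Q"
  shows "P = Q"
proof (rule ccontr)
  assume "P \<noteq> Q"
  then obtain x where x: "x \<in> Q" "x \<notin> P" using assms(4) by blast
  obtain y where y: "algebraic_int y" "1 - x * y \<in> P"
    using prime_above_maximal[OF P assms(3) prime_aboveD(1)[OF Q x(1)] x(2)] .
  have "y * x \<in> Q" by (rule prime_aboveD(6)[OF Q y(1) x(1)])
  with y(2) assms(4) have "(1 - x * y) + y * x \<in> Q" using prime_aboveD(5)[OF Q] by blast
  then show False using prime_aboveD(3)[OF Q] by (simp add: mult.commute)
qed

text \<open>For each \<open>Q\<close> there is an \<open>f Q\<close> in \<open>P\<close> congruent
  to 1 modulo \<open>Q\<close>. The product of all \<open>1 - f Q\<close> is congruent to 1 modulo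
  \<open>P\<close> and lies in every \<open>Q\<close>; its complement to 1 is the desired
  element.\<close>

lemma prime_above_crt:
  assumes P: "prime_above p P" and "p > 0" and fin: "finite Qs"
    and Q: "\<And>Q. Q \<in> Qs \<Longrightarrow> prime_above p Q \<and> Q \<noteq> P"
  obtains x where "x \<in> P" "\<And>Q. Q \<in> Qs \<Longrightarrow> 1 - x \<in> Q"
proof -
  have "\<exists>x. x \<in> P \<and> 1 - x \<in> Q" if QQ: "Q \<in> Qs" for Q
  proof -
    have "\<not> P \<subseteq> Q" using prime_above_subset_eq[OF P _ assms(2)] Q[OF QQ] by blast
    then obtain x where x: "x \<in> P" "x \<notin> Q" by blast
    obtain y where y: "algebraic_int y" "1 - x * y \<in> Q"
      using prime_above_maximal[OF _ assms(2) prime_aboveD(1)[OF P x(1)] x(2)] Q[OF QQ] by metis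
    have "x * y \<in> P" using prime_aboveD(6)[OF P y(1) x(1)] by (simp add: mult.commute)
    then show ?thesis using y(2) by blast
  qed
  then obtain f where f: "\<And>Q. Q \<in> Qs \<Longrightarrow> f Q \<in> P" "\<And>Q. Q \<in> Qs \<Longrightarrow> 1 - f Q \<in> Q" by metis
  have "1 - (\<Prod>Q\<in>R. 1 - f Q) \<in> P \<and> algebraic_int (\<Prod>Q\<in>R. 1 - f Q)" if "R \<subseteq> Qs" for R
    using finite_subset[OF that fin] that
  proof (induction R rule: finite_induct)
    case (insert Q R)
    let ?b = "\<Prod>Q\<in>R. 1 - f Q"
    have fQ: "f Q \<in> P" using f(1) insert.prems by blast
    have IH: "1 - ?b \<in> P" "algebraic_int ?b" using insert by auto
    have "(1 - ?b) + ?b * f Q \<in> P" by (intro prime_aboveD(5,6)[OF P] IH fQ)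
    moreover have "algebraic_int (1 - f Q)" by (intro algebraic_int_diff prime_aboveD(1)[OF P fQ]) simp
    then have "algebraic_int ((1 - f Q) * ?b)" by (rule algebraic_int_mult[OF _ IH(2)])
    moreover have "1 - (1 - f Q) * ?b = (1 - ?b) + ?b * f Q" by (simp add: algebra_simps)
    ultimately have "1 - (1 - f Q) * ?b \<in> P \<and> algebraic_int ((1 - f Q) * ?b)" by metis
    then show ?case unfolding prod.insert[OF insert.hyps] .
  qed (use prime_aboveD(2)[OF P] in simp)
  then have 1: "1 - (\<Prod>Q\<in>Qs. 1 - f Q) \<in> P" by blast
  have 2: "1 - (1 - (\<Prod>Q\<in>Qs. 1 - f Q)) \<in> Q" if "Q \<in> Qs" for Q
  proof -
    have "algebraic_int (\<Prod>Q\<in>Qs - {Q}. 1 - f Q)"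
      using f(1) prime_aboveD(1)[OF P] by (intro algebraic_int_prod algebraic_int_diff) auto
    then have "(\<Prod>Q\<in>Qs - {Q}. 1 - f Q) * (1 - f Q) \<in> Q"
      using Q[OF that] f(2)[OF that] prime_aboveD(6) by blast
    then show ?thesis using prod.remove[OF fin that, of "\<lambda>Q. 1 - f Q"] by (simp add: mult.commute)
  qed
  show ?thesis by (rule that[OF 1 2])
qed

section \<open>Primes as centres of embeddings into non-archimedean fields\<close>

definition center :: "('m::field_char_0 \<Rightarrow> 'a::nonarch_field) \<Rightarrow> 'm set" where
  "center \<sigma> = {x. algebraic_int x \<and> absval (\<sigma> x) < 1}"

lemma absval_hom_int:
  fixes \<sigma> :: "'m::field_char_0 \<Rightarrow> 'a::nonarch_field"
  assumes "field_hom \<sigma>" "algebraic_int x"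
  shows "absval (\<sigma> x) \<le> 1"
  using assms field_hom_algebraic_int[OF assms(1)] by (intro absval_algebraic_int) simp

lemma prime_above_center:
  fixes \<sigma> :: "'m::field_char_0 \<Rightarrow> 'a::nonarch_field"
  assumes \<sigma>: "field_hom \<sigma>" and p: "absval (of_nat p :: 'a) < 1"
  shows "prime_above p (center \<sigma>)"
proof -
  interpret s: field_hom \<sigma> by fact
  show ?thesis
    unfolding prime_above_def
  proof (intro conjI ballI allI impI)
    show "center \<sigma> \<subseteq> {x. algebraic_int x}" by (auto simp: center_def)
    show "0 \<in> center \<sigma>" by (simp add: center_def)
    show "1 \<notin> center \<sigma>" by (simp add: center_def)
    show "of_nat p \<in> center \<sigma>" using p by (simp add: center_def algebraic_int_of_nat s.hom_of_nat)
    show "x + y \<in> center \<sigma>" if "x \<in> center \<sigma>" "y \<in> center \<sigma>" for x y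
      using that by (simp add: center_def algebraic_int_add s.hom_add absval_add_less)
    show "a * x \<in> center \<sigma>" if "algebraic_int a" "x \<in> center \<sigma>" for a x
      using that absval_lt_1_mult[OF absval_hom_int[OF \<sigma> that(1)]]
      by (simp add: center_def algebraic_int_mult s.hom_mult)
    show "x \<in> center \<sigma> \<or> y \<in> center \<sigma>" if "algebraic_int x" "algebraic_int y" "x * y \<in> center \<sigma>" for x y
    proof (rule ccontr)
      assume "\<not> (x \<in> center \<sigma> \<or> y \<in> center \<sigma>)"
      then have "absval (\<sigma> x) = 1" "absval (\<sigma> y) = 1"
        using that absval_hom_int[OF \<sigma>] by (auto simp: center_def not_less intro: antisym)
      then show False using that(3) by (simp add: center_def s.hom_mult absval_mult)
    qed
  qed
qed

context primitive_generator
begin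

text \<open>Otherwise an element of \<open>P\<close> congruent to 1 modulo all conjugates of
  the centre of \<open>\<sigma>\<close> would have a norm divisible by \<open>p\<close> but prime to these conjugates.\<close>

lemma prime_above_conjugate:
  fixes \<sigma> :: "'m \<Rightarrow> 'a::nonarch_field"
  assumes \<sigma>: "field_hom \<sigma>" and p: "Factorial_Ring.prime p" "absval (of_nat p :: 'a) < 1" and P: "prime_above p P"
  obtains g where "g \<in> G" "P = center (\<lambda>x. \<sigma> (g x))"
proof -
  have "\<exists>g\<in>G. P = center (\<lambda>x. \<sigma> (g x))"
  proof (rule ccontr)
    assume no: "\<not> (\<exists>g\<in>G. P = center (\<lambda>x. \<sigma> (g x)))"
    have p0: "p > 0" using p(1) by (simp add: prime_gt_0_nat)
    have hom: "field_hom (\<lambda>x. \<sigma> (g x))" if "g \<in> G" for g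
      using field_hom_comp[OF \<sigma>, of g] that by (simp add: gal_eq comp_def)
    define Qs where "Qs = (\<lambda>g. center (\<lambda>x. \<sigma> (g x))) ` G"
    have "finite Qs" using finite_gal by (simp add: Qs_def)
    moreover have "prime_above p Q \<and> Q \<noteq> P" if "Q \<in> Qs" for Q
      using that no prime_above_center[OF hom p(2)] unfolding Qs_def by blast
    ultimately obtain x where x: "x \<in> P" "\<And>Q. Q \<in> Qs \<Longrightarrow> 1 - x \<in> Q"
      using prime_above_crt[OF P p0] by metis
    have xi: "algebraic_int x" by (rule prime_aboveD(1)[OF P x(1)])
    obtain k where k: "(\<Prod>g\<in>G. g x) = of_int k"
      using gal_norm_int[OF xi] by (auto elim: Ints_cases)
    have "algebraic_int (\<Prod>g\<in>G - {id}. g x)" using xi gal_algebraic_int by (intro algebraic_int_prod) blast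
    then have "(\<Prod>g\<in>G - {id}. g x) * x \<in> P" by (rule prime_aboveD(6)[OF P _ x(1)])
    then have "of_int k \<in> P"
      unfolding k[symmetric] using prod.remove[OF finite_gal id_gal, of "\<lambda>g. g x"] by (simp add: mult.commute)
    then have "int p dvd k" by (rule prime_above_int_dvd[OF P p(1)])
    then obtain l where l: "k = int p * l" unfolding dvd_def by blast
    interpret s: field_hom \<sigma> by fact
    have "(\<Prod>g\<in>G. absval (\<sigma> (g x))) = absval (\<sigma> (\<Prod>g\<in>G. g x))" by (simp add: s.hom_prod absval_prod)
    also have "\<dots> = absval (of_int l * of_nat p :: 'a)" unfolding k l by (simp add: s.hom_mult s.hom_of_int s.hom_of_nat mult.commute)
    also have "\<dots> < 1" by (rule absval_lt_1_mult[OF absval_of_int_le_1 p(2)])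
    finally have lt: "(\<Prod>g\<in>G. absval (\<sigma> (g x))) < 1" .
    have "\<exists>g\<in>G. absval (\<sigma> (g x)) < 1"
    proof (rule ccontr)
      assume "\<not> (\<exists>g\<in>G. absval (\<sigma> (g x)) < 1)"
      then have "(\<Prod>g\<in>G. absval (\<sigma> (g x))) \<ge> (\<Prod>g\<in>G. 1)" by (intro prod_mono) auto
      then show False using lt by simp
    qed
    then obtain g where g: "g \<in> G" "absval (\<sigma> (g x)) < 1" by blast
    define Q where "Q = center (\<lambda>x. \<sigma> (g x))"
    have Q: "prime_above p Q" unfolding Q_def by (rule prime_above_center[OF hom[OF g(1)] p(2)])
    have "x \<in> Q" using g(2) xi by (simp add: Q_def center_def)
    moreover have "1 - x \<in> Q" using x(2) g(1) by (simp add: Q_def Qs_def)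
    ultimately have "x + (1 - x) \<in> Q" by (rule prime_aboveD(5)[OF Q])
    then show False using prime_aboveD(3)[OF Q] by simp
  qed
  then show ?thesis using that by blast
qed

text \<open>The degree of this relation does not depend on \<open>x\<close>; this later bounds the
  exponents uniformly by \<open>card A\<close>.\<close>

lemma hom_char_poly_root:
  fixes \<sigma> :: "'m \<Rightarrow> 'a::field_char_0"
  assumes \<sigma>: "field_hom \<sigma>"
  obtains cf where "\<And>i. cf i \<in> \<rat>" "cf (card A) = 1" "(\<Sum>i\<le>card A. cf i * \<sigma> x ^ i) = (0::'a)"
proof -
  interpret s: field_hom \<sigma> by fact
  define f where "f = (\<Prod>g\<in>G. [:- g x, 1:])"
  have deg: "degree f = card A"
    unfolding f_def by (subst degree_prod_sum_eq) (simp_all add: card_gal)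
  have "lead_coeff f = 1" unfolding f_def by (simp add: lead_coeff_prod)
  have "poly f x = 0" unfolding f_def poly_prod using id_gal by (intro prod_zero finite_gal bexI[of _ id]) simp_all
  then have "\<sigma> (\<Sum>i\<le>card A. coeff f i * x ^ i) = 0" by (simp add: poly_altdef deg)
  then have "(\<Sum>i\<le>card A. \<sigma> (coeff f i) * \<sigma> x ^ i) = 0"
    by (simp only: s.hom_sum s.hom_mult s.hom_power)
  moreover have "\<sigma> (coeff f i) \<in> \<rat>" for i
  proof -
    obtain r where "coeff f i = of_rat r" using char_poly_rat[of x i] unfolding f_def by (rule Rats_cases)
    then show ?thesis by (simp add: field_hom_of_rat[OF \<sigma>])
  qed
  moreover have "\<sigma> (coeff f (card A)) = 1" using \<open>lead_coeff f = 1\<close> deg by simp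
  ultimately show ?thesis using that[of "\<lambda>i. \<sigma> (coeff f i)"] by blast
qed

end

locale galois_padic = primitive_generator \<theta> q A + padic_field p T
  for \<theta> :: "'m::field_char_0" and q A and p and T :: "'a::{nonarch_field, complete_space} itself"
begin

lemma hom_absval_power:
  fixes \<sigma> :: "'m \<Rightarrow> 'a"
  assumes \<sigma>: "field_hom \<sigma>" and "x \<noteq> 0"
  obtains k s where "k > 0" "k \<le> card A" "absval (\<sigma> x) ^ k = absval (of_nat p :: 'a) powi s"
proof -
  interpret s: field_hom \<sigma> by fact
  obtain cf where cf: "\<And>i. cf i \<in> \<rat>" "cf (card A) = 1" "(\<Sum>i\<le>card A. cf i * \<sigma> x ^ i) = (0::'a)"
    using hom_char_poly_root[OF \<sigma>] by metis
  have "\<sigma> x \<noteq> 0" using assms(2) by simp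
  then show ?thesis
    using algebraic_absval[OF closure_Rats_closed(5)[OF cf(1)] order.refl _ cf(3)] cf(2) that by (metis one_neq_zero)
qed

lemma hom_unit_power:
  fixes \<sigma> :: "'m \<Rightarrow> 'a"
  assumes \<sigma>: "field_hom \<sigma>" and "absval (\<sigma> x) = 1"
  obtains k where "k > 0" "absval (\<sigma> x ^ k - 1) < 1"
proof -
  obtain cf where cf: "\<And>i. cf i \<in> \<rat>" "cf (card A) = 1" "(\<Sum>i\<le>card A. cf i * \<sigma> x ^ i) = (0::'a)"
    using hom_char_poly_root[OF \<sigma>] by metis
  then show ?thesis
    using algebraic_unit_power[OF closure_Rats_closed(5)[OF cf(1)] order.refl _ cf(3) assms(2)] that by (metis one_neq_zero)
qed

text \<open>A power with exponent at most \<open>card A\<close> has the value of an integral power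
  of \<open>p\<close>, and the exponent of \<open>p\<close> is positive as the value is below 1. The
  elements of a centre thus stay uniformly away from absolute value 1.\<close>

lemma center_absval_bound:
  fixes \<sigma> :: "'m \<Rightarrow> 'a"
  assumes \<sigma>: "field_hom \<sigma>" and "x \<in> center \<sigma>"
  shows "absval (\<sigma> x) ^ card A \<le> absval (of_nat p :: 'a)"
proof (cases "x = 0")
  case True
  interpret s: field_hom \<sigma> by fact
  show ?thesis using True card_A_pos by (simp add: power_0_left)
next
  case False
  interpret s: field_hom \<sigma> by fact
  obtain k s where k: "k > 0" "k \<le> card A" "absval (\<sigma> x) ^ k = absval (of_nat p :: 'a) powi s"
    using hom_absval_power[OF \<sigma> False] .
  have x: "absval (\<sigma> x) < 1" using assms(2) by (simp add: center_def)
  have "s \<ge> 1"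
  proof (rule ccontr)
    assume "\<not> s \<ge> 1"
    then have "absval (of_nat p :: 'a) powi s \<ge> absval (of_nat p :: 'a) powi 0"
      using pv_pos absval_p by (intro power_int_decreasing) auto
    moreover have "absval (\<sigma> x) ^ k < 1" using x k(1) by (simp add: power_less_one_iff)
    ultimately show False using k(3) by simp
  qed
  then have "absval (of_nat p :: 'a) powi s \<le> absval (of_nat p :: 'a) powi 1"
    using pv_pos absval_p by (intro power_int_decreasing) auto
  moreover have "absval (\<sigma> x) ^ card A \<le> absval (\<sigma> x) ^ k" using x k(2) by (intro power_decreasing) auto
  ultimately show ?thesis using k(3) by simp
qed

end

section \<open>Powers of a prime ideal and the order of an element\<close>

lemma ideals_set_one: "\<one>\<^bsub>ideals_set ring_of_integers\<^esub> = {x. algebraic_int x}"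
  by (simp add: ideals_set_def ring_of_integers_def)

lemma ideals_set_power_Suc:
  "P [^]\<^bsub>ideals_set R\<^esub> (Suc n) = ideal_prod R (P [^]\<^bsub>ideals_set R\<^esub> n) P"
  by (simp add: nat_pow_def ideals_set_def)

lemma mult_ring_of_integers: "x \<otimes>\<^bsub>ring_of_integers\<^esub> y = x * y" "x \<oplus>\<^bsub>ring_of_integers\<^esub> y = x + y"
  by (simp_all add: ring_of_integers_def ring_of_type_algebra_def)

lemma ideal_power_subset:
  fixes n :: nat
  assumes P: "prime_above p P" and "a \<in> P [^]\<^bsub>ideals_set ring_of_integers\<^esub> n"
  shows "algebraic_int a" "n > 0 \<Longrightarrow> a \<in> P"
proof -
  have "algebraic_int a \<and> (n > 0 \<longrightarrow> a \<in> P)" using assms(2)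
  proof (induction n arbitrary: a)
    case 0
    then show ?case by (simp add: ideals_set_one)
  next
    case (Suc n)
    from Suc.prems have "a \<in> P" unfolding ideals_set_power_Suc
    proof (induction rule: ideal_prod.induct)
      case (prod i j)
      then show ?case using Suc.IH[of i] prime_aboveD(6)[OF P] by (simp add: mult_ring_of_integers)
    next
      case (sum x y)
      then show ?case using prime_aboveD(5)[OF P] by (simp add: mult_ring_of_integers)
    qed
    then show ?case using prime_aboveD(1)[OF P] by simp
  qed
  then show "algebraic_int a" "n > 0 \<Longrightarrow> a \<in> P" by simp_all
qed

context galois_padic
begin

lemma ideal_power_absval:
  fixes n :: nat and \<sigma> :: "'m \<Rightarrow> 'a"
  assumes \<sigma>: "field_hom \<sigma>" and "a \<in> center \<sigma> [^]\<^bsub>ideals_set ring_of_integers\<^esub> n"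
  shows "absval (\<sigma> a) ^ card A \<le> absval (of_nat p :: 'a) ^ n"
  using assms(2)
proof (induction n arbitrary: a)
  case 0
  then have "absval (\<sigma> a) \<le> 1" using absval_hom_int[OF \<sigma>] by (simp add: ideals_set_one)
  then show ?case by (simp add: power_le_one)
next
  case (Suc n)
  interpret s: field_hom \<sigma> by fact
  from Suc.prems show ?case unfolding ideals_set_power_Suc
  proof (induction rule: ideal_prod.induct)
    case (prod i j)
    have "absval (\<sigma> i) ^ card A * absval (\<sigma> j) ^ card A \<le> absval (of_nat p :: 'a) ^ n * absval (of_nat p :: 'a)"
      by (intro mult_mono Suc.IH[OF prod(1)] center_absval_bound[OF \<sigma> prod(2)]) simp_all
    then show ?case by (simp add: mult_ring_of_integers s.hom_mult absval_mult power_mult_distrib mult.commute)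
  next
    case (sum x y)
    \<comment> \<open>The ultrametric inequality bounds a sum by one of its two terms, so the
      \<open>card A\<close>-th power causes no loss.\<close>
    have "absval (\<sigma> (x + y)) \<le> absval (\<sigma> x) \<or> absval (\<sigma> (x + y)) \<le> absval (\<sigma> y)"
      using absval_add[of "\<sigma> x" "\<sigma> y"] by (auto simp: s.hom_add max_def split: if_splits)
    then have "absval (\<sigma> (x + y)) ^ card A \<le> absval (\<sigma> x) ^ card A \<or> absval (\<sigma> (x + y)) ^ card A \<le> absval (\<sigma> y) ^ card A"
      using power_mono absval_nonneg by blast
    then show ?case using sum by (auto simp: mult_ring_of_integers)
  qed
qed

text \<open>\<open>P\<close> is the centre of some conjugate of \<open>\<sigma>\<close>, and
  elements of high powers of \<open>P\<close> are arbitrarily small there, unlike the fixed nonzero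
  \<open>a\<close>.\<close>

lemma ideal_power_bounded:
  fixes \<sigma> :: "'m \<Rightarrow> 'a" and a :: 'm
  assumes \<sigma>: "field_hom \<sigma>" and P: "prime_above p P" and "a \<noteq> 0"
  obtains B where "\<And>n::nat. a \<in> P [^]\<^bsub>ideals_set ring_of_integers\<^esub> n \<Longrightarrow> n \<le> B"
proof -
  obtain g where g: "g \<in> G" "P = center (\<lambda>x. \<sigma> (g x))"
    using prime_above_conjugate[OF \<sigma> prime_p absval_p P] .
  define \<sigma>' where "\<sigma>' = (\<lambda>x. \<sigma> (g x))"
  have s': "field_hom \<sigma>'" using field_hom_comp[OF \<sigma>, of g] g(1) by (simp add: gal_eq comp_def \<sigma>'_def)
  interpret s: field_hom \<sigma>' by fact
  have "absval (\<sigma>' a) ^ card A > 0" using assms(3) by simp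
  then obtain B where B: "absval (of_nat p :: 'a) ^ B < absval (\<sigma>' a) ^ card A" using pv_power_small by blast
  have "n \<le> B" if "a \<in> P [^]\<^bsub>ideals_set ring_of_integers\<^esub> n" for n :: nat
  proof (rule ccontr)
    assume "\<not> n \<le> B"
    then have "absval (of_nat p :: 'a) ^ n \<le> absval (of_nat p :: 'a) ^ B"
      using pv_pos absval_p by (intro power_decreasing) auto
    then show False using ideal_power_absval[OF s', of a n] that B unfolding g(2) \<sigma>'_def by linarith
  qed
  then show ?thesis using that by blast
qed

text \<open>The bound on the exponents makes \<open>GREATEST\<close> in the definition of
  \<open>ideal_ord\<close> a genuine maximum.\<close>

lemma ideal_ord_properties:
  fixes \<sigma> :: "'m \<Rightarrow> 'a" and a :: 'm
  assumes \<sigma>: "field_hom \<sigma>" and P: "prime_above p P" and a: "a \<noteq> 0" "algebraic_int a"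
  shows "a \<in> P [^]\<^bsub>ideals_set ring_of_integers\<^esub> ideal_ord P a" "ideal_ord P a > 0 \<longleftrightarrow> a \<in> P"
proof -
  obtain B where B: "\<And>n::nat. a \<in> P [^]\<^bsub>ideals_set ring_of_integers\<^esub> n \<Longrightarrow> n \<le> B"
    using ideal_power_bounded[OF \<sigma> P a(1)] by blast
  have 0: "a \<in> P [^]\<^bsub>ideals_set ring_of_integers\<^esub> (0::nat)" using a(2) by (simp add: ideals_set_one)
  show 1: "a \<in> P [^]\<^bsub>ideals_set ring_of_integers\<^esub> ideal_ord P a"
    unfolding ideal_ord_def
    by (rule GreatestI_nat[of "\<lambda>n. a \<in> P [^]\<^bsub>ideals_set ring_of_integers\<^esub> n", OF 0 B])
  show "ideal_ord P a > 0 \<longleftrightarrow> a \<in> P"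
  proof
    show "a \<in> P" if "ideal_ord P a > 0" using ideal_power_subset(2)[OF P 1 that] .
    assume "a \<in> P"
    have "1 \<otimes>\<^bsub>ring_of_integers\<^esub> a \<in> P [^]\<^bsub>ideals_set ring_of_integers\<^esub> (Suc 0)"
      unfolding ideals_set_power_Suc
      by (rule ideal_prod.prod[OF _ \<open>a \<in> P\<close>]) (simp add: ideals_set_one)
    then have "a \<in> P [^]\<^bsub>ideals_set ring_of_integers\<^esub> (Suc 0)" by (simp add: mult_ring_of_integers)
    then have "Suc 0 \<le> ideal_ord P a"
      unfolding ideal_ord_def by (rule Greatest_le_nat[of "\<lambda>n. a \<in> P [^]\<^bsub>ideals_set ring_of_integers\<^esub> n", OF _ B])
    then show "ideal_ord P a > 0" by simp
  qed
qed

end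

lemma ideal_power_gal:
  fixes g :: "'m::field_char_0 \<Rightarrow> 'm" and n :: nat
  assumes "field_hom g" "a \<in> P [^]\<^bsub>ideals_set ring_of_integers\<^esub> n"
  shows "g a \<in> (g ` P) [^]\<^bsub>ideals_set ring_of_integers\<^esub> n"
  using assms(2)
proof (induction n arbitrary: a)
  case 0
  then show ?case by (simp add: ideals_set_one field_hom_algebraic_int[OF assms(1)])
next
  case (Suc n)
  interpret s: field_hom g by fact
  from Suc.prems show ?case unfolding ideals_set_power_Suc
  proof (induction rule: ideal_prod.induct)
    case (prod i j)
    have "g i \<otimes>\<^bsub>ring_of_integers\<^esub> g j \<in> ideal_prod ring_of_integers ((g ` P) [^]\<^bsub>ideals_set ring_of_integers\<^esub> n) (g ` P)"
      by (intro ideal_prod.prod Suc.IH prod(1) imageI prod(2))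
    then show ?case by (simp add: mult_ring_of_integers s.hom_mult)
  next
    case (sum x y)
    then have "g x \<oplus>\<^bsub>ring_of_integers\<^esub> g y \<in> ideal_prod ring_of_integers ((g ` P) [^]\<^bsub>ideals_set ring_of_integers\<^esub> n) (g ` P)"
      by (intro ideal_prod.sum)
    then show ?case by (simp add: mult_ring_of_integers s.hom_add)
  qed
qed

lemma ideal_ord_gal:
  fixes g :: "'m::field_char_0 \<Rightarrow> 'm"
  assumes "g \<in> carrier gal"
  shows "ideal_ord (g ` P) (g a) = ideal_ord P a"
proof -
  have g: "field_hom g" using assms by (simp add: gal_iff)
  define h where "h = inv_into UNIV g"
  have h: "field_hom h" using inv_gal[OF assms] by (simp add: gal_iff h_def)
  have hg: "h (g x) = x" for x using gal_inv_comp(1)[OF assms] by (simp add: h_def fun_eq_iff)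
  have "h ` g ` P = P" by (auto simp: hg image_image)
  then have "g a \<in> (g ` P) [^]\<^bsub>ideals_set ring_of_integers\<^esub> n \<longleftrightarrow> a \<in> P [^]\<^bsub>ideals_set ring_of_integers\<^esub> n" for n :: nat
    using ideal_power_gal[OF g, of a P n] ideal_power_gal[OF h, of "g a" "g ` P" n] hg by metis
  then show ?thesis by (simp add: ideal_ord_def)
qed

section \<open>Comparison of the places given by completions, automorphisms and continuous
  maps\<close>

lemma (in galois_padic) adic_completion_center:
  fixes \<sigma> :: "'m \<Rightarrow> 'a" and \<phi> :: "'m \<Rightarrow> 'k::{nonarch_field, complete_space}"
  assumes \<sigma>: "field_hom \<sigma>" and P: "prime_above p P" and ac: "adic_completion P \<phi>"
  shows "center \<phi> = P"
proof -
  obtain c where c: "0 < c" "c < 1" "\<And>a. algebraic_int a \<Longrightarrow> a \<noteq> 0 \<Longrightarrow> absval (\<phi> a) = c ^ ideal_ord P a"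
    using ac unfolding adic_completion_def by blast
  have f: "field_hom \<phi>" using ac by (simp add: adic_completion_def ring_hom_fld_iff)
  interpret f: field_hom \<phi> by fact
  have "absval (\<phi> a) < 1 \<longleftrightarrow> a \<in> P" if "algebraic_int a" for a
  proof (cases "a = 0")
    case False
    have "c ^ ideal_ord P a < 1 \<longleftrightarrow> ideal_ord P a > 0"
      using c(1,2) by (cases "ideal_ord P a = 0") (simp_all add: power_less_one_iff)
    then show ?thesis using ideal_ord_properties(2)[OF \<sigma> P False that] c(3)[OF that False] by simp
  qed (use prime_aboveD(2)[OF P] in simp)
  then show ?thesis using prime_aboveD(1)[OF P] by (auto simp: center_def)
qed

lemma absval_hom_quotient:
  fixes f :: "'b::field \<Rightarrow> 'a::nonarch_field"
  assumes "field_hom f" "b \<noteq> 0"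
  shows "absval (f (a / b)) < 1 \<longleftrightarrow> absval (f a) < absval (f b)"
proof -
  interpret f: field_hom f by fact
  have "absval (f (a / b)) = absval (f a) / absval (f b)"
    by (simp add: divide_inverse f.hom_mult f.hom_inverse absval_mult absval_inverse)
  moreover have "absval (f b) > 0" using assms(2) by simp
  ultimately show ?thesis by (simp add: pos_divide_less_eq)
qed

text \<open>The two absolute values may use different constants, so only the condition of being
  below 1 is compared. For a quotient of integers it is an inequality of orders, which the
  automorphism preserves.\<close>

lemma (in primitive_generator) adic_completion_gal:
  fixes \<phi> \<phi>' :: "'m \<Rightarrow> 'k::{nonarch_field, complete_space}"
  assumes ac: "adic_completion P \<phi>" "adic_completion P' \<phi>'" and g: "g \<in> G" "g ` P = P'"
  shows "absval (\<phi> x) < 1 \<longleftrightarrow> absval (\<phi>' (g x)) < 1"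
proof (cases "x = 0")
  case False
  obtain c where c: "0 < c" "c < 1" "\<And>a. algebraic_int a \<Longrightarrow> a \<noteq> 0 \<Longrightarrow> absval (\<phi> a) = c ^ ideal_ord P a"
    using ac(1) unfolding adic_completion_def by blast
  obtain c' where c': "0 < c'" "c' < 1" "\<And>a. algebraic_int a \<Longrightarrow> a \<noteq> 0 \<Longrightarrow> absval (\<phi>' a) = c' ^ ideal_ord P' a"
    using ac(2) unfolding adic_completion_def by blast
  have f: "field_hom \<phi>" "field_hom \<phi>'" using ac by (simp_all add: adic_completion_def ring_hom_fld_iff)
  have fg: "field_hom g" using g(1) by (simp add: gal_iff)
  interpret f: field_hom \<phi> by fact
  interpret f': field_hom \<phi>' by fact
  interpret g: field_hom g by fact
  obtain d :: int where d: "d \<noteq> 0" "algebraic_int (of_int d * x)" using integer_denominator .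
  define a where "a = of_int d * x"
  define b where "b = (of_int d :: 'm)"
  have ab: "algebraic_int a" "a \<noteq> 0" "algebraic_int b" "b \<noteq> 0" using d False by (simp_all add: a_def b_def)
  have x: "x = a / b" using d by (simp add: a_def b_def)
  have gab: "algebraic_int (g a)" "g a \<noteq> 0" "algebraic_int (g b)" "g b \<noteq> 0"
    using ab gal_algebraic_int[OF g(1)] by simp_all
  have "absval (\<phi> x) < 1 \<longleftrightarrow> absval (\<phi> a) < absval (\<phi> b)"
    unfolding x by (rule absval_hom_quotient[OF f(1) ab(4)])
  also have "\<dots> \<longleftrightarrow> ideal_ord P b < ideal_ord P a"
    using c by (simp add: c(3) ab power_strict_decreasing_iff)
  also have "\<dots> \<longleftrightarrow> ideal_ord P' (g b) < ideal_ord P' (g a)"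
    using ideal_ord_gal[OF g(1)] g(2) by metis
  also have "\<dots> \<longleftrightarrow> absval (\<phi>' (g a)) < absval (\<phi>' (g b))"
    using c' by (simp add: c'(3) ab gab power_strict_decreasing_iff)
  also have "\<dots> \<longleftrightarrow> absval (\<phi>' (g x)) < 1"
    using absval_hom_quotient[OF f(2) gab(4), of "g a"] by (simp add: x divide_inverse g.hom_mult g.hom_inverse)
  finally show ?thesis .
next
  case True
  interpret f: field_hom \<phi> using ac(1) by (simp add: adic_completion_def ring_hom_fld_iff)
  interpret f': field_hom \<phi>' using ac(2) by (simp add: adic_completion_def ring_hom_fld_iff)
  interpret g: field_hom g using g(1) by (simp add: gal_iff)
  show ?thesis using True by simp
qed

text \<open>Being smaller than 1 means that the powers tend to zero, which a continuous map
  preserves. For the converse, absolute value above 1 is treated by inversion, and absolute value 1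
  by a power close to 1, whose image stays close to 1.\<close>

lemma (in galois_padic) continuous_hom_absval:
  fixes \<phi> :: "'m \<Rightarrow> 'a" and j :: "'a \<Rightarrow> 'c::nonarch_field"
  assumes \<phi>: "field_hom \<phi>" and j: "field_hom (\<lambda>x. j (\<phi> x))" and cont: "continuous_on (closure (range \<phi>)) j"
  shows "absval (\<phi> x) < 1 \<longleftrightarrow> absval (j (\<phi> x)) < 1"
proof -
  interpret f: field_hom \<phi> by fact
  interpret j: field_hom "\<lambda>x. j (\<phi> x)" by fact
  have j0: "j 0 = 0" and j1: "j 1 = 1" using j.hom_zero j.hom_one by simp_all
  have 1: "absval (j (\<phi> x)) < 1" if "absval (\<phi> x) < 1" for x
  proof (rule ccontr)
    assume not: "\<not> absval (j (\<phi> x)) < 1"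
    have "(\<lambda>n. absval (\<phi> x) ^ n) \<longlonglongrightarrow> 0" using that by (intro LIMSEQ_power_zero) simp
    then have lim: "(\<lambda>n. \<phi> (x ^ n)) \<longlonglongrightarrow> 0" unfolding tendsto_absval_iff by (simp add: absval_power f.hom_power)
    have cl: "\<phi> (x ^ n) \<in> closure (range \<phi>)" for n by (rule subsetD[OF closure_subset rangeI])
    have cl0: "0 \<in> closure (range \<phi>)" using subsetD[OF closure_subset rangeI[of \<phi> 0]] by simp
    have "(\<lambda>n. j (\<phi> (x ^ n))) \<longlonglongrightarrow> j 0"
      by (rule continuous_on_tendsto_compose[OF cont lim cl0]) (rule always_eventually[OF allI[OF cl]])
    then have "(\<lambda>n. absval (j (\<phi> x)) ^ n) \<longlonglongrightarrow> 0" unfolding tendsto_absval_iff j0 by (simp add: absval_power j.hom_power)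
    then have "\<forall>\<^sub>F n in sequentially. absval (j (\<phi> x)) ^ n < 1" by (rule order_tendstoD) simp
    then obtain n where "absval (j (\<phi> x)) ^ n < 1" using eventually_happens by force
    moreover have "absval (j (\<phi> x)) ^ n \<ge> 1" using not by (intro one_le_power) simp
    ultimately show False by simp
  qed
  moreover have "absval (\<phi> x) < 1" if jx: "absval (j (\<phi> x)) < 1"
  proof (rule ccontr)
    assume "\<not> absval (\<phi> x) < 1"
    then consider "absval (\<phi> x) > 1" | "absval (\<phi> x) = 1" by linarith
    then show False
    proof cases
      case 1
      then have "absval (\<phi> (inverse x)) < 1" by (simp add: f.hom_inverse absval_inverse inverse_less_1_iff)
      then have "absval (j (\<phi> (inverse x))) < 1" by (rule \<open>\<And>x. absval (\<phi> x) < 1 \<Longrightarrow> absval (j (\<phi> x)) < 1\<close>)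
      then have "absval (j (\<phi> (x * inverse x))) < 1"
        using jx absval_lt_1_mult[of "j (\<phi> x)" "j (\<phi> (inverse x))"] by (simp only: j.hom_mult)
      moreover have "x \<noteq> 0" using 1 by auto
      ultimately show False by (simp add: j1)
    next
      case 2
      obtain k where k: "k > 0" "absval (\<phi> x ^ k - 1) < 1" using hom_unit_power[OF \<phi> 2] .
      then have "absval (\<phi> (x ^ k - 1)) < 1" by (simp add: f.hom_power f.hom_minus)
      then have "absval (j (\<phi> (x ^ k - 1))) < 1" by (rule \<open>\<And>x. absval (\<phi> x) < 1 \<Longrightarrow> absval (j (\<phi> x)) < 1\<close>)
      then have "absval (j (\<phi> x) ^ k - 1) < 1" by (simp only: j.hom_minus j.hom_power j.hom_one)
      moreover have "absval (j (\<phi> x) ^ k) < 1" using jx k(1) by (simp add: absval_power power_less_one_iff)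
      ultimately have "absval (j (\<phi> x) ^ k - (j (\<phi> x) ^ k - 1)) < 1" by (rule absval_diff_less[rotated])
      then show False by simp
    qed
  qed
  ultimately show ?thesis by blast
qed

lemma (in padic_field) lg_padic_power:
  assumes x: "absval (x - 1 :: 'a) < 1" and a: "a \<in> closure \<int>"
  shows "lg (padic_power x a) = a * lg x"
proof -
  obtain s :: "nat \<Rightarrow> nat" where s: "(\<lambda>n. of_nat (s n)) \<longlonglongrightarrow> a" using closure_Ints_nat_seq[OF a] .
  have "(\<lambda>n. lg (x ^ s n)) \<longlonglongrightarrow> lg (padic_power x a)"
    by (rule lg_continuous[OF principal_power[OF x] padic_power_limit[OF x s]])
  moreover have "(\<lambda>n. of_nat (s n) * lg x) \<longlonglongrightarrow> a * lg x" by (intro tendsto_intros s)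
  ultimately show ?thesis using LIMSEQ_unique by (simp add: lg_power[OF x])
qed

lemma (in padic_field) lg_prod:
  "(\<And>i. i \<in> I \<Longrightarrow> absval (f i - 1 :: 'a) < 1) \<Longrightarrow> lg (\<Prod>i\<in>I. f i) = (\<Sum>i\<in>I. lg (f i)) \<and> absval ((\<Prod>i\<in>I. f i) - 1) < 1"
proof (induction I rule: infinite_finite_induct)
  case (insert i I)
  then show ?case using lg_mult[of "f i" "prod f I"] principal_mult[of "f i" "prod f I"] by simp
qed (simp_all add: lg_1)

text \<open>Two embeddings of a field that define the same place extend to isomorphic completions.\<close>

locale twin = s: padic_field p S + t: padic_field p T
  for p and S :: "'a::{nonarch_field, complete_space} itself" and T :: "'c::{nonarch_field, complete_space} itself" +
  fixes \<phi> :: "'m::field_char_0 \<Rightarrow> 'a" and \<psi> :: "'m \<Rightarrow> 'c"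
  assumes hom: "field_hom \<phi>" "field_hom \<psi>" and less_1: "\<And>x. absval (\<phi> x) < 1 \<longleftrightarrow> absval (\<psi> x) < 1"
begin

sublocale f: field_hom \<phi> by (rule hom)
sublocale g: field_hom \<psi> by (rule hom)

abbreviation "K \<equiv> closure (range \<phi>)"

lemma twin_sym: "twin p \<psi> \<phi>"
  by unfold_locales (simp add: less_1)

text \<open>Division by a power of \<open>p\<close> reduces these balls to the unit ball. As their
  radii shrink to zero, both embeddings induce the same topology.\<close>

lemma less_power: "absval (\<phi> x) < absval (of_nat p :: 'a) ^ N \<longleftrightarrow> absval (\<psi> x) < absval (of_nat p :: 'c) ^ N"
proof -
  have p: "(of_nat p :: 'm) ^ N \<noteq> 0" using s.p_gt_1 by simp
  show ?thesis
    using less_1[of "x / of_nat p ^ N"] absval_hom_quotient[OF hom(1) p, of x] absval_hom_quotient[OF hom(2) p, of x]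
    by (simp add: f.hom_power g.hom_power f.hom_of_nat g.hom_of_nat absval_power)
qed

lemma eventually_small:
  assumes "e > 0"
  obtains d where "d > 0" "\<And>x. absval (\<phi> x) < d \<Longrightarrow> absval (\<psi> x) < e"
proof -
  obtain N where "absval (of_nat p :: 'c) ^ N < e" using t.pv_power_small[OF assms] .
  then show ?thesis using that[of "absval (of_nat p :: 'a) ^ N"] s.pv_pos less_power by (meson less_trans zero_less_power)
qed

lemma Cauchy_transfer:
  assumes "Cauchy (\<lambda>n. \<phi> (x n))"
  shows "Cauchy (\<lambda>n. \<psi> (x n))"
  unfolding t.Cauchy_absval
proof (intro allI impI)
  fix e :: real assume "e > 0"
  then obtain d where d: "d > 0" "\<And>x. absval (\<phi> x) < d \<Longrightarrow> absval (\<psi> x) < e" using eventually_small by blast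
  obtain M where M: "\<And>m n. m \<ge> M \<Longrightarrow> n \<ge> M \<Longrightarrow> absval (\<phi> (x m) - \<phi> (x n)) < d"
    using assms d(1) unfolding s.Cauchy_absval by blast
  have "absval (\<psi> (x m) - \<psi> (x n)) < e" if "m \<ge> M" "n \<ge> M" for m n
    using d(2)[of "x m - x n"] M[OF that] by (simp add: f.hom_minus g.hom_minus)
  then show "\<exists>M. \<forall>m\<ge>M. \<forall>n\<ge>M. absval (\<psi> (x m) - \<psi> (x n)) < e" by blast
qed

lemma null_transfer:
  assumes "(\<lambda>n. \<phi> (x n)) \<longlonglongrightarrow> 0"
  shows "(\<lambda>n. \<psi> (x n)) \<longlonglongrightarrow> 0"
proof (rule metric_LIMSEQ_I)
  fix e :: real assume "e > 0"
  then obtain d where d: "d > 0" "\<And>x. absval (\<phi> x) < d \<Longrightarrow> absval (\<psi> x) < e" using eventually_small by blast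
  obtain M where "\<And>n. n \<ge> M \<Longrightarrow> absval (\<phi> (x n)) < d"
    using metric_LIMSEQ_D[OF assms d(1)] by (auto simp: dist_absval)
  then show "\<exists>M. \<forall>n\<ge>M. dist (\<psi> (x n)) 0 < e" using d(2) by (auto simp: dist_absval)
qed

text \<open>Meaningful on \<open>K\<close> only: elsewhere no sequence converges to
  \<open>y\<close>, and nothing is known about the value.\<close>

definition ext :: "'a \<Rightarrow> 'c" where
  "ext y = (THE z. \<forall>x. (\<lambda>n. \<phi> (x n)) \<longlonglongrightarrow> y \<longrightarrow> (\<lambda>n. \<psi> (x n)) \<longlonglongrightarrow> z)"

lemma ext_limit:
  assumes x: "(\<lambda>n. \<phi> (x n)) \<longlonglongrightarrow> y"
  shows "(\<lambda>n. \<psi> (x n)) \<longlonglongrightarrow> ext y"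
proof -
  obtain z where z: "(\<lambda>n. \<psi> (x n)) \<longlonglongrightarrow> z"
    using Cauchy_transfer[OF LIMSEQ_imp_Cauchy[OF x]] Cauchy_convergent convergent_def by blast
  have *: "(\<lambda>n. \<psi> (w n)) \<longlonglongrightarrow> z" if w: "(\<lambda>n. \<phi> (w n)) \<longlonglongrightarrow> y" for w
  proof -
    have "(\<lambda>n. \<phi> (w n - x n)) \<longlonglongrightarrow> 0" using tendsto_diff[OF w x] by (simp add: f.hom_minus)
    from tendsto_add[OF null_transfer[OF this] z] show ?thesis by (simp add: g.hom_minus)
  qed
  have "ext y = z"
    unfolding ext_def
  proof (rule the_equality)
    show "z' = z" if "\<forall>x. (\<lambda>n. \<phi> (x n)) \<longlonglongrightarrow> y \<longrightarrow> (\<lambda>n. \<psi> (x n)) \<longlonglongrightarrow> z'" for z'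
      using that x z LIMSEQ_unique by blast
  qed (use * in blast)
  then show ?thesis using z by simp
qed

lemma K_seq:
  assumes "y \<in> K"
  obtains x where "(\<lambda>n. \<phi> (x n)) \<longlonglongrightarrow> y"
proof -
  obtain u where u: "\<And>n. u n \<in> range \<phi>" "u \<longlonglongrightarrow> y" using assms unfolding closure_sequential by blast
  then obtain x where "\<And>n. u n = \<phi> (x n)" unfolding image_def by (auto) metis
  then have "u = (\<lambda>n. \<phi> (x n))" by blast
  then show ?thesis using that u(2) by simp
qed

lemma K_limit: "(\<lambda>n. \<phi> (x n)) \<longlonglongrightarrow> y \<Longrightarrow> y \<in> K"
  unfolding closure_sequential by (intro exI[of _ "\<lambda>n. \<phi> (x n)"]) simp

lemma ext_hom: "ext (\<phi> x) = \<psi> x"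
  using ext_limit[of "\<lambda>_. x" "\<phi> x"] LIMSEQ_unique tendsto_const by blast

lemma K_hom: "\<phi> x \<in> K" by (rule subsetD[OF closure_subset rangeI])

lemma ext_of_nat: "ext (of_nat n) = of_nat n" and ext_1: "ext 1 = 1" and ext_0: "ext 0 = 0"
  using ext_hom[of "of_nat n"] ext_hom[of 1] ext_hom[of 0] by (simp_all add: f.hom_of_nat g.hom_of_nat)

lemma K_1: "1 \<in> K" and K_0: "0 \<in> K"
  using K_hom[of 1] K_hom[of 0] by simp_all

lemma K_add: "x \<in> K \<Longrightarrow> y \<in> K \<Longrightarrow> x + y \<in> K"
  and K_mult: "x \<in> K \<Longrightarrow> y \<in> K \<Longrightarrow> x * y \<in> K"
  and K_diff: "x \<in> K \<Longrightarrow> y \<in> K \<Longrightarrow> x - y \<in> K"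
  and ext_add: "x \<in> K \<Longrightarrow> y \<in> K \<Longrightarrow> ext (x + y) = ext x + ext y"
  and ext_mult: "x \<in> K \<Longrightarrow> y \<in> K \<Longrightarrow> ext (x * y) = ext x * ext y"
  and ext_diff: "x \<in> K \<Longrightarrow> y \<in> K \<Longrightarrow> ext (x - y) = ext x - ext y"
proof -
  assume xy: "x \<in> K" "y \<in> K"
  obtain u where u: "(\<lambda>n. \<phi> (u n)) \<longlonglongrightarrow> x" using K_seq[OF xy(1)] .
  obtain v where v: "(\<lambda>n. \<phi> (v n)) \<longlonglongrightarrow> y" using K_seq[OF xy(2)] .
  have a: "(\<lambda>n. \<phi> (u n + v n)) \<longlonglongrightarrow> x + y" using tendsto_add[OF u v] by (simp add: f.hom_add)
  have m: "(\<lambda>n. \<phi> (u n * v n)) \<longlonglongrightarrow> x * y" using tendsto_mult[OF u v] by (simp add: f.hom_mult)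
  have d: "(\<lambda>n. \<phi> (u n - v n)) \<longlonglongrightarrow> x - y" using tendsto_diff[OF u v] by (simp add: f.hom_minus)
  show "x + y \<in> K" "x * y \<in> K" "x - y \<in> K" by (rule K_limit[OF a], rule K_limit[OF m], rule K_limit[OF d])
  have "(\<lambda>n. \<psi> (u n + v n)) \<longlonglongrightarrow> ext x + ext y"
    using tendsto_add[OF ext_limit[OF u] ext_limit[OF v]] by (simp add: g.hom_add)
  then show "ext (x + y) = ext x + ext y" using ext_limit[OF a] LIMSEQ_unique by blast
  have "(\<lambda>n. \<psi> (u n * v n)) \<longlonglongrightarrow> ext x * ext y"
    using tendsto_mult[OF ext_limit[OF u] ext_limit[OF v]] by (simp add: g.hom_mult)
  then show "ext (x * y) = ext x * ext y" using ext_limit[OF m] LIMSEQ_unique by blast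
  have "(\<lambda>n. \<psi> (u n - v n)) \<longlonglongrightarrow> ext x - ext y"
    using tendsto_diff[OF ext_limit[OF u] ext_limit[OF v]] by (simp add: g.hom_minus)
  then show "ext (x - y) = ext x - ext y" using ext_limit[OF d] LIMSEQ_unique by blast
qed

lemma ext_less_power:
  assumes "y \<in> K"
  shows "absval (ext y) < absval (of_nat p :: 'c) ^ N \<longleftrightarrow> absval y < absval (of_nat p :: 'a) ^ N"
proof -
  obtain x where x: "(\<lambda>n. \<phi> (x n)) \<longlonglongrightarrow> y" using K_seq[OF assms] .
  have close: "absval a < e \<longleftrightarrow> absval b < e" if "absval (a - b) < e" for a b :: "'b::nonarch_field" and e
    using absval_add_less[of "a - b" e b] absval_diff_less[of a e "a - b"] that by auto
  have pos: "absval (of_nat p :: 'a) ^ N > 0" "absval (of_nat p :: 'c) ^ N > 0" using s.pv_pos t.pv_pos by simp_all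
  obtain M1 where M1: "\<And>n. n \<ge> M1 \<Longrightarrow> absval (\<phi> (x n) - y) < absval (of_nat p :: 'a) ^ N"
    using metric_LIMSEQ_D[OF x pos(1)] by (auto simp: dist_absval)
  obtain M2 where M2: "\<And>n. n \<ge> M2 \<Longrightarrow> absval (\<psi> (x n) - ext y) < absval (of_nat p :: 'c) ^ N"
    using metric_LIMSEQ_D[OF ext_limit[OF x] pos(2)] by (auto simp: dist_absval)
  show ?thesis
    using close[OF M1[of "max M1 M2"]] close[OF M2[of "max M1 M2"]] less_power[of "x (max M1 M2)" N] by simp
qed

lemma ext_less_1: "y \<in> K \<Longrightarrow> absval (ext y) < 1 \<longleftrightarrow> absval y < 1"
  using ext_less_power[of y 0] by simp

lemma ext_principal: "y \<in> K \<Longrightarrow> absval (ext y - 1) < 1 \<longleftrightarrow> absval (y - 1) < 1"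
  using ext_less_1[of "y - 1"] by (simp add: K_diff K_1 ext_diff ext_1)

lemma ext_eq_0:
  assumes "y \<in> K" "ext y = 0"
  shows "y = 0"
proof (rule ccontr)
  assume "y \<noteq> 0"
  then obtain N where "absval (of_nat p :: 'a) ^ N < absval y" using s.pv_power_small absval_pos_iff by metis
  then show False using ext_less_power[OF assms(1), of N] assms(2) t.pv_pos by simp
qed

lemma ext_inject: "x \<in> K \<Longrightarrow> y \<in> K \<Longrightarrow> ext x = ext y \<Longrightarrow> x = y"
  using ext_eq_0[of "x - y"] by (simp add: K_diff ext_diff)

lemma ext_continuous:
  assumes y: "\<And>n. y n \<in> K" "y \<longlonglongrightarrow> z" "z \<in> K"
  shows "(\<lambda>n. ext (y n)) \<longlonglongrightarrow> ext z"
proof (rule metric_LIMSEQ_I)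
  fix e :: real assume "e > 0"
  then obtain N where N: "absval (of_nat p :: 'c) ^ N < e" using t.pv_power_small by blast
  have "absval (of_nat p :: 'a) ^ N > 0" using s.pv_pos by simp
  from metric_LIMSEQ_D[OF y(2) this]
  obtain M where M: "\<And>n. n \<ge> M \<Longrightarrow> absval (y n - z) < absval (of_nat p :: 'a) ^ N" by (auto simp: dist_absval)
  have "absval (ext (y n) - ext z) < e" if "n \<ge> M" for n
    using ext_less_power[of "y n - z" N] M[OF that] N by (simp add: K_diff y ext_diff)
  then show "\<exists>M. \<forall>n\<ge>M. dist (ext (y n)) (ext z) < e" by (auto simp: dist_absval)
qed

lemma ext_power: "y \<in> K \<Longrightarrow> y ^ n \<in> K \<and> ext (y ^ n) = ext y ^ n"
  by (induction n) (simp_all add: K_1 ext_1 K_mult ext_mult)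

lemma ext_prod: "(\<And>i. i \<in> I \<Longrightarrow> f i \<in> K) \<Longrightarrow> (\<Prod>i\<in>I. f i) \<in> K \<and> ext (\<Prod>i\<in>I. f i) = (\<Prod>i\<in>I. ext (f i))"
  by (induction I rule: infinite_finite_induct) (simp_all add: K_1 ext_1 K_mult ext_mult)

lemma ext_of_nat_limit: "(\<lambda>n. of_nat (s n)) \<longlonglongrightarrow> a \<Longrightarrow> (\<lambda>n. of_nat (s n)) \<longlonglongrightarrow> ext a"
  using ext_limit[of "\<lambda>n. of_nat (s n)" a] by (simp add: f.hom_of_nat g.hom_of_nat)

lemma ext_closure_Ints:
  assumes "a \<in> closure \<int>"
  shows "a \<in> K" "ext a \<in> closure \<int>"
proof -
  obtain s :: "nat \<Rightarrow> nat" where s: "(\<lambda>n. of_nat (s n)) \<longlonglongrightarrow> a" using s.closure_Ints_nat_seq[OF assms] .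
  show "a \<in> K" using K_limit[of "\<lambda>n. of_nat (s n)" a] s by (simp add: f.hom_of_nat)
  show "ext a \<in> closure \<int>" using t.of_nat_limit_in_closure_Ints[OF ext_of_nat_limit[OF s]] .
qed

lemma ext_closure_Ints_surj:
  assumes "b \<in> closure \<int>"
  obtains a where "a \<in> closure \<int>" "ext a = b"
proof -
  obtain s :: "nat \<Rightarrow> nat" where s: "(\<lambda>n. of_nat (s n)) \<longlonglongrightarrow> b" using t.closure_Ints_nat_seq[OF assms] .
  have "Cauchy (\<lambda>n. \<psi> (of_nat (s n)))" using LIMSEQ_imp_Cauchy[OF s] by (simp add: g.hom_of_nat)
  then have "Cauchy (\<lambda>n. \<phi> (of_nat (s n)))" by (rule twin.Cauchy_transfer[OF twin_sym])
  then have "Cauchy (\<lambda>n. of_nat (s n) :: 'a)" by (simp add: f.hom_of_nat)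
  then obtain a :: 'a where a: "(\<lambda>n. of_nat (s n)) \<longlonglongrightarrow> a" using Cauchy_convergent convergent_def by blast
  have "ext a = b" using ext_of_nat_limit[OF a] s LIMSEQ_unique by blast
  then show ?thesis using that s.of_nat_limit_in_closure_Ints[OF a] by blast
qed

lemma ext_padic_power:
  assumes x: "x \<in> K" "absval (x - 1) < 1" and a: "a \<in> closure \<int>"
  shows "padic_power x a \<in> K" "ext (padic_power x a) = padic_power (ext x) (ext a)"
proof -
  obtain s :: "nat \<Rightarrow> nat" where s: "(\<lambda>n. of_nat (s n)) \<longlonglongrightarrow> a" using s.closure_Ints_nat_seq[OF a] .
  have l: "(\<lambda>n. x ^ s n) \<longlonglongrightarrow> padic_power x a" by (rule s.padic_power_limit[OF x(2) s])
  have xK: "x ^ k \<in> K" for k using ext_power[OF x(1)] by blast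
  show K: "padic_power x a \<in> K"
    by (rule closed_sequentially[OF closed_closure xK l])
  have "(\<lambda>n. ext (x ^ s n)) \<longlonglongrightarrow> ext (padic_power x a)" by (rule ext_continuous[OF xK l K])
  then have "(\<lambda>n. ext x ^ s n) \<longlonglongrightarrow> ext (padic_power x a)" using ext_power[OF x(1)] by simp
  moreover have "(\<lambda>n. ext x ^ s n) \<longlonglongrightarrow> padic_power (ext x) (ext a)"
    using x by (intro t.padic_power_limit ext_of_nat_limit s) (simp add: ext_principal)
  ultimately show "ext (padic_power x a) = padic_power (ext x) (ext a)" using LIMSEQ_unique by blast
qed

end

section \<open>Algebraic independence and linear algebra\<close>

abbreviation eval_monom :: "(nat \<Rightarrow> 'a::field_char_0) \<Rightarrow> (nat \<Rightarrow>\<^sub>0 nat) \<Rightarrow> 'a" where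
  "eval_monom x m \<equiv> \<Prod>i\<in>Poly_Mapping.keys m. x i ^ Poly_Mapping.lookup m i"

lemma eval_monom_superset:
  assumes "finite I" "Poly_Mapping.keys m \<subseteq> I"
  shows "eval_monom x m = (\<Prod>i\<in>I. x i ^ Poly_Mapping.lookup m i)"
  using assms by (intro prod.mono_neutral_left) (auto simp: in_keys_iff)

lemma eval_monom_add: "eval_monom x (m + m') = eval_monom x m * eval_monom x m'"
proof -
  define I where "I = Poly_Mapping.keys m \<union> Poly_Mapping.keys m'"
  have "finite I" "Poly_Mapping.keys m \<subseteq> I" "Poly_Mapping.keys m' \<subseteq> I" "Poly_Mapping.keys (m + m') \<subseteq> I"
    using Poly_Mapping.keys_add[of m m'] by (auto simp: I_def)
  then show ?thesis
    using eval_monom_superset[of I m x] eval_monom_superset[of I m' x] eval_monom_superset[of I "m + m'" x]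
    by (simp only: lookup_add power_add prod.distrib)
qed

lemma eval_mpoly_superset:
  assumes "finite I" "Poly_Mapping.keys f \<subseteq> I"
  shows "eval_mpoly x f = (\<Sum>m\<in>I. of_rat (Poly_Mapping.lookup f m) * eval_monom x m)"
  unfolding eval_mpoly_def using assms by (intro sum.mono_neutral_left) (auto simp: in_keys_iff)

lemma eval_mpoly_add: "eval_mpoly x (f + g) = eval_mpoly x f + eval_mpoly x g"
proof -
  define I where "I = Poly_Mapping.keys f \<union> Poly_Mapping.keys g"
  have "finite I" "Poly_Mapping.keys f \<subseteq> I" "Poly_Mapping.keys g \<subseteq> I" "Poly_Mapping.keys (f + g) \<subseteq> I"
    using Poly_Mapping.keys_add[of f g] by (auto simp: I_def)
  then show ?thesis
    using eval_mpoly_superset[of I _ x] by (simp add: lookup_add of_rat_add distrib_right sum.distrib)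
qed

lemma eval_mpoly_0: "eval_mpoly x 0 = 0"
  by (simp add: eval_mpoly_def)

lemma eval_mpoly_sum: "eval_mpoly x (\<Sum>i\<in>I. f i) = (\<Sum>i\<in>I. eval_mpoly x (f i))"
  by (induction I rule: infinite_finite_induct) (simp_all add: eval_mpoly_0 eval_mpoly_add)

lemma eval_mpoly_single: "eval_mpoly x (Poly_Mapping.single m c) = of_rat c * eval_monom x m"
  using eval_mpoly_superset[of "{m}" "Poly_Mapping.single m c" x] by (simp add: lookup_single)

lemma sum_single: "(\<Sum>m\<in>Poly_Mapping.keys f. Poly_Mapping.single m (Poly_Mapping.lookup f m)) = f"
proof (rule poly_mapping_eqI)
  fix k
  have "Poly_Mapping.lookup (\<Sum>m\<in>Poly_Mapping.keys f. Poly_Mapping.single m (Poly_Mapping.lookup f m)) k =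
    (\<Sum>m\<in>Poly_Mapping.keys f. if m = k then Poly_Mapping.lookup f m else 0)"
    by (simp add: lookup_sum lookup_single when_def)
  also have "\<dots> = Poly_Mapping.lookup f k" by (simp add: in_keys_iff)
  finally show "Poly_Mapping.lookup (\<Sum>m\<in>Poly_Mapping.keys f. Poly_Mapping.single m (Poly_Mapping.lookup f m)) k =
    Poly_Mapping.lookup f k" .
qed

lemma eval_mpoly_mult: "eval_mpoly x (f * g) = eval_mpoly x f * eval_mpoly x g"
proof -
  have "f * g = (\<Sum>m\<in>Poly_Mapping.keys f. \<Sum>m'\<in>Poly_Mapping.keys g.
      Poly_Mapping.single (m + m') (Poly_Mapping.lookup f m * Poly_Mapping.lookup g m'))"
    using arg_cong2[OF sum_single[of f, symmetric] sum_single[of g, symmetric], of "(*)"]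
    by (simp only: sum_product mult_single)
  then have "eval_mpoly x (f * g) = (\<Sum>m\<in>Poly_Mapping.keys f. \<Sum>m'\<in>Poly_Mapping.keys g.
      (of_rat (Poly_Mapping.lookup f m) * eval_monom x m) * (of_rat (Poly_Mapping.lookup g m') * eval_monom x m'))"
    by (simp add: eval_mpoly_sum eval_mpoly_single eval_monom_add of_rat_mult mult_ac)
  then show ?thesis by (simp add: eval_mpoly_def sum_product)
qed

text \<open>Pairs of values of one polynomial at two points: what is nonzero at a rational point stays
  nonzero at algebraically independent arguments.\<close>

definition mpoly_values :: "nat \<Rightarrow> (nat \<Rightarrow> 'a::field_char_0) \<Rightarrow> (nat \<Rightarrow> 'b::field_char_0) \<Rightarrow> ('a \<times> 'b) set" where
  "mpoly_values n x y = {(eval_mpoly x f, eval_mpoly y f) |f. \<forall>m\<in>Poly_Mapping.keys f. Poly_Mapping.keys m \<subseteq> {..<n}}"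

lemma mpoly_values_add:
  assumes "(a, b) \<in> mpoly_values n x y" "(a', b') \<in> mpoly_values n x y"
  shows "(a + a', b + b') \<in> mpoly_values n x y"
proof -
  obtain f g where "a = eval_mpoly x f" "b = eval_mpoly y f" "\<forall>m\<in>Poly_Mapping.keys f. Poly_Mapping.keys m \<subseteq> {..<n}"
    "a' = eval_mpoly x g" "b' = eval_mpoly y g" "\<forall>m\<in>Poly_Mapping.keys g. Poly_Mapping.keys m \<subseteq> {..<n}"
    using assms unfolding mpoly_values_def by blast
  then show ?thesis unfolding mpoly_values_def
    using Poly_Mapping.keys_add[of f g] by (auto simp: eval_mpoly_add intro!: exI[of _ "f + g"])
qed

lemma mpoly_values_mult:
  assumes "(a, b) \<in> mpoly_values n x y" "(a', b') \<in> mpoly_values n x y"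
  shows "(a * a', b * b') \<in> mpoly_values n x y"
proof -
  obtain f g where fg: "a = eval_mpoly x f" "b = eval_mpoly y f" "\<forall>m\<in>Poly_Mapping.keys f. Poly_Mapping.keys m \<subseteq> {..<n}"
    "a' = eval_mpoly x g" "b' = eval_mpoly y g" "\<forall>m\<in>Poly_Mapping.keys g. Poly_Mapping.keys m \<subseteq> {..<n}"
    using assms unfolding mpoly_values_def by blast
  have "Poly_Mapping.keys m \<subseteq> {..<n}" if m: "m \<in> Poly_Mapping.keys (f * g)" for m
  proof -
    obtain u v where "m = u + v" "u \<in> Poly_Mapping.keys f" "v \<in> Poly_Mapping.keys g"
      by (use subsetD[OF keys_mult m] in blast)
    then show ?thesis using fg(3,6) Poly_Mapping.keys_add[of u v] by blast
  qed
  then show ?thesis unfolding mpoly_values_def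
    using fg by (auto simp: eval_mpoly_mult intro!: exI[of _ "f * g"])
qed

lemma mpoly_values_of_rat: "(of_rat c, of_rat c) \<in> mpoly_values n x y"
  unfolding mpoly_values_def
  by (rule CollectI, rule exI[of _ "Poly_Mapping.single 0 c"]) (auto simp: eval_mpoly_single)

lemma mpoly_values_of_int: "(of_int c, of_int c) \<in> mpoly_values n x y"
  using mpoly_values_of_rat[of "of_int c"] by simp

lemma mpoly_values_var:
  assumes "i < n"
  shows "(x i, y i) \<in> mpoly_values n x y"
  unfolding mpoly_values_def
  using assms
  by (intro CollectI exI[of _ "Poly_Mapping.single (Poly_Mapping.single i 1) 1"]) (auto simp: eval_mpoly_single)

lemma mpoly_values_sum:
  "(\<And>i. i \<in> I \<Longrightarrow> (a i, b i) \<in> mpoly_values n x y) \<Longrightarrow> (\<Sum>i\<in>I. a i, \<Sum>i\<in>I. b i) \<in> mpoly_values n x y"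
proof (induction I rule: infinite_finite_induct)
  case (insert i I)
  then show ?case using mpoly_values_add[of "a i" "b i" n x y "sum a I" "sum b I"] by simp
qed (use mpoly_values_of_int[of 0 n x y] in simp_all)

lemma mpoly_values_prod:
  "(\<And>i. i \<in> I \<Longrightarrow> (a i, b i) \<in> mpoly_values n x y) \<Longrightarrow> (\<Prod>i\<in>I. a i, \<Prod>i\<in>I. b i) \<in> mpoly_values n x y"
proof (induction I rule: infinite_finite_induct)
  case (insert i I)
  then show ?case using mpoly_values_mult[of "a i" "b i" n x y "prod a I" "prod b I"] by simp
qed (use mpoly_values_of_int[of 1 n x y] in simp_all)

text \<open>By the Leibniz formula the determinant is one polynomial expression in the entries,
  evaluated at both points.\<close>

lemma mpoly_values_det:
  assumes "\<And>i j. i < d \<Longrightarrow> j < d \<Longrightarrow> (a i j, b i j) \<in> mpoly_values n x y"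
  shows "(det (mat d d (\<lambda>(i, j). a i j)), det (mat d d (\<lambda>(i, j). b i j))) \<in> mpoly_values n x y"
proof -
  have *: "det (mat d d (\<lambda>(i, j). c i j)) = (\<Sum>\<pi> | \<pi> permutes {0..<d}. of_int (sign \<pi>) * (\<Prod>i=0..<d. c i (\<pi> i)))"
    for c :: "nat \<Rightarrow> nat \<Rightarrow> 'z::field_char_0"
  proof -
    have "(\<Prod>i=0..<d. mat d d (\<lambda>(i, j). c i j) $$ (i, \<pi> i)) = (\<Prod>i=0..<d. c i (\<pi> i))" if "\<pi> permutes {0..<d}" for \<pi>
      using permutes_in_image[OF that] by (intro prod.cong) auto
    then show ?thesis unfolding det_def'[OF mat_carrier] by (intro sum.cong) auto
  qed
  show ?thesis
    unfolding *
  proof (intro mpoly_values_sum mpoly_values_mult mpoly_values_of_int mpoly_values_prod)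
    fix \<pi> i assume "\<pi> \<in> {\<pi>. \<pi> permutes {0..<d}}" "i \<in> {0..<d}"
    then show "(a i (\<pi> i), b i (\<pi> i)) \<in> mpoly_values n x y"
      using permutes_in_image[of \<pi> "{0..<d}" i] assms by simp
  qed
qed

lemma alg_independent_nonzero:
  assumes "alg_independent n x" "(a, b) \<in> mpoly_values n x y" "b \<noteq> 0"
  shows "a \<noteq> 0"
proof
  assume "a = 0"
  obtain f where f: "a = eval_mpoly x f" "b = eval_mpoly y f" "\<forall>m\<in>Poly_Mapping.keys f. Poly_Mapping.keys m \<subseteq> {..<n}"
    using assms(2) unfolding mpoly_values_def by blast
  then have "f = 0" using assms(1) \<open>a = 0\<close> unfolding alg_independent_def by metis
  then show False using f(2) assms(3) by (simp add: eval_mpoly_0)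
qed

text \<open>Specialising all variables to \<open>-1\<close> turns the matrix into \<open>(k + 1) I - J\<close>, where \<open>J\<close> is the
  all-ones matrix.\<close>

lemma alg_independent_matrix:
  fixes x :: "nat \<Rightarrow> 'a::field_char_0"
  assumes x: "alg_independent k x" and d: "d \<le> k" and f: "\<And>i j. i < d \<Longrightarrow> j < d \<Longrightarrow> i \<noteq> j \<Longrightarrow> f i j < k"
    and v: "\<And>i. i < d \<Longrightarrow> (\<Sum>j<d. (if i = j then - (\<Sum>l<k. x l) else x (f i j)) * v j) = 0" and "j < d"
  shows "v j = 0"
proof -
  define a where "a = (\<lambda>i j. if i = j then - (\<Sum>l<k. x l) else x (f i j))"
  define y where "y = (\<lambda>i::nat. - 1 :: rat)"
  define b where "b = (\<lambda>i j. if i = j then - (\<Sum>l<k. y l) else y (f i j))"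
  let ?A = "mat d d (\<lambda>(i, j). a i j)" and ?B = "mat d d (\<lambda>(i, j). b i j)"
  have neg: "(- s, - t) \<in> mpoly_values k x y" if "(s, t) \<in> mpoly_values k x y" for s t
    using mpoly_values_mult[OF mpoly_values_of_int[of "- 1"] that] by simp
  have "(a i j, b i j) \<in> mpoly_values k x y" if "i < d" "j < d" for i j
  proof (cases "i = j")
    case True
    then show ?thesis unfolding a_def b_def
      using neg[OF mpoly_values_sum[of "{..<k}" x y k x y, OF mpoly_values_var]] by simp
  next
    case False
    then show ?thesis using mpoly_values_var[OF f[OF that False]] by (simp add: a_def b_def)
  qed
  then have det: "(det ?A, det ?B) \<in> mpoly_values k x y" by (rule mpoly_values_det)
  have "det ?B \<noteq> 0"
  proof
    assume "det ?B = 0"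
    then obtain w where w: "w \<in> carrier_vec d" "w \<noteq> 0\<^sub>v d" "?B *\<^sub>v w = 0\<^sub>v d"
      using det_0_iff_vec_prod_zero_field[of ?B d] by auto
    define s where "s = (\<Sum>j<d. w $ j)"
    have e: "w $ i * of_nat (k + 1) = s" if "i < d" for i
    proof -
      have "0 = (?B *\<^sub>v w) $ i" using that w(3) by simp
      also have "\<dots> = (\<Sum>j<d. b i j * w $ j)"
        using that w(1) by (simp add: scalar_prod_def lessThan_atLeast0)
      also have "\<dots> = (\<Sum>j<d. (if i = j then of_nat (k + 1) * w $ j else 0) - w $ j)"
        by (intro sum.cong) (auto simp: b_def y_def algebra_simps)
      also have "\<dots> = of_nat (k + 1) * w $ i - s" using that by (simp add: sum_subtractf s_def)
      finally show ?thesis by (simp add: mult.commute)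
    qed
    \<comment> \<open>Every entry of a kernel vector is \<open>s / (k + 1)\<close>; adding up the
      \<open>d\<close> entries gives \<open>(k + 1 - d) s = 0\<close>, while
      \<open>d \<le> k\<close>.\<close>
    have "s * of_nat (k + 1) = (\<Sum>i<d. w $ i * of_nat (k + 1))" by (simp add: s_def sum_distrib_right)
    also have "\<dots> = of_nat d * s" using e by simp
    finally have "s * of_int (int k + 1 - int d) = 0" by (simp add: algebra_simps)
    moreover have "int k + 1 - int d \<noteq> 0" using d by simp
    ultimately have "s = 0" by (metis mult_eq_0_iff of_int_eq_0_iff)
    then have "w $ i = 0" if "i < d" for i using e[OF that] by (metis mult_eq_0_iff of_nat_eq_0_iff add_is_0 one_neq_zero)
    then have "w = 0\<^sub>v d" using w(1) by (intro eq_vecI) auto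
    then show False using w(2) by simp
  qed
  then have A: "det ?A \<noteq> 0" by (rule alg_independent_nonzero[OF x det])
  have "?A *\<^sub>v vec d v = 0\<^sub>v d"
    using v by (intro eq_vecI) (simp_all add: scalar_prod_def lessThan_atLeast0 a_def)
  then have "vec d v = 0\<^sub>v d" using A det_0_iff_vec_prod_zero_field[of ?A d] vec_carrier[of d v] mat_carrier[of d d] by metis
  then have "vec d v $ j = 0" using \<open>j < d\<close> by simp
  then show ?thesis using \<open>j < d\<close> by simp
qed

text \<open>Gaussian elimination by induction on the number of equations. The solution is kept in
  the subfield \<open>F\<close>, which is a set, because the trace will be applied to its
  entries.\<close>

lemma nontrivial_solution:
  fixes c :: "'s \<Rightarrow> 'i \<Rightarrow> 'a::field" and F :: "'a set"
  assumes F: "0 \<in> F" "1 \<in> F" "\<And>x y. x \<in> F \<Longrightarrow> y \<in> F \<Longrightarrow> x - y \<in> F" "\<And>x y. x \<in> F \<Longrightarrow> y \<in> F \<Longrightarrow> x * y \<in> F"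
    "\<And>x. x \<in> F \<Longrightarrow> inverse x \<in> F"
    and "finite S" "finite I" "card S < card I" "\<And>s i. s \<in> S \<Longrightarrow> i \<in> I \<Longrightarrow> c s i \<in> F"
  shows "\<exists>a. (\<forall>i\<in>I. a i \<in> F) \<and> (\<exists>i\<in>I. a i \<noteq> 0) \<and> (\<forall>s\<in>S. (\<Sum>i\<in>I. a i * c s i) = 0)"
  using assms(6-)
proof (induction S arbitrary: I c rule: finite_induct)
  case empty
  then show ?case using F(2) by (intro exI[of _ "\<lambda>_. 1"]) (auto simp: card_gt_0_iff)
next
  case (insert s S)
  have sum_F: "(\<Sum>i\<in>J. h i) \<in> F" if "\<And>i. i \<in> J \<Longrightarrow> h i \<in> F" for J and h :: "'i \<Rightarrow> 'a"
    using that
  proof (induction J rule: infinite_finite_induct)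
    case (insert j J)
    have "h j - (0 - (\<Sum>i\<in>J. h i)) \<in> F" by (intro F(1,3) insert.prems insert.IH insertI1 insertI2)
    then show ?case using insert.hyps by simp
  qed (use F(1) in simp_all)
  show ?case
  proof (cases "\<forall>i\<in>I. c s i = 0")
    case True
    then show ?thesis using insert.IH[of I c] insert.prems insert.hyps by auto
  next
    case False
    then obtain i0 where i0: "i0 \<in> I" "c s i0 \<noteq> 0" by blast
    define q where "q = (\<lambda>i. c s i * inverse (c s i0))"
    have q: "q i \<in> F" if "i \<in> I" for i using that i0 insert.prems(3) by (simp add: q_def F(4,5))
    define I' where "I' = I - {i0}"
    have I': "finite I'" "card S < card I'" using insert.prems(1,2) insert.hyps i0(1) by (simp_all add: I'_def)
    have c': "c t i - c t i0 * q i \<in> F" if "t \<in> S" "i \<in> I'" for t i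
      using that i0(1) by (intro F(3,4) insert.prems(3) q) (auto simp: I'_def)
    have "\<exists>a. (\<forall>i\<in>I'. a i \<in> F) \<and> (\<exists>i\<in>I'. a i \<noteq> 0) \<and> (\<forall>t\<in>S. (\<Sum>i\<in>I'. a i * (c t i - c t i0 * q i)) = 0)"
      by (rule insert.IH[OF I' c'])
    then obtain a where "(\<forall>i\<in>I'. a i \<in> F) \<and> (\<exists>i\<in>I'. a i \<noteq> 0) \<and> (\<forall>t\<in>S. (\<Sum>i\<in>I'. a i * (c t i - c t i0 * q i)) = 0)"
      by (rule exE)
    then have a: "\<And>i. i \<in> I' \<Longrightarrow> a i \<in> F" "\<exists>i\<in>I'. a i \<noteq> 0" "\<And>t. t \<in> S \<Longrightarrow> (\<Sum>i\<in>I'. a i * (c t i - c t i0 * q i)) = 0"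
      by simp_all
    \<comment> \<open>The value at the pivot \<open>i0\<close> makes equation \<open>s\<close> hold;
      substituting it turns the other equations into the reduced ones that \<open>a\<close>
      solves.\<close>
    define a' where "a' = a(i0 := 0 - (\<Sum>i\<in>I'. a i * q i))"
    have split: "(\<Sum>i\<in>I. a' i * c t i) = (\<Sum>i\<in>I'. a i * c t i) - (\<Sum>i\<in>I'. a i * q i) * c t i0" for t
    proof -
      have "(\<Sum>i\<in>I. a' i * c t i) = a' i0 * c t i0 + (\<Sum>i\<in>I'. a' i * c t i)"
        unfolding I'_def by (rule sum.remove[OF insert.prems(1) i0(1)])
      moreover have "(\<Sum>i\<in>I'. a' i * c t i) = (\<Sum>i\<in>I'. a i * c t i)"
        by (intro sum.cong) (auto simp: a'_def I'_def)
      ultimately show ?thesis by (simp add: a'_def)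
    qed
    have "(\<Sum>i\<in>I. a' i * c t i) = 0" if "t \<in> insert s S" for t
    proof (cases "t = s")
      case True
      have "(\<Sum>i\<in>I'. a i * q i) * c s i0 = (\<Sum>i\<in>I'. a i * c s i)"
        unfolding sum_distrib_right using i0(2) by (intro sum.cong) (simp_all add: q_def)
      then show ?thesis unfolding split True by simp
    next
      case False
      then have "(\<Sum>i\<in>I'. a i * (c t i - c t i0 * q i)) = 0" using a(3) that by blast
      then show ?thesis unfolding split by (simp add: algebra_simps sum_subtractf sum_distrib_left)
    qed
    moreover have "a' i \<in> F" if "i \<in> I" for i
    proof -
      have "0 - (\<Sum>i\<in>I'. a i * q i) \<in> F" using a(1) q by (intro F(1,3,4) sum_F) (auto simp: I'_def)
      then show ?thesis using that a(1) by (auto simp: a'_def I'_def)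
    qed
    moreover have "\<exists>i\<in>I. a' i \<noteq> 0" using a(2) by (auto simp: a'_def I'_def)
    ultimately show ?thesis by blast
  qed
qed

section \<open>The module of limits of units\<close>

lemma closure_range_hom:
  fixes \<phi> :: "'m::field_char_0 \<Rightarrow> 'a::nonarch_field"
  assumes "field_hom \<phi>"
  shows "\<phi> x \<in> closure (range \<phi>)" "0 \<in> closure (range \<phi>)" "1 \<in> closure (range \<phi>)"
    "a \<in> closure (range \<phi>) \<Longrightarrow> b \<in> closure (range \<phi>) \<Longrightarrow> a + b \<in> closure (range \<phi>)"
    "a \<in> closure (range \<phi>) \<Longrightarrow> b \<in> closure (range \<phi>) \<Longrightarrow> a * b \<in> closure (range \<phi>)"
    "a \<in> closure (range \<phi>) \<Longrightarrow> b \<in> closure (range \<phi>) \<Longrightarrow> a - b \<in> closure (range \<phi>)"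
    "a \<in> closure (range \<phi>) \<Longrightarrow> inverse a \<in> closure (range \<phi>)"
proof -
  interpret f: field_hom \<phi> by fact
  show c: "\<phi> x \<in> closure (range \<phi>)" for x by (rule subsetD[OF closure_subset rangeI])
  show "0 \<in> closure (range \<phi>)" using c[of 0] by simp
  show "1 \<in> closure (range \<phi>)" using c[of 1] by simp
  have r: "x + y \<in> range \<phi>" "x * y \<in> range \<phi>" "- x \<in> range \<phi>" "inverse x \<in> range \<phi>"
    if "x \<in> range \<phi>" "y \<in> range \<phi>" for x y
  proof -
    from that obtain v w where "x = \<phi> v" "y = \<phi> w" by (elim rangeE)
    then show "x + y \<in> range \<phi>" "x * y \<in> range \<phi>" "- x \<in> range \<phi>" "inverse x \<in> range \<phi>"
      using rangeI[of \<phi> "v + w"] rangeI[of \<phi> "v * w"] rangeI[of \<phi> "- v"] rangeI[of \<phi> "inverse v"]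
      by (simp_all add: f.hom_add f.hom_mult f.hom_uminus f.hom_inverse)
  qed
  show add: "a + b \<in> closure (range \<phi>)" if "a \<in> closure (range \<phi>)" "b \<in> closure (range \<phi>)" for a b
    by (rule closure_add[OF _ that]) (rule r(1))
  show "a * b \<in> closure (range \<phi>)" if "a \<in> closure (range \<phi>)" "b \<in> closure (range \<phi>)"
    by (rule closure_mult[OF _ that]) (rule r(2))
  show "a - b \<in> closure (range \<phi>)" if "a \<in> closure (range \<phi>)" "b \<in> closure (range \<phi>)"
    using add[OF that(1) closure_uminus[OF _ that(2)]] r(3) by simp
  show "inverse a \<in> closure (range \<phi>)" if "a \<in> closure (range \<phi>)"
    by (rule closure_inverse[OF _ that]) (rule r(4))
qed

lemma local_integers_simps:
  "carrier (local_integers \<phi>) = {x \<in> closure (range \<phi>). absval x \<le> 1}"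
  "x \<otimes>\<^bsub>local_integers \<phi>\<^esub> y = x * y"
  by (simp_all add: local_integers_def local_field_def ring_of_type_algebra_def)

context galois_padic
begin

text \<open>A fixed power of every nonzero absolute value up to 1 in the completion is a power of
  \<open>absval p\<close> with a natural exponent. A smallest exponent therefore belongs to a
  largest absolute value below 1.\<close>

lemma uniformizer_exists:
  fixes \<phi> :: "'m \<Rightarrow> 'a"
  assumes \<phi>: "field_hom \<phi>"
  obtains \<pi> where "uniformizer \<phi> \<pi>"
proof -
  \<comment> \<open>The factorial is a multiple of all exponents up to \<open>card A\<close> that
    \<open>hom_absval_power\<close> may return.\<close>
  define N where "N = (fact (card A) :: nat)"
  interpret f: field_hom \<phi> by fact
  have ex: "\<exists>s. absval y ^ N = absval (of_nat p :: 'a) ^ s" if y: "y \<in> closure (range \<phi>)" "y \<noteq> 0" "absval y \<le> 1" for y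
  proof -
    obtain z where "z \<in> range \<phi>" "absval (z - y) < absval y" using closure_approx[OF y(1), of "absval y"] y(2) by auto
    then obtain x where "absval (\<phi> x - y) < absval y" by (elim rangeE) simp
    then have x: "absval (\<phi> x) = absval y" by (rule absval_eq_if_close)
    then have "x \<noteq> 0" using y(2) by auto
    obtain k s where k: "k > 0" "k \<le> card A" "absval (\<phi> x) ^ k = absval (of_nat p :: 'a) powi s"
      using hom_absval_power[OF \<phi> \<open>x \<noteq> 0\<close>] .
    have "s \<ge> 0"
    proof (rule ccontr)
      assume "\<not> s \<ge> 0"
      then have "absval (of_nat p :: 'a) powi s > absval (of_nat p :: 'a) powi 0"
        using pv_pos absval_p by (intro power_int_strict_decreasing) auto
      moreover have "absval (\<phi> x) ^ k \<le> 1" using x y(3) by (simp add: power_le_one)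
      ultimately show False using k(3) by simp
    qed
    then have k': "absval (\<phi> x) ^ k = absval (of_nat p :: 'a) ^ nat s" using k(3) by (simp add: power_int_def)
    have "k dvd N" unfolding N_def using k(1,2) by (intro dvd_fact) auto
    then obtain l where "N = k * l" unfolding dvd_def by blast
    then have "absval y ^ N = absval (of_nat p :: 'a) ^ (nat s * l)" using k' x by (simp add: power_mult)
    then show ?thesis by blast
  qed
  define V where "V = {y \<in> closure (range \<phi>). y \<noteq> 0 \<and> absval y < 1}"
  have "of_nat p \<in> V"
    using closure_range_hom(1)[OF \<phi>, of "of_nat p"] absval_p pv_pos by (simp add: V_def f.hom_of_nat)
  define e :: "'a \<Rightarrow> nat" where "e y = (SOME s. absval y ^ N = absval (of_nat p :: 'a) ^ s)" for y
  have e: "absval y ^ N = absval (of_nat p :: 'a) ^ e y" if "y \<in> V" for y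
    using someI_ex[OF ex[of y]] that by (simp add: V_def e_def)
  obtain \<pi> where \<pi>: "\<pi> \<in> V" "\<And>y. y \<in> V \<Longrightarrow> e \<pi> \<le> e y"
    using ex_has_least_nat[of "\<lambda>y. y \<in> V", OF \<open>of_nat p \<in> V\<close>, of e] by blast
  have max: "absval y \<le> absval \<pi>" if "y \<in> V" for y
  proof -
    have "absval y ^ N \<le> absval \<pi> ^ N"
      unfolding e[OF that] e[OF \<pi>(1)] using pv_pos absval_p \<pi>(2)[OF that] by (intro power_decreasing) auto
    moreover have "N > 0" by (simp add: N_def)
    ultimately show ?thesis by (simp add: power_mono_iff)
  qed
  have "uniformizer \<phi> \<pi>"
    unfolding uniformizer_def cgenideal_def local_integers_simps
  proof (intro conjI equalityI subsetI)
    show "\<pi> \<in> {x \<in> closure (range \<phi>). absval x \<le> 1}" using \<pi>(1) by (simp add: V_def)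
  next
    fix x assume "x \<in> {x * \<pi> |x. x \<in> {x \<in> closure (range \<phi>). absval x \<le> 1}}"
    then obtain y where y: "x = y * \<pi>" "y \<in> closure (range \<phi>)" "absval y \<le> 1" by blast
    then show "x \<in> {x \<in> {x \<in> closure (range \<phi>). absval x \<le> 1}. absval x < 1}"
      using \<pi>(1) closure_range_hom(5)[OF \<phi> y(2)] absval_lt_1_mult[OF y(3)] by (simp add: V_def less_imp_le)
  next
    fix x assume "x \<in> {x \<in> {x \<in> closure (range \<phi>). absval x \<le> 1}. absval x < 1}"
    then have x: "x \<in> closure (range \<phi>)" "absval x < 1" by simp_all
    have "absval x \<le> absval \<pi>" using max[of x] x by (cases "x = 0") (simp_all add: V_def)
    moreover have "\<pi> \<noteq> 0" "\<pi> \<in> closure (range \<phi>)" using \<pi>(1) by (simp_all add: V_def)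
    ultimately have "absval (x * inverse \<pi>) \<le> 1" "x = (x * inverse \<pi>) * \<pi>"
      by (simp_all add: absval_mult absval_inverse absval_divide divide_le_eq_1_pos flip: divide_inverse)
    moreover have "x * inverse \<pi> \<in> closure (range \<phi>)"
      using \<pi>(1) by (intro closure_range_hom(5,7)[OF \<phi>] x(1)) (simp add: V_def)
    ultimately show "x \<in> {x * \<pi> |x. x \<in> {x \<in> closure (range \<phi>). absval x \<le> 1}}" by blast
  qed
  then show ?thesis by (rule that)
qed

text \<open>A uniformizer generates the elements smaller than 1, so its choice disappears and a
  condition on the distance to 1 remains.\<close>

lemma principal_units_eq:
  fixes \<phi> :: "'m \<Rightarrow> 'a"
  assumes \<phi>: "field_hom \<phi>"
  shows "principal_units \<phi> = {x \<in> closure (range \<phi>). absval (x - 1) < 1}"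
proof (intro equalityI subsetI)
  fix x assume "x \<in> principal_units \<phi>"
  then obtain \<pi> y where *: "uniformizer \<phi> \<pi>" "y \<in> carrier (local_integers \<phi>)" "x = 1 + \<pi> * y"
    unfolding principal_units_def by blast
  have y: "y \<in> closure (range \<phi>)" "absval y \<le> 1" using *(2) by (simp_all add: local_integers_simps)
  have "1 * \<pi> \<in> PIdl\<^bsub>local_integers \<phi>\<^esub> \<pi>"
    unfolding cgenideal_def local_integers_simps using closure_range_hom(3)[OF \<phi>] by force
  then have \<pi>: "\<pi> \<in> closure (range \<phi>)" "absval \<pi> < 1"
    using *(1) unfolding uniformizer_def by (simp_all add: local_integers_simps)
  show "x \<in> {x \<in> closure (range \<phi>). absval (x - 1) < 1}"
    using absval_lt_1_mult[OF y(2) \<pi>(2)] closure_range_hom(3,4,5)[OF \<phi>] y(1) \<pi>(1) by (simp add: *(3) mult.commute)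
next
  fix x assume "x \<in> {x \<in> closure (range \<phi>). absval (x - 1) < 1}"
  then have x: "x \<in> closure (range \<phi>)" "absval (x - 1) < 1" by simp_all
  obtain \<pi> where \<pi>: "uniformizer \<phi> \<pi>" using uniformizer_exists[OF \<phi>] .
  have "x - 1 \<in> {x \<in> carrier (local_integers \<phi>). absval x < 1}"
    using x closure_range_hom(3,6)[OF \<phi>] by (simp add: local_integers_simps)
  then have "x - 1 \<in> PIdl\<^bsub>local_integers \<phi>\<^esub> \<pi>" using \<pi> by (simp add: uniformizer_def)
  then obtain y where "y \<in> carrier (local_integers \<phi>)" "x - 1 = y * \<pi>"
    unfolding cgenideal_def local_integers_simps by blast
  moreover from this(2) have "x = 1 + \<pi> * y" by (simp add: algebra_simps)
  ultimately show "x \<in> principal_units \<phi>" using \<pi> unfolding principal_units_def by blast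
qed

end

section \<open>The closure of the units as a module over the \<open>p\<close>-adic integers\<close>

locale local_units = galois_padic \<theta> q A p T
  for \<theta> :: "'m::field_char_0" and q A p and T :: "'k::{nonarch_field, complete_space} itself" +
  fixes \<Gamma> :: "'m set set" and \<iota> :: "'m set \<Rightarrow> 'm \<Rightarrow> 'k"
  assumes finite_\<Gamma>: "finite \<Gamma>" and \<iota>_hom: "P \<in> \<Gamma> \<Longrightarrow> field_hom (\<iota> P)"
begin

abbreviation "Y \<equiv> Y_group \<Gamma> \<iota>"

lemma Y_iff: "u \<in> Y \<longleftrightarrow> u \<in> Units ring_of_integers \<and> (\<forall>P\<in>\<Gamma>. absval (\<iota> P u - 1) < 1)"
  using closure_range_hom(1)[OF \<iota>_hom] by (auto simp: Y_group_def diag_def principal_units_eq[OF \<iota>_hom] PiE_iff)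

lemma approx_principal:
  assumes R: "x \<in> extensional \<Gamma> \<and> (\<forall>e>0. \<exists>u\<in>Y. \<forall>P\<in>\<Gamma>. absval (\<iota> P u - x P) < e)" and P: "P \<in> \<Gamma>"
  shows "x P \<in> closure (range (\<iota> P))" "absval (x P - 1) < 1"
proof -
  show "x P \<in> closure (range (\<iota> P))"
    unfolding closure_approachable dist_absval using R P by (meson rangeI)
  have "\<exists>u\<in>Y. \<forall>P\<in>\<Gamma>. absval (\<iota> P u - x P) < 1" using R by simp
  then obtain u where u: "u \<in> Y" "absval (\<iota> P u - x P) < 1" using P by blast
  have "absval ((\<iota> P u - 1) - (\<iota> P u - x P)) < 1" using u P Y_iff[of u] by (intro absval_diff_less[OF _ u(2)]) simp
  then show "absval (x P - 1) < 1" by simp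
qed

text \<open>With finitely many factors every product neighbourhood contains a box of a single
  radius, so the closure consists of the points that one unit approximates at all primes
  simultaneously.\<close>

lemma closure_diag_Y_iff:
  "x \<in> closure_diag_Y \<Gamma> \<iota> \<longleftrightarrow> x \<in> extensional \<Gamma> \<and> (\<forall>e>0. \<exists>u\<in>Y. \<forall>P\<in>\<Gamma>. absval (\<iota> P u - x P) < e)"
  (is "_ \<longleftrightarrow> ?R")
proof -
  define U where "U P = principal_units (\<iota> P)" for P
  have U: "U P = {x \<in> closure (range (\<iota> P)). absval (x - 1) < 1}" if "P \<in> \<Gamma>" for P
    using principal_units_eq[OF \<iota>_hom[OF that]] by (simp add: U_def)
  have iY: "\<iota> P u \<in> U P" if "u \<in> Y" "P \<in> \<Gamma>" for u P
    using that Y_iff[of u] closure_range_hom(1)[OF \<iota>_hom[OF that(2)]] by (simp add: U)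
  let ?X = "product_topology (\<lambda>P. top_of_set (U P)) \<Gamma>"
  have def: "closure_diag_Y \<Gamma> \<iota> = ?X closure_of (diag \<Gamma> \<iota> ` Y)" by (simp add: closure_diag_Y_def U_def)
  have top: "topspace ?X = (\<Pi>\<^sub>E P\<in>\<Gamma>. U P)" by simp
  show ?thesis
  proof
    assume "x \<in> closure_diag_Y \<Gamma> \<iota>"
    then have x: "x \<in> (\<Pi>\<^sub>E P\<in>\<Gamma>. U P)" "\<And>T. x \<in> T \<Longrightarrow> openin ?X T \<Longrightarrow> \<exists>y. y \<in> diag \<Gamma> \<iota> ` Y \<and> y \<in> T"
      unfolding def in_closure_of top by blast+
    have "\<exists>u\<in>Y. \<forall>P\<in>\<Gamma>. absval (\<iota> P u - x P) < e" if "e > 0" for e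
    proof -
      let ?T = "\<Pi>\<^sub>E P\<in>\<Gamma>. U P \<inter> ball (x P) e"
      have "openin ?X ?T"
        unfolding openin_PiE[OF finite_\<Gamma>] by (intro disjI2 ballI openin_open_Int open_ball)
      moreover have "x \<in> ?T" using x(1) that by (auto simp: PiE_iff)
      ultimately obtain y where y: "y \<in> diag \<Gamma> \<iota> ` Y" "y \<in> ?T" using x(2) by metis
      then obtain u where u: "u \<in> Y" "y = diag \<Gamma> \<iota> u" by blast
      have "absval (\<iota> P u - x P) < e" if "P \<in> \<Gamma>" for P
        using y(2) that unfolding u(2) by (auto simp: PiE_iff diag_def dist_absval absval_minus_commute)
      then show ?thesis using u(1) by blast
    qed
    then show ?R using x(1) by (simp add: PiE_iff)
  next
    assume R: ?R
    have xU: "x P \<in> U P" if "P \<in> \<Gamma>" for P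
      using approx_principal[OF R that] by (simp add: U[OF that])
    have "\<exists>y. y \<in> diag \<Gamma> \<iota> ` Y \<and> y \<in> W" if W: "x \<in> W" "openin ?X W" for W
    proof -
      obtain V where V: "\<And>P. P \<in> \<Gamma> \<Longrightarrow> openin (top_of_set (U P)) (V P)" "x \<in> (\<Pi>\<^sub>E P\<in>\<Gamma>. V P)" "(\<Pi>\<^sub>E P\<in>\<Gamma>. V P) \<subseteq> W"
        using W unfolding openin_product_topology_alt by meson
      have "\<exists>e>0. \<forall>z\<in>U P. absval (z - x P) < e \<longrightarrow> z \<in> V P" if P: "P \<in> \<Gamma>" for P
      proof -
        have "x P \<in> V P" using V(2) P by auto
        then show ?thesis using V(1)[OF P] unfolding openin_euclidean_subtopology_iff dist_absval by blast
      qed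
      then obtain e where e: "\<And>P. P \<in> \<Gamma> \<Longrightarrow> e P > 0" "\<And>P z. P \<in> \<Gamma> \<Longrightarrow> z \<in> U P \<Longrightarrow> absval (z - x P) < e P \<Longrightarrow> z \<in> V P"
        by metis
      define e0 where "e0 = Min (insert 1 (e ` \<Gamma>))"
      have "e0 > 0" using finite_\<Gamma> e(1) by (simp add: e0_def)
      then obtain u where u: "u \<in> Y" "\<And>P. P \<in> \<Gamma> \<Longrightarrow> absval (\<iota> P u - x P) < e0" using R by metis
      have "\<iota> P u \<in> V P" if P: "P \<in> \<Gamma>" for P
      proof (rule e(2)[OF P iY[OF u(1) P]])
        have "e0 \<le> e P" unfolding e0_def using finite_\<Gamma> P by (intro Min_le) auto
        then show "absval (\<iota> P u - x P) < e P" using u(2)[OF P] by linarith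
      qed
      then have "diag \<Gamma> \<iota> u \<in> W" using V(3) by (auto simp: diag_def)
      then show ?thesis using u(1) by blast
    qed
    moreover have "x \<in> (\<Pi>\<^sub>E P\<in>\<Gamma>. U P)" using R xU by (simp add: PiE_iff)
    ultimately show "x \<in> closure_diag_Y \<Gamma> \<iota>" unfolding def in_closure_of top by blast
  qed
qed

lemma closure_diag_Y_D:
  assumes "x \<in> closure_diag_Y \<Gamma> \<iota>"
  shows "x \<in> extensional \<Gamma>" "P \<in> \<Gamma> \<Longrightarrow> x P \<in> closure (range (\<iota> P))" "P \<in> \<Gamma> \<Longrightarrow> absval (x P - 1) < 1"
    "e > 0 \<Longrightarrow> \<exists>u\<in>Y. \<forall>P\<in>\<Gamma>. absval (\<iota> P u - x P) < e"
proof -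
  note x = assms[unfolded closure_diag_Y_iff]
  show "x \<in> extensional \<Gamma>" using x by (rule conjunct1)
  show "e > 0 \<Longrightarrow> \<exists>u\<in>Y. \<forall>P\<in>\<Gamma>. absval (\<iota> P u - x P) < e" using x[THEN conjunct2] by simp
  show "P \<in> \<Gamma> \<Longrightarrow> x P \<in> closure (range (\<iota> P))" "P \<in> \<Gamma> \<Longrightarrow> absval (x P - 1) < 1"
    using approx_principal[OF x] by simp_all
qed

lemma \<iota>_1: "P \<in> \<Gamma> \<Longrightarrow> \<iota> P 1 = 1"
proof -
  assume "P \<in> \<Gamma>"
  then interpret i: field_hom "\<iota> P" by (rule \<iota>_hom)
  show ?thesis by (rule i.hom_one)
qed

lemma Y_one: "1 \<in> Y"
  by (simp add: Y_iff unit_one \<iota>_1)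

lemma Y_mult:
  assumes "u \<in> Y" "v \<in> Y" shows "u * v \<in> Y"
proof -
  have "absval (\<iota> P (u * v) - 1) < 1" if "P \<in> \<Gamma>" for P
  proof -
    interpret i: field_hom "\<iota> P" by (rule \<iota>_hom[OF that])
    show ?thesis unfolding i.hom_mult using assms that by (intro principal_mult) (simp_all add: Y_iff)
  qed
  then show ?thesis using assms by (simp add: Y_iff unit_mult)
qed

lemma Y_inverse:
  assumes "u \<in> Y" shows "inverse u \<in> Y"
proof -
  have "absval (\<iota> P (inverse u) - 1) < 1" if "P \<in> \<Gamma>" for P
  proof -
    interpret i: field_hom "\<iota> P" by (rule \<iota>_hom[OF that])
    show ?thesis unfolding i.hom_inverse using assms that by (intro principal_inverse) (simp_all add: Y_iff)
  qed
  then show ?thesis using assms by (simp add: Y_iff unit_inverse)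
qed

lemma diag_in_closure: "u \<in> Y \<Longrightarrow> diag \<Gamma> \<iota> u \<in> closure_diag_Y \<Gamma> \<iota>"
  unfolding closure_diag_Y_iff by (auto simp: diag_def intro!: bexI[of _ u])

lemma closure_mult_close:
  assumes "absval (a - 1 :: 'k) < 1" "absval (b - x) < e" "absval (a - y) < e" "absval (x - 1) < 1" "e \<le> 1"
  shows "absval (a * b - y * x) < e"
proof -
  have 1: "absval a \<le> 1" "absval x \<le> 1" using principal_absval[OF assms(1)] principal_absval[OF assms(4)] by simp_all
  have "absval (a * (b - x)) < e" "absval (x * (a - y)) < e"
    unfolding absval_mult using 1 assms(2,3) mult_left_le_one_le[of "absval (b - x)" "absval a"] mult_left_le_one_le[of "absval (a - y)" "absval x"]
    by (simp_all add: mult.commute)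
  then have "absval (a * (b - x) + x * (a - y)) < e" by (rule absval_add_less)
  then show ?thesis by (simp add: algebra_simps)
qed

lemma closure_diag_Y_mult:
  assumes x: "x \<in> closure_diag_Y \<Gamma> \<iota>" and y: "y \<in> closure_diag_Y \<Gamma> \<iota>"
  shows "(\<lambda>P\<in>\<Gamma>. x P * y P) \<in> closure_diag_Y \<Gamma> \<iota>"
  unfolding closure_diag_Y_iff
proof (intro conjI allI impI)
  fix e :: real assume "e > 0"
  define d where "d = min e 1"
  have d: "d > 0" "d \<le> e" "d \<le> 1" using \<open>e > 0\<close> by (simp_all add: d_def)
  obtain u where u: "u \<in> Y" "\<And>P. P \<in> \<Gamma> \<Longrightarrow> absval (\<iota> P u - x P) < d" using closure_diag_Y_D(4)[OF x d(1)] by blast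
  obtain v where v: "v \<in> Y" "\<And>P. P \<in> \<Gamma> \<Longrightarrow> absval (\<iota> P v - y P) < d" using closure_diag_Y_D(4)[OF y d(1)] by blast
  have "absval (\<iota> P (u * v) - (\<lambda>P\<in>\<Gamma>. x P * y P) P) < e" if P: "P \<in> \<Gamma>" for P
  proof -
    interpret i: field_hom "\<iota> P" by (rule \<iota>_hom[OF P])
    have "absval (\<iota> P u * \<iota> P v - x P * y P) < d"
      using u(1) P by (intro closure_mult_close u(2) v(2) closure_diag_Y_D(3)[OF y] d(3)) (simp_all add: Y_iff)
    then show ?thesis using P d(2) by (simp add: i.hom_mult)
  qed
  then show "\<exists>u\<in>Y. \<forall>P\<in>\<Gamma>. absval (\<iota> P u - (\<lambda>P\<in>\<Gamma>. x P * y P) P) < e" using Y_mult[OF u(1) v(1)] by blast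
qed simp

lemma closure_diag_Y_inverse:
  assumes x: "x \<in> closure_diag_Y \<Gamma> \<iota>"
  shows "(\<lambda>P\<in>\<Gamma>. inverse (x P)) \<in> closure_diag_Y \<Gamma> \<iota>"
  unfolding closure_diag_Y_iff
proof (intro conjI allI impI)
  fix e :: real assume "e > 0"
  obtain u where u: "u \<in> Y" "\<And>P. P \<in> \<Gamma> \<Longrightarrow> absval (\<iota> P u - x P) < e" using closure_diag_Y_D(4)[OF x \<open>e > 0\<close>] by blast
  have "absval (\<iota> P (inverse u) - (\<lambda>P\<in>\<Gamma>. inverse (x P)) P) < e" if P: "P \<in> \<Gamma>" for P
  proof -
    interpret i: field_hom "\<iota> P" by (rule \<iota>_hom[OF P])
    have 1: "absval (\<iota> P u) = 1" "absval (x P) = 1"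
      using u(1) P closure_diag_Y_D(3)[OF x P] by (auto simp: Y_iff intro!: principal_absval)
    then have "\<iota> P u \<noteq> 0" "x P \<noteq> 0" by auto
    then have "inverse (\<iota> P u) - inverse (x P) = - ((\<iota> P u - x P) * (inverse (\<iota> P u) * inverse (x P)))"
      by (simp add: field_simps)
    then have "absval (inverse (\<iota> P u) - inverse (x P)) = absval (\<iota> P u - x P)"
      using 1 by (simp add: absval_mult absval_inverse)
    then show ?thesis using u(2)[OF P] P by (simp add: i.hom_inverse)
  qed
  then show "\<exists>u\<in>Y. \<forall>P\<in>\<Gamma>. absval (\<iota> P u - (\<lambda>P\<in>\<Gamma>. inverse (x P)) P) < e" using Y_inverse[OF u(1)] by blast
qed simp

lemma closure_diag_Y_power:
  assumes x: "x \<in> closure_diag_Y \<Gamma> \<iota>"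
  shows "(\<lambda>P\<in>\<Gamma>. x P ^ n) \<in> closure_diag_Y \<Gamma> \<iota>"
proof (induction n)
  case 0
  have "diag \<Gamma> \<iota> 1 = (\<lambda>P\<in>\<Gamma>. 1)"
    unfolding diag_def by (intro restrict_ext) (rule \<iota>_1)
  then show ?case using diag_in_closure[OF Y_one] by (simp only: power_0)
next
  case (Suc n)
  have "(\<lambda>P\<in>\<Gamma>. x P * (\<lambda>P\<in>\<Gamma>. x P ^ n) P) = (\<lambda>P\<in>\<Gamma>. x P ^ Suc n)" by (rule restrict_ext) simp
  then show ?case using closure_diag_Y_mult[OF x Suc.IH] by (simp only:)
qed

text \<open>Finiteness of \<open>\<Gamma>\<close> provides one natural exponent that is good at all
  primes; natural powers already lie in the closure and are approximated by units.\<close>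

lemma closure_diag_Y_padic_power:
  assumes x: "x \<in> closure_diag_Y \<Gamma> \<iota>" and a: "a \<in> closure \<int>"
  shows "(\<lambda>P\<in>\<Gamma>. padic_power (x P) a) \<in> closure_diag_Y \<Gamma> \<iota>"
  unfolding closure_diag_Y_iff
proof (intro conjI allI impI)
  fix e :: real assume "e > 0"
  obtain s :: "nat \<Rightarrow> nat" where s: "(\<lambda>n. of_nat (s n)) \<longlonglongrightarrow> a" using closure_Ints_nat_seq[OF a] .
  have "\<forall>P\<in>\<Gamma>. \<forall>\<^sub>F n in sequentially. absval (x P ^ s n - padic_power (x P) a) < e"
  proof
    fix P assume P: "P \<in> \<Gamma>"
    from tendstoD[OF padic_power_limit[OF closure_diag_Y_D(3)[OF x P] s] \<open>e > 0\<close>]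
    show "\<forall>\<^sub>F n in sequentially. absval (x P ^ s n - padic_power (x P) a) < e" by (simp add: dist_absval)
  qed
  then have "\<forall>\<^sub>F n in sequentially. \<forall>P\<in>\<Gamma>. absval (x P ^ s n - padic_power (x P) a) < e"
    by (rule eventually_ball_finite[OF finite_\<Gamma>])
  then obtain n where n: "\<forall>P\<in>\<Gamma>. absval (x P ^ s n - padic_power (x P) a) < e"
    using eventually_happens'[OF sequentially_bot] by blast
  obtain u where u: "u \<in> Y" "\<forall>P\<in>\<Gamma>. absval (\<iota> P u - (\<lambda>P\<in>\<Gamma>. x P ^ s n) P) < e"
    using closure_diag_Y_D(4)[OF closure_diag_Y_power[OF x] \<open>e > 0\<close>] by blast
  have "absval (\<iota> P u - (\<lambda>P\<in>\<Gamma>. padic_power (x P) a) P) < e" if P: "P \<in> \<Gamma>" for P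
  proof -
    have "absval ((\<iota> P u - x P ^ s n) + (x P ^ s n - padic_power (x P) a)) < e"
      using n u(2) P by (intro absval_add_less) auto
    then show ?thesis using P by simp
  qed
  then show "\<exists>u\<in>Y. \<forall>P\<in>\<Gamma>. absval (\<iota> P u - (\<lambda>P\<in>\<Gamma>. padic_power (x P) a) P) < e" using u(1) by blast
qed simp

lemma closure_Ints_ring:
  "a \<in> closure \<int> \<Longrightarrow> b \<in> closure \<int> \<Longrightarrow> a + b \<in> closure (\<int> :: 'k set)"
  "a \<in> closure \<int> \<Longrightarrow> b \<in> closure \<int> \<Longrightarrow> a * b \<in> closure (\<int> :: 'k set)"
  "a \<in> closure \<int> \<Longrightarrow> - a \<in> closure (\<int> :: 'k set)"
  "k \<in> \<int> \<Longrightarrow> k \<in> closure (\<int> :: 'k set)"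
proof -
  show "a + b \<in> closure (\<int> :: 'k set)" if "a \<in> closure \<int>" "b \<in> closure \<int>"
    by (rule closure_add[OF _ that]) (rule Ints_add)
  show "a * b \<in> closure (\<int> :: 'k set)" if "a \<in> closure \<int>" "b \<in> closure \<int>"
    by (rule closure_mult[OF _ that]) (rule Ints_mult)
  show "- a \<in> closure (\<int> :: 'k set)" if "a \<in> closure \<int>"
    by (rule closure_uminus[OF _ that]) (rule Ints_minus)
  show "k \<in> \<int> \<Longrightarrow> k \<in> closure (\<int> :: 'k set)" using closure_subset by blast
qed

lemma padic_integers_simps:
  "carrier padic_integers = closure (\<int> :: 'k set)" "x \<oplus>\<^bsub>padic_integers\<^esub> y = x + (y :: 'k)"
  "x \<otimes>\<^bsub>padic_integers\<^esub> y = x * y" "\<zero>\<^bsub>padic_integers\<^esub> = (0 :: 'k)" "\<one>\<^bsub>padic_integers\<^esub> = (1 :: 'k)"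
  by (simp_all add: padic_integers_def ring_of_type_algebra_def)

lemma cring_padic_integers: "cring (padic_integers :: 'k ring)"
proof (rule cringI)
  show "abelian_group (padic_integers :: 'k ring)"
  proof (rule abelian_groupI)
    fix x :: 'k assume "x \<in> carrier padic_integers"
    then show "\<exists>y\<in>carrier padic_integers. y \<oplus>\<^bsub>padic_integers\<^esub> x = \<zero>\<^bsub>padic_integers\<^esub>"
      using closure_Ints_ring(3)[of x] by (intro bexI[of _ "- x"]) (simp_all add: padic_integers_simps)
  qed (simp_all add: padic_integers_simps closure_Ints_ring add_ac)
  show "Group.comm_monoid (padic_integers :: 'k ring)"
    by (rule comm_monoidI) (simp_all add: padic_integers_simps closure_Ints_ring mult_ac)
qed (simp add: padic_integers_simps distrib_right)

lemma closure_module_simps: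
  "carrier (closure_module \<Gamma> \<iota>) = closure_diag_Y \<Gamma> \<iota>" "\<zero>\<^bsub>closure_module \<Gamma> \<iota>\<^esub> = (\<lambda>P\<in>\<Gamma>. 1)"
  "x \<oplus>\<^bsub>closure_module \<Gamma> \<iota>\<^esub> y = (\<lambda>P\<in>\<Gamma>. x P * y P)"
  "a \<odot>\<^bsub>closure_module \<Gamma> \<iota>\<^esub> x = (\<lambda>P\<in>\<Gamma>. padic_power (x P) a)"
  by (simp_all add: closure_module_def)

lemma closure_diag_Y_1: "(\<lambda>P\<in>\<Gamma>. 1) \<in> closure_diag_Y \<Gamma> \<iota>"
  using closure_diag_Y_power[OF diag_in_closure[OF Y_one], of 0] by simp

lemma module_closure_module: "module padic_integers (closure_module \<Gamma> \<iota>)"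
proof (rule moduleI)
  show "cring (padic_integers :: 'k ring)" by (rule cring_padic_integers)
  show "abelian_group (closure_module \<Gamma> \<iota>)"
  proof (rule abelian_groupI)
    fix x assume "x \<in> carrier (closure_module \<Gamma> \<iota>)"
    then have x: "x \<in> closure_diag_Y \<Gamma> \<iota>" by (simp add: closure_module_simps)
    have "x P \<noteq> 0" if "P \<in> \<Gamma>" for P
      using principal_absval[OF closure_diag_Y_D(3)[OF x that]] by auto
    then have "(\<lambda>P\<in>\<Gamma>. (\<lambda>P\<in>\<Gamma>. inverse (x P)) P * x P) = (\<lambda>P\<in>\<Gamma>. 1)" by (intro restrict_ext) simp
    then show "\<exists>y\<in>carrier (closure_module \<Gamma> \<iota>). y \<oplus>\<^bsub>closure_module \<Gamma> \<iota>\<^esub> x = \<zero>\<^bsub>closure_module \<Gamma> \<iota>\<^esub>"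
      unfolding closure_module_simps using closure_diag_Y_inverse[OF x] by blast
  next
    fix x assume "x \<in> carrier (closure_module \<Gamma> \<iota>)"
    then have "x \<in> extensional \<Gamma>" using closure_diag_Y_D(1) by (simp add: closure_module_simps)
    then show "\<zero>\<^bsub>closure_module \<Gamma> \<iota>\<^esub> \<oplus>\<^bsub>closure_module \<Gamma> \<iota>\<^esub> x = x"
      by (intro extensionalityI[of _ \<Gamma>]) (simp_all add: closure_module_simps)
  qed (simp_all add: closure_module_simps closure_diag_Y_mult closure_diag_Y_1 mult_ac cong: restrict_cong)
next
  fix a :: 'k and x assume ax: "a \<in> carrier padic_integers" "x \<in> carrier (closure_module \<Gamma> \<iota>)"
  then have ax: "a \<in> closure \<int>" "x \<in> closure_diag_Y \<Gamma> \<iota>" by (simp_all add: closure_module_simps padic_integers_simps)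
  show "a \<odot>\<^bsub>closure_module \<Gamma> \<iota>\<^esub> x \<in> carrier (closure_module \<Gamma> \<iota>)"
    using closure_diag_Y_padic_power[OF ax(2,1)] by (simp add: closure_module_simps)
next
  fix a b :: 'k and x
  assume "a \<in> carrier padic_integers" "b \<in> carrier padic_integers" "x \<in> carrier (closure_module \<Gamma> \<iota>)"
  then have abx: "a \<in> closure \<int>" "b \<in> closure \<int>" "x \<in> closure_diag_Y \<Gamma> \<iota>" by (simp_all add: closure_module_simps padic_integers_simps)
  note x = closure_diag_Y_D(3)[OF abx(3)]
  show "(a \<oplus>\<^bsub>padic_integers\<^esub> b) \<odot>\<^bsub>closure_module \<Gamma> \<iota>\<^esub> x =
      a \<odot>\<^bsub>closure_module \<Gamma> \<iota>\<^esub> x \<oplus>\<^bsub>closure_module \<Gamma> \<iota>\<^esub> b \<odot>\<^bsub>closure_module \<Gamma> \<iota>\<^esub> x"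
    unfolding closure_module_simps padic_integers_simps
    by (rule restrict_ext) (simp add: padic_power_add[OF x abx(1,2)])
  show "(a \<otimes>\<^bsub>padic_integers\<^esub> b) \<odot>\<^bsub>closure_module \<Gamma> \<iota>\<^esub> x =
      a \<odot>\<^bsub>closure_module \<Gamma> \<iota>\<^esub> (b \<odot>\<^bsub>closure_module \<Gamma> \<iota>\<^esub> x)"
    unfolding closure_module_simps padic_integers_simps
    by (rule restrict_ext) (simp add: padic_power_power[OF x abx(2,1), symmetric] mult.commute)
next
  fix a :: 'k and x y
  assume "a \<in> carrier padic_integers" "x \<in> carrier (closure_module \<Gamma> \<iota>)" "y \<in> carrier (closure_module \<Gamma> \<iota>)"
  then have a: "a \<in> closure \<int>" "x \<in> closure_diag_Y \<Gamma> \<iota>" "y \<in> closure_diag_Y \<Gamma> \<iota>" by (simp_all add: closure_module_simps padic_integers_simps)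
  show "a \<odot>\<^bsub>closure_module \<Gamma> \<iota>\<^esub> (x \<oplus>\<^bsub>closure_module \<Gamma> \<iota>\<^esub> y) =
      a \<odot>\<^bsub>closure_module \<Gamma> \<iota>\<^esub> x \<oplus>\<^bsub>closure_module \<Gamma> \<iota>\<^esub> a \<odot>\<^bsub>closure_module \<Gamma> \<iota>\<^esub> y"
    unfolding closure_module_simps
    by (rule restrict_ext) (simp add: padic_power_mult_base[OF closure_diag_Y_D(3)[OF a(2)] closure_diag_Y_D(3)[OF a(3)] a(1)])
next
  fix x assume "x \<in> carrier (closure_module \<Gamma> \<iota>)"
  then have x: "x \<in> closure_diag_Y \<Gamma> \<iota>" by (simp add: closure_module_simps)
  show "\<one>\<^bsub>padic_integers\<^esub> \<odot>\<^bsub>closure_module \<Gamma> \<iota>\<^esub> x = x"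
    unfolding closure_module_simps padic_integers_simps
  proof (rule extensionalityI[OF _ closure_diag_Y_D(1)[OF x]])
    fix P assume "P \<in> \<Gamma>"
    then show "(\<lambda>P\<in>\<Gamma>. padic_power (x P) 1) P = x P"
      using padic_power_of_nat[OF closure_diag_Y_D(3)[OF x], of P 1] by simp
  qed simp
qed

lemma lincomb_closure_module:
  assumes "finite S" "S \<subseteq> closure_diag_Y \<Gamma> \<iota>" "\<And>x. x \<in> S \<Longrightarrow> a x \<in> closure \<int>"
  shows "module.lincomb (closure_module \<Gamma> \<iota>) a S = (\<lambda>P\<in>\<Gamma>. \<Prod>x\<in>S. padic_power (x P) (a x))"
proof -
  interpret N: module padic_integers "closure_module \<Gamma> \<iota>" by (rule module_closure_module)
  show ?thesis
    using assms
  proof (induction S rule: finite_induct)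
    case empty
    then show ?case by (simp only: N.lincomb_def N.finsum_empty closure_module_simps prod.empty)
  next
    case (insert x S)
    have "N.lincomb a (insert x S) = (a x \<odot>\<^bsub>closure_module \<Gamma> \<iota>\<^esub> x) \<oplus>\<^bsub>closure_module \<Gamma> \<iota>\<^esub> N.lincomb a S"
      unfolding N.lincomb_def using insert.hyps insert.prems
      by (intro N.finsum_insert) (auto simp: closure_module_simps closure_diag_Y_padic_power)
    also have "\<dots> = (\<lambda>P\<in>\<Gamma>. padic_power (x P) (a x) * (\<Prod>x\<in>S. padic_power (x P) (a x)))"
      using insert by (simp add: closure_module_simps cong: restrict_cong)
    also have "\<dots> = (\<lambda>P\<in>\<Gamma>. \<Prod>x\<in>insert x S. padic_power (x P) (a x))" using insert.hyps by simp
    finally show ?case .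
  qed
qed

lemma lin_dep_closure_module:
  assumes "finite S" "S \<subseteq> closure_diag_Y \<Gamma> \<iota>"
  shows "module.lin_dep padic_integers (closure_module \<Gamma> \<iota>) S \<longleftrightarrow>
    (\<exists>a. (\<forall>x\<in>S. a x \<in> closure \<int>) \<and> (\<exists>x\<in>S. a x \<noteq> 0) \<and> (\<forall>P\<in>\<Gamma>. (\<Prod>x\<in>S. padic_power (x P) (a x)) = 1))"
proof -
  interpret N: module padic_integers "closure_module \<Gamma> \<iota>" by (rule module_closure_module)
  have eq: "(\<lambda>P\<in>\<Gamma>. f P) = (\<lambda>P\<in>\<Gamma>. 1) \<longleftrightarrow> (\<forall>P\<in>\<Gamma>. f P = (1 :: 'k))" for f
    by (auto simp: restrict_def fun_eq_iff)
  show ?thesis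
  proof
    assume "N.lin_dep S"
    then obtain A a v where A: "finite A" "A \<subseteq> S" "a \<in> A \<rightarrow> closure \<int>"
      "N.lincomb a A = \<zero>\<^bsub>closure_module \<Gamma> \<iota>\<^esub>" "v \<in> A" "a v \<noteq> 0"
      unfolding N.lin_dep_def padic_integers_simps by metis
    have 1: "(\<Prod>x\<in>A. padic_power (x P) (a x)) = 1" if "P \<in> \<Gamma>" for P
    proof -
      have "A \<subseteq> closure_diag_Y \<Gamma> \<iota>" using A(2) assms(2) by (rule order_trans)
      moreover have "a x \<in> closure \<int>" if "x \<in> A" for x using A(3) that by (rule funcset_mem)
      ultimately have "(\<lambda>P\<in>\<Gamma>. \<Prod>x\<in>A. padic_power (x P) (a x)) = (\<lambda>P\<in>\<Gamma>. 1)"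
        using A(4) lincomb_closure_module[OF A(1)] unfolding closure_module_simps by simp
      then show ?thesis using that unfolding eq by blast
    qed
    define a' where "a' x = (if x \<in> A then a x else 0)" for x
    have "(\<Prod>x\<in>S. padic_power (x P) (a' x)) = 1" if P: "P \<in> \<Gamma>" for P
    proof -
      have "padic_power (x P) 0 = 1" if "x \<in> S" for x
        using padic_power_of_nat[OF closure_diag_Y_D(3)[OF subsetD[OF assms(2) that] P], of 0] by simp
      then have "(\<Prod>x\<in>S. padic_power (x P) (a' x)) = (\<Prod>x\<in>A. padic_power (x P) (a x))"
        using A(2) assms(1) by (intro prod.mono_neutral_cong_right) (auto simp: a'_def)
      then show ?thesis using 1[OF P] by simp
    qed
    moreover have "a' x \<in> closure \<int>" for x using A(3) closure_Ints_ring(4)[OF Ints_0] by (auto simp: a'_def)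
    moreover have "v \<in> S" "a' v \<noteq> 0" using A by (auto simp: a'_def)
    ultimately show "\<exists>a. (\<forall>x\<in>S. a x \<in> closure \<int>) \<and> (\<exists>x\<in>S. a x \<noteq> 0) \<and> (\<forall>P\<in>\<Gamma>. (\<Prod>x\<in>S. padic_power (x P) (a x)) = 1)"
      by blast
  next
    assume "\<exists>a. (\<forall>x\<in>S. a x \<in> closure \<int>) \<and> (\<exists>x\<in>S. a x \<noteq> 0) \<and> (\<forall>P\<in>\<Gamma>. (\<Prod>x\<in>S. padic_power (x P) (a x)) = 1)"
    then obtain a v where a: "\<And>x. x \<in> S \<Longrightarrow> a x \<in> closure \<int>" "v \<in> S" "a v \<noteq> 0" "\<And>P. P \<in> \<Gamma> \<Longrightarrow> (\<Prod>x\<in>S. padic_power (x P) (a x)) = 1"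
      by blast
    have "N.lincomb a S = \<zero>\<^bsub>closure_module \<Gamma> \<iota>\<^esub>"
      using lincomb_closure_module[OF assms, of a] a(1,4) by (auto simp: closure_module_simps intro!: restrict_ext)
    moreover have "a \<in> S \<rightarrow> closure \<int>" using a(1) by blast
    ultimately show "N.lin_dep S"
      unfolding N.lin_dep_def padic_integers_simps using assms(1) a(2,3) by blast
  qed
qed

end

section \<open>Logarithmic coordinates\<close>

text \<open>\<open>\<iota>\<close> and \<open>\<sigma>\<^sub>0\<close> take values in differently
  normalised fields, and \<open>same_place\<close> ties them together. The centre of
  \<open>\<sigma>\<^sub>0 \<circ> g\<close> is the preimage under \<open>g\<close> of that of
  \<open>\<sigma>\<^sub>0\<close>, which is the prime in the definition of
  \<open>S_p\<close>.\<close>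

locale cm_padic = cm_galois \<theta> q A \<tau> c + k: local_units \<theta> q A p T' \<Gamma> \<iota> + C: padic_complex_field p T
  for \<theta> :: "'m::field_char_0" and q A \<tau> c p and T' :: "'k::{nonarch_field, complete_space} itself"
    and \<Gamma> \<iota> and T :: "'c::{nonarch_field, complete_space} itself" +
  fixes \<sigma>\<^sub>0 :: "'m \<Rightarrow> 'c"
  assumes \<sigma>\<^sub>0: "field_hom \<sigma>\<^sub>0" and center_\<Gamma>: "center \<sigma>\<^sub>0 \<in> \<Gamma>"
    and \<Gamma>_prime: "\<And>P. P \<in> \<Gamma> \<Longrightarrow> prime_above p P"
    and same_place: "\<And>g x. g \<in> G \<Longrightarrow> center (\<lambda>x. \<sigma>\<^sub>0 (g x)) \<in> \<Gamma> \<Longrightarrow>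
      absval (\<iota> (center (\<lambda>x. \<sigma>\<^sub>0 (g x))) x) < 1 \<longleftrightarrow> absval (\<sigma>\<^sub>0 (g x)) < 1"
begin

sublocale s: field_hom \<sigma>\<^sub>0 by (rule \<sigma>\<^sub>0)

definition place :: "('m \<Rightarrow> 'm) \<Rightarrow> 'm set" where
  "place g = center (\<lambda>x. \<sigma>\<^sub>0 (g x))"

lemma place_id: "place id = center \<sigma>\<^sub>0"
  by (simp add: place_def)

lemma place_comp: "g \<in> G \<Longrightarrow> place (h \<circ> g) = g -` place h"
  by (auto simp: place_def center_def gal_algebraic_int)

lemma hom_gal: "g \<in> G \<Longrightarrow> field_hom (\<lambda>x. \<sigma>\<^sub>0 (g x))"
  using field_hom_comp[OF \<sigma>\<^sub>0, of g] by (simp add: gal_eq comp_def)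

text \<open>\<open>S\<close> indexes the embeddings in \<open>S_p\<close>, and \<open>D\<close> is the decomposition group.\<close>

definition S :: "('m \<Rightarrow> 'm) set" where
  "S = {g \<in> G. place g \<in> \<Gamma>}"

definition D :: "('m \<Rightarrow> 'm) set" where
  "D = {g \<in> G. place g = place id}"

lemma S_gal: "g \<in> S \<Longrightarrow> g \<in> G" and D_gal: "h \<in> D \<Longrightarrow> h \<in> G"
  by (simp_all add: S_def D_def)

lemma id_D: "id \<in> D" and id_S: "id \<in> S"
  using id_gal center_\<Gamma> by (simp_all add: D_def S_def place_id)

lemma place_D_comp: "h \<in> D \<Longrightarrow> g \<in> G \<Longrightarrow> place (h \<circ> g) = place g"
  using place_comp[of g h] place_comp[of g id] by (simp add: D_def)

lemma D_comp_S: "h \<in> D \<Longrightarrow> g \<in> S \<Longrightarrow> h \<circ> g \<in> S"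
  using place_D_comp[of h g] comp_gal[of h g] by (simp add: S_def D_def)

lemma inv_D: "h \<in> D \<Longrightarrow> inv_into UNIV h \<in> D"
  using place_D_comp[of h "inv_into UNIV h"] inv_gal[of h] gal_inv_comp(2)[of h] by (simp add: D_def)

lemma finite_D: "finite D"
  using finite_gal by (rule rev_finite_subset) (auto simp: D_def)

lemma finite_S: "finite S"
  using finite_gal by (rule rev_finite_subset) (auto simp: S_def)

lemma twin_S:
  assumes "g \<in> S"
  shows "twin p (\<iota> (place g)) (\<lambda>x. \<sigma>\<^sub>0 (g x))"
proof -
  have g: "g \<in> G" "place g \<in> \<Gamma>" using assms by (simp_all add: S_def)
  show ?thesis
    using k.\<iota>_hom[OF g(2)] hom_gal[OF g(1)] same_place[OF g(1)] g(2)
    by (intro twin.intro twin_axioms.intro k.padic_field_axioms C.padic_field_axioms) (simp_all add: place_def)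
qed

lemma absval_D: "h \<in> D \<Longrightarrow> absval (\<sigma>\<^sub>0 x) < 1 \<longleftrightarrow> absval (\<sigma>\<^sub>0 (h x)) < 1"
  using same_place[OF id_gal, of x] same_place[of h x] center_\<Gamma> by (simp add: D_def place_def)

lemma twin_D:
  assumes "h \<in> D"
  shows "twin p \<sigma>\<^sub>0 (\<lambda>x. \<sigma>\<^sub>0 (h x))"
  using \<sigma>\<^sub>0 hom_gal[OF D_gal[OF assms]] absval_D[OF assms]
  by (intro twin.intro twin_axioms.intro C.padic_field_axioms) simp_all

lemma place_surj:
  assumes "P \<in> \<Gamma>"
  obtains g where "g \<in> S" "place g = P"
proof -
  obtain g where "g \<in> G" "P = center (\<lambda>x. \<sigma>\<^sub>0 (g x))"
    using prime_above_conjugate[OF \<sigma>\<^sub>0 C.prime_p C.absval_p \<Gamma>_prime[OF assms]] .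
  then show ?thesis using that[of g] assms by (simp add: S_def place_def)
qed

abbreviation F :: "'c set" where
  "F \<equiv> closure (range \<sigma>\<^sub>0)"

lemma lg_in_F:
  assumes "absval (\<sigma>\<^sub>0 x - 1) < 1"
  shows "C.lg (\<sigma>\<^sub>0 x) \<in> F"
proof (rule closed_sequentially[OF closed_closure _ C.lg_limit[OF assms]])
  fix n
  have "(\<sigma>\<^sub>0 x ^ (p ^ n) - 1) / of_nat (p ^ n) = \<sigma>\<^sub>0 ((x ^ (p ^ n) - 1) * inverse (of_nat (p ^ n)))"
    by (simp only: s.hom_mult s.hom_inverse s.hom_minus s.hom_power s.hom_one s.hom_of_nat divide_inverse)
  then show "(\<sigma>\<^sub>0 x ^ (p ^ n) - 1) / of_nat (p ^ n) \<in> F" using closure_range_hom(1)[OF \<sigma>\<^sub>0] by simp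
qed

text \<open>The logarithm is a limit of images of field elements, and the extension is defined by
  such limits.\<close>

lemma ext_lg:
  assumes h: "h \<in> D" and x: "absval (\<sigma>\<^sub>0 x - 1) < 1"
  shows "twin.ext \<sigma>\<^sub>0 (\<lambda>x. \<sigma>\<^sub>0 (h x)) (C.lg (\<sigma>\<^sub>0 x)) = C.lg (\<sigma>\<^sub>0 (h x))"
proof -
  interpret t: twin p "TYPE('c)" "TYPE('c)" \<sigma>\<^sub>0 "\<lambda>x. \<sigma>\<^sub>0 (h x)" by (rule twin_D[OF h])
  let ?y = "\<lambda>n. (x ^ (p ^ n) - 1) * inverse (of_nat (p ^ n))"
  have 1: "(\<sigma>\<^sub>0 x ^ (p ^ n) - 1) / of_nat (p ^ n) = \<sigma>\<^sub>0 (?y n)" for n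
    by (simp only: s.hom_mult s.hom_inverse s.hom_minus s.hom_power s.hom_one s.hom_of_nat divide_inverse)
  have 2: "(\<sigma>\<^sub>0 (h x) ^ (p ^ n) - 1) / of_nat (p ^ n) = \<sigma>\<^sub>0 (h (?y n))" for n
    by (simp only: t.g.hom_mult t.g.hom_inverse t.g.hom_minus t.g.hom_power t.g.hom_one t.g.hom_of_nat divide_inverse)
  have "absval (\<sigma>\<^sub>0 (x - 1)) < 1" using x by (simp add: s.hom_minus)
  then have "absval (\<sigma>\<^sub>0 (h (x - 1))) < 1" using absval_D[OF h] by simp
  then have hx: "absval (\<sigma>\<^sub>0 (h x) - 1) < 1" by (simp only: t.g.hom_minus t.g.hom_one)
  have "(\<lambda>n. \<sigma>\<^sub>0 (h (?y n))) \<longlonglongrightarrow> t.ext (C.lg (\<sigma>\<^sub>0 x))"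
    using C.lg_limit[OF x] unfolding 1 by (rule t.ext_limit)
  moreover have "(\<lambda>n. \<sigma>\<^sub>0 (h (?y n))) \<longlonglongrightarrow> C.lg (\<sigma>\<^sub>0 (h x))"
    using C.lg_limit[OF hx] unfolding 2 .
  ultimately show ?thesis by (rule LIMSEQ_unique)
qed

text \<open>The logarithm of the component at \<open>place g\<close>, carried into the \<open>p\<close>-adic complex numbers by the
  extension of \<open>\<sigma>\<^sub>0 \<circ> g\<close> to the completion.\<close>

definition \<Lambda> :: "('m \<Rightarrow> 'm) \<Rightarrow> ('m set \<Rightarrow> 'k) \<Rightarrow> 'c" where
  "\<Lambda> g x = C.lg (twin.ext (\<iota> (place g)) (\<lambda>x. \<sigma>\<^sub>0 (g x)) (x (place g)))"

abbreviation "\<C> \<equiv> closure_diag_Y \<Gamma> \<iota>"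

lemma approximating_sequence:
  assumes "x \<in> \<C>"
  obtains u where "\<And>n. u n \<in> k.Y" "\<And>P. P \<in> \<Gamma> \<Longrightarrow> (\<lambda>n. \<iota> P (u n)) \<longlonglongrightarrow> x P"
proof -
  have "\<forall>n. \<exists>u\<in>k.Y. \<forall>P\<in>\<Gamma>. absval (\<iota> P u - x P) < inverse (real (Suc n))"
    using k.closure_diag_Y_D(4)[OF assms] by simp
  then obtain u where u: "\<And>n. u n \<in> k.Y" "\<And>n P. P \<in> \<Gamma> \<Longrightarrow> absval (\<iota> P (u n) - x P) < inverse (real (Suc n))"
    by metis
  have "(\<lambda>n. \<iota> P (u n)) \<longlonglongrightarrow> x P" if "P \<in> \<Gamma>" for P
    unfolding tendsto_absval_iff
    by (rule Lim_null_comparison[OF _ LIMSEQ_inverse_real_of_nat]) (use u(2)[OF that] in \<open>auto intro!: always_eventually less_imp_le\<close>)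
  then show ?thesis using that u(1) by blast
qed

lemma Y_principal:
  assumes u: "u \<in> k.Y" and g: "g \<in> S"
  shows "absval (\<sigma>\<^sub>0 (g u) - 1) < 1"
proof -
  interpret t: twin p "TYPE('k)" "TYPE('c)" "\<iota> (place g)" "\<lambda>x. \<sigma>\<^sub>0 (g x)" by (rule twin_S[OF g])
  have "absval (\<iota> (place g) u - 1) < 1" using u g by (simp add: k.Y_iff S_def)
  then have "absval (\<iota> (place g) (u - 1)) < 1" by (simp add: t.f.hom_minus)
  then have "absval (\<sigma>\<^sub>0 (g (u - 1))) < 1" using t.less_1 by blast
  then show ?thesis by (simp only: t.g.hom_minus t.g.hom_one)
qed

text \<open>Identities between logarithms of units pass to the closure through this limit.\<close>

lemma \<Lambda>_limit:
  assumes g: "g \<in> S" and u: "\<And>n. u n \<in> k.Y" and lim: "\<And>P. P \<in> \<Gamma> \<Longrightarrow> (\<lambda>n. \<iota> P (u n)) \<longlonglongrightarrow> x P"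
  shows "(\<lambda>n. C.lg (\<sigma>\<^sub>0 (g (u n)))) \<longlonglongrightarrow> \<Lambda> g x"
proof -
  interpret t: twin p "TYPE('k)" "TYPE('c)" "\<iota> (place g)" "\<lambda>x. \<sigma>\<^sub>0 (g x)" by (rule twin_S[OF g])
  show ?thesis unfolding \<Lambda>_def
    using g by (intro C.lg_continuous[OF Y_principal[OF u g] t.ext_limit[OF lim]]) (simp add: S_def)
qed

lemma \<Lambda>_diag:
  assumes "g \<in> S"
  shows "\<Lambda> g (diag \<Gamma> \<iota> u) = C.lg (\<sigma>\<^sub>0 (g u))"
proof -
  interpret t: twin p "TYPE('k)" "TYPE('c)" "\<iota> (place g)" "\<lambda>x. \<sigma>\<^sub>0 (g x)" by (rule twin_S[OF assms])
  show ?thesis using assms t.ext_hom by (simp add: \<Lambda>_def diag_def S_def)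
qed

lemma \<Lambda>_in_F:
  assumes "g \<in> S" "x \<in> \<C>"
  shows "\<Lambda> g x \<in> F"
proof -
  obtain u where u: "\<And>n. u n \<in> k.Y" "\<And>P. P \<in> \<Gamma> \<Longrightarrow> (\<lambda>n. \<iota> P (u n)) \<longlonglongrightarrow> x P"
    using approximating_sequence[OF assms(2)] by metis
  show ?thesis
    by (rule closed_sequentially[OF closed_closure lg_in_F[OF Y_principal[OF u(1) assms(1)]] \<Lambda>_limit[OF assms(1) u]])
qed

lemma \<Lambda>_D:
  assumes h: "h \<in> D" and g: "g \<in> S" and x: "x \<in> \<C>"
  shows "twin.ext \<sigma>\<^sub>0 (\<lambda>x. \<sigma>\<^sub>0 (h x)) (\<Lambda> g x) = \<Lambda> (h \<circ> g) x"
proof -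
  interpret t: twin p "TYPE('c)" "TYPE('c)" \<sigma>\<^sub>0 "\<lambda>x. \<sigma>\<^sub>0 (h x)" by (rule twin_D[OF h])
  obtain u where u: "\<And>n. u n \<in> k.Y" "\<And>P. P \<in> \<Gamma> \<Longrightarrow> (\<lambda>n. \<iota> P (u n)) \<longlonglongrightarrow> x P"
    using approximating_sequence[OF x] by metis
  have "(\<lambda>n. t.ext (C.lg (\<sigma>\<^sub>0 (g (u n))))) \<longlonglongrightarrow> t.ext (\<Lambda> g x)"
    by (rule t.ext_continuous[OF lg_in_F[OF Y_principal[OF u(1) g]] \<Lambda>_limit[OF g u] \<Lambda>_in_F[OF g x]])
  then have "(\<lambda>n. C.lg (\<sigma>\<^sub>0 (h (g (u n))))) \<longlonglongrightarrow> t.ext (\<Lambda> g x)"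
    using ext_lg[OF h Y_principal[OF u(1) g]] by simp
  moreover have "(\<lambda>n. C.lg (\<sigma>\<^sub>0 (h (g (u n))))) \<longlonglongrightarrow> \<Lambda> (h \<circ> g) x"
    using \<Lambda>_limit[OF D_comp_S[OF h g] u] by simp
  ultimately show ?thesis by (rule LIMSEQ_unique)
qed

subsection \<open>Relations among the coordinates\<close>

definition L :: "'m \<Rightarrow> ('m \<Rightarrow> 'm) \<Rightarrow> 'c" where
  "L u g = C.Lg (\<sigma>\<^sub>0 (g u))"

lemma L_c:
  assumes u: "u \<in> Units ring_of_integers" and g: "g \<in> G"
  shows "L u (c \<circ> g) = L u g"
proof -
  have gu: "g u \<in> Units ring_of_integers" by (rule unit_gal[OF g u])
  obtain N where N: "N > 0" "c (g u) ^ N = g u ^ N" using unit_c_quotient[OF gu] .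
  have nz: "\<sigma>\<^sub>0 (g u) \<noteq> 0" "\<sigma>\<^sub>0 (c (g u)) \<noteq> 0" using unit_nonzero[OF gu] unit_nonzero[OF unit_gal[OF c_gal gu]] by simp_all
  have "\<sigma>\<^sub>0 (c (g u)) ^ N = \<sigma>\<^sub>0 (g u) ^ N" using N(2) by (simp add: s.hom_power[symmetric])
  then have "of_nat N * C.Lg (\<sigma>\<^sub>0 (c (g u))) = of_nat N * C.Lg (\<sigma>\<^sub>0 (g u))"
    using C.Lg_power[OF nz(1), of N] C.Lg_power[OF nz(2), of N] by metis
  then have "C.Lg (\<sigma>\<^sub>0 (c (g u))) = C.Lg (\<sigma>\<^sub>0 (g u))" using N(1) by (metis mult_cancel_left of_nat_eq_0_iff less_irrefl)
  then show ?thesis by (simp add: L_def)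
qed

lemma L_rep: "u \<in> Units ring_of_integers \<Longrightarrow> g \<in> G \<Longrightarrow> L u (rep g) = L u g"
  using rep_cases[of g] L_c[of u g] by auto

text \<open>The norm of a unit is 1 or -1 and has logarithm zero; the sum over the group counts each
  coset twice.\<close>

lemma L_sum:
  assumes u: "u \<in> Units ring_of_integers"
  shows "(\<Sum>g\<in>reps. L u g) = 0"
proof -
  have int: "algebraic_int u" "algebraic_int (inverse u)" using u by (simp_all add: unit_iff)
  have inv: "(\<Prod>g\<in>G. g (inverse u)) = inverse (\<Prod>g\<in>G. g u)"
  proof -
    have "g (inverse u) = inverse (g u)" if "g \<in> G" for g
    proof -
      interpret g: field_hom g using that by (simp add: gal_iff)
      show ?thesis by (rule g.hom_inverse)
    qed
    then show ?thesis by (simp add: prod_inversef[symmetric] comp_def)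
  qed
  obtain a b where a: "(\<Prod>g\<in>G. g u) = of_int a" and b: "inverse (\<Prod>g\<in>G. g u) = of_int b"
    using gal_norm_int[OF int(1)] gal_norm_int[OF int(2)] unfolding inv by (auto elim!: Ints_cases)
  have nz: "g u \<noteq> 0" if "g \<in> G" for g using unit_nonzero[OF unit_gal[OF that u]] .
  then have "(\<Prod>g\<in>G. g u) \<noteq> 0" using finite_gal by simp
  then have "(of_int (a * b) :: 'm) = of_int 1" using a b by (metis of_int_mult of_int_1 right_inverse)
  then have "a * b = 1" by (simp only: of_int_eq_iff)
  then have "a ^ 2 = 1" by (auto simp: zmult_eq_1_iff)
  then have "\<sigma>\<^sub>0 (\<Prod>g\<in>G. g u) ^ 2 = 1" unfolding a by (simp only: s.hom_of_int of_int_power[symmetric] of_int_1)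
  then have "C.Lg (\<sigma>\<^sub>0 (\<Prod>g\<in>G. g u)) = 0" using C.Lg_torsion[of 2 _ 0] by simp
  moreover have "C.Lg (\<sigma>\<^sub>0 (\<Prod>g\<in>G. g u)) = (\<Sum>g\<in>G. L u g)"
    unfolding s.hom_prod L_def using nz by (intro C.Lg_prod) simp
  moreover have "(\<Sum>g\<in>G. L u g) = 2 * (\<Sum>g\<in>reps. L u g)"
  proof -
    have "(\<Sum>g\<in>G. L u g) = (\<Sum>g\<in>reps. L u g + L u (c \<circ> g))" by (rule sum_gal_reps)
    also have "\<dots> = (\<Sum>g\<in>reps. 2 * L u g)" using L_c[OF u] reps_gal by (intro sum.cong) auto
    finally show ?thesis by (simp add: sum_distrib_left)
  qed
  ultimately show ?thesis by simp
qed

lemma lg_Y: "u \<in> k.Y \<Longrightarrow> g \<in> S \<Longrightarrow> C.lg (\<sigma>\<^sub>0 (g u)) = L u (rep g)"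
  using L_rep[of u g] C.Lg_principal[OF Y_principal] S_gal by (simp add: k.Y_iff L_def)

lemma \<Lambda>_rep:
  assumes "g \<in> S" "h \<in> S" "rep g = rep h" "x \<in> \<C>"
  shows "\<Lambda> g x = \<Lambda> h x"
proof -
  obtain u where u: "\<And>n. u n \<in> k.Y" "\<And>P. P \<in> \<Gamma> \<Longrightarrow> (\<lambda>n. \<iota> P (u n)) \<longlonglongrightarrow> x P"
    using approximating_sequence[OF assms(4)] by metis
  have "(\<lambda>n. C.lg (\<sigma>\<^sub>0 (g (u n)))) \<longlonglongrightarrow> \<Lambda> h x"
    using \<Lambda>_limit[OF assms(2) u] by (simp add: lg_Y[OF u(1)] assms(1-3))
  then show ?thesis using \<Lambda>_limit[OF assms(1) u] LIMSEQ_unique by blast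
qed

text \<open>The fixed representative of a coset need not belong to \<open>S\<close> even if the
  coset meets \<open>S\<close>; \<open>f\<close> selects a member that does. The sum vanishes on
  units and hence on limits.\<close>

lemma \<Lambda>_sum:
  assumes f: "\<And>r. r \<in> reps \<Longrightarrow> f r \<in> S \<and> rep (f r) = r" and x: "x \<in> \<C>"
  shows "(\<Sum>r\<in>reps. \<Lambda> (f r) x) = 0"
proof -
  obtain u where u: "\<And>n. u n \<in> k.Y" "\<And>P. P \<in> \<Gamma> \<Longrightarrow> (\<lambda>n. \<iota> P (u n)) \<longlonglongrightarrow> x P"
    using approximating_sequence[OF x] by metis
  have "(\<lambda>n. \<Sum>r\<in>reps. C.lg (\<sigma>\<^sub>0 (f r (u n)))) \<longlonglongrightarrow> (\<Sum>r\<in>reps. \<Lambda> (f r) x)"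
  proof (rule tendsto_sum)
    fix r assume "r \<in> reps"
    then have "f r \<in> S" using f by blast
    then show "(\<lambda>n. C.lg (\<sigma>\<^sub>0 (f r (u n)))) \<longlonglongrightarrow> \<Lambda> (f r) x"
      by (rule \<Lambda>_limit[OF _ u])
  qed
  moreover have "(\<Sum>r\<in>reps. C.lg (\<sigma>\<^sub>0 (f r (u n)))) = 0" for n
  proof -
    have "(\<Sum>r\<in>reps. C.lg (\<sigma>\<^sub>0 (f r (u n)))) = (\<Sum>r\<in>reps. L (u n) r)"
      using f by (intro sum.cong) (simp_all add: lg_Y[OF u(1)])
    also have "\<dots> = 0" using u(1)[of n] by (intro L_sum) (simp add: k.Y_iff)
    finally show ?thesis .
  qed
  ultimately have "(\<lambda>n. 0) \<longlonglongrightarrow> (\<Sum>r\<in>reps. \<Lambda> (f r) x)" by simp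
  then show ?thesis using LIMSEQ_unique tendsto_const by blast
qed

end

context cm_padic
begin

subsection \<open>Relations between limits of units\<close>

text \<open>The identification of the two copies of the \<open>p\<close>-adic integers, read off at
  one place; \<open>ext_eq_\<kappa>\<close> makes it independent of the place.\<close>

definition \<kappa> :: "'k \<Rightarrow> 'c" where
  "\<kappa> = twin.ext (\<iota> (place id)) (\<lambda>x. \<sigma>\<^sub>0 (id x))"

lemma ext_eq_\<kappa>:
  assumes g: "g \<in> S" and a: "a \<in> closure \<int>"
  shows "twin.ext (\<iota> (place g)) (\<lambda>x. \<sigma>\<^sub>0 (g x)) a = \<kappa> a"
proof -
  interpret t: twin p "TYPE('k)" "TYPE('c)" "\<iota> (place g)" "\<lambda>x. \<sigma>\<^sub>0 (g x)" by (rule twin_S[OF g])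
  interpret i: twin p "TYPE('k)" "TYPE('c)" "\<iota> (place id)" "\<lambda>x. \<sigma>\<^sub>0 (id x)" by (rule twin_S[OF id_S])
  obtain s :: "nat \<Rightarrow> nat" where s: "(\<lambda>n. of_nat (s n)) \<longlonglongrightarrow> a" using k.closure_Ints_nat_seq[OF a] .
  show ?thesis unfolding \<kappa>_def using t.ext_of_nat_limit[OF s] i.ext_of_nat_limit[OF s] by (rule LIMSEQ_unique)
qed

lemma \<kappa>_surj:
  assumes "b \<in> closure \<int>"
  obtains a where "a \<in> closure \<int>" "\<kappa> a = b"
proof -
  interpret i: twin p "TYPE('k)" "TYPE('c)" "\<iota> (place id)" "\<lambda>x. \<sigma>\<^sub>0 (id x)" by (rule twin_S[OF id_S])
  show ?thesis using i.ext_closure_Ints_surj[OF assms] that unfolding \<kappa>_def by blast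
qed

lemma \<kappa>_eq_0: "a \<in> closure \<int> \<Longrightarrow> \<kappa> a = 0 \<longleftrightarrow> a = 0"
proof -
  assume a: "a \<in> closure \<int>"
  interpret i: twin p "TYPE('k)" "TYPE('c)" "\<iota> (place id)" "\<lambda>x. \<sigma>\<^sub>0 (id x)" by (rule twin_S[OF id_S])
  show ?thesis using i.ext_eq_0[OF i.ext_closure_Ints(1)[OF a]] i.ext_0 unfolding \<kappa>_def by blast
qed

text \<open>Linearity of \<open>\<Lambda> g\<close> over the \<open>p\<close>-adic integers,
  together with the two properties of \<open>z\<close> under which a vanishing logarithm makes
  \<open>z\<close> torsion.\<close>

lemma \<Lambda>_relation:
  assumes g: "g \<in> S" and x: "\<And>i. i \<in> I \<Longrightarrow> x i \<in> \<C>" and a: "\<And>i. i \<in> I \<Longrightarrow> a i \<in> closure \<int>"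
  defines "z \<equiv> \<Prod>i\<in>I. padic_power (x i (place g)) (a i)"
  shows "z \<in> closure (range (\<iota> (place g)))" "absval (z - 1) < 1"
    "C.lg (twin.ext (\<iota> (place g)) (\<lambda>x. \<sigma>\<^sub>0 (g x)) z) = (\<Sum>i\<in>I. \<kappa> (a i) * \<Lambda> g (x i))"
proof -
  interpret t: twin p "TYPE('k)" "TYPE('c)" "\<iota> (place g)" "\<lambda>x. \<sigma>\<^sub>0 (g x)" by (rule twin_S[OF g])
  have P: "place g \<in> \<Gamma>" using g by (simp add: S_def)
  have xP: "x i (place g) \<in> t.K" "absval (x i (place g) - 1) < 1" if "i \<in> I" for i
    using k.closure_diag_Y_D(2,3)[OF x[OF that] P] .
  have pw: "padic_power (x i (place g)) (a i) \<in> t.K" "absval (padic_power (x i (place g)) (a i) - 1) < 1"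
    "t.ext (padic_power (x i (place g)) (a i)) = padic_power (t.ext (x i (place g))) (\<kappa> (a i))" if "i \<in> I" for i
    using t.ext_padic_power[OF xP[OF that] a[OF that]] k.padic_power_principal[OF xP(2)[OF that] a[OF that]]
      ext_eq_\<kappa>[OF g a[OF that]] by simp_all
  show "z \<in> t.K" unfolding z_def using t.ext_prod[of I "\<lambda>i. padic_power (x i (place g)) (a i)"] pw(1) by blast
  show "absval (z - 1) < 1" unfolding z_def using k.lg_prod[of I "\<lambda>i. padic_power (x i (place g)) (a i)"] pw(2) by blast
  have "t.ext z = (\<Prod>i\<in>I. t.ext (padic_power (x i (place g)) (a i)))"
    unfolding z_def using t.ext_prod[of I "\<lambda>i. padic_power (x i (place g)) (a i)"] pw(1) by blast
  also have "\<dots> = (\<Prod>i\<in>I. padic_power (t.ext (x i (place g))) (\<kappa> (a i)))" using pw(3) by (rule prod.cong[OF refl])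
  finally have z: "t.ext z = (\<Prod>i\<in>I. padic_power (t.ext (x i (place g))) (\<kappa> (a i)))" .
  have e: "absval (t.ext (x i (place g)) - 1) < 1" "\<kappa> (a i) \<in> closure \<int>" if "i \<in> I" for i
    using t.ext_principal xP[OF that] t.ext_closure_Ints(2)[OF a[OF that]] ext_eq_\<kappa>[OF g a[OF that]] by simp_all
  have "C.lg (t.ext z) = (\<Sum>i\<in>I. C.lg (padic_power (t.ext (x i (place g))) (\<kappa> (a i))))"
    unfolding z using C.lg_prod[of I "\<lambda>i. padic_power (t.ext (x i (place g))) (\<kappa> (a i))"] C.padic_power_principal[OF e] by blast
  also have "\<dots> = (\<Sum>i\<in>I. \<kappa> (a i) * \<Lambda> g (x i))"
    unfolding \<Lambda>_def using C.lg_padic_power[OF e] by (rule sum.cong[OF refl])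
  finally show "C.lg (t.ext z) = (\<Sum>i\<in>I. \<kappa> (a i) * \<Lambda> g (x i))" .
qed

lemma relation_imp_sum:
  assumes "finite Z" "Z \<subseteq> \<C>" "\<And>x. x \<in> Z \<Longrightarrow> a x \<in> closure \<int>"
    and "\<And>P. P \<in> \<Gamma> \<Longrightarrow> (\<Prod>x\<in>Z. padic_power (x P) (a x)) = 1" and g: "g \<in> S"
  shows "(\<Sum>x\<in>Z. \<kappa> (a x) * \<Lambda> g x) = 0"
proof -
  interpret t: twin p "TYPE('k)" "TYPE('c)" "\<iota> (place g)" "\<lambda>x. \<sigma>\<^sub>0 (g x)" by (rule twin_S[OF g])
  have "place g \<in> \<Gamma>" using g by (simp add: S_def)
  then show ?thesis
    using \<Lambda>_relation(3)[OF g, of Z "\<lambda>x. x" a] assms(2,3,4) t.ext_1 C.lg_1 by auto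
qed

text \<open>If all logarithms of the combination vanish, each component is a root of unity of
  \<open>p\<close>-power order. Multiplying all coefficients by a common power of \<open>p\<close>
  makes it trivial and keeps a nonzero coefficient.\<close>

lemma lin_dep_if_sum:
  assumes Z: "finite Z" "Z \<subseteq> \<C>" and a: "\<And>x. x \<in> Z \<Longrightarrow> a x \<in> closure \<int>" and x0: "x0 \<in> Z" "a x0 \<noteq> 0"
    and sum: "\<And>g. g \<in> S \<Longrightarrow> (\<Sum>x\<in>Z. \<kappa> (a x) * \<Lambda> g x) = 0"
  shows "module.lin_dep padic_integers (closure_module \<Gamma> \<iota>) Z"
proof -
  define z where "z P = (\<Prod>x\<in>Z. padic_power (x P) (a x))" for P
  have "\<exists>N. z P ^ (p ^ N) = 1" if P: "P \<in> \<Gamma>" for P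
  proof -
    obtain g where g: "g \<in> S" "place g = P" using place_surj[OF P] .
    interpret t: twin p "TYPE('k)" "TYPE('c)" "\<iota> (place g)" "\<lambda>x. \<sigma>\<^sub>0 (g x)" by (rule twin_S[OF g(1)])
    have z: "z P \<in> t.K" "absval (z P - 1) < 1" "C.lg (t.ext (z P)) = 0"
      using \<Lambda>_relation[OF g(1), of Z "\<lambda>x. x" a] Z(2) a sum[OF g(1)] by (auto simp: z_def g(2)[symmetric])
    have "absval (t.ext (z P) - 1) < 1" using t.ext_principal[OF z(1)] z(2) by blast
    then obtain N where "t.ext (z P) ^ (p ^ N) = 1" using C.lg_eq_0 z(3) by blast
    then have "t.ext (z P ^ (p ^ N)) = t.ext 1" using t.ext_power[OF z(1)] t.ext_1 by metis
    then have "z P ^ (p ^ N) = 1" using t.ext_power[OF z(1)] t.K_1 by (intro t.ext_inject) blast+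
    then show ?thesis by blast
  qed
  then obtain N where N: "\<And>P. P \<in> \<Gamma> \<Longrightarrow> z P ^ (p ^ N P) = 1" by metis
  \<comment> \<open>The sum serves as a common bound for the exponents \<open>N P\<close>.\<close>
  define M where "M = (\<Sum>P\<in>\<Gamma>. N P)"
  have M: "z P ^ (p ^ M) = 1" if P: "P \<in> \<Gamma>" for P
  proof -
    have "N P \<le> M" unfolding M_def using k.finite_\<Gamma> P by (intro member_le_sum) auto
    then have "p ^ M = p ^ N P * p ^ (M - N P)" by (simp add: power_add[symmetric])
    then show ?thesis using N[OF P] by (simp add: power_mult)
  qed
  show ?thesis
    unfolding k.lin_dep_closure_module[OF Z]
  proof (intro exI[of _ "\<lambda>x. a x * of_nat (p ^ M)"] conjI ballI)
    show "a x * of_nat (p ^ M) \<in> closure \<int>" if "x \<in> Z" for x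
      by (intro k.closure_Ints_ring(2,4) a[OF that]) simp
    have "(of_nat (p ^ M) :: 'k) \<noteq> 0" using k.p_gt_1 by simp
    then show "\<exists>x\<in>Z. a x * of_nat (p ^ M) \<noteq> 0" using x0 by auto
    fix P assume P: "P \<in> \<Gamma>"
    have "(\<Prod>x\<in>Z. padic_power (x P) (a x * of_nat (p ^ M))) = (\<Prod>x\<in>Z. padic_power (x P) (a x) ^ (p ^ M))"
      using Z(2) P a k.closure_diag_Y_D(3) by (intro prod.cong refl k.padic_power_of_nat_power[symmetric]) blast+
    also have "\<dots> = z P ^ (p ^ M)" unfolding z_def by (rule prod_power_distrib[symmetric])
    finally show "(\<Prod>x\<in>Z. padic_power (x P) (a x * of_nat (p ^ M))) = 1" using M[OF P] by simp
  qed
qed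

subsection \<open>The trace to the rational \<open>p\<close>-adic numbers\<close>

lemma p_power_small_seq:
  assumes "absval (a :: 'c) < 1"
  shows "(\<lambda>n. a ^ (p ^ n)) \<longlonglongrightarrow> 0"
  unfolding tendsto_absval_iff
proof (rule Lim_null_comparison)
  show "(\<lambda>n. absval a ^ n) \<longlonglongrightarrow> 0" using assms by (intro LIMSEQ_power_zero) simp
  have "n \<le> p ^ n" for n using less_exp[of n] power_mono[of 2 p n] C.p_gt_1 by simp
  then have "absval (a ^ (p ^ n)) \<le> absval a ^ n" for n
    unfolding absval_power using assms by (intro power_decreasing) auto
  then show "\<forall>\<^sub>F n in sequentially. norm (absval (a ^ (p ^ n) - 0)) \<le> absval a ^ n" by simp
qed

lemma p_power_principal_seq:
  assumes "absval (a - 1 :: 'c) < 1"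
  shows "(\<lambda>n. a ^ (p ^ n)) \<longlonglongrightarrow> 1"
  unfolding tendsto_absval_iff
proof (rule Lim_null_comparison)
  have c: "0 < C.contr a" "C.contr a < 1" using C.contr_bounds[OF assms] by auto
  then have "(\<lambda>n. C.contr a ^ n) \<longlonglongrightarrow> 0" by (intro LIMSEQ_power_zero) simp
  then show "(\<lambda>n. C.contr a ^ n * absval (a - 1)) \<longlonglongrightarrow> 0" by (rule tendsto_mult_left_zero)
  show "\<forall>\<^sub>F n in sequentially. norm (absval (a ^ (p ^ n) - 1)) \<le> C.contr a ^ n * absval (a - 1)"
    using C.absval_p_power_iter[OF assms] by simp
qed

text \<open>The powers \<open>e ^ (p ^ n)\<close> tend to 1 at the place of \<open>\<sigma>\<^sub>0\<close> and to 0 at its other conjugates, so they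
  cut the sum over the decomposition group out of the trace to the rationals.\<close>

lemma decomposition_idempotent:
  obtains e where "\<And>h. h \<in> D \<Longrightarrow> (\<lambda>n. \<sigma>\<^sub>0 (h (e ^ (p ^ n)))) \<longlonglongrightarrow> 1" "\<And>h. h \<in> G - D \<Longrightarrow> (\<lambda>n. \<sigma>\<^sub>0 (h (e ^ (p ^ n)))) \<longlonglongrightarrow> 0"
proof -
  have pr: "prime_above p (place h)" if "h \<in> G" for h
    unfolding place_def by (rule prime_above_center[OF hom_gal[OF that] C.absval_p])
  have "finite (place ` (G - D))" using finite_gal by simp
  moreover have "prime_above p Q \<and> Q \<noteq> place id" if "Q \<in> place ` (G - D)" for Q
    using that pr by (auto simp: D_def)
  moreover have "p > 0" using C.p_gt_1 by simp
  ultimately obtain x where x: "x \<in> place id" "\<And>Q. Q \<in> place ` (G - D) \<Longrightarrow> 1 - x \<in> Q"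
    using prime_above_crt[OF pr[OF id_gal]] by metis
  have pow: "\<sigma>\<^sub>0 (h ((1 - x) ^ (p ^ n))) = \<sigma>\<^sub>0 (h (1 - x)) ^ (p ^ n)" if "h \<in> G" for h n
  proof -
    interpret h: field_hom h using that by (simp add: gal_iff)
    show ?thesis by (simp only: h.hom_power s.hom_power)
  qed
  show ?thesis
  proof (rule that[of "1 - x"])
    fix h assume h: "h \<in> D"
    have "absval (\<sigma>\<^sub>0 x) < 1" using x(1) by (simp add: place_id center_def)
    then have hx: "absval (\<sigma>\<^sub>0 (h x)) < 1" using absval_D[OF h] by blast
    interpret h: field_hom h using D_gal[OF h] by (simp add: gal_iff)
    have "absval (\<sigma>\<^sub>0 (h (1 - x)) - 1) < 1" using hx by (simp add: h.hom_minus s.hom_minus)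
    then show "(\<lambda>n. \<sigma>\<^sub>0 (h ((1 - x) ^ (p ^ n)))) \<longlonglongrightarrow> 1" unfolding pow[OF D_gal[OF h]] by (rule p_power_principal_seq)
  next
    fix h assume h: "h \<in> G - D"
    then have "1 - x \<in> place h" using x(2) by blast
    then have "absval (\<sigma>\<^sub>0 (h (1 - x))) < 1" by (simp add: place_def center_def)
    moreover have "h \<in> G" using h by blast
    ultimately show "(\<lambda>n. \<sigma>\<^sub>0 (h ((1 - x) ^ (p ^ n)))) \<longlonglongrightarrow> 0" unfolding pow[OF \<open>h \<in> G\<close>] by (intro p_power_small_seq)
  qed
qed

abbreviation ext_D :: "('m \<Rightarrow> 'm) \<Rightarrow> 'c \<Rightarrow> 'c" where
  "ext_D h \<equiv> twin.ext \<sigma>\<^sub>0 (\<lambda>x. \<sigma>\<^sub>0 (h x))"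

text \<open>The sum of \<open>h (e ^ (p ^ n) * m)\<close> over the whole group is rational, and its
  image tends to the sum over \<open>D\<close>; continuity of the extensions carries this from the
  field to its completion.\<close>

lemma trace_closure_Rats:
  assumes "y \<in> F"
  shows "(\<Sum>h\<in>D. ext_D h y) \<in> closure \<rat>"
proof -
  obtain e where e: "\<And>h. h \<in> D \<Longrightarrow> (\<lambda>n. \<sigma>\<^sub>0 (h (e ^ (p ^ n)))) \<longlonglongrightarrow> 1" "\<And>h. h \<in> G - D \<Longrightarrow> (\<lambda>n. \<sigma>\<^sub>0 (h (e ^ (p ^ n)))) \<longlonglongrightarrow> 0"
    using decomposition_idempotent by metis
  have 1: "(\<Sum>h\<in>D. \<sigma>\<^sub>0 (h m)) \<in> closure \<rat>" for m
  proof (rule closed_sequentially[OF closed_closure])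
    have "(\<lambda>n. \<sigma>\<^sub>0 (h (e ^ (p ^ n))) * \<sigma>\<^sub>0 (h m)) \<longlonglongrightarrow> (if h \<in> D then 1 else 0) * \<sigma>\<^sub>0 (h m)" if "h \<in> G" for h
      using e that by (intro tendsto_mult tendsto_const) auto
    then have "(\<lambda>n. \<Sum>h\<in>G. \<sigma>\<^sub>0 (h (e ^ (p ^ n))) * \<sigma>\<^sub>0 (h m)) \<longlonglongrightarrow> (\<Sum>h\<in>G. (if h \<in> D then 1 else 0) * \<sigma>\<^sub>0 (h m))"
      by (rule tendsto_sum)
    moreover have "(\<Sum>h\<in>G. (if h \<in> D then 1 else 0) * \<sigma>\<^sub>0 (h m)) = (\<Sum>h\<in>D. \<sigma>\<^sub>0 (h m))"
      using finite_gal D_gal by (intro sum.mono_neutral_cong_right) auto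
    ultimately show "(\<lambda>n. \<Sum>h\<in>G. \<sigma>\<^sub>0 (h (e ^ (p ^ n))) * \<sigma>\<^sub>0 (h m)) \<longlonglongrightarrow> (\<Sum>h\<in>D. \<sigma>\<^sub>0 (h m))" by simp
    fix n
    have "(\<Sum>h\<in>G. \<sigma>\<^sub>0 (h (e ^ (p ^ n))) * \<sigma>\<^sub>0 (h m)) = \<sigma>\<^sub>0 (\<Sum>h\<in>G. h (e ^ (p ^ n) * m))"
      unfolding s.hom_sum
    proof (rule sum.cong[OF refl])
      fix h assume "h \<in> G"
      then interpret h: field_hom h by (simp add: gal_iff)
      show "\<sigma>\<^sub>0 (h (e ^ (p ^ n))) * \<sigma>\<^sub>0 (h m) = \<sigma>\<^sub>0 (h (e ^ (p ^ n) * m))" by (simp only: h.hom_mult s.hom_mult)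
    qed
    moreover obtain r where "(\<Sum>h\<in>G. h (e ^ (p ^ n) * m)) = of_rat r" using gal_sum_Rats by (metis Rats_cases)
    ultimately have "(\<Sum>h\<in>G. \<sigma>\<^sub>0 (h (e ^ (p ^ n))) * \<sigma>\<^sub>0 (h m)) = of_rat r" by (simp add: field_hom_of_rat[OF \<sigma>\<^sub>0])
    then show "(\<Sum>h\<in>G. \<sigma>\<^sub>0 (h (e ^ (p ^ n))) * \<sigma>\<^sub>0 (h m)) \<in> closure \<rat>" using closure_subset[of "\<rat> :: 'c set"] by auto
  qed
  interpret i: twin p "TYPE('c)" "TYPE('c)" \<sigma>\<^sub>0 "\<lambda>x. \<sigma>\<^sub>0 (id x)" by (rule twin_D[OF id_D])
  obtain m where m: "(\<lambda>n. \<sigma>\<^sub>0 (m n)) \<longlonglongrightarrow> y" using i.K_seq[OF assms] .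
  have "(\<lambda>n. \<Sum>h\<in>D. \<sigma>\<^sub>0 (h (m n))) \<longlonglongrightarrow> (\<Sum>h\<in>D. ext_D h y)"
    by (intro tendsto_sum twin.ext_limit[OF twin_D m])
  then show ?thesis by (rule closed_sequentially[OF closed_closure 1])
qed

subsection \<open>The upper bound\<close>

text \<open>If \<open>S\<close> meets every coset, the coordinates sum to zero, and the one at the identity is redundant.\<close>

definition spans :: "('m \<Rightarrow> 'm) set \<Rightarrow> bool" where
  "spans E \<longleftrightarrow> E \<subseteq> S \<and> inj_on rep E \<and> (rep ` E = rep ` S \<or> rep ` S = reps \<and> rep ` E = reps - {id})"

text \<open>Coordinates in one coset agree, so only a coset missed by \<open>E\<close> matters. It
  can only be the one of the identity, and the zero sum over all cosets supplies its value.\<close>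

lemma spans_zero:
  assumes E: "spans E" and Z: "finite Z" "Z \<subseteq> \<C>" and 0: "\<And>g. g \<in> E \<Longrightarrow> (\<Sum>x\<in>Z. a x * \<Lambda> g x) = 0" and g: "g \<in> S"
  shows "(\<Sum>x\<in>Z. a x * \<Lambda> g x) = 0"
proof -
  have eq: "(\<Sum>x\<in>Z. a x * \<Lambda> g x) = (\<Sum>x\<in>Z. a x * \<Lambda> h x)" if "g \<in> S" "h \<in> S" "rep g = rep h" for g h
    using \<Lambda>_rep[OF that] Z(2) by (intro sum.cong refl) (metis subsetD)
  have ES: "E \<subseteq> S" using E by (simp add: spans_def)
  show ?thesis
  proof (cases "rep g \<in> rep ` E")
    case True
    then obtain h where "h \<in> E" "rep g = rep h" by blast
    then show ?thesis using eq[OF g, of h] ES 0 by auto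
  next
    case False
    then have r: "rep ` S = reps" "rep ` E = reps - {id}" using E g unfolding spans_def by blast+
    have "rep g = id" using False r rep_in_reps[OF S_gal[OF g]] by blast
    have "\<forall>r\<in>reps. \<exists>h. h \<in> S \<and> rep h = r" using r(1) by (metis imageE)
    then obtain f where f: "\<And>r. r \<in> reps \<Longrightarrow> f r \<in> S \<and> rep (f r) = r" by metis
    have z: "(\<Sum>x\<in>Z. a x * \<Lambda> (f r) x) = 0" if "r \<in> reps - {id}" for r
    proof -
      have "r \<in> rep ` E" using that r(2) by blast
      then obtain h where h: "h \<in> E" "r = rep h" by blast
      then show ?thesis using eq[of "f r" h] f[of r] that ES 0 by auto
    qed
    have "(\<Sum>r\<in>reps. \<Sum>x\<in>Z. a x * \<Lambda> (f r) x) = (\<Sum>x\<in>Z. a x * (\<Sum>r\<in>reps. \<Lambda> (f r) x))"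
      by (subst sum.swap) (simp add: sum_distrib_left)
    also have "\<dots> = 0" using \<Lambda>_sum[OF f] Z(2) by (intro sum.neutral) auto
    finally have "(\<Sum>r\<in>reps. \<Sum>x\<in>Z. a x * \<Lambda> (f r) x) = 0" .
    moreover have "(\<Sum>r\<in>reps. \<Sum>x\<in>Z. a x * \<Lambda> (f r) x) =
        (\<Sum>x\<in>Z. a x * \<Lambda> (f id) x) + (\<Sum>r\<in>reps - {id}. \<Sum>x\<in>Z. a x * \<Lambda> (f r) x)"
      by (rule sum.remove[OF finite_reps id_reps])
    moreover have "(\<Sum>r\<in>reps - {id}. \<Sum>x\<in>Z. a x * \<Lambda> (f r) x) = 0" using z by (intro sum.neutral) blast
    ultimately have "(\<Sum>x\<in>Z. a x * \<Lambda> (f id) x) = 0" by simp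
    moreover have "(\<Sum>x\<in>Z. a x * \<Lambda> g x) = (\<Sum>x\<in>Z. a x * \<Lambda> (f id) x)"
      using f[OF id_reps] \<open>rep g = id\<close> by (intro eq[OF g]) simp_all
    ultimately show ?thesis by simp
  qed
qed

text \<open>Applying the extension of \<open>h\<close> to the relation at
  \<open>h\<^sup>-\<^sup>1 \<circ> g\<close> yields the relation at \<open>g\<close> with conjugated
  coefficients; these are added over \<open>D\<close>.\<close>

lemma trace_relation:
  assumes Z: "finite Z" "Z \<subseteq> \<C>" and a: "\<And>x. x \<in> Z \<Longrightarrow> a x \<in> F" and 0: "\<And>g. g \<in> S \<Longrightarrow> (\<Sum>x\<in>Z. a x * \<Lambda> g x) = 0" and g: "g \<in> S"
  shows "(\<Sum>x\<in>Z. (\<Sum>h\<in>D. ext_D h (a x)) * \<Lambda> g x) = 0"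
proof -
  have "(\<Sum>x\<in>Z. ext_D h (a x) * \<Lambda> g x) = 0" if h: "h \<in> D" for h
  proof -
    interpret t: twin p "TYPE('c)" "TYPE('c)" \<sigma>\<^sub>0 "\<lambda>x. \<sigma>\<^sub>0 (h x)" by (rule twin_D[OF h])
    define g' where "g' = inv_into UNIV h \<circ> g"
    have g': "g' \<in> S" unfolding g'_def by (rule D_comp_S[OF inv_D[OF h] g])
    have hg: "h \<circ> g' = g" using gal_inv_comp(2)[OF D_gal[OF h]] by (simp add: g'_def comp_assoc[symmetric])
    have in_F: "a x * \<Lambda> g' x \<in> F" if "x \<in> Z" for x
      using \<Lambda>_in_F[OF g', of x] Z(2) that a by (intro t.K_mult) auto
    have sum: "(\<Sum>x\<in>V. f x) \<in> F \<and> t.ext (\<Sum>x\<in>V. f x) = (\<Sum>x\<in>V. t.ext (f x))" if "\<And>x. x \<in> V \<Longrightarrow> f x \<in> F" for f :: "('m set \<Rightarrow> 'k) \<Rightarrow> 'c" and V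
      using that by (induction V rule: infinite_finite_induct) (simp_all add: t.K_0 t.ext_0 t.K_add t.ext_add)
    have "0 = t.ext (\<Sum>x\<in>Z. a x * \<Lambda> g' x)" using 0[OF g'] t.ext_0 by simp
    also have "\<dots> = (\<Sum>x\<in>Z. t.ext (a x * \<Lambda> g' x))" using sum[of Z "\<lambda>x. a x * \<Lambda> g' x"] in_F by blast
    also have "\<dots> = (\<Sum>x\<in>Z. t.ext (a x) * \<Lambda> g x)"
    proof (rule sum.cong[OF refl])
      fix x assume x: "x \<in> Z"
      then have xC: "x \<in> \<C>" using Z(2) by blast
      show "t.ext (a x * \<Lambda> g' x) = t.ext (a x) * \<Lambda> g x"
        using t.ext_mult[OF a[OF x] \<Lambda>_in_F[OF g' xC]] \<Lambda>_D[OF h g' xC] hg by simp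
    qed
    finally show ?thesis by simp
  qed
  then have "(\<Sum>h\<in>D. \<Sum>x\<in>Z. ext_D h (a x) * \<Lambda> g x) = 0" by simp
  then show ?thesis by (subst (asm) sum.swap) (simp add: sum_distrib_right)
qed

lemma lin_dep_if_card:
  assumes E: "spans E" and Z: "finite Z" "Z \<subseteq> \<C>" and card: "card E < card Z"
  shows "module.lin_dep padic_integers (closure_module \<Gamma> \<iota>) Z"
proof -
  have ES: "E \<subseteq> S" using E by (simp add: spans_def)
  have finE: "finite E" using ES finite_S by (rule finite_subset)
  note Fc = closure_range_hom[OF \<sigma>\<^sub>0]
  have "\<exists>a. (\<forall>x\<in>Z. a x \<in> F) \<and> (\<exists>x\<in>Z. a x \<noteq> 0) \<and> (\<forall>g\<in>E. (\<Sum>x\<in>Z. a x * \<Lambda> g x) = 0)"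
    using Z ES by (intro nontrivial_solution Fc(2,3,5,6,7) finE card \<Lambda>_in_F) auto
  then obtain a where "(\<forall>x\<in>Z. a x \<in> F) \<and> (\<exists>x\<in>Z. a x \<noteq> 0) \<and> (\<forall>g\<in>E. (\<Sum>x\<in>Z. a x * \<Lambda> g x) = 0)" by (rule exE)
  then obtain x0 where a: "\<And>x. x \<in> Z \<Longrightarrow> a x \<in> F" "x0 \<in> Z" "a x0 \<noteq> 0" "\<And>g. g \<in> E \<Longrightarrow> (\<Sum>x\<in>Z. a x * \<Lambda> g x) = 0" by blast
  \<comment> \<open>After this scaling the coefficient at \<open>x0\<close> is 1 and its trace is
    the order of \<open>D\<close>, so the traced relation is nontrivial.\<close>
  define a' where "a' x = inverse (a x0) * a x" for x
  have a': "a' x \<in> F" if "x \<in> Z" for x unfolding a'_def by (intro Fc(5,7) a(1,2) that)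
  have "(\<Sum>x\<in>Z. a' x * \<Lambda> g x) = 0" if "g \<in> S" for g
  proof -
    have "(\<Sum>x\<in>Z. a' x * \<Lambda> g x) = inverse (a x0) * (\<Sum>x\<in>Z. a x * \<Lambda> g x)"
      by (simp add: a'_def sum_distrib_left mult.assoc)
    then show ?thesis using spans_zero[OF E Z a(4) that] by simp
  qed
  then have rel: "(\<Sum>x\<in>Z. (\<Sum>h\<in>D. ext_D h (a' x)) * \<Lambda> g x) = 0" if "g \<in> S" for g
    using that by (intro trace_relation Z a')
  define b where "b x = (\<Sum>h\<in>D. ext_D h (a' x))" for x
  have b: "b x \<in> closure \<rat>" if "x \<in> Z" for x unfolding b_def by (rule trace_closure_Rats[OF a'[OF that]])
  have "a' x0 = 1" using a(3) by (simp add: a'_def)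
  then have "b x0 = of_nat (card D)" using twin.ext_1[OF twin_D] by (simp add: b_def)
  moreover have "card D > 0" using finite_D id_D by (auto simp: card_gt_0_iff)
  ultimately have b0: "b x0 \<noteq> 0" by simp
  \<comment> \<open>A bound for all coefficients, positive thanks to the 1; a power of
    \<open>p\<close> smaller than its inverse moves the coefficients into the \<open>p\<close>-adic
    integers.\<close>
  define B where "B = 1 + (\<Sum>x\<in>Z. absval (b x))"
  have "B > 0" unfolding B_def by (intro add_pos_nonneg sum_nonneg) auto
  then obtain N where N: "absval (of_nat p :: 'c) ^ N < inverse B" using C.pv_power_small[of "inverse B"] by auto
  have int: "of_nat p ^ N * b x \<in> closure \<int>" if x: "x \<in> Z" for x
  proof (rule C.closure_Ints_if_absval_le)
    show "of_nat p ^ N * b x \<in> closure \<rat>" by (intro C.closure_Rats_closed(2,5) b[OF x]) simp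
    have "absval (b x) \<le> (\<Sum>x\<in>Z. absval (b x))" using Z(1) x by (intro member_le_sum) auto
    then have "absval (b x) \<le> B" by (simp add: B_def)
    then have "absval (of_nat p :: 'c) ^ N * absval (b x) \<le> inverse B * B" using N \<open>B > 0\<close> by (intro mult_mono) auto
    then show "absval (of_nat p ^ N * b x) \<le> 1" using \<open>B > 0\<close> by (simp add: absval_mult absval_power)
  qed
  have "\<exists>a. a \<in> closure \<int> \<and> \<kappa> a = of_nat p ^ N * b x" if "x \<in> Z" for x using \<kappa>_surj[OF int[OF that]] by metis
  then obtain \<alpha> where \<alpha>: "\<And>x. x \<in> Z \<Longrightarrow> \<alpha> x \<in> closure \<int>" "\<And>x. x \<in> Z \<Longrightarrow> \<kappa> (\<alpha> x) = of_nat p ^ N * b x" by metis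
  show ?thesis
  proof (rule lin_dep_if_sum[OF Z \<alpha>(1) a(2)])
    have "(of_nat p :: 'c) ^ N \<noteq> 0" using C.p_gt_1 by simp
    then have "\<kappa> (\<alpha> x0) \<noteq> 0" using b0 \<alpha>(2)[OF a(2)] by simp
    then show "\<alpha> x0 \<noteq> 0" using \<kappa>_eq_0[OF \<alpha>(1)[OF a(2)]] by blast
    fix g assume g: "g \<in> S"
    have "(\<Sum>x\<in>Z. \<kappa> (\<alpha> x) * \<Lambda> g x) = of_nat p ^ N * (\<Sum>x\<in>Z. b x * \<Lambda> g x)"
      unfolding sum_distrib_left using \<alpha>(2) by (intro sum.cong) (simp_all add: mult.assoc)
    then show "(\<Sum>x\<in>Z. \<kappa> (\<alpha> x) * \<Lambda> g x) = 0" using rel[OF g] by (simp add: b_def)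
  qed
qed

end

lemma common_denominator:
  fixes r :: "'i \<Rightarrow> rat"
  assumes "finite I"
  obtains d :: int and k where "d > 0" "\<And>i. i \<in> I \<Longrightarrow> of_int d * r i = of_int (k i)"
proof -
  define d where "d = (\<Prod>i\<in>I. snd (quotient_of (r i)))"
  have pos: "snd (quotient_of x) > 0" for x by (metis quotient_of_denom_pos prod.collapse)
  have "\<exists>k. of_int d * r i = of_int k" if "i \<in> I" for i
  proof -
    define a b where "a = fst (quotient_of (r i))" and "b = snd (quotient_of (r i))"
    have "r i = of_int a / of_int b" by (rule quotient_of_div) (simp add: a_def b_def)
    then have "r i * of_int b = of_int a" using pos[of "r i"] unfolding b_def by (metis less_irrefl nonzero_eq_divide_eq of_int_eq_0_iff)
    then have "r i * of_int (snd (quotient_of (r i))) = of_int (fst (quotient_of (r i)))" by (simp only: a_def b_def)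
    moreover have "d = snd (quotient_of (r i)) * (\<Prod>j\<in>I - {i}. snd (quotient_of (r j)))"
      unfolding d_def by (rule prod.remove[OF assms that])
    ultimately have "of_int d * r i = of_int (fst (quotient_of (r i)) * (\<Prod>j\<in>I - {i}. snd (quotient_of (r j))))"
      by (simp add: mult_ac)
    then show ?thesis by blast
  qed
  then obtain k where "\<And>i. i \<in> I \<Longrightarrow> of_int d * r i = of_int (k i)" by metis
  moreover have "d > 0" unfolding d_def using pos by (intro prod_pos) blast
  ultimately show ?thesis using that by blast
qed

context cm_padic
begin

subsection \<open>The lower bound\<close>

text \<open>At each prime of \<open>\<Gamma>\<close> each conjugate of the unit has a principal
  power; the product of these finitely many exponents serves all of them.\<close>

lemma unit_power_in_Y:
  assumes u: "u \<in> Units ring_of_integers"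
  obtains e where "e > 0" "\<And>g. g \<in> G \<Longrightarrow> g (u ^ e) \<in> k.Y"
proof -
  have "\<exists>n>0. absval (\<iota> P (g u) ^ n - 1) < 1" if Pg: "P \<in> \<Gamma>" "g \<in> G" for P g
  proof -
    have gu: "algebraic_int (g u)" "algebraic_int (inverse (g u))" "g u \<noteq> 0"
      using unit_gal[OF Pg(2) u] by (simp_all add: unit_iff)
    interpret i: field_hom "\<iota> P" by (rule k.\<iota>_hom[OF Pg(1)])
    have "absval (\<iota> P (g u)) \<le> 1" "absval (\<iota> P (inverse (g u))) \<le> 1"
      using absval_hom_int[OF k.\<iota>_hom[OF Pg(1)]] gu by blast+
    moreover have "absval (\<iota> P (g u)) * absval (\<iota> P (inverse (g u))) = 1"
      using gu(3) by (simp add: i.hom_inverse absval_inverse)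
    ultimately have "absval (\<iota> P (g u)) = 1"
      using mult_le_one[of "absval (\<iota> P (g u))" "absval (\<iota> P (inverse (g u)))"]
      by (smt (verit) absval_nonneg mult_left_le mult_cancel_left1)
    from k.hom_unit_power[OF k.\<iota>_hom[OF Pg(1)] this] show ?thesis by metis
  qed
  then obtain n where n: "\<And>P g. P \<in> \<Gamma> \<Longrightarrow> g \<in> G \<Longrightarrow> n P g > 0 \<and> absval (\<iota> P (g u) ^ n P g - 1) < 1" by metis
  define e where "e = (\<Prod>(P, g)\<in>\<Gamma> \<times> G. n P g)"
  have fin: "finite (\<Gamma> \<times> G)" using k.finite_\<Gamma> finite_gal by simp
  have "e > 0" unfolding e_def using n by (intro prod_pos) auto
  moreover have "g (u ^ e) \<in> k.Y" if g: "g \<in> G" for g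
  proof -
    have "absval (\<iota> P (g (u ^ e)) - 1) < 1" if P: "P \<in> \<Gamma>" for P
    proof -
      interpret i: field_hom "\<iota> P" by (rule k.\<iota>_hom[OF P])
      interpret g: field_hom g using g by (simp add: gal_iff)
      have "n P g dvd e" unfolding e_def using dvd_prodI[OF fin, of "(P, g)" "\<lambda>(P, g). n P g"] P g by simp
      then obtain l where "e = n P g * l" unfolding dvd_def by blast
      then have "\<iota> P (g (u ^ e)) = (\<iota> P (g u) ^ n P g) ^ l" by (simp add: g.hom_power i.hom_power power_mult)
      then show ?thesis using n[OF P g] by (simp add: k.principal_power)
    qed
    then show ?thesis using unit_gal[OF g unit_power[OF u]] by (simp add: k.Y_iff)
  qed
  ultimately show ?thesis using that by blast
qed

text \<open>A rational relation, cleared of denominators, gives a product \<open>y\<close> of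
  conjugates with logarithm zero. As a unit it has absolute value 1, so it is a root of unity, and
  archimedean independence of the conjugates makes the exponents vanish.\<close>

lemma L_independent:
  assumes u: "mink u" and "e > 0" and \<rho>: "bij_betw \<rho> {..<n} (reps - {id})"
  shows "rat_independent n (\<lambda>i. L (u ^ e) (\<rho> i))"
  unfolding rat_independent_def
proof (intro allI impI)
  fix r :: "nat \<Rightarrow> rat" and i0 assume sum: "(\<Sum>i<n. of_rat (r i) * L (u ^ e) (\<rho> i)) = 0" and i0: "i0 < n"
  obtain d k where dk: "d > 0" "\<And>i. i \<in> {..<n} \<Longrightarrow> of_int d * r i = of_int (k i)"
    using common_denominator[of "{..<n}" r] by auto
  have uU: "u \<in> Units ring_of_integers" using u by (simp add: mink_def)
  have \<rho>_gal: "\<rho> i \<in> G" "\<rho> i \<in> reps" "\<rho> i \<noteq> id" if "i < n" for i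
    using bij_betw_apply[OF \<rho>, of i] that reps_gal by auto
  have nz: "\<sigma>\<^sub>0 (\<rho> i u) \<noteq> 0" if "i < n" for i using unit_nonzero[OF unit_gal[OF \<rho>_gal(1)[OF that] uU]] by simp
  have Lu: "L (u ^ e) (\<rho> i) = of_nat e * C.Lg (\<sigma>\<^sub>0 (\<rho> i u))" if "i < n" for i
  proof -
    interpret g: field_hom "\<rho> i" using \<rho>_gal(1)[OF that] by (simp add: gal_iff)
    show ?thesis using C.Lg_power[OF nz[OF that], of e] by (simp add: L_def g.hom_power s.hom_power)
  qed
  have "0 = of_int d * (\<Sum>i<n. of_rat (r i) * L (u ^ e) (\<rho> i))" using sum by simp
  also have "\<dots> = (\<Sum>i<n. of_rat (of_int d * r i) * (of_nat e * C.Lg (\<sigma>\<^sub>0 (\<rho> i u))))"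
    unfolding sum_distrib_left by (intro sum.cong) (simp_all add: Lu of_rat_mult mult.assoc)
  also have "\<dots> = (\<Sum>i<n. of_nat e * (of_int (k i) * C.Lg (\<sigma>\<^sub>0 (\<rho> i u))))"
    by (intro sum.cong) (simp_all add: dk(2) mult_ac)
  finally have "of_nat e * (\<Sum>i<n. of_int (k i) * C.Lg (\<sigma>\<^sub>0 (\<rho> i u))) = 0" by (simp add: sum_distrib_left)
  then have s0: "(\<Sum>i<n. of_int (k i) * C.Lg (\<sigma>\<^sub>0 (\<rho> i u))) = 0" using \<open>e > 0\<close> by simp
  define y where "y = (\<Prod>i<n. \<rho> i u powi k i)"
  have y: "y \<in> Units ring_of_integers"
    unfolding y_def by (intro unit_prod unit_power_int unit_gal[OF \<rho>_gal(1) uU]) simp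
  have "\<sigma>\<^sub>0 (x powi j) = \<sigma>\<^sub>0 x powi j" for x j by (simp add: power_int_def s.hom_power s.hom_inverse)
  then have sy: "\<sigma>\<^sub>0 y = (\<Prod>i<n. \<sigma>\<^sub>0 (\<rho> i u) powi k i)" by (simp add: y_def s.hom_prod)
  have "C.Lg (\<sigma>\<^sub>0 y) = (\<Sum>i<n. C.Lg (\<sigma>\<^sub>0 (\<rho> i u) powi k i))"
    unfolding sy by (rule C.Lg_prod) (use nz in simp)
  also have "\<dots> = (\<Sum>i<n. of_int (k i) * C.Lg (\<sigma>\<^sub>0 (\<rho> i u)))"
    by (rule sum.cong[OF refl], rule C.Lg_power_int, rule nz) simp
  finally have Lg0: "C.Lg (\<sigma>\<^sub>0 y) = 0" using s0 by simp
  have y': "algebraic_int y" "algebraic_int (inverse y)" "y \<noteq> 0" using y by (simp_all add: unit_iff)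
  have le: "absval (\<sigma>\<^sub>0 y) \<le> 1" "absval (\<sigma>\<^sub>0 (inverse y)) \<le> 1" using absval_hom_int[OF \<sigma>\<^sub>0] y' by blast+
  have "absval (\<sigma>\<^sub>0 y) > 0" using y'(3) by simp
  moreover have "absval (\<sigma>\<^sub>0 y) \<le> 0 \<or> 1 \<le> absval (\<sigma>\<^sub>0 y)"
    using le(2) unfolding s.hom_inverse absval_inverse inverse_le_1_iff .
  ultimately have "absval (\<sigma>\<^sub>0 y) = 1" using le(1) by linarith
  then obtain N where N: "N > 0" "\<sigma>\<^sub>0 y ^ N = 1" using C.Lg_eq_0 Lg0 by metis
  have "\<sigma>\<^sub>0 (y ^ N) = \<sigma>\<^sub>0 1" using N(2) by (simp add: s.hom_power)
  then have yN: "y ^ N = 1" by (rule field_hom_inject[OF \<sigma>\<^sub>0, THEN iffD1])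
  define k' where "k' g = (if g = id then 0 else k (the_inv_into {..<n} \<rho> g))" for g
  have inv: "the_inv_into {..<n} \<rho> (\<rho> i) = i" if "i < n" for i
    using the_inv_into_f_f[OF bij_betw_imp_inj_on[OF \<rho>]] that by simp
  have "(\<Prod>g\<in>reps. g u powi k' g) = (\<Prod>g\<in>reps - {id}. g u powi k' g)"
    using finite_reps by (intro prod.mono_neutral_right) (auto simp: k'_def)
  also have "\<dots> = (\<Prod>i<n. \<rho> i u powi k' (\<rho> i))" by (rule prod.reindex_bij_betw[OF \<rho>, symmetric])
  also have "\<dots> = y" unfolding y_def using inv \<rho>_gal(3) by (intro prod.cong) (auto simp: k'_def)
  finally have "(\<Prod>g\<in>reps. g u powi k' g) ^ N = 1" using yN by simp
  moreover have "k' id = 0" by (simp add: k'_def)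
  ultimately have "k' (\<rho> i0) = 0" using mink_independent[OF u _ N(1)] \<rho>_gal(2)[OF i0] by blast
  then have "k i0 = 0" using inv[OF i0] \<rho>_gal(3)[OF i0] by (simp add: k'_def)
  then have "of_int d * r i0 = 0" using dk(2)[of i0] i0 by simp
  then show "r i0 = 0" using dk(1) by simp
qed

lemma lin_indep_exists:
  assumes schanuel: "padic_schanuel_log_conjecture p TYPE('c)" and E: "spans E" "card E < card reps"
  obtains Z where "finite Z" "Z \<subseteq> \<C>" "card Z = card E" "\<not> module.lin_dep padic_integers (closure_module \<Gamma> \<iota>) Z"
proof -
  obtain u where u: "mink u" using mink_exists by (rule exE)
  then have uU: "u \<in> Units ring_of_integers" by (simp add: mink_def)
  obtain e where e: "e > 0" "\<And>g. g \<in> G \<Longrightarrow> g (u ^ e) \<in> k.Y" using unit_power_in_Y[OF uU] by metis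
  define w where "w = u ^ e"
  have w: "w \<in> Units ring_of_integers" "\<And>g. g \<in> G \<Longrightarrow> g w \<in> k.Y" using e(2) unit_power[OF uU] by (simp_all add: w_def)
  define n where "n = card (reps - {id})"
  have n: "card reps = n + 1" using finite_reps id_reps card_Diff_singleton[of id reps] card_gt_0_iff[of reps] by (auto simp: n_def)
  have "\<exists>\<rho>. bij_betw \<rho> {..<n} (reps - {id})"
    using ex_bij_betw_nat_finite[of "reps - {id}"] finite_reps by (simp add: n_def lessThan_atLeast0)
  then obtain \<rho> where \<rho>: "bij_betw \<rho> {..<n} (reps - {id})" by (rule exE)
  have \<rho>_gal: "\<rho> i \<in> G" if "i < n" for i using bij_betw_apply[OF \<rho>, of i] that reps_gal by auto
  have "alg_independent n (\<lambda>i. padic_log p (\<sigma>\<^sub>0 (\<rho> i w)))"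
  proof -
    have 1: "\<forall>i<n. \<sigma>\<^sub>0 (\<rho> i w) \<noteq> 0 \<and> algebraic (\<sigma>\<^sub>0 (\<rho> i w))"
    proof (intro allI impI)
      fix i assume "i < n"
      then have "\<rho> i w \<in> Units ring_of_integers" using unit_gal[OF \<rho>_gal w(1)] by blast
      then show "\<sigma>\<^sub>0 (\<rho> i w) \<noteq> 0 \<and> algebraic (\<sigma>\<^sub>0 (\<rho> i w))"
        using field_hom_algebraic[OF \<sigma>\<^sub>0] by (simp add: unit_iff algebraic_int_imp_algebraic)
    qed
    have 2: "rat_independent n (\<lambda>i. padic_log p (\<sigma>\<^sub>0 (\<rho> i w)))"
      using L_independent[OF u e(1) \<rho>] unfolding C.padic_log_eq L_def w_def .
    show ?thesis
      by (rule schanuel[unfolded padic_schanuel_log_conjecture_def, THEN spec[of _ n],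
        THEN spec[of _ "\<lambda>i. \<sigma>\<^sub>0 (\<rho> i w)"], THEN mp, THEN mp, OF 1 2])
  qed
  then have alg: "alg_independent n (\<lambda>i. L w (\<rho> i))" unfolding C.padic_log_eq L_def .
  have ES: "E \<subseteq> S" "inj_on rep E" using E(1) by (simp_all add: spans_def)
  have finE: "finite E" using ES(1) finite_S by (rule finite_subset)
  define d where "d = card E"
  have "\<exists>\<epsilon>. bij_betw \<epsilon> {..<d} E"
    using ex_bij_betw_nat_finite[OF finE] by (simp add: d_def lessThan_atLeast0)
  then obtain \<epsilon> where \<epsilon>: "bij_betw \<epsilon> {..<d} E" by (rule exE)
  have \<epsilon>S: "\<epsilon> i \<in> S" "\<epsilon> i \<in> G" "\<epsilon> i \<in> E" if "i < d" for i
    using bij_betw_apply[OF \<epsilon>, of i] that ES(1) S_gal by auto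
  \<comment> \<open>With inverse automorphisms the entry at \<open>(i, j)\<close> depends on
    \<open>\<epsilon> i\<close> composed with the inverse of \<open>\<epsilon> j\<close>; every
    diagonal entry then belongs to the identity coset.\<close>
  define x where "x i = diag \<Gamma> \<iota> (inv_into UNIV (\<epsilon> i) w)" for i
  have xC: "x i \<in> \<C>" if "i < d" for i
    unfolding x_def by (intro k.diag_in_closure w(2) inv_gal \<epsilon>S(2) that)
  \<comment> \<open>The index of the independent logarithm in an off-diagonal entry. On the diagonal
    nothing is claimed, as \<open>\<rho>\<close> does not enumerate \<open>id\<close>.\<close>
  define f where "f i j = the_inv_into {..<n} \<rho> (rep (\<epsilon> i \<circ> inv_into UNIV (\<epsilon> j)))" for i j
  have f: "f i j < n" "\<rho> (f i j) = rep (\<epsilon> i \<circ> inv_into UNIV (\<epsilon> j))" if ij: "i < d" "j < d" "i \<noteq> j" for i j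
  proof -
    let ?g = "\<epsilon> i \<circ> inv_into UNIV (\<epsilon> j)"
    have g: "?g \<in> G" by (intro comp_gal inv_gal \<epsilon>S(2) ij)
    have "rep ?g \<noteq> id"
    proof
      assume "rep ?g = id"
      then have "?g = id \<or> ?g = c \<circ> id" using rep_eq_iff[of ?g id] rep_id by simp
      then have "?g \<circ> \<epsilon> j = \<epsilon> j \<or> ?g \<circ> \<epsilon> j = c \<circ> \<epsilon> j" by auto
      then have "\<epsilon> i = \<epsilon> j \<or> \<epsilon> i = c \<circ> \<epsilon> j"
        using gal_inv_comp(1)[OF \<epsilon>S(2)[OF ij(2)]] by (simp add: comp_assoc)
      then have "rep (\<epsilon> i) = rep (\<epsilon> j)" using rep_eq_iff by blast
      then have "\<epsilon> i = \<epsilon> j" using ES(2) \<epsilon>S(3) ij by (simp add: inj_on_eq_iff)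
      then show False using bij_betw_imp_inj_on[OF \<epsilon>] ij by (simp add: inj_on_eq_iff)
    qed
    then have "rep ?g \<in> \<rho> ` {..<n}" using rep_in_reps[OF g] bij_betw_imp_surj_on[OF \<rho>] by simp
    then show "f i j < n" "\<rho> (f i j) = rep ?g"
      unfolding f_def using the_inv_into_into[OF bij_betw_imp_inj_on[OF \<rho>], of "rep ?g" "{..<n}"]
        f_the_inv_into_f[OF bij_betw_imp_inj_on[OF \<rho>], of "rep ?g"] by simp_all
  qed
  have \<Lambda>x: "\<Lambda> (\<epsilon> i) (x j) = (if i = j then - (\<Sum>l<n. L w (\<rho> l)) else L w (\<rho> (f i j)))" if ij: "i < d" "j < d" for i j
  proof -
    let ?g = "\<epsilon> i \<circ> inv_into UNIV (\<epsilon> j)"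
    have gG: "?g \<in> G" by (intro comp_gal inv_gal \<epsilon>S(2) ij)
    have "\<Lambda> (\<epsilon> i) (x j) = C.lg (\<sigma>\<^sub>0 (?g w))" unfolding x_def using \<Lambda>_diag[OF \<epsilon>S(1)[OF ij(1)]] by simp
    also have "\<dots> = C.Lg (\<sigma>\<^sub>0 (?g w))"
      using Y_principal[OF w(2)[OF gG] id_S] by (intro C.Lg_principal[symmetric]) simp
    also have "\<dots> = L w (rep ?g)" using L_rep[OF w(1) gG] by (simp add: L_def)
    finally have *: "\<Lambda> (\<epsilon> i) (x j) = L w (rep ?g)" .
    show ?thesis
    proof (cases "i = j")
      case True
      then have "rep ?g = id" using gal_inv_comp(2)[OF \<epsilon>S(2)[OF ij(2)]] rep_id by simp
      moreover have "(\<Sum>g\<in>reps. L w g) = L w id + (\<Sum>g\<in>reps - {id}. L w g)" by (rule sum.remove[OF finite_reps id_reps])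
      moreover have "(\<Sum>g\<in>reps - {id}. L w g) = (\<Sum>l<n. L w (\<rho> l))" by (rule sum.reindex_bij_betw[OF \<rho>, symmetric])
      ultimately show ?thesis using True * L_sum[OF w(1)] by (simp add: eq_neg_iff_add_eq_0)
    next
      case False
      then show ?thesis using * f(2)[OF ij False] by simp
    qed
  qed
  have dn: "d \<le> n" using E(2) n by (simp add: d_def)
  have nonsing: "v j = 0" if v: "\<And>i. i < d \<Longrightarrow> (\<Sum>j<d. v j * \<Lambda> (\<epsilon> i) (x j)) = 0" and j: "j < d" for v :: "nat \<Rightarrow> 'c" and j
  proof (rule alg_independent_matrix[OF alg dn f(1) _ j])
    fix i assume i: "i < d"
    have "(\<Sum>j<d. (if i = j then - (\<Sum>l<n. L w (\<rho> l)) else L w (\<rho> (f i j))) * v j) = (\<Sum>j<d. v j * \<Lambda> (\<epsilon> i) (x j))"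
      using \<Lambda>x[OF i] by (intro sum.cong) simp_all
    then show "(\<Sum>j<d. (if i = j then - (\<Sum>l<n. L w (\<rho> l)) else L w (\<rho> (f i j))) * v j) = 0" using v[OF i] by simp
  qed
  have inj: "inj_on x {..<d}"
  proof (rule inj_onI, rule ccontr)
    fix a b assume ab: "a \<in> {..<d}" "b \<in> {..<d}" "x a = x b" "a \<noteq> b"
    \<comment> \<open>Two equal elements would give equal columns, and this vector would lie in the
      kernel.\<close>
    define v :: "nat \<Rightarrow> 'c" where "v j = (if j = a then 1 else if j = b then - 1 else 0)" for j
    have "(\<Sum>j<d. v j * \<Lambda> (\<epsilon> i) (x j)) = 0" for i
    proof -
      have "(\<Sum>j<d. v j * \<Lambda> (\<epsilon> i) (x j)) = (\<Sum>j\<in>{a, b}. v j * \<Lambda> (\<epsilon> i) (x j))"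
        using ab by (intro sum.mono_neutral_right) (auto simp: v_def)
      then show ?thesis using ab by (simp add: v_def)
    qed
    then have "v a = 0" using nonsing[of v a] ab by simp
    then show False by (simp add: v_def)
  qed
  define Z where "Z = x ` {..<d}"
  have Z: "finite Z" "Z \<subseteq> \<C>" "card Z = card E"
    using xC card_image[OF inj] by (auto simp: Z_def d_def)
  have "\<not> module.lin_dep padic_integers (closure_module \<Gamma> \<iota>) Z"
  proof
    assume "module.lin_dep padic_integers (closure_module \<Gamma> \<iota>) Z"
    then obtain a where a: "\<And>x. x \<in> Z \<Longrightarrow> a x \<in> closure \<int>" "\<exists>x\<in>Z. a x \<noteq> 0"
      "\<And>P. P \<in> \<Gamma> \<Longrightarrow> (\<Prod>x\<in>Z. padic_power (x P) (a x)) = 1"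
      unfolding k.lin_dep_closure_module[OF Z(1,2)] by metis
    have "(\<Sum>j<d. \<kappa> (a (x j)) * \<Lambda> (\<epsilon> i) (x j)) = 0" if "i < d" for i
    proof -
      have "(\<Sum>z\<in>Z. \<kappa> (a z) * \<Lambda> (\<epsilon> i) z) = 0"
        by (rule relation_imp_sum[OF Z(1,2) a(1,3) \<epsilon>S(1)[OF that]])
      then show ?thesis unfolding Z_def by (simp add: sum.reindex[OF inj])
    qed
    then have "\<kappa> (a (x j)) = 0" if "j < d" for j using nonsing[of "\<lambda>j. \<kappa> (a (x j))"] that by blast
    then have "a z = 0" if "z \<in> Z" for z using \<kappa>_eq_0[OF a(1)[OF that]] that by (auto simp: Z_def)
    then show False using a(2) by blast
  qed
  then show ?thesis using that Z by blast
qed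

lemma closure_module_rank:
  assumes schanuel: "padic_schanuel_log_conjecture p TYPE('c)"
  shows "module_rank padic_integers (closure_module \<Gamma> \<iota>) = enat (min (card (rep ` S)) (card reps - 1))"
proof -
  have sub: "rep ` S \<subseteq> reps" using rep_in_reps S_gal by blast
  define B where "B = (if rep ` S = reps then reps - {id} else rep ` S)"
  have BS: "B \<subseteq> rep ` S" by (auto simp: B_def)
  then have "\<forall>b\<in>B. \<exists>g. g \<in> S \<and> rep g = b" by blast
  then obtain f where f: "\<And>b. b \<in> B \<Longrightarrow> f b \<in> S \<and> rep (f b) = b" by metis
  define E where "E = f ` B"
  have repE: "rep ` E = B" using f by (auto simp: E_def image_image)
  have "inj_on rep E" by (rule inj_onI) (auto simp: E_def f)
  then have E: "spans E" using f repE by (auto simp: spans_def E_def B_def split: if_splits)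
  have "inj_on f B" by (rule inj_onI) (metis f)
  then have cE: "card E = card B" by (simp add: E_def card_image)
  have pos: "card reps > 0" using finite_reps id_reps by (auto simp: card_gt_0_iff)
  have cB: "card B = min (card (rep ` S)) (card reps - 1)"
  proof (cases "rep ` S = reps")
    case True
    then show ?thesis using id_reps finite_reps by (simp add: B_def)
  next
    case False
    then have "card (rep ` S) < card reps" using sub finite_reps by (intro psubset_card_mono) auto
    then show ?thesis using False by (simp add: B_def)
  qed
  have "card E < card reps" using cE cB pos by simp
  then obtain Z where Z: "finite Z" "Z \<subseteq> \<C>" "card Z = card E" "\<not> module.lin_dep padic_integers (closure_module \<Gamma> \<iota>) Z"
    using lin_indep_exists[OF schanuel E] by metis
  show ?thesis
    unfolding cB[symmetric] cE[symmetric]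
  proof (rule module_rank_eqI[OF _ Z(1) _ Z(4,3)])
    show "Z \<subseteq> carrier (closure_module \<Gamma> \<iota>)" using Z(2) by (simp add: k.closure_module_simps)
    fix V assume V: "finite V" "V \<subseteq> carrier (closure_module \<Gamma> \<iota>)" "\<not> module.lin_dep padic_integers (closure_module \<Gamma> \<iota>) V"
    have "V \<subseteq> \<C>" using V(2) by (simp add: k.closure_module_simps)
    then show "card V \<le> card E" using lin_dep_if_card[OF E V(1)] V(3) by (meson not_le)
  qed
qed

subsection \<open>Counting cosets\<close>

text \<open>\<open>h\<close> commutes with \<open>c\<close>, so composition with it permutes the
  cosets, and those to be counted correspond to the cosets disjoint from \<open>S\<close>. A coset
  is disjoint from \<open>S\<close> exactly if its representative is not in the image of
  \<open>S\<close> under \<open>rep\<close>.\<close>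

lemma card_cosets:
  assumes h: "h \<in> G"
  shows "card {C \<in> rcosets\<^bsub>gal\<^esub> {id, c}. C \<subseteq> {g \<in> G. h \<circ> g \<notin> S}} = card (reps - rep ` S)"
proof -
  define k where "k = inv_into UNIV h"
  have k: "k \<in> G" "h \<circ> k = id" "k \<circ> h = id" using inv_gal[OF h] gal_inv_comp[OF h] by (simp_all add: k_def)
  have coset: "{id, c} #>\<^bsub>gal\<^esub> g = {g, c \<circ> g}" for g by (auto simp: r_coset_def gal_simps)
  define f :: "('m \<Rightarrow> 'm) \<Rightarrow> ('m \<Rightarrow> 'm) set" where "f r = {k \<circ> r, c \<circ> (k \<circ> r)}" for r
  have hc: "h \<circ> (c \<circ> g) = c \<circ> (h \<circ> g)" for g by (simp add: fun_eq_iff c_commute[OF h])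
  have "{C \<in> rcosets\<^bsub>gal\<^esub> {id, c}. C \<subseteq> {g \<in> G. h \<circ> g \<notin> S}} = f ` (reps - rep ` S)"
  proof (intro equalityI subsetI)
    fix C assume "C \<in> {C \<in> rcosets\<^bsub>gal\<^esub> {id, c}. C \<subseteq> {g \<in> G. h \<circ> g \<notin> S}}"
    then have C: "C \<in> rcosets\<^bsub>gal\<^esub> {id, c}" "C \<subseteq> {g \<in> G. h \<circ> g \<notin> S}" by simp_all
    obtain g where g: "g \<in> G" "C = {g, c \<circ> g}" using C(1) unfolding RCOSETS_def coset by blast
    have no: "h \<circ> g \<notin> S" "c \<circ> (h \<circ> g) \<notin> S" using C(2) unfolding g(2) by (auto simp: hc)
    have "rep (h \<circ> g) \<notin> rep ` S"
    proof
      assume "rep (h \<circ> g) \<in> rep ` S"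
      then obtain s where s: "s \<in> S" "rep s = rep (h \<circ> g)" by (metis imageE)
      then have "s = h \<circ> g \<or> s = c \<circ> (h \<circ> g)" using rep_eq_iff by blast
      then show False using no s(1) by blast
    qed
    moreover have "rep (h \<circ> g) \<in> reps" by (intro rep_in_reps comp_gal h g(1))
    moreover have "C = f (rep (h \<circ> g))"
    proof -
      have kh: "k \<circ> (h \<circ> g) = g" using k(3) by (simp add: comp_assoc[symmetric])
      have kc: "k \<circ> (c \<circ> (h \<circ> g)) = c \<circ> g" using kh c_commute[OF k(1)] by (simp add: fun_eq_iff)
      show ?thesis using rep_cases[of "h \<circ> g"] kh kc c_comp(3)[of g] unfolding f_def g(2) by auto
    qed
    ultimately show "C \<in> f ` (reps - rep ` S)" by blast
  next
    fix C assume "C \<in> f ` (reps - rep ` S)"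
    then obtain r where r: "r \<in> reps" "r \<notin> rep ` S" "C = f r" by blast
    have kr: "k \<circ> r \<in> G" using k(1) r(1) reps_gal by (intro comp_gal) auto
    have hkr: "h \<circ> (k \<circ> r) = r" using k(2) by (simp add: comp_assoc[symmetric])
    have "r \<notin> S" "c \<circ> r \<notin> S" using r rep_reps[OF r(1)] rep_c[of r] by (metis imageI)+
    then have "C \<subseteq> {g \<in> G. h \<circ> g \<notin> S}"
      using kr comp_gal[OF c_gal kr] hkr unfolding r(3) f_def by (auto simp: hc)
    moreover have "C \<in> rcosets\<^bsub>gal\<^esub> {id, c}" unfolding RCOSETS_def coset using kr r(3) by (auto simp: f_def)
    ultimately show "C \<in> {C \<in> rcosets\<^bsub>gal\<^esub> {id, c}. C \<subseteq> {g \<in> G. h \<circ> g \<notin> S}}" by blast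
  qed
  moreover have "inj_on f (reps - rep ` S)"
  proof (rule inj_onI)
    fix r s assume rs: "r \<in> reps - rep ` S" "s \<in> reps - rep ` S" "f r = f s"
    then have "k \<circ> r = k \<circ> s \<or> k \<circ> r = c \<circ> (k \<circ> s)" unfolding f_def by blast
    then have "h \<circ> (k \<circ> r) = h \<circ> (k \<circ> s) \<or> h \<circ> (k \<circ> r) = c \<circ> (h \<circ> (k \<circ> s))" using hc by metis
    then have "r = s \<or> r = c \<circ> s" using k(2) by (simp add: comp_assoc[symmetric])
    then have "rep r = rep s" using rep_eq_iff by blast
    then show "r = s" using rep_reps rs(1,2) by (metis DiffD1)
  qed
  ultimately show ?thesis by (simp add: card_image)
qed

end

section \<open>Assembly of the rank formula\<close>

lemma (in cm_padic) S_p_iff: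
  assumes "g \<in> G"
  shows "\<sigma>\<^sub>0 \<circ> g \<in> S_p \<Gamma> (center \<sigma>\<^sub>0) \<sigma>\<^sub>0 \<longleftrightarrow> g \<in> S"
proof -
  have inv: "(inv\<^bsub>gal\<^esub> g) ` center \<sigma>\<^sub>0 = place g" if g: "g \<in> G" for g
  proof -
    have "bij g" using g by (simp add: gal_iff)
    then show ?thesis
      using place_comp[OF g, of id] m_inv_gal[OF g] by (simp add: place_id bij_vimage_eq_inv_image)
  qed
  have "g = g'" if "\<sigma>\<^sub>0 \<circ> g = \<sigma>\<^sub>0 \<circ> g'" for g'
    using that field_hom_inject[OF \<sigma>\<^sub>0] by (auto simp: fun_eq_iff)
  then show ?thesis using assms inv unfolding S_p_def S_def by auto
qed

text \<open>Replacing \<open>\<sigma>\<^sub>0\<close> by \<open>\<sigma>\<close> only translates the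
  cosets, so \<open>S\<close> meets all but \<open>t\<close> of them. Since \<open>r\<close> is the
  number of cosets minus 1, the minimum in the rank becomes the stated expression.\<close>

lemma (in cm_padic) rank_formula:
  assumes schanuel: "padic_schanuel_log_conjecture p TYPE('c)"
    and r: "module_rank \<Z> (unit_module :: (int, 'm) module) = enat r"
    and \<sigma>: "field_hom \<sigma>"
    and t: "t = card {C \<in> rcosets\<^bsub>gal\<^esub> {id, c}. C \<subseteq> J_set (S_p \<Gamma> (center \<sigma>\<^sub>0) \<sigma>\<^sub>0) \<sigma>}"
  shows "\<exists>d. module_rank padic_integers (closure_module \<Gamma> \<iota>) = enat d \<and> int d = int r - max 0 (int t - 1)"
proof -
  obtain h where h: "h \<in> G" "\<sigma> = \<sigma>\<^sub>0 \<circ> h" using hom_factor[OF \<sigma> \<sigma>\<^sub>0] .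
  have J: "J_set (S_p \<Gamma> (center \<sigma>\<^sub>0) \<sigma>\<^sub>0) \<sigma> = {g \<in> G. h \<circ> g \<notin> S}"
  proof -
    have "\<sigma> \<circ> g \<in> E_p - S_p \<Gamma> (center \<sigma>\<^sub>0) \<sigma>\<^sub>0 \<longleftrightarrow> h \<circ> g \<notin> S" if g: "g \<in> G" for g
    proof -
      have "field_hom (\<sigma>\<^sub>0 \<circ> (h \<circ> g))" using hom_gal[OF comp_gal[OF h(1) g]] by (simp add: comp_def)
      then show ?thesis using S_p_iff[OF comp_gal[OF h(1) g]] by (simp add: h(2) comp_assoc ring_hom_fld_iff)
    qed
    then show ?thesis unfolding J_set_def by blast
  qed
  have sub: "rep ` S \<subseteq> reps" using rep_in_reps S_gal by blast
  have "t = card reps - card (rep ` S)"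
    unfolding t J card_cosets[OF h(1)] by (rule card_Diff_subset[OF finite_imageI[OF finite_S] sub])
  moreover have "card (rep ` S) \<le> card reps" by (rule card_mono[OF finite_reps sub])
  moreover have "card reps > 0" using finite_reps id_reps by (auto simp: card_gt_0_iff)
  moreover have "r = card reps - 1" using r unit_rank by simp
  ultimately have "int (min (card (rep ` S)) (card reps - 1)) = int r - max 0 (int t - 1)" by linarith
  then show ?thesis using closure_module_rank[OF schanuel] by blast
qed

theorem corollary7p14:
  fixes p r t :: nat
    and \<Gamma> :: "'m::field_char_0 set set"
    and P\<^sub>0 :: "'m set"
    and \<iota> :: "'m set \<Rightarrow> 'm \<Rightarrow> 'k::{nonarch_field, complete_space}"
    and j :: "'k \<Rightarrow> 'c::{nonarch_field, complete_space}"
    and \<sigma>\<^sub>0 \<sigma> :: "'m \<Rightarrow> 'c"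
    and c :: "'m \<Rightarrow> 'm"
  assumes "CM_field TYPE('m)" and "galois_over_rat TYPE('m)"
    and "Factorial_Ring.prime p"
    and "\<Gamma> \<subseteq> primes_above p" and "\<Gamma> \<noteq> {}"
    and completions: "\<And>P. P \<in> \<Gamma> \<Longrightarrow> adic_completion P (\<iota> P)"
    and "padic_complex p TYPE('c)"
    and "P\<^sub>0 \<in> \<Gamma>"
    and "j \<in> ring_hom (local_field (\<iota> P\<^sub>0)) fld"
    and "continuous_on (carrier (local_field (\<iota> P\<^sub>0))) j"
    and "\<sigma>\<^sub>0 = j \<circ> \<iota> P\<^sub>0"
    and "module_rank \<Z> (unit_module :: (int, 'm) module) = enat r"
    and "c \<in> carrier gal"
    and "\<And>\<tau> m. \<tau> \<in> ring_hom fld (fld :: complex ring) \<Longrightarrow> \<tau> (c m) = cnj (\<tau> m)"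
    and "\<sigma> \<in> E_p"
    and "t = card {C \<in> rcosets\<^bsub>gal\<^esub> {id, c}. C \<subseteq> J_set (S_p \<Gamma> P\<^sub>0 \<sigma>\<^sub>0) \<sigma>}"
    and "schanuel_log_conjecture"
    and "padic_schanuel_log_conjecture p TYPE('c)"
  shows "\<exists>d. module_rank padic_integers (closure_module \<Gamma> \<iota>) = enat d \<and>
             int d = int r - max 0 (int t - 1)"
proof -
  have nf: "number_field TYPE('m)" and im: "totally_imaginary TYPE('m)"
    using assms(1) by (simp_all add: CM_field_def)
  obtain \<theta> :: 'm and q A where pg: "primitive_generator \<theta> q A"
    using primitive_generator_exists[OF nf assms(2)] .
  interpret primitive_generator \<theta> q A by (rule pg)
  have \<iota>_hom: "field_hom (\<iota> P)" if "P \<in> \<Gamma>" for P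
    using completions[OF that] by (simp add: adic_completion_def ring_hom_fld_iff)
  have carrier_local: "carrier (local_field (\<iota> P\<^sub>0)) = closure (range (\<iota> P\<^sub>0))" by (simp add: local_field_def)
  have "\<iota> P\<^sub>0 \<in> ring_hom fld fld" using \<iota>_hom[OF assms(8)] by (simp add: ring_hom_fld_iff)
  moreover have "range (\<iota> P\<^sub>0) \<subseteq> closure (range (\<iota> P\<^sub>0))" by (rule closure_subset)
  ultimately have "\<iota> P\<^sub>0 \<in> ring_hom fld (local_field (\<iota> P\<^sub>0))"
    by (auto simp: ring_hom_def local_field_def ring_of_type_algebra_def)
  then have "j \<circ> \<iota> P\<^sub>0 \<in> ring_hom fld fld" using assms(9) by (rule ring_hom_trans)
  then have \<sigma>\<^sub>0: "field_hom \<sigma>\<^sub>0" by (simp add: assms(11) ring_hom_fld_iff)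
  interpret C: padic_complex_field p "TYPE('c)" by unfold_locales (rule assms(3), rule assms(7))
  \<comment> \<open>The centres of the completions are determined by way of the embedding into
    \<open>'c\<close>, before \<open>p\<close> is known to be small in \<open>'k\<close>.\<close>
  have gc: "galois_padic TYPE('c) \<theta> q A p"
    by (intro galois_padic.intro pg C.padic_field_axioms)
  have prime_\<Gamma>: "prime_above p P" if "P \<in> \<Gamma>" for P
    using prime_aboveI_primes_above assms(4) that by blast
  have center_\<iota>: "center (\<iota> P) = P" if "P \<in> \<Gamma>" for P
    by (rule galois_padic.adic_completion_center[OF gc \<sigma>\<^sub>0 prime_\<Gamma>[OF that] completions[OF that]])
  interpret i0: field_hom "\<iota> P\<^sub>0" by (rule \<iota>_hom[OF assms(8)])
  \<comment> \<open>Membership of \<open>p\<close> in the centre makes it small in the completion,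
    whatever the normalisation there.\<close>
  have "of_nat p \<in> center (\<iota> P\<^sub>0)" using prime_aboveD(4)[OF prime_\<Gamma>[OF assms(8)]] center_\<iota>[OF assms(8)] by simp
  then have "absval (of_nat p :: 'k) < 1" by (simp add: center_def i0.hom_of_nat)
  then have "padic_field TYPE('k) p" using assms(3) by (intro padic_field.intro)
  then have gk: "galois_padic TYPE('k) \<theta> q A p" by (intro galois_padic.intro pg)
  have abs0: "absval (\<iota> P\<^sub>0 x) < 1 \<longleftrightarrow> absval (\<sigma>\<^sub>0 x) < 1" for x
    using galois_padic.continuous_hom_absval[OF gk \<iota>_hom[OF assms(8)], of j x] \<sigma>\<^sub>0 assms(10)
    by (simp add: assms(11) comp_def carrier_local)
  then have center_\<sigma>\<^sub>0: "center \<sigma>\<^sub>0 = P\<^sub>0" using center_\<iota>[OF assms(8)] by (auto simp: center_def)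
  \<comment> \<open>The prime in question is the preimage of \<open>P\<^sub>0\<close> under
    \<open>g\<close>, so \<open>g\<close> maps it onto \<open>P\<^sub>0\<close>, and the completions
    at the two primes can be compared.\<close>
  have same_place: "absval (\<iota> (center (\<lambda>x. \<sigma>\<^sub>0 (g x))) x) < 1 \<longleftrightarrow> absval (\<sigma>\<^sub>0 (g x)) < 1"
    if g: "g \<in> G" "center (\<lambda>x. \<sigma>\<^sub>0 (g x)) \<in> \<Gamma>" for g x
  proof -
    have "bij g" using g(1) by (simp add: gal_iff)
    have "center (\<lambda>x. \<sigma>\<^sub>0 (g x)) = g -` P\<^sub>0"
      unfolding center_\<sigma>\<^sub>0[symmetric] by (auto simp: center_def gal_algebraic_int[OF g(1)])
    then have "g ` center (\<lambda>x. \<sigma>\<^sub>0 (g x)) = P\<^sub>0" using bij_is_surj[OF \<open>bij g\<close>] by (simp add: surj_image_vimage_eq)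
    then show ?thesis
      using adic_completion_gal[OF completions[OF g(2)] completions[OF assms(8)] g(1)] abs0 by simp
  qed
  have "finite \<Gamma>"
  proof (rule finite_subset)
    show "finite ((\<lambda>g. center (\<lambda>x. \<sigma>\<^sub>0 (g x))) ` G)" using finite_gal by simp
    show "\<Gamma> \<subseteq> (\<lambda>g. center (\<lambda>x. \<sigma>\<^sub>0 (g x))) ` G"
    proof
      fix P assume "P \<in> \<Gamma>"
      then obtain g where "g \<in> G" "P = center (\<lambda>x. \<sigma>\<^sub>0 (g x))"
        using prime_above_conjugate[OF \<sigma>\<^sub>0 assms(3) C.absval_p prime_\<Gamma>] by metis
      then show "P \<in> (\<lambda>g. center (\<lambda>x. \<sigma>\<^sub>0 (g x))) ` G" by blast
    qed
  qed
  \<comment> \<open>A complex root of \<open>q\<close> yields a complex embedding, which serves to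
    measure all archimedean absolute values.\<close>
  have "degree (map_poly of_rat q :: complex poly) > 0" using card_A_pos by (simp add: degree_map_poly degree_q)
  then obtain z :: complex where z: "rpoly q z = 0" using alg_closed_imp_poly_has_root by blast
  obtain \<tau> :: "'m \<Rightarrow> complex" where \<tau>: "field_hom \<tau>" using hom_exists[OF z] by blast
  have c_conj: "\<tau>' (c x) = cnj (\<tau>' x)" if "field_hom \<tau>'" for \<tau>' x
    using assms(14)[of \<tau>' x] that by (simp add: ring_hom_fld_iff)
  have "c \<noteq> id"
  proof
    assume "c = id"
    then have "range \<tau> \<subseteq> \<real>" using c_conj[OF \<tau>] by (auto simp: complex_is_Real_iff complex_eq_iff)
    then show False using im \<tau> by (simp add: totally_imaginary_def ring_hom_fld_iff)
  qed
  then have "cm_galois \<theta> q A \<tau> c"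
    using pg \<tau> assms(13) c_conj by (intro cm_galois.intro cm_galois_axioms.intro)
  moreover have "local_units \<theta> q A p \<Gamma> \<iota>"
    using gk \<open>finite \<Gamma>\<close> \<iota>_hom by (intro local_units.intro local_units_axioms.intro)
  ultimately have cm: "cm_padic \<theta> q A \<tau> c p \<Gamma> \<iota> \<sigma>\<^sub>0"
    using C.padic_complex_field_axioms \<sigma>\<^sub>0 assms(8) prime_\<Gamma> same_place
    by (intro cm_padic.intro cm_padic_axioms.intro) (simp_all add: center_\<sigma>\<^sub>0)
  have "field_hom \<sigma>" using assms(15) by (simp add: ring_hom_fld_iff)
  then show ?thesis
    using cm_padic.rank_formula[OF cm assms(18,12)] assms(16) by (simp add: center_\<sigma>\<^sub>0)
qed

end
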